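(* Let $A=\mathbb{Z}[t]/(t^2)$ and $B=\mathbb{Z}[w]/(w^2)$ with $\deg t=(1,0)$ and $\deg w=(0,1)$, let $G$ be a finite graph with $|E(G)|=n$ and a fixed ordering of its edges, and let $C_Y(G)$ and $C_T(G)$ be the complexes constructed in the context from $R=\mathbb{Z}$, $M=A$, $N=B$, the multiplication $m$ of $A$, $u=u_A$ and $f_k:B^{\otimes k}\to B^{\otimes(k+1)}$ induced by $u_B$. Then: (a) The modules $C^i_Y(G)$ and homomorphisms $d^i$ form a cochain complex of bigraded $\mathbb{Z}$-modules $$0\rightarrow C^0_Y(G)\xrightarrow{d^0}C^1_Y(G)\xrightarrow{d^1}\cdots\xrightarrow{d^{n-1}}C^n_Y(G)\rightarrow0$$ whose differential preserves the bidegree. (b) The cohomology groups $H^i_Y(G)$ of this complex are (up to isomorphism of bigraded modules) invariants of the graph $G$; they are independent of the ordering of the edges of $G$. The isomorphism type of the bigraded complex $C_Y(G)$ is an invariant of $G$. (c$'$) The graded Euler characteristic satisfies $$\chi_q(C_Y(G))=\sum_{0\le i\le n}(-1)^i\,q\dim H^i_Y(G)=\sum_{0\le i\le n}(-1)^i\,q\dim C^i_Y(G)=g(G;t,w).$$ (d$'\cup$e$'$) There are morphisms of complexes $\phi:C_T(G)\to C_Y(G)$ and $\psi:C_Y(G)\to C_T(G)$ with $\psi\circ\phi$ equal to the identity of $C_T(G)$, so $C_T(G)$ is a direct summand of $C_Y(G)$. These induce morphisms of bigraded modules $H^i_T(G)\to H^i_Y(G)$ and $H^i_Y(G)\to H^i_T(G)$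 whose composition is the identity of $H^i_T(G)$, so $H^i_T(G)$ is a direct summand of $H^i_Y(G)$.
   Context: Graphs are finite; loops and multiple edges are allowed. For a graph $G$ with vertex set $V(G)$ and edge set $E(G)$, and $S\subseteq E(G)$, $[G:S]$ denotes the graph with vertex set $V(G)$ and edge set $S$; $b_0([G:S])$ is its number of connected components and $b_1([G:S])$ its first Betti number. **Algebras.** $A=\mathbb{Z}[t]/(t^2)$ and $B=\mathbb{Z}[w]/(w^2)$ are bigraded with $\deg t=(1,0)$, $\deg w=(0,1)$. Tensor products are over $\mathbb{Z}$, with the induced bigrading; the zeroth tensor power is $\mathbb{Z}$ in bidegree $(0,0)$. $m:A\otimes A\to A$ is the multiplication of $A$. $u_A:\mathbb{Z}\to A$ and $u_B:\mathbb{Z}\to B$ are given by $u_A(1)=1$, $u_B(1)=1$, and $\eta_A:A\to\mathbb{Z}$ by $\eta_A(1)=1$, $\eta_A(t)=0$. The map $f_k:B^{\otimes k}\to B^{\otimes(k+1)}$ is $b\mapsto b\otimes u_B(1)=b\otimes1$. **The complex $C_Y(G)$.** Fix an ordering $e_1,\dots,e_n$ of $E(G)$. To $\alpha=(\alpha_1,\dots,\alpha_n)\in\{0,1\}^n$ associate $S=S_\alpha=\{e_i:\alpha_i=1\}$ and $|\alpha|=\sum\alpha_i=|S_\alpha|$. Put $$C^\alpha(G)=A^{\otimes\lambda}\otimes A^{\otimes\mu}\otimes B^{\otimes\nu},\qquad\lambda=|S|,\ \mu=b_0([G:S]),\ \nu=b_1([G:S]),$$ where the factors of $A^{\otimes\lambda}$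 are indexed by the edges in $S$ and those of $A^{\otimes\mu}$ by the connected components of $[G:S]$. Set $C^i_Y(G)=\bigoplus_{|\alpha|=i}C^\alpha(G)$. An edge $\xi$ of the cube is a sequence $(\xi_1,\dots,\xi_n)\in\{0,1,*\}^n$ with exactly one $*$, in position $j$ say; $|\xi|$ is the number of $1$'s. Let $\alpha_\xi(0),\alpha_\xi(1)$ be obtained by setting $*=0$, $*=1$, let $S_0,S_1$ be the corresponding edge sets, so $S_1=S_0\cup\{e\}$ with $e=e_j$, and put $\nu_0=b_1([G:S_0])$. The per-edge map $d_\xi:C^{\alpha_\xi(0)}(G)\to C^{\alpha_\xi(1)}(G)$ is the tensor product of the following maps: - on the edge factors, $A^{\otimes|S_0|}\to A^{\otimes|S_1|}$ inserts $u_A:\mathbb{Z}\to A$ in the new tensor position corresponding to $e$ (identity on the other factors); - if the endpoints of $e$ lie in the same component of $[G:S_0]$: the identity on the component factors, and $f_{\nu_0}$ on the $B$-factors; - if the endpoints of $e$ lie in different components $E_0,E_1$ of $[G:S_0]$: on the component factors, $m$ applied to the two factors corresponding to $E_0,E_1$ (the result placed at the merged component) and the identity on the remaining components; the identity on the $B$-factors. The differential is $d^i=\sum_{|\xi|=i}\mathrm{sign}(\xi)\,d_\xi:C^i_Y(G)\to C^{i+1}_Y(G)$, where $\mathrm{sign}(\xi)=(-1)^{\sum_{i<j}\xi_i}$ and $j$ is the position of $*$. Its cohomology is $H^i_Y(G)$. **The complex $C_T(G)$** is defined in the same way but without the edge factors: $C^\alpha_T(G)=A^{\otimes\mu}\otimes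 B^{\otimes\nu}$, $C_T^i(G)=\bigoplus_{|\alpha|=i}C_T^\alpha(G)$, with per-edge maps given by the component-factor and $B$-factor parts above and the same signs. Its cohomology is $H^i_T(G)$. **The maps $\phi,\psi$.** On the summand indexed by $\alpha$, $\phi$ is $u_A^{\otimes\lambda}\otimes\mathrm{id}$ and $\psi$ is $\eta_A^{\otimes\lambda}\otimes\mathrm{id}$. **Graded dimension.** For a bigraded $\mathbb{Z}$-module $M=\bigoplus_{n,k}M_{n,k}$, $q\dim M=\sum_{n,k}t^nw^k\dim_{\mathbb{Q}}(M_{n,k}\otimes\mathbb{Q})$; thus $q\dim A=1+t$, $q\dim B=1+w$. **The polynomial $g$.** $$g(G;t,w)=\sum_{S\subseteq E(G)}(-1)^{|S|}(1+t)^{|S|+b_0([G:S])}(1+w)^{b_1([G:S])}.$$ Equivalently $g(G;t,w)=(-x)^{|E(G)|}h(G;x,y)$ with $x=1+t$, $y=1+w$, where $h(G;x,y)=\sum_{S\subseteq E(G)}(-x)^{-|E(G)|+|S|}x^{b_0([G:S])}y^{b_1([G:S])}$ is the Yamada polynomial. *)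

theory Defs
  imports
    "HOL-Algebra.Free_Abelian_Groups"
    "HOL-Algebra.Generated_Groups"
    "HOL-Algebra.IntRing"
    "HOL-Algebra.UnivPoly"
    "HOL-Computational_Algebra.Polynomial"
    "Jordan_Normal_Form.Missing_VectorSpace"
begin

(* Z-modules are abelian groups, in the multiplicative notation of HOL-Algebra. *)

section \<open>Tensor products over the integers\<close>

text \<open>The abelian group with generators X and relators R, and the homomorphism out of it
  that is prescribed on the generators.\<close>

definition presented :: "'x set \<Rightarrow> ('x \<Rightarrow>\<^sub>0 int) set \<Rightarrow> ('x \<Rightarrow>\<^sub>0 int) set monoid" where
  "presented X R = free_Abelian_group X Mod generate (free_Abelian_group X) R"

definition gen_class :: "'x set \<Rightarrow> ('x \<Rightarrow>\<^sub>0 int) set \<Rightarrow> 'x \<Rightarrow> ('x \<Rightarrow>\<^sub>0 int) set" where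
  "gen_class X R x = generate (free_Abelian_group X) R #>\<^bsub>free_Abelian_group X\<^esub> frag_of x"

definition presented_lift ::
  "'x set \<Rightarrow> ('x \<Rightarrow>\<^sub>0 int) set \<Rightarrow> ('t, 'm) monoid_scheme \<Rightarrow> ('x \<Rightarrow> 't) \<Rightarrow> ('x \<Rightarrow>\<^sub>0 int) set \<Rightarrow> 't" where
  "presented_lift X R T b =
    (THE h. h \<in> hom (presented X R) T \<and> h \<in> extensional (carrier (presented X R)) \<and>
            (\<forall>x\<in>X. h (gen_class X R x) = b x))"

text \<open>The lift exists and is unique whenever the values prescribed on the generators respect
  the relators.\<close>

lemma presented_universal:
  fixes T (structure)
  assumes T: "comm_group T" and b: "b \<in> X \<rightarrow> carrier T"
    and R: "R \<subseteq> carrier (free_Abelian_group X)"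
    and k: "k \<in> hom (free_Abelian_group X) T" and kb: "\<And>x. x \<in> X \<Longrightarrow> k (frag_of x) = b x"
    and kR: "\<And>r. r \<in> R \<Longrightarrow> k r = \<one>"
  shows "\<exists>!h. h \<in> hom (presented X R) T \<and> h \<in> extensional (carrier (presented X R)) \<and>
              (\<forall>x\<in>X. h (gen_class X R x) = b x)"
proof -
  let ?F = "free_Abelian_group X" and ?N = "generate (free_Abelian_group X) R"
  interpret F: comm_group ?F by (rule abelian_free_Abelian_group)
  interpret T: comm_group T by (rule T)
  interpret k: group_hom ?F T k by unfold_locales (rule k)
  have sub: "subgroup ?N ?F" by (rule F.generate_is_subgroup[OF R])
  have nor: "?N \<lhd> ?F" using F.normal_iff_subgroup sub by blast
  then interpret N: normal ?N ?F .
  have "?N \<subseteq> kernel ?F T k"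
    by (rule F.generate_subgroup_incl[OF _ k.subgroup_kernel])
      (use subsetD[OF R] kR in \<open>auto simp: kernel_def simp del: carrier_free_Abelian_group_iff\<close>)
  then obtain g where g: "g \<in> hom (?F Mod ?N) T"
    and gk: "\<And>x. x \<in> carrier ?F \<Longrightarrow> g (?N #>\<^bsub>?F\<^esub> x) = k x"
    using k.FactGroup_universal_kernel[OF nor] by blast
  let ?h = "restrict g (carrier (presented X R))"
  have cl: "gen_class X R x \<in> carrier (presented X R)" if "x \<in> X" for x
    using that by (auto simp: gen_class_def presented_def carrier_FactGroup)
  have 1: "?h \<in> hom (presented X R) T"
    using g monoid.m_closed[OF group.is_monoid[OF N.factorgroup_is_group]]
    by (auto simp: presented_def hom_def Pi_iff)
  have 2: "?h (gen_class X R x) = b x" if "x \<in> X" for x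
    using cl[OF that] gk[of "frag_of x"] kb[OF that] that by (simp add: gen_class_def)
  show ?thesis
  proof (rule ex1I[of _ ?h], intro conjI ballI)
    fix h assume h: "h \<in> hom (presented X R) T \<and> h \<in> extensional (carrier (presented X R)) \<and>
              (\<forall>x\<in>X. h (gen_class X R x) = b x)"
    have "(\<lambda>c. h (?N #>\<^bsub>?F\<^esub> c)) \<in> hom ?F T"
      using h N.r_coset_hom_Mod by (auto simp: presented_def hom_def Pi_iff)
    then interpret q: group_hom ?F T "\<lambda>c. h (?N #>\<^bsub>?F\<^esub> c)" by unfold_locales
    have hk: "Poly_Mapping.keys c \<subseteq> X \<and> h (?N #>\<^bsub>?F\<^esub> c) = k c" if "Poly_Mapping.keys c \<subseteq> X" for c
      using that
    proof (induction rule: frag_induction)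
      case zero then show ?case using q.hom_one k.hom_one by simp
    next
      case (one x) then show ?case using h kb by (simp add: gen_class_def)
    next
      case (diff c c')
      then have c: "c \<in> carrier ?F" "c' \<in> carrier ?F" by auto
      then have e: "c - c' = c \<otimes>\<^bsub>?F\<^esub> inv\<^bsub>?F\<^esub> c'" by simp
      have "h (?N #>\<^bsub>?F\<^esub> (c - c')) = k (c - c')"
        unfolding e using diff c q.hom_mult q.hom_inv k.hom_mult k.hom_inv F.inv_closed by metis
      then show ?case using diff keys_diff[of c c'] by blast
    qed
    then show "h = ?h"
      using h gk hk by (intro extensionalityI[of _ "carrier (presented X R)"])
        (auto simp: presented_def carrier_FactGroup)
  qed (use 1 2 in auto)
qed

lemma frag_rel_one:
  fixes T (structure)
  assumes T: "comm_group T" and k: "k \<in> hom (free_Abelian_group X) T"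
    and "x \<in> X" "y \<in> X" "z \<in> X" and xyz: "k (frag_of x) = k (frag_of y) \<otimes> k (frag_of z)"
  shows "k (frag_of x - frag_of y - frag_of z) = \<one>"
proof -
  let ?F = "free_Abelian_group X"
  interpret T: comm_group T by (rule T)
  interpret F: comm_group ?F by (rule abelian_free_Abelian_group)
  interpret k: group_hom ?F T k by unfold_locales (rule k)
  have c: "frag_of x \<in> carrier ?F" "frag_of y \<in> carrier ?F" "frag_of z \<in> carrier ?F"
    using assms by auto
  have "frag_of x - frag_of y - frag_of z =
      frag_of x \<otimes>\<^bsub>?F\<^esub> inv\<^bsub>?F\<^esub> (frag_of y \<otimes>\<^bsub>?F\<^esub> frag_of z)"
    using c by (subst inv_free_Abelian_group) (auto dest!: subsetD[OF keys_add])
  also have "k \<dots> = \<one>"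
    using c xyz by (simp add: k.hom_mult k.hom_inv F.m_closed del: mult_free_Abelian_group inv_free_Abelian_group carrier_free_Abelian_group_iff)
  finally show ?thesis .
qed

text \<open>Binary tensor product.\<close>

definition tensor_rels ::
  "('a, 'm) monoid_scheme \<Rightarrow> ('b, 'n) monoid_scheme \<Rightarrow> (('a \<times> 'b) \<Rightarrow>\<^sub>0 int) set" where
  "tensor_rels M N =
     {frag_of (x \<otimes>\<^bsub>M\<^esub> x', y) - frag_of (x, y) - frag_of (x', y) | x x' y.
        x \<in> carrier M \<and> x' \<in> carrier M \<and> y \<in> carrier N} \<union>
     {frag_of (x, y \<otimes>\<^bsub>N\<^esub> y') - frag_of (x, y) - frag_of (x, y') | x y y'.
        x \<in> carrier M \<and> y \<in> carrier N \<and> y' \<in> carrier N}"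

definition tensor_group ::
  "('a, 'm) monoid_scheme \<Rightarrow> ('b, 'n) monoid_scheme \<Rightarrow> (('a \<times> 'b) \<Rightarrow>\<^sub>0 int) set monoid" where
  "tensor_group M N = presented (carrier M \<times> carrier N) (tensor_rels M N)"

definition pure_tensor ::
  "('a, 'm) monoid_scheme \<Rightarrow> ('b, 'n) monoid_scheme \<Rightarrow> 'a \<Rightarrow> 'b \<Rightarrow> (('a \<times> 'b) \<Rightarrow>\<^sub>0 int) set" where
  "pure_tensor M N x y = gen_class (carrier M \<times> carrier N) (tensor_rels M N) (x, y)"

definition tensor_lift ::
  "('a, 'm) monoid_scheme \<Rightarrow> ('b, 'n) monoid_scheme \<Rightarrow> ('t, 'k) monoid_scheme \<Rightarrow>
   ('a \<Rightarrow> 'b \<Rightarrow> 't) \<Rightarrow> (('a \<times> 'b) \<Rightarrow>\<^sub>0 int) set \<Rightarrow> 't" where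
  "tensor_lift M N T b =
     presented_lift (carrier M \<times> carrier N) (tensor_rels M N) T (\<lambda>(x, y). b x y)"

definition tensor_map ::
  "('a, 'm) monoid_scheme \<Rightarrow> ('b, 'n) monoid_scheme \<Rightarrow>
   ('c, 'k) monoid_scheme \<Rightarrow> ('d, 'l) monoid_scheme \<Rightarrow>
   ('a \<Rightarrow> 'c) \<Rightarrow> ('b \<Rightarrow> 'd) \<Rightarrow> (('a \<times> 'b) \<Rightarrow>\<^sub>0 int) set \<Rightarrow> (('c \<times> 'd) \<Rightarrow>\<^sub>0 int) set" where
  "tensor_map M N M' N' f g =
     tensor_lift M N (tensor_group M' N') (\<lambda>x y. pure_tensor M' N' (f x) (g y))"

lemma tensor_universal:
  fixes T (structure)
  assumes T: "comm_group T" and M: "comm_group M" and N: "comm_group N"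
    and b: "\<And>x y. x \<in> carrier M \<Longrightarrow> y \<in> carrier N \<Longrightarrow> b x y \<in> carrier T"
    and l: "\<And>x x' y. x \<in> carrier M \<Longrightarrow> x' \<in> carrier M \<Longrightarrow> y \<in> carrier N \<Longrightarrow>
              b (x \<otimes>\<^bsub>M\<^esub> x') y = b x y \<otimes> b x' y"
    and r: "\<And>x y y'. x \<in> carrier M \<Longrightarrow> y \<in> carrier N \<Longrightarrow> y' \<in> carrier N \<Longrightarrow>
              b x (y \<otimes>\<^bsub>N\<^esub> y') = b x y \<otimes> b x y'"
  shows "tensor_lift M N T b \<in> hom (tensor_group M N) T"
    and "x \<in> carrier M \<Longrightarrow> y \<in> carrier N \<Longrightarrow> tensor_lift M N T b (pure_tensor M N x y) = b x y"
proof -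
  let ?X = "carrier M \<times> carrier N"
  interpret M: comm_group M by (rule M)
  interpret N: comm_group N by (rule N)
  interpret T: comm_group T by (rule T)
  have b': "(\<lambda>(x, y). b x y) \<in> ?X \<rightarrow> carrier T" using b by auto
  obtain k where k: "k \<in> hom (free_Abelian_group ?X) T"
    and kb: "\<And>x. x \<in> ?X \<Longrightarrow> k (frag_of x) = (\<lambda>(x, y). b x y) x"
    using T.free_Abelian_group_universal[of "\<lambda>(x, y). b x y" ?X] b' by blast
  have R: "tensor_rels M N \<subseteq> carrier (free_Abelian_group ?X)"
    unfolding tensor_rels_def
    by (intro Un_least subsetI) (auto dest!: subsetD[OF keys_diff])
  have "k r = \<one>" if "r \<in> tensor_rels M N" for r
    using that unfolding tensor_rels_def
    by (auto simp: frag_rel_one[OF T k] kb b l r)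
  note u = theI'[OF presented_universal[OF T b' R k kb this], folded presented_lift_def]
  show "tensor_lift M N T b \<in> hom (tensor_group M N) T"
    using u by (simp add: tensor_lift_def tensor_group_def)
  show "tensor_lift M N T b (pure_tensor M N x y) = b x y" if "x \<in> carrier M" "y \<in> carrier N"
    using u that by (auto simp: tensor_lift_def pure_tensor_def)
qed

text \<open>Tensor power with factors indexed by a finite set I. For empty I it is free on one
  generator, that is, the integers.\<close>

definition power_rels :: "'i set \<Rightarrow> ('a, 'm) monoid_scheme \<Rightarrow> (('i \<Rightarrow> 'a) \<Rightarrow>\<^sub>0 int) set" where
  "power_rels I M =
     {frag_of (f(i := x \<otimes>\<^bsub>M\<^esub> y)) - frag_of (f(i := x)) - frag_of (f(i := y)) | f i x y.
        f \<in> (I \<rightarrow>\<^sub>E carrier M) \<and> i \<in> I \<and> x \<in> carrier M \<and> y \<in> carrier M}"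

definition power_group :: "'i set \<Rightarrow> ('a, 'm) monoid_scheme \<Rightarrow> (('i \<Rightarrow> 'a) \<Rightarrow>\<^sub>0 int) set monoid" where
  "power_group I M = presented (I \<rightarrow>\<^sub>E carrier M) (power_rels I M)"

definition pure_power :: "'i set \<Rightarrow> ('a, 'm) monoid_scheme \<Rightarrow> ('i \<Rightarrow> 'a) \<Rightarrow> (('i \<Rightarrow> 'a) \<Rightarrow>\<^sub>0 int) set" where
  "pure_power I M x = gen_class (I \<rightarrow>\<^sub>E carrier M) (power_rels I M) x"

definition power_lift ::
  "'i set \<Rightarrow> ('a, 'm) monoid_scheme \<Rightarrow> ('t, 'k) monoid_scheme \<Rightarrow> (('i \<Rightarrow> 'a) \<Rightarrow> 't) \<Rightarrow>
   (('i \<Rightarrow> 'a) \<Rightarrow>\<^sub>0 int) set \<Rightarrow> 't" where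
  "power_lift I M T b = presented_lift (I \<rightarrow>\<^sub>E carrier M) (power_rels I M) T b"

lemma power_universal:
  fixes T (structure)
  assumes T: "comm_group T" and M: "comm_group M"
    and b: "b \<in> (I \<rightarrow>\<^sub>E carrier M) \<rightarrow> carrier T"
    and add: "\<And>f i x y. f \<in> (I \<rightarrow>\<^sub>E carrier M) \<Longrightarrow> i \<in> I \<Longrightarrow> x \<in> carrier M \<Longrightarrow> y \<in> carrier M \<Longrightarrow>
              b (f(i := x \<otimes>\<^bsub>M\<^esub> y)) = b (f(i := x)) \<otimes> b (f(i := y))"
  shows "power_lift I M T b \<in> hom (power_group I M) T"
    and "x \<in> (I \<rightarrow>\<^sub>E carrier M) \<Longrightarrow> power_lift I M T b (pure_power I M x) = b x"
proof -
  let ?X = "I \<rightarrow>\<^sub>E carrier M"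
  interpret M: comm_group M by (rule M)
  interpret T: comm_group T by (rule T)
  obtain k where k: "k \<in> hom (free_Abelian_group ?X) T"
    and kb: "\<And>x. x \<in> ?X \<Longrightarrow> k (frag_of x) = b x"
    using T.free_Abelian_group_universal[of b ?X] b by blast
  have up: "f(i := x) \<in> ?X" if "f \<in> ?X" "i \<in> I" "x \<in> carrier M" for f i x
    using that by (auto simp: PiE_iff extensional_def)
  have R: "power_rels I M \<subseteq> carrier (free_Abelian_group ?X)"
  proof
    fix r assume "r \<in> power_rels I M"
    then obtain f i x y where r: "r = frag_of (f(i := x \<otimes>\<^bsub>M\<^esub> y)) - frag_of (f(i := x)) - frag_of (f(i := y))"
      and f: "f \<in> ?X" "i \<in> I" "x \<in> carrier M" "y \<in> carrier M"
      unfolding power_rels_def by blast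
    have "Poly_Mapping.keys r \<subseteq> {f(i := x \<otimes>\<^bsub>M\<^esub> y), f(i := x), f(i := y)}"
      unfolding r by (auto dest!: subsetD[OF keys_diff])
    also have "\<dots> \<subseteq> ?X" using up f by blast
    finally show "r \<in> carrier (free_Abelian_group ?X)" by simp
  qed
  have "k r = \<one>" if rr: "r \<in> power_rels I M" for r
  proof -
    obtain f i x y where r: "r = frag_of (f(i := x \<otimes>\<^bsub>M\<^esub> y)) - frag_of (f(i := x)) - frag_of (f(i := y))"
      and f: "f \<in> ?X" "i \<in> I" "x \<in> carrier M" "y \<in> carrier M"
      using rr unfolding power_rels_def by blast
    show ?thesis unfolding r
      by (rule frag_rel_one[OF T k up up up]) (use f in \<open>simp_all add: kb up add\<close>)
  qed
  note u = theI'[OF presented_universal[OF T b R k kb this], folded presented_lift_def]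
  show "power_lift I M T b \<in> hom (power_group I M) T"
    using u by (simp add: power_lift_def power_group_def)
  show "power_lift I M T b (pure_power I M x) = b x" if "x \<in> ?X"
    using u that by (auto simp: power_lift_def pure_power_def)
qed


section \<open>Bigraded modules\<close>

record 'a bigraded = "'a monoid" +
  grade :: "nat \<times> nat \<Rightarrow> 'a set"

definition with_grading :: "('a, 'm) monoid_scheme \<Rightarrow> (nat \<times> nat \<Rightarrow> 'a set) \<Rightarrow> 'a bigraded" where
  "with_grading M gr = \<lparr>carrier = carrier M, monoid.mult = monoid.mult M, one = one M, grade = gr\<rparr>"

definition graded_part :: "'a bigraded \<Rightarrow> nat \<times> nat \<Rightarrow> 'a monoid" where
  "graded_part M d = \<lparr>carrier = grade M d, monoid.mult = monoid.mult M, one = one M\<rparr>"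

text \<open>The last clause says that M is the internal direct sum of its graded parts.\<close>

definition bigraded_module :: "'a bigraded \<Rightarrow> bool" where
  "bigraded_module M \<longleftrightarrow>
     comm_group M \<and> (\<forall>d. subgroup (grade M d) M) \<and>
     (\<lambda>c. gfinprod M c UNIV) \<in> iso (sum_group UNIV (graded_part M)) M"

definition bigraded_hom :: "'a bigraded \<Rightarrow> 'b bigraded \<Rightarrow> ('a \<Rightarrow> 'b) \<Rightarrow> bool" where
  "bigraded_hom M N f \<longleftrightarrow>
     bigraded_module M \<and> bigraded_module N \<and> f \<in> hom M N \<and> (\<forall>d. f ` grade M d \<subseteq> grade N d)"

definition bigraded_iso :: "'a bigraded \<Rightarrow> 'b bigraded \<Rightarrow> ('a \<Rightarrow> 'b) \<Rightarrow> bool" where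
  "bigraded_iso M N f \<longleftrightarrow>
     bigraded_module M \<and> bigraded_module N \<and> f \<in> iso M N \<and> (\<forall>d. f ` grade M d = grade N d)"

definition bigraded_isomorphic :: "'a bigraded \<Rightarrow> 'b bigraded \<Rightarrow> bool" where
  "bigraded_isomorphic M N \<longleftrightarrow> (\<exists>f. bigraded_iso M N f)"

definition tensor :: "'a bigraded \<Rightarrow> 'b bigraded \<Rightarrow> (('a \<times> 'b) \<Rightarrow>\<^sub>0 int) set bigraded" where
  "tensor M N = with_grading (tensor_group M N)
     (\<lambda>d. generate (tensor_group M N)
        {pure_tensor M N x y | x y a b. x \<in> grade M a \<and> y \<in> grade N b \<and>
           fst a + fst b = fst d \<and> snd a + snd b = snd d})"

definition tensor_power :: "'i set \<Rightarrow> 'a bigraded \<Rightarrow> (('i \<Rightarrow> 'a) \<Rightarrow>\<^sub>0 int) set bigraded" where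
  "tensor_power I M = with_grading (power_group I M)
     (\<lambda>d. generate (power_group I M)
        {pure_power I M x | x a. x \<in> (\<Pi>\<^sub>E i\<in>I. grade M (a i)) \<and>
           (\<Sum>i\<in>I. fst (a i)) = fst d \<and> (\<Sum>i\<in>I. snd (a i)) = snd d})"

definition direct_sum :: "'i set \<Rightarrow> ('i \<Rightarrow> 'a bigraded) \<Rightarrow> ('i \<Rightarrow> 'a) bigraded" where
  "direct_sum I M = with_grading (sum_group I M)
     (\<lambda>d. {x \<in> carrier (sum_group I M). \<forall>i\<in>I. x i \<in> grade (M i) d})"

definition bigraded_prod :: "'a bigraded \<Rightarrow> 'b bigraded \<Rightarrow> ('a \<times> 'b) bigraded" where
  "bigraded_prod M N = with_grading (M \<times>\<times> N) (\<lambda>d. grade M d \<times> grade N d)"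

text \<open>A complement of M in N is isomorphic to a submodule of N, so its elements may be taken
  from the type of N.\<close>

definition direct_summand :: "'a bigraded \<Rightarrow> 'b bigraded \<Rightarrow> bool" where
  "direct_summand M N \<longleftrightarrow>
     (\<exists>K :: 'b bigraded. bigraded_module K \<and> bigraded_isomorphic (bigraded_prod M K) N)"


section \<open>Graded dimension\<close>

definition rat_field :: "rat ring" where
  "rat_field = \<lparr>carrier = UNIV, monoid.mult = (*), one = 1, zero = 0, add = (+)\<rparr>"

definition rat_group :: "rat monoid" where
  "rat_group = \<lparr>carrier = UNIV, monoid.mult = (+), one = 0\<rparr>"

text \<open>The rational vector space obtained by tensoring M with the rationals. The ring
  multiplication fields of the module record are not used.\<close>

definition rationalization ::
  "('a, 'm) monoid_scheme \<Rightarrow> (rat, (('a \<times> rat) \<Rightarrow>\<^sub>0 int) set) module" where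
  "rationalization M =
     \<lparr>carrier = carrier (tensor_group M rat_group), monoid.mult = undefined, one = undefined,
      zero = one (tensor_group M rat_group), add = monoid.mult (tensor_group M rat_group),
      module.smult = (\<lambda>q. tensor_lift M rat_group (tensor_group M rat_group)
                     (\<lambda>x r. pure_tensor M rat_group x (q * r)))\<rparr>"

definition rank_Q :: "('a, 'm) monoid_scheme \<Rightarrow> nat" where
  "rank_Q M = vectorspace.dim rat_field (rationalization M)"

definition finite_type :: "'a bigraded \<Rightarrow> bool" where
  "finite_type M \<longleftrightarrow>
     finite {d. grade M d \<noteq> {\<one>\<^bsub>M\<^esub>}} \<and>
     (\<forall>d. vectorspace.fin_dim rat_field (rationalization (graded_part M d)))"

text \<open>Polynomials in t and w are polynomials in w over polynomials in t.\<close>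

definition t_var :: "int poly poly" where "t_var = [:[:0, 1:]:]"

definition w_var :: "int poly poly" where "w_var = [:0, 1:]"

definition qdim :: "'a bigraded \<Rightarrow> int poly poly" where
  "qdim M = (\<Sum>(n, k) | rank_Q (graded_part M (n, k)) \<noteq> 0.
     of_nat (rank_Q (graded_part M (n, k))) * t_var ^ n * w_var ^ k)"


section \<open>Bigraded cochain complexes\<close>

record 'a complex_data =
  obj :: "nat \<Rightarrow> 'a bigraded"
  diff :: "nat \<Rightarrow> 'a \<Rightarrow> 'a"

definition cochain_complex :: "'a complex_data \<Rightarrow> bool" where
  "cochain_complex C \<longleftrightarrow>
     (\<forall>i. bigraded_hom (obj C i) (obj C (Suc i)) (diff C i)) \<and>
     (\<forall>i. \<forall>x\<in>carrier (obj C i). diff C (Suc i) (diff C i x) = \<one>\<^bsub>obj C (Suc (Suc i))\<^esub>)"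

definition chain_map :: "'a complex_data \<Rightarrow> 'b complex_data \<Rightarrow> (nat \<Rightarrow> 'a \<Rightarrow> 'b) \<Rightarrow> bool" where
  "chain_map C D f \<longleftrightarrow>
     cochain_complex C \<and> cochain_complex D \<and>
     (\<forall>i. bigraded_hom (obj C i) (obj D i) (f i)) \<and>
     (\<forall>i. \<forall>x\<in>carrier (obj C i). f (Suc i) (diff C i x) = diff D i (f i x))"

definition complex_isomorphic :: "'a complex_data \<Rightarrow> 'b complex_data \<Rightarrow> bool" where
  "complex_isomorphic C D \<longleftrightarrow>
     (\<exists>f. chain_map C D f \<and> (\<forall>i. bigraded_iso (obj C i) (obj D i) (f i)))"

definition complex_prod :: "'a complex_data \<Rightarrow> 'b complex_data \<Rightarrow> ('a \<times> 'b) complex_data" where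
  "complex_prod C D =
     \<lparr>obj = (\<lambda>i. bigraded_prod (obj C i) (obj D i)), diff = (\<lambda>i. map_prod (diff C i) (diff D i))\<rparr>"

definition complex_summand :: "'a complex_data \<Rightarrow> 'b complex_data \<Rightarrow> bool" where
  "complex_summand C D \<longleftrightarrow>
     (\<exists>K :: 'b complex_data. cochain_complex K \<and> complex_isomorphic (complex_prod C K) D)"

definition cocycles :: "'a complex_data \<Rightarrow> nat \<Rightarrow> 'a set" where
  "cocycles C i = kernel (obj C i) (obj C (Suc i)) (diff C i)"

definition coboundaries :: "'a complex_data \<Rightarrow> nat \<Rightarrow> 'a set" where
  "coboundaries C i =
     (case i of 0 \<Rightarrow> {\<one>\<^bsub>obj C 0\<^esub>} | Suc j \<Rightarrow> diff C j ` carrier (obj C j))"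

definition cohomology :: "'a complex_data \<Rightarrow> nat \<Rightarrow> 'a set bigraded" where
  "cohomology C i = with_grading
     ((obj C i)\<lparr>carrier := cocycles C i\<rparr> Mod coboundaries C i)
     (\<lambda>d. (\<lambda>z. coboundaries C i #>\<^bsub>obj C i\<^esub> z) ` (cocycles C i \<inter> grade (obj C i) d))"

definition cohomology_map ::
  "'a complex_data \<Rightarrow> 'b complex_data \<Rightarrow> (nat \<Rightarrow> 'a \<Rightarrow> 'b) \<Rightarrow> nat \<Rightarrow> 'a set \<Rightarrow> 'b set" where
  "cohomology_map C D f i =
     (\<lambda>X\<in>carrier (cohomology C i). \<Union>x\<in>X. coboundaries D i #>\<^bsub>obj D i\<^esub> f i x)"

definition graded_euler :: "'a complex_data \<Rightarrow> int poly poly" where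
  "graded_euler C =
     (\<Sum>i | qdim (cohomology C i) \<noteq> 0. (-1) ^ i * qdim (cohomology C i))"


section \<open>The algebras A and B\<close>

type_synonym dual = "(nat \<Rightarrow> int) set"

text \<open>The integer polynomials modulo the square of the indeterminate, as an ungraded ring.
  It underlies both A and B.\<close>

definition dual_ideal :: "(nat \<Rightarrow> int) set" where
  "dual_ideal = PIdl\<^bsub>UP \<Z>\<^esub> (up_ring.monom (UP \<Z>) 1 2)"

definition dual_ring :: "dual ring" where
  "dual_ring = UP \<Z> Quot dual_ideal"

definition dual_gen :: dual where
  "dual_gen = dual_ideal +>\<^bsub>UP \<Z>\<^esub> up_ring.monom (UP \<Z>) 1 1"

text \<open>Its additive group, with the unit in degree (0,0) and the class of the indeterminate in
  degree \<open>d\<close>.\<close>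

definition graded_dual :: "nat \<times> nat \<Rightarrow> dual bigraded" where
  "graded_dual d = with_grading (add_monoid dual_ring)
     (\<lambda>d'. generate (add_monoid dual_ring)
             ((if d' = (0, 0) then {\<one>\<^bsub>dual_ring\<^esub>} else {}) \<union> (if d' = d then {dual_gen} else {})))"

definition alg_A :: "dual bigraded" where "alg_A = graded_dual (1, 0)"

definition alg_B :: "dual bigraded" where "alg_B = graded_dual (0, 1)"

definition eta_A :: "dual \<Rightarrow> int" where
  "eta_A = (THE h. h \<in> hom alg_A integer_group \<and> h \<in> extensional (carrier alg_A) \<and>
                   h \<one>\<^bsub>dual_ring\<^esub> = 1 \<and> h dual_gen = 0)"


section \<open>Graphs\<close>

text \<open>\<open>ends e\<close> is the set of endpoints of \<open>e\<close>, a singleton for a loop.\<close>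

record ('v, 'e) multigraph =
  verts :: "'v set"
  edges :: "'e set"
  ends :: "'e \<Rightarrow> 'v set"

definition finite_graph :: "('v, 'e) multigraph \<Rightarrow> bool" where
  "finite_graph G \<longleftrightarrow> finite (verts G) \<and> finite (edges G) \<and>
     (\<forall>e\<in>edges G. ends G e \<subseteq> verts G \<and> card (ends G e) \<in> {1, 2})"

definition graph_isomorphic :: "('v, 'e) multigraph \<Rightarrow> ('x, 'y) multigraph \<Rightarrow> bool" where
  "graph_isomorphic G G' \<longleftrightarrow>
     (\<exists>f h. bij_betw f (verts G) (verts G') \<and> bij_betw h (edges G) (edges G') \<and>
            (\<forall>e\<in>edges G. ends G' (h e) = f ` ends G e))"

definition edge_ordering :: "('v, 'e) multigraph \<Rightarrow> 'e list \<Rightarrow> bool" where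
  "edge_ordering G es \<longleftrightarrow> distinct es \<and> set es = edges G"

text \<open>In the following, a set S of edges stands for the spanning subgraph [G:S].\<close>

definition reachable :: "('v, 'e) multigraph \<Rightarrow> 'e set \<Rightarrow> ('v \<times> 'v) set" where
  "reachable G S = {(x, y). \<exists>e\<in>S. ends G e = {x, y}}\<^sup>* \<inter> verts G \<times> verts G"

definition component_of :: "('v, 'e) multigraph \<Rightarrow> 'e set \<Rightarrow> 'v \<Rightarrow> 'v set" where
  "component_of G S v = reachable G S `` {v}"

definition components :: "('v, 'e) multigraph \<Rightarrow> 'e set \<Rightarrow> 'v set set" where
  "components G S = verts G // reachable G S"

definition betti0 :: "('v, 'e) multigraph \<Rightarrow> 'e set \<Rightarrow> nat" where
  "betti0 G S = card (components G S)"

text \<open>An arbitrary choice of first and second endpoint, used to orient the edges for cellular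
  homology and to name the two components joined by an edge.\<close>

definition endpoints :: "('v, 'e) multigraph \<Rightarrow> 'e \<Rightarrow> 'v \<times> 'v" where
  "endpoints G e = (SOME p. ends G e = {fst p, snd p})"

definition boundary :: "('v, 'e) multigraph \<Rightarrow> ('e \<Rightarrow>\<^sub>0 int) \<Rightarrow> ('v \<Rightarrow>\<^sub>0 int)" where
  "boundary G = frag_extend (\<lambda>e. frag_of (snd (endpoints G e)) - frag_of (fst (endpoints G e)))"

text \<open>The first homology group of the one-dimensional complex [G:S].\<close>

definition homology1 :: "('v, 'e) multigraph \<Rightarrow> 'e set \<Rightarrow> ('e \<Rightarrow>\<^sub>0 int) monoid" where
  "homology1 G S = (free_Abelian_group S)
     \<lparr>carrier := kernel (free_Abelian_group S) (free_Abelian_group (verts G)) (boundary G)\<rparr>"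

definition betti1 :: "('v, 'e) multigraph \<Rightarrow> 'e set \<Rightarrow> nat" where
  "betti1 G S = rank_Q (homology1 G S)"

definition g_poly :: "('v, 'e) multigraph \<Rightarrow> int poly poly" where
  "g_poly G = (\<Sum>S\<in>Pow (edges G).
     (-1) ^ card S * (1 + t_var) ^ (card S + betti0 G S) * (1 + w_var) ^ betti1 G S)"


section \<open>The complexes\<close>

text \<open>Vertices of the cube are identified with the edge sets S they encode, and a cube edge with
  a pair (S, e) where S is the edge set at its initial vertex and \<open>e \<notin> S\<close> is the edge at the
  starred position.\<close>

definition cube_level :: "'e list \<Rightarrow> nat \<Rightarrow> 'e set set" where
  "cube_level es i = {S. S \<subseteq> set es \<and> card S = i}"

definition cube_sign :: "'e list \<Rightarrow> 'e set \<Rightarrow> 'e \<Rightarrow> int" where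
  "cube_sign es S e =
     (let j = (THE j. j < length es \<and> es ! j = e) in (-1) ^ card {i. i < j \<and> es ! i \<in> S})"

definition cube_complex ::
  "'e list \<Rightarrow> ('e set \<Rightarrow> 'a bigraded) \<Rightarrow> ('e set \<Rightarrow> 'e \<Rightarrow> 'a \<Rightarrow> 'a) \<Rightarrow> ('e set \<Rightarrow> 'a) complex_data" where
  "cube_complex es M d =
     \<lparr>obj = (\<lambda>i. direct_sum (cube_level es i) M),
      diff = (\<lambda>i. \<lambda>c\<in>carrier (direct_sum (cube_level es i) M). \<lambda>T\<in>cube_level es (Suc i).
        finprod (M T)
          (\<lambda>e. d (T - {e}) e (c (T - {e})) [^]\<^bsub>M T\<^esub> cube_sign es (T - {e}) e) T)\<rparr>"

definition mod_T where
  "mod_T G S = tensor (tensor_power (components G S) alg_A) (tensor_power {..<betti1 G S} alg_B)"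

definition mod_Y where
  "mod_Y G S = tensor (tensor_power S alg_A) (mod_T G S)"

text \<open>The map sending b to \<open>b \<otimes> 1\<close>, from k to k + 1 tensor factors.\<close>

definition append_unit_B :: "nat \<Rightarrow> ((nat \<Rightarrow> dual) \<Rightarrow>\<^sub>0 int) set \<Rightarrow> ((nat \<Rightarrow> dual) \<Rightarrow>\<^sub>0 int) set" where
  "append_unit_B k = power_lift {..<k} alg_B (power_group {..<Suc k} alg_B)
     (\<lambda>x. pure_power {..<Suc k} alg_B (x(k := \<one>\<^bsub>dual_ring\<^esub>)))"

definition insert_unit_A :: "'e set \<Rightarrow> 'e \<Rightarrow> (('e \<Rightarrow> dual) \<Rightarrow>\<^sub>0 int) set \<Rightarrow> (('e \<Rightarrow> dual) \<Rightarrow>\<^sub>0 int) set" where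
  "insert_unit_A S e = power_lift S alg_A (power_group (insert e S) alg_A)
     (\<lambda>x. pure_power (insert e S) alg_A (x(e := \<one>\<^bsub>dual_ring\<^esub>)))"

definition merge_A :: "'c set \<Rightarrow> 'c set \<Rightarrow> 'c \<Rightarrow> 'c \<Rightarrow> 'c \<Rightarrow>
    (('c \<Rightarrow> dual) \<Rightarrow>\<^sub>0 int) set \<Rightarrow> (('c \<Rightarrow> dual) \<Rightarrow>\<^sub>0 int) set" where
  "merge_A I J c0 c1 c' = power_lift I alg_A (power_group J alg_A)
     (\<lambda>x. pure_power J alg_A (\<lambda>c\<in>J. if c = c' then x c0 \<otimes>\<^bsub>dual_ring\<^esub> x c1 else x c))"

definition edge_map_T where
  "edge_map_T G S e =
     (let E0 = component_of G S (fst (endpoints G e)); E1 = component_of G S (snd (endpoints G e));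
          S' = insert e S; same = (E0 = E1)
      in tensor_map
           (tensor_power (components G S) alg_A) (tensor_power {..<betti1 G S} alg_B)
           (tensor_power (components G S') alg_A) (tensor_power {..<betti1 G S'} alg_B)
           (if same then (\<lambda>z. z) else merge_A (components G S) (components G S') E0 E1 (E0 \<union> E1))
           (if same then append_unit_B (betti1 G S) else (\<lambda>z. z)))"

definition edge_map_Y where
  "edge_map_Y G S e =
     tensor_map (tensor_power S alg_A) (mod_T G S) (tensor_power (insert e S) alg_A) (mod_T G (insert e S))
       (insert_unit_A S e) (edge_map_T G S e)"

definition C_T where
  "C_T G es = cube_complex es (mod_T G) (edge_map_T G)"

definition C_Y where
  "C_Y G es = cube_complex es (mod_Y G) (edge_map_Y G)"

text \<open>The maps phi and psi on the summand of S. The zeroth power of the integers and its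
  tensor product with a module are identified with the integers and with that module.\<close>

definition phi_summand where
  "phi_summand G S z =
     pure_tensor (tensor_power S alg_A) (mod_T G S) (pure_power S alg_A (\<lambda>e\<in>S. \<one>\<^bsub>dual_ring\<^esub>)) z"

definition eta_power :: "'e set \<Rightarrow> (('e \<Rightarrow> dual) \<Rightarrow>\<^sub>0 int) set \<Rightarrow> int" where
  "eta_power S = power_lift S alg_A integer_group (\<lambda>x. \<Prod>e\<in>S. eta_A (x e))"

definition psi_summand where
  "psi_summand G S =
     tensor_lift (tensor_power S alg_A) (mod_T G S) (mod_T G S)
       (\<lambda>p z. z [^]\<^bsub>mod_T G S\<^esub> eta_power S p)"

definition phi where
  "phi G es i = (\<lambda>c\<in>carrier (obj (C_T G es) i). \<lambda>S\<in>cube_level es i. phi_summand G S (c S))"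

definition psi where
  "psi G es i = (\<lambda>c\<in>carrier (obj (C_Y G es) i). \<lambda>S\<in>cube_level es i. psi_summand G S (c S))"

end

theory Submission
  imports Defs "HOL-Library.Product_Plus"
begin

text \<open>Every module of the two cubes is free on homogeneous elements, so its elements are
  separated by homomorphisms to the integers. Identities between maps of the complexes thereby
  become identities of integer sums, in which the signs of the cube are treated by counting
  inversions; the same count gives the signs that correct a change of the order of the edges.

  The maps m, u and f, and the relabelling along an isomorphism of graphs, are all induced by maps
  of index sets that multiply the tensor factors over each index. This assignment is functorial, so
  the squares of the cube commute because the components of [G:S] are mapped compatibly along the
  inclusions of edge sets.

  Since eta sends 1 to 1, psi after phi is the identity, and a retraction splits off its kernel.
  For the Euler characteristic, rank-nullity is applied to the differential in every bidegree; the
  summand of S contributes a product of factors 1 + t and 1 + w, one for each tensor factor.\<close>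

section \<open>Abelian groups\<close>

text \<open>Tensor products are given by generators and relations, where it is easy to show that an
  element vanishes and hard to show that it does not. Freeness is therefore never argued with
  relations: the universal property supplies functionals dual to a generating family, and
  independence follows. The homogeneous parts, defined by generators, can then be described as
  common zeros of coordinates, a form in which degrees can be checked. Cohomology may have torsion,
  so bases there are understood up to nonzero multiples: every element has a multiple that is an
  integral combination. This keeps the rank count inside abelian groups until it is compared with
  the rational dimension. The first Betti number is defined by cycles, whereas the B-factors are
  merely numbered and not attached to particular cycles. All maps between them are initial
  inclusions, so only the growth of b_1 along an edge matters. That growth is deduced from the
  relation b_1 + |V| = |S| + b_0, which in turn comes from two applications of rank-nullity.\<close>

lemma hom_ext_generate:
  assumes "group M" "group N" and f: "f \<in> hom M N" and g: "g \<in> hom M N"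
    and B: "B \<subseteq> carrier M" and eq: "\<And>x. x \<in> B \<Longrightarrow> f x = g x" and x: "x \<in> generate M B"
  shows "f x = g x"
proof -
  interpret M: group M by fact
  interpret N: group N by fact
  interpret f: group_hom M N f by unfold_locales (rule f)
  interpret g: group_hom M N g by unfold_locales (rule g)
  show ?thesis using x
  proof (induction rule: generate.induct)
    case (eng a b)
    then show ?case using M.generate_in_carrier[OF B] by simp
  qed (use B eq in auto)
qed

text \<open>The homogeneous parts of tensor modules are subgroups given by generators. Both the
  preservation of bidegrees and the spanning arguments for bases reduce to a check on generators in
  this way.\<close>

lemma hom_generate_subset:
  assumes "group M" "group N" and f: "f \<in> hom M N" and H: "subgroup H N"
    and B: "B \<subseteq> carrier M" and fB: "\<And>x. x \<in> B \<Longrightarrow> f x \<in> H" and x: "x \<in> generate M B"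
  shows "f x \<in> H"
proof -
  interpret M: group M by fact
  interpret N: group N by fact
  interpret f: group_hom M N f by unfold_locales (rule f)
  interpret H: subgroup H N by (rule H)
  show ?thesis using x
  proof (induction rule: generate.induct)
    case (eng a b)
    then show ?case using M.generate_in_carrier[OF B] by simp
  next
    case (inv a)
    then show ?case using B fB[OF inv] H.m_inv_closed by (auto simp: subset_iff)
  qed (use B fB in auto)
qed

lemma finprod_in_subgroup:
  assumes "comm_group M" "subgroup H M" "\<And>x. x \<in> A \<Longrightarrow> f x \<in> H"
  shows "finprod M f A \<in> H"
proof -
  interpret comm_group M by fact
  interpret H: subgroup H M by fact
  show ?thesis using assms(3)
    by (induction A rule: infinite_finite_induct) (auto simp: Pi_iff)
qed

lemma hom_finprod:
  assumes "comm_group M" "comm_group N" "h \<in> hom M N" "\<And>x. x \<in> A \<Longrightarrow> f x \<in> carrier M"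
  shows "h (finprod M f A) = finprod N (\<lambda>x. h (f x)) A"
proof -
  interpret M: comm_group M by fact
  interpret N: comm_group N by fact
  interpret h: group_hom M N h by unfold_locales (rule assms(3))
  show ?thesis using assms(4)
    by (induction A rule: infinite_finite_induct) (auto simp: Pi_iff)
qed

lemma comm_group_integer_group: "comm_group integer_group"
  by (rule abelian_integer_group)

lemma finprod_integer_group: "finprod integer_group f A = sum f A"
proof -
  interpret comm_group integer_group by (rule comm_group_integer_group)
  show ?thesis
    by (induction A rule: infinite_finite_induct) auto
qed

lemma hom_integer_finprod:
  assumes "comm_group M" "h \<in> hom M integer_group" "\<And>x. x \<in> A \<Longrightarrow> f x \<in> carrier M"
  shows "h (finprod M f A) = (\<Sum>x\<in>A. h (f x))"
  using hom_finprod[OF assms(1) comm_group_integer_group assms(2,3)]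
  by (simp add: finprod_integer_group)

lemma hom_integer_pow:
  assumes "group M" "h \<in> hom M integer_group" "x \<in> carrier M"
  shows "h (x [^]\<^bsub>M\<^esub> (k::int)) = k * h x"
  using hom_int_pow[OF assms(2,3,1)] by simp

lemma comm_group_rat_group: "comm_group rat_group"
proof (rule comm_groupI)
  fix x :: rat
  show "\<exists>y\<in>carrier rat_group. y \<otimes>\<^bsub>rat_group\<^esub> x = \<one>\<^bsub>rat_group\<^esub>"
    by (rule bexI[of _ "- x"]) (auto simp: rat_group_def)
qed (auto simp: rat_group_def)

lemma rat_group_simps [simp]: "carrier rat_group = UNIV" "x \<otimes>\<^bsub>rat_group\<^esub> y = x + y"
    "\<one>\<^bsub>rat_group\<^esub> = 0"
  by (auto simp: rat_group_def)

lemma finprod_rat_group: "finprod rat_group f A = sum f A"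
proof -
  interpret comm_group rat_group by (rule comm_group_rat_group)
  show ?thesis
    by (induction A rule: infinite_finite_induct) auto
qed

lemma inv_rat_group [simp]: "inv\<^bsub>rat_group\<^esub> x = - x"
proof -
  interpret comm_group rat_group by (rule comm_group_rat_group)
  show ?thesis by (rule inv_equality) auto
qed

lemma nat_pow_rat_group: "x [^]\<^bsub>rat_group\<^esub> (n::nat) = of_nat n * x"
proof -
  interpret comm_group rat_group by (rule comm_group_rat_group)
  show ?thesis by (induction n) (auto simp: algebra_simps)
qed

lemma int_pow_rat_group [simp]: "x [^]\<^bsub>rat_group\<^esub> (k::int) = of_int k * x"
  by (auto simp: int_pow_def2 nat_pow_rat_group)

lemma hom_rat_finprod:
  assumes "comm_group M" "h \<in> hom M rat_group" "\<And>x. x \<in> A \<Longrightarrow> f x \<in> carrier M"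
  shows "h (finprod M f A) = (\<Sum>x\<in>A. h (f x))"
  using hom_finprod[OF assms(1) comm_group_rat_group assms(2,3)]
  by (simp add: finprod_rat_group)

lemma hom_rat_pow:
  assumes "group M" "h \<in> hom M rat_group" "x \<in> carrier M"
  shows "h (x [^]\<^bsub>M\<^esub> (k::int)) = of_int k * h x"
  using hom_int_pow[OF assms(2,3,1) comm_group.axioms(2)[OF comm_group_rat_group]] by simp

lemma int_pow_hom:
  assumes "comm_group M"
  shows "(\<lambda>x. x [^]\<^bsub>M\<^esub> (k::int)) \<in> hom M M"
proof -
  interpret comm_group M by fact
  show ?thesis by (auto simp: hom_def int_pow_distrib)
qed

lemma int_pow_in_subgroup:
  assumes "group M" "subgroup H M" "x \<in> H"
  shows "x [^]\<^bsub>M\<^esub> (k::int) \<in> H"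
  using group.subgroup_int_pow_closed[OF assms] .


section \<open>Groups given by generators and relations\<close>

context
  fixes X :: "'x set" and R :: "('x \<Rightarrow>\<^sub>0 int) set"
  assumes R: "R \<subseteq> carrier (free_Abelian_group X)"
begin

lemma normal_relators: "generate (free_Abelian_group X) R \<lhd> free_Abelian_group X"
proof -
  interpret F: comm_group "free_Abelian_group X" by (rule abelian_free_Abelian_group)
  show ?thesis using F.normal_iff_subgroup F.generate_is_subgroup[OF R] by blast
qed

lemma comm_group_presented: "comm_group (presented X R)"
proof -
  interpret F: comm_group "free_Abelian_group X" by (rule abelian_free_Abelian_group)
  show ?thesis unfolding presented_def
    by (rule F.abelian_FactGroup) (rule F.generate_is_subgroup[OF R])
qed

lemma presented_proj:
  "(\<lambda>c. generate (free_Abelian_group X) R #>\<^bsub>free_Abelian_group X\<^esub> c)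
     \<in> hom (free_Abelian_group X) (presented X R)"
  unfolding presented_def by (rule normal.r_coset_hom_Mod[OF normal_relators])

lemma gen_class_closed: "x \<in> X \<Longrightarrow> gen_class X R x \<in> carrier (presented X R)"
  using hom_in_carrier[OF presented_proj, of "frag_of x"] by (simp add: gen_class_def)

lemma presented_generated:
  "carrier (presented X R) \<subseteq> generate (presented X R) (gen_class X R ` X)"
proof
  fix y assume "y \<in> carrier (presented X R)"
  then obtain c where c: "Poly_Mapping.keys c \<subseteq> X"
    and y: "y = generate (free_Abelian_group X) R #>\<^bsub>free_Abelian_group X\<^esub> c"
    by (auto simp: presented_def carrier_FactGroup)
  let ?p = "\<lambda>c. generate (free_Abelian_group X) R #>\<^bsub>free_Abelian_group X\<^esub> c"
  interpret F: comm_group "free_Abelian_group X" by (rule abelian_free_Abelian_group)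
  interpret P: comm_group "presented X R" by (rule comm_group_presented)
  interpret p: group_hom "free_Abelian_group X" "presented X R" ?p
    by unfold_locales (rule presented_proj)
  have sub: "gen_class X R ` X \<subseteq> carrier (presented X R)" using gen_class_closed by blast
  interpret S: subgroup "generate (presented X R) (gen_class X R ` X)" "presented X R"
    by (rule P.generate_is_subgroup[OF sub])
  have "Poly_Mapping.keys c \<subseteq> X \<and> ?p c \<in> generate (presented X R) (gen_class X R ` X)" using c
  proof (induction rule: frag_induction)
    case zero
    then show ?case using p.hom_one S.one_closed by simp
  next
    case (one a)
    then show ?case unfolding gen_class_def[symmetric] by (auto intro: generate.incl)
  next
    case (diff a b)
    then have ab: "a \<in> carrier (free_Abelian_group X)" "b \<in> carrier (free_Abelian_group X)" by auto
    then have e: "a - b = a \<otimes>\<^bsub>free_Abelian_group X\<^esub> inv\<^bsub>free_Abelian_group X\<^esub> b" by simp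
    have "?p (a - b) = ?p a \<otimes>\<^bsub>presented X R\<^esub> inv\<^bsub>presented X R\<^esub> ?p b"
      unfolding e using ab p.hom_mult p.hom_inv F.inv_closed by metis
    then show ?case using diff S.m_closed S.m_inv_closed keys_diff[of a b] by auto
  qed
  then show "y \<in> generate (presented X R) (gen_class X R ` X)" using y by simp
qed

text \<open>Adding an element of the subgroup that is divided out does not change a coset. All
  relators of tensor products and tensor powers have the form x - y - z, so every additivity law of
  pure tensors is an instance.\<close>

lemma gen_class_rel:
  assumes xyz: "x \<in> X" "y \<in> X" "z \<in> X" and r: "frag_of x - frag_of y - frag_of z \<in> R"
  shows "gen_class X R x = gen_class X R y \<otimes>\<^bsub>presented X R\<^esub> gen_class X R z"
proof -
  let ?F = "free_Abelian_group X" and ?N = "generate (free_Abelian_group X) R"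
  interpret F: comm_group ?F by (rule abelian_free_Abelian_group)
  interpret N: normal ?N ?F by (rule normal_relators)
  have yz: "frag_of y + frag_of z \<in> carrier ?F"
    using xyz by (auto dest!: subsetD[OF keys_add])
  have d: "frag_of x - frag_of y - frag_of z \<in> ?N" using r by (rule generate.incl)
  have "?N #>\<^bsub>?F\<^esub> (frag_of x) = ?N #>\<^bsub>?F\<^esub> ((frag_of x - frag_of y - frag_of z) \<otimes>\<^bsub>?F\<^esub> (frag_of y + frag_of z))"
    by simp
  also have "\<dots> = (?N #>\<^bsub>?F\<^esub> (frag_of x - frag_of y - frag_of z)) #>\<^bsub>?F\<^esub> (frag_of y + frag_of z)"
    using F.coset_mult_assoc[OF N.subset subsetD[OF R r] yz] by simp
  also have "\<dots> = ?N #>\<^bsub>?F\<^esub> (frag_of y + frag_of z)"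
    using F.coset_join2[OF subsetD[OF R r] N.subgroup_axioms d] by simp
  also have "\<dots> = gen_class X R y \<otimes>\<^bsub>presented X R\<^esub> gen_class X R z"
    using hom_mult[OF presented_proj, of "frag_of y" "frag_of z"] xyz by (simp add: gen_class_def)
  finally show ?thesis by (simp add: gen_class_def)
qed

end


section \<open>Tensor products\<close>

lemma tensor_rels_closed:
  assumes "comm_group M" "comm_group N"
  shows "tensor_rels M N \<subseteq> carrier (free_Abelian_group (carrier M \<times> carrier N))"
proof -
  interpret M: comm_group M by fact
  interpret N: comm_group N by fact
  show ?thesis unfolding tensor_rels_def
    by (intro Un_least subsetI) (auto dest!: subsetD[OF keys_diff])
qed

context
  fixes M :: "('a, 'm) monoid_scheme" and N :: "('b, 'n) monoid_scheme"
  assumes M: "comm_group M" and N: "comm_group N"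
begin

interpretation M: comm_group M by (rule M)
interpretation N: comm_group N by (rule N)

lemma comm_group_tensor_group: "comm_group (tensor_group M N)"
  unfolding tensor_group_def by (rule comm_group_presented[OF tensor_rels_closed[OF M N]])

lemma pure_tensor_closed:
  "x \<in> carrier M \<Longrightarrow> y \<in> carrier N \<Longrightarrow> pure_tensor M N x y \<in> carrier (tensor_group M N)"
  unfolding tensor_group_def pure_tensor_def
  by (rule gen_class_closed[OF tensor_rels_closed[OF M N]]) auto

lemma tensor_generated:
  "carrier (tensor_group M N) \<subseteq>
     generate (tensor_group M N) {pure_tensor M N x y | x y. x \<in> carrier M \<and> y \<in> carrier N}"
  (is "_ \<subseteq> generate _ ?P")
proof -
  have "?P = gen_class (carrier M \<times> carrier N) (tensor_rels M N) ` (carrier M \<times> carrier N)"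
    unfolding pure_tensor_def by auto
  then show ?thesis unfolding tensor_group_def
    using presented_generated[OF tensor_rels_closed[OF M N]] by simp
qed

lemma pure_tensor_left_hom:
  assumes y: "y \<in> carrier N"
  shows "(\<lambda>x. pure_tensor M N x y) \<in> hom M (tensor_group M N)"
proof (rule homI)
  fix x x' assume x: "x \<in> carrier M" "x' \<in> carrier M"
  then have "frag_of (x \<otimes>\<^bsub>M\<^esub> x', y) - frag_of (x, y) - frag_of (x', y) \<in> tensor_rels M N"
    using y unfolding tensor_rels_def by blast
  then show "pure_tensor M N (x \<otimes>\<^bsub>M\<^esub> x') y =
      pure_tensor M N x y \<otimes>\<^bsub>tensor_group M N\<^esub> pure_tensor M N x' y"
    unfolding tensor_group_def pure_tensor_def
    using x y by (intro gen_class_rel[OF tensor_rels_closed[OF M N]]) auto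
qed (use y pure_tensor_closed in auto)

lemma pure_tensor_right_hom:
  assumes x: "x \<in> carrier M"
  shows "(\<lambda>y. pure_tensor M N x y) \<in> hom N (tensor_group M N)"
proof (rule homI)
  fix y y' assume y: "y \<in> carrier N" "y' \<in> carrier N"
  then have "frag_of (x, y \<otimes>\<^bsub>N\<^esub> y') - frag_of (x, y) - frag_of (x, y') \<in> tensor_rels M N"
    using x unfolding tensor_rels_def by blast
  then show "pure_tensor M N x (y \<otimes>\<^bsub>N\<^esub> y') =
      pure_tensor M N x y \<otimes>\<^bsub>tensor_group M N\<^esub> pure_tensor M N x y'"
    unfolding tensor_group_def pure_tensor_def
    using x y by (intro gen_class_rel[OF tensor_rels_closed[OF M N]]) auto
qed (use x pure_tensor_closed in auto)

lemma tensor_hom_ext: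
  assumes "group T" "f \<in> hom (tensor_group M N) T" "g \<in> hom (tensor_group M N) T"
    and "\<And>x y. x \<in> carrier M \<Longrightarrow> y \<in> carrier N \<Longrightarrow> f (pure_tensor M N x y) = g (pure_tensor M N x y)"
    and "z \<in> carrier (tensor_group M N)"
  shows "f z = g z"
  by (rule hom_ext_generate[OF comm_group.axioms(2)[OF comm_group_tensor_group] assms(1,2,3) _ _ subsetD[OF tensor_generated assms(5)]])
    (use assms(4) pure_tensor_closed in auto)

end

section \<open>Tensor powers over an index set\<close>

lemma power_rels_closed:
  assumes "comm_group M"
  shows "power_rels I M \<subseteq> carrier (free_Abelian_group (I \<rightarrow>\<^sub>E carrier M))"
proof
  interpret M: comm_group M by fact
  fix r assume "r \<in> power_rels I M"
  then obtain f i x y where r: "r = frag_of (f(i := x \<otimes>\<^bsub>M\<^esub> y)) - frag_of (f(i := x)) - frag_of (f(i := y))"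
    and f: "f \<in> (I \<rightarrow>\<^sub>E carrier M)" "i \<in> I" "x \<in> carrier M" "y \<in> carrier M"
    unfolding power_rels_def by blast
  have "Poly_Mapping.keys r \<subseteq> {f(i := x \<otimes>\<^bsub>M\<^esub> y), f(i := x), f(i := y)}"
    unfolding r by (auto dest!: subsetD[OF keys_diff])
  also have "\<dots> \<subseteq> (I \<rightarrow>\<^sub>E carrier M)" using f by (auto simp: PiE_iff extensional_def)
  finally show "r \<in> carrier (free_Abelian_group (I \<rightarrow>\<^sub>E carrier M))" by simp
qed

lemma fun_upd_in_PiE: "f \<in> (I \<rightarrow>\<^sub>E A) \<Longrightarrow> i \<in> I \<Longrightarrow> x \<in> A \<Longrightarrow> f(i := x) \<in> (I \<rightarrow>\<^sub>E A)"
  by (auto simp: PiE_iff extensional_def)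

context
  fixes M :: "('a, 'm) monoid_scheme" and I :: "'i set"
  assumes M: "comm_group M"
begin

interpretation M: comm_group M by (rule M)

lemma comm_group_power_group: "comm_group (power_group I M)"
  unfolding power_group_def by (rule comm_group_presented[OF power_rels_closed[OF M]])

lemma pure_power_closed:
  "x \<in> (I \<rightarrow>\<^sub>E carrier M) \<Longrightarrow> pure_power I M x \<in> carrier (power_group I M)"
  unfolding power_group_def pure_power_def
  by (rule gen_class_closed[OF power_rels_closed[OF M]]) auto

lemma power_generated:
  "carrier (power_group I M) \<subseteq> generate (power_group I M) (pure_power I M ` (I \<rightarrow>\<^sub>E carrier M))"
proof -
  have "pure_power I M ` (I \<rightarrow>\<^sub>E carrier M) =
      gen_class (I \<rightarrow>\<^sub>E carrier M) (power_rels I M) ` (I \<rightarrow>\<^sub>E carrier M)"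
    unfolding pure_power_def by auto
  then show ?thesis unfolding power_group_def
    using presented_generated[OF power_rels_closed[OF M]] by simp
qed

lemma pure_power_hom:
  assumes f: "f \<in> (I \<rightarrow>\<^sub>E carrier M)" and i: "i \<in> I"
  shows "(\<lambda>x. pure_power I M (f(i := x))) \<in> hom M (power_group I M)"
proof (rule homI)
  fix x y assume x: "x \<in> carrier M" and y: "y \<in> carrier M"
  then have "frag_of (f(i := x \<otimes>\<^bsub>M\<^esub> y)) - frag_of (f(i := x)) - frag_of (f(i := y)) \<in> power_rels I M"
    using f i unfolding power_rels_def by blast
  then show "pure_power I M (f(i := x \<otimes>\<^bsub>M\<^esub> y)) =
      pure_power I M (f(i := x)) \<otimes>\<^bsub>power_group I M\<^esub> pure_power I M (f(i := y))"
    unfolding power_group_def pure_power_def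
    using f i x y by (intro gen_class_rel[OF power_rels_closed[OF M]] fun_upd_in_PiE) auto
qed (rule pure_power_closed[OF fun_upd_in_PiE[OF f i]])

lemma power_hom_ext:
  assumes "group T" "f \<in> hom (power_group I M) T" "g \<in> hom (power_group I M) T"
    and "\<And>x. x \<in> (I \<rightarrow>\<^sub>E carrier M) \<Longrightarrow> f (pure_power I M x) = g (pure_power I M x)"
    and "z \<in> carrier (power_group I M)"
  shows "f z = g z"
  by (rule hom_ext_generate[OF comm_group.axioms(2)[OF comm_group_power_group] assms(1,2,3) _ _ subsetD[OF power_generated assms(5)]])
    (use assms(4) pure_power_closed in auto)

end


section \<open>Gradings\<close>

lemma with_grading_simps [simp]:
  "carrier (with_grading M g) = carrier M" "x \<otimes>\<^bsub>with_grading M g\<^esub> y = x \<otimes>\<^bsub>M\<^esub> y"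
  "\<one>\<^bsub>with_grading M g\<^esub> = \<one>\<^bsub>M\<^esub>" "grade (with_grading M g) = g"
  by (simp_all add: with_grading_def)

lemma graded_part_simps [simp]:
  "carrier (graded_part M d) = grade M d" "x \<otimes>\<^bsub>graded_part M d\<^esub> y = x \<otimes>\<^bsub>M\<^esub> y"
  "\<one>\<^bsub>graded_part M d\<^esub> = \<one>\<^bsub>M\<^esub>"
  by (simp_all add: graded_part_def)

context
  fixes M :: "('a, 'm) monoid_scheme" and N :: "('a, 'n) monoid_scheme"
  assumes same: "carrier M = carrier N" "monoid.mult M = monoid.mult N" "one M = one N"
begin

text \<open>Attaching a grading changes the type of a record but not the three fields on which the
  group notions depend. These transfer rules allow facts about a bare group to be used for its
  graded version.\<close>

lemma same_group: "group M = group N"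
  unfolding group_def group_axioms_def Group.monoid_def Units_def same by (rule refl)

lemma same_comm_group: "comm_group M = comm_group N"
  unfolding comm_group_def comm_monoid_def comm_monoid_axioms_def
    group_def group_axioms_def Group.monoid_def Units_def same by (rule refl)

lemma same_inv: "m_inv M = m_inv N"
  unfolding m_inv_def same by (rule refl)

lemma same_subgroup: "subgroup H M = subgroup H N"
  unfolding subgroup_def same same_inv by (rule refl)

lemma same_generate: "generate M = generate N"
proof (rule ext)
  fix B
  have "x \<in> generate N B" if "x \<in> generate M B" for x using that
  proof (induction rule: generate.induct)
    case one show ?case unfolding same by (rule generate.one)
  next
    case (incl h) then show ?case by (rule generate.incl)
  next
    case (inv h) then show ?case unfolding same_inv by (rule generate.inv)
  next
    case (eng a b) show ?case unfolding same by (rule generate.eng[OF eng.IH])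
  qed
  moreover have "x \<in> generate M B" if "x \<in> generate N B" for x using that
  proof (induction rule: generate.induct)
    case one show ?case unfolding same[symmetric] by (rule generate.one)
  next
    case (incl h) then show ?case by (rule generate.incl)
  next
    case (inv h) then show ?case unfolding same_inv[symmetric] by (rule generate.inv)
  next
    case (eng a b) show ?case unfolding same[symmetric] by (rule generate.eng[OF eng.IH])
  qed
  ultimately show "generate M B = generate N B" by (intro equalityI subsetI)
qed

lemma same_int_pow: "x [^]\<^bsub>M\<^esub> (k::int) = x [^]\<^bsub>N\<^esub> k"
  unfolding int_pow_def2 nat_pow_def same same_inv by (rule refl)

lemma same_finprod: "finprod M f A = finprod N f A"
  unfolding finprod_def same by (rule refl)

lemma same_gfinprod: "gfinprod M f A = gfinprod N f A"
  unfolding gfinprod_def same_finprod same by (rule refl)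

end

lemmas same_monoid = same_group same_comm_group same_inv same_subgroup same_generate
  same_int_pow same_finprod same_gfinprod

lemma mult_with_grading [simp]: "monoid.mult (with_grading M g) = monoid.mult M"
  by (simp add: with_grading_def)

lemmas same_with_grading [simp] =
  same_monoid[OF with_grading_simps(1) mult_with_grading with_grading_simps(3)]

lemma hom_with_grading [simp]: "hom (with_grading M g) N = hom M N" "hom N (with_grading M g) = hom N M"
  by (auto simp: hom_def)

lemma tensor_simps [simp]:
  "carrier (tensor M N) = carrier (tensor_group M N)"
  "monoid.mult (tensor M N) = monoid.mult (tensor_group M N)"
  "\<one>\<^bsub>tensor M N\<^esub> = \<one>\<^bsub>tensor_group M N\<^esub>"
  by (simp_all only: tensor_def with_grading_simps mult_with_grading)

lemma tensor_power_simps [simp]: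
  "carrier (tensor_power I M) = carrier (power_group I M)"
  "monoid.mult (tensor_power I M) = monoid.mult (power_group I M)"
  "\<one>\<^bsub>tensor_power I M\<^esub> = \<one>\<^bsub>power_group I M\<^esub>"
  by (simp_all only: tensor_power_def with_grading_simps mult_with_grading)

declare split_paired_All [simp del] split_paired_Ex [simp del]

lemma (in comm_group) comm_group_subgroup:
  assumes "subgroup H G"
  shows "comm_group (G\<lparr>carrier := H\<rparr>)"
proof -
  interpret H: group "G\<lparr>carrier := H\<rparr>" by (rule subgroup_imp_group[OF assms])
  show ?thesis
    by (rule H.group_comm_groupI) (use subgroup.subset[OF assms] in \<open>auto intro: m_comm\<close>)
qed

section \<open>Bigraded modules through their homogeneous projections\<close>

text \<open>The decomposition into homogeneous components, as a family of projections.
  \<open>bigraded_module\<close> only says that the sum map is an isomorphism; projections commute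
  with graded maps, and stability under them is the condition for a grading to pass to submodules
  and quotients.\<close>

definition grading_proj :: "'a bigraded \<Rightarrow> (nat \<times> nat \<Rightarrow> 'a \<Rightarrow> 'a) \<Rightarrow> bool" where
  "grading_proj M p \<longleftrightarrow>
     (\<forall>d. p d \<in> hom M M) \<and> (\<forall>d. \<forall>x\<in>carrier M. p d x \<in> grade M d) \<and>
     (\<forall>d e. \<forall>x\<in>grade M e. p d x = (if d = e then x else \<one>\<^bsub>M\<^esub>)) \<and>
     (\<forall>x\<in>carrier M. finite {d. p d x \<noteq> \<one>\<^bsub>M\<^esub>} \<and> gfinprod M (\<lambda>d. p d x) UNIV = x)"

lemma comm_group_graded_part:
  assumes "comm_group M" "subgroup (grade M d) M"
  shows "comm_group (graded_part M d)"
proof -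
  have "comm_group (M\<lparr>carrier := grade M d\<rparr>)"
    by (rule comm_group.comm_group_subgroup[OF assms])
  moreover have "comm_group (graded_part M d) = comm_group (M\<lparr>carrier := grade M d\<rparr>)"
    by (rule same_comm_group) (simp_all add: graded_part_def)
  ultimately show ?thesis by simp
qed

text \<open>The projection onto degree d kills every summand except the one of index d, so the
  components of a finite sum of homogeneous elements can be read off. This is the injectivity of the
  sum map.\<close>

lemma gfinprod_homog:
  assumes M: "comm_group M" and sub: "\<And>d. subgroup (grade M d) M" and p: "grading_proj M p"
    and c: "\<And>d. c d \<in> grade M d" and fin: "finite {d. c d \<noteq> \<one>\<^bsub>M\<^esub>}"
  shows "p d (gfinprod M c UNIV) = c d"
proof -
  interpret M: comm_group M by (rule M)
  have cc: "c e \<in> carrier M" for e using subgroup.subset[OF sub[of e]] c[of e] by blast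
  have ph: "p d \<in> hom M M" using p by (simp add: grading_proj_def)
  let ?D = "{d. c d \<noteq> \<one>\<^bsub>M\<^esub>}"
  have "p d (gfinprod M c UNIV) = finprod M (\<lambda>e. p d (c e)) ?D"
    using fin cc by (simp add: gfinprod_def hom_finprod[OF M M ph])
  also have "\<dots> = finprod M (\<lambda>e. if d = e then c e else \<one>\<^bsub>M\<^esub>) ?D"
    using p c cc by (intro M.finprod_cong') (auto simp: grading_proj_def)
  also have "\<dots> = c d"
  \<comment> \<open>The product runs over the support, which omits d if that component is
    trivial.\<close>
  proof (cases "c d = \<one>\<^bsub>M\<^esub>")
    case True
    then show ?thesis by (intro trans[OF M.finprod_one_eqI]) auto
  next
    case False
    then show ?thesis using fin cc by (intro M.finprod_singleton) auto
  qed
  finally show ?thesis .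
qed

lemma carrier_sum_graded_part:
  assumes M: "comm_group M" and sub: "\<And>d. subgroup (grade M d) M"
  shows "carrier (sum_group UNIV (graded_part M)) =
    {c. (\<forall>d. c d \<in> grade M d) \<and> finite {d. c d \<noteq> \<one>\<^bsub>M\<^esub>}}"
proof -
  have "group (graded_part M d)" for d
    using comm_group_graded_part[OF M sub] by (rule comm_group.axioms(2))
  then show ?thesis by (subst carrier_sum_group) auto
qed

lemma gfinprod_graded_hom:
  assumes M: "comm_group M" and sub: "\<And>d. subgroup (grade M d) M"
  shows "(\<lambda>c. gfinprod M c UNIV) \<in> hom (sum_group UNIV (graded_part M)) M"
proof (rule homI)
  interpret M: comm_group M by (rule M)
  have gc: "grade M d \<subseteq> carrier M" for d using subgroup.subset[OF sub] .
  note cs = carrier_sum_graded_part[OF M sub]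
  show "gfinprod M c UNIV \<in> carrier M" if "c \<in> carrier (sum_group UNIV (graded_part M))" for c
    using that gc unfolding cs by (intro M.gfinprod_closed) auto
  show "gfinprod M (c \<otimes>\<^bsub>sum_group UNIV (graded_part M)\<^esub> c') UNIV = gfinprod M c UNIV \<otimes>\<^bsub>M\<^esub> gfinprod M c' UNIV"
    if "c \<in> carrier (sum_group UNIV (graded_part M))" "c' \<in> carrier (sum_group UNIV (graded_part M))"
    for c c'
  proof -
    have "c d \<in> carrier M" "c' d \<in> carrier M" for d using that gc unfolding cs by blast+
    moreover have "(c \<otimes>\<^bsub>sum_group UNIV (graded_part M)\<^esub> c') = (\<lambda>d. c d \<otimes>\<^bsub>M\<^esub> c' d)" by (simp add: restrict_def)
    ultimately show ?thesis using that unfolding cs by (simp add: M.gfinprod_distrib Pi_iff)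
  qed
qed

lemma bigraded_moduleI:
  assumes M: "comm_group M" and sub: "\<And>d. subgroup (grade M d) M" and p: "grading_proj M p"
  shows "bigraded_module M"
proof -
  note cs = carrier_sum_graded_part[OF M sub]
  have gc: "grade M d \<subseteq> carrier M" for d using subgroup.subset[OF sub] .
  have "bij_betw (\<lambda>c. gfinprod M c UNIV) (carrier (sum_group UNIV (graded_part M))) (carrier M)"
  proof (rule bij_betw_imageI)
    show "inj_on (\<lambda>c. gfinprod M c UNIV) (carrier (sum_group UNIV (graded_part M)))"
    proof (rule inj_onI, rule ext)
      fix c c' d
      assume c: "c \<in> carrier (sum_group UNIV (graded_part M))"
        "c' \<in> carrier (sum_group UNIV (graded_part M))" and eq: "gfinprod M c UNIV = gfinprod M c' UNIV"
      show "c d = c' d"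
        using gfinprod_homog[OF M sub p, of c d] gfinprod_homog[OF M sub p, of c' d] c eq
        unfolding cs by auto
    qed
    show "(\<lambda>c. gfinprod M c UNIV) ` carrier (sum_group UNIV (graded_part M)) = carrier M"
    proof (intro equalityI subsetI)
      fix x assume x: "x \<in> carrier M"
      have "(\<lambda>d. p d x) \<in> carrier (sum_group UNIV (graded_part M))"
        using x p unfolding cs by (auto simp: grading_proj_def)
      moreover have "gfinprod M (\<lambda>d. p d x) UNIV = x" using x p by (auto simp: grading_proj_def)
      ultimately show "x \<in> (\<lambda>c. gfinprod M c UNIV) ` carrier (sum_group UNIV (graded_part M))"
        by (metis (no_types, lifting) image_iff)
    qed (use hom_carrier[OF gfinprod_graded_hom[OF M sub]] in auto)
  qed
  then show ?thesis
    using M sub gfinprod_graded_hom[OF M sub] by (simp add: bigraded_module_def iso_def)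
qed

lemma bigraded_module_proj:
  assumes "bigraded_module M"
  obtains p where "grading_proj M p"
proof -
  have M: "comm_group M" and sub: "\<And>d. subgroup (grade M d) M"
    and iso: "(\<lambda>c. gfinprod M c UNIV) \<in> iso (sum_group UNIV (graded_part M)) M"
    using assms by (auto simp: bigraded_module_def)
  interpret M: comm_group M by (rule M)
  let ?S = "sum_group UNIV (graded_part M)" and ?s = "\<lambda>c. gfinprod M c UNIV"
  note cs = carrier_sum_graded_part[OF M sub]
  have gc: "grade M d \<subseteq> carrier M" for d using subgroup.subset[OF sub] .
  have gS: "group ?S"
    using comm_group_graded_part[OF M sub] by (intro sum_group) (rule comm_group.axioms(2))
  \<comment> \<open>The components of x are the entries of its preimage under the sum
    isomorphism.\<close>
  define q where "q = inv_into (carrier ?S) ?s"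
  have bij: "bij_betw ?s (carrier ?S) (carrier M)" using iso by (simp add: iso_def)
  have qiso: "q \<in> iso M ?S" unfolding q_def by (rule group.iso_set_sym[OF gS iso])
  then have qh: "q \<in> hom M ?S" by (simp add: iso_def)
  have qs: "q (?s c) = c" if "c \<in> carrier ?S" for c
    unfolding q_def using bij that by (rule bij_betw_inv_into_left)
  have sq: "?s (q x) = x" if "x \<in> carrier M" for x
    unfolding q_def using bij that by (rule bij_betw_inv_into_right)
  have qc: "q x \<in> carrier ?S" if "x \<in> carrier M" for x using hom_in_carrier[OF qh that] .
  \<comment> \<open>The family with x at e and the neutral element elsewhere sums to x, so it is the
    preimage of x.\<close>
  have single: "q x d = (if d = e then x else \<one>\<^bsub>M\<^esub>)" if x: "x \<in> grade M e" for x d e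
  proof -
    let ?c = "\<lambda>d. if d = e then x else \<one>\<^bsub>M\<^esub>"
    have "{d. ?c d \<noteq> \<one>\<^bsub>M\<^esub>} \<subseteq> {e}" by auto
    then have fin: "finite {d. ?c d \<noteq> \<one>\<^bsub>M\<^esub>}" by (rule finite_subset) simp
    have c: "?c \<in> carrier ?S"
      unfolding cs using fin x subgroup.one_closed[OF sub] by auto
    have "?s ?c = finprod M ?c {e}"
      unfolding gfinprod_def using x gc[of e]
      by (simp only: fin if_True Set.mem_Collect_eq UNIV_I simp_thms)
         (intro M.finprod_mono_neutral_cong_left, auto)
    also have "\<dots> = x" using x gc[of e] by auto
    finally have "q x = ?c" using qs[OF c] by simp
    then show ?thesis by simp
  qed
  have "grading_proj M (\<lambda>d x. q x d)"
    unfolding grading_proj_def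
  proof (intro conjI allI ballI)
    fix d
    show "(\<lambda>x. q x d) \<in> hom M M"
    proof (rule homI)
      fix x y assume "x \<in> carrier M" "y \<in> carrier M"
      then show "q (x \<otimes>\<^bsub>M\<^esub> y) d = q x d \<otimes>\<^bsub>M\<^esub> q y d" using hom_mult[OF qh] by simp
    next
      fix x assume "x \<in> carrier M"
      from qc[OF this] show "q x d \<in> carrier M" unfolding cs using gc by blast
    qed
  next
    fix d x assume x: "x \<in> carrier M"
    show "q x d \<in> grade M d" using qc[OF x] unfolding cs by auto
    show "finite {d. q x d \<noteq> \<one>\<^bsub>M\<^esub>}" using qc[OF x] unfolding cs by auto
    show "gfinprod M (q x) UNIV = x" using sq[OF x] .
  qed (rule single)
  then show ?thesis by (rule that)
qed


section \<open>Free abelian groups with a dual basis\<close>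

lemma subgroup_common_zeros:
  assumes "comm_group M" "\<And>x. x \<in> Z \<Longrightarrow> c x \<in> hom M integer_group"
  shows "subgroup {m \<in> carrier M. \<forall>x\<in>Z. c x m = 0} M"
proof -
  interpret comm_group M by fact
  show ?thesis
  proof (rule subgroupI)
    have "c x \<one>\<^bsub>M\<^esub> = 0" if "x \<in> Z" for x
      using hom_one[OF assms(2)[OF that]] by simp
    then show "{m \<in> carrier M. \<forall>x\<in>Z. c x m = 0} \<noteq> {}" by blast
  next
    fix a assume a: "a \<in> {m \<in> carrier M. \<forall>x\<in>Z. c x m = 0}"
    have "c x (inv\<^bsub>M\<^esub> a) = 0" if "x \<in> Z" for x
    proof -
      interpret I: group integer_group by simp
      interpret c: group_hom M integer_group "c x" by unfold_locales (rule assms(2)[OF that])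
      show ?thesis using a that by simp
    qed
    then show "inv\<^bsub>M\<^esub> a \<in> {m \<in> carrier M. \<forall>x\<in>Z. c x m = 0}" using a by simp
  next
    fix a b assume a: "a \<in> {m \<in> carrier M. \<forall>x\<in>Z. c x m = 0}" and b: "b \<in> {m \<in> carrier M. \<forall>x\<in>Z. c x m = 0}"
    then show "a \<otimes>\<^bsub>M\<^esub> b \<in> {m \<in> carrier M. \<forall>x\<in>Z. c x m = 0}"
      using hom_mult[OF assms(2)] by simp
  qed auto
qed

text \<open>Generators together with dual functionals; independence is then automatic. This form
  suits groups given by presentations, where functionals come from the universal property while
  relations among the generators are hard to exclude directly.\<close>

locale free_basis =
  fixes M :: "('a, 'm) monoid_scheme" and X :: "'x set" and b :: "'x \<Rightarrow> 'a" and c :: "'x \<Rightarrow> 'a \<Rightarrow> int"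
  assumes comm: "comm_group M" and fin: "finite X"
    and b_closed: "x \<in> X \<Longrightarrow> b x \<in> carrier M"
    and c_hom: "x \<in> X \<Longrightarrow> c x \<in> hom M integer_group"
    and c_b: "x \<in> X \<Longrightarrow> y \<in> X \<Longrightarrow> c x (b y) = (if x = y then 1 else 0)"
    and gen: "carrier M \<subseteq> generate M (b ` X)"
begin

sublocale comm_group M by (rule comm)

lemma c_pow: "x \<in> X \<Longrightarrow> m \<in> carrier M \<Longrightarrow> c x (m [^]\<^bsub>M\<^esub> (k::int)) = k * c x m"
  by (rule hom_integer_pow[OF is_group c_hom])

lemma c_finprod:
  "x \<in> X \<Longrightarrow> (\<And>y. y \<in> Y \<Longrightarrow> f y \<in> carrier M) \<Longrightarrow> c x (finprod M f Y) = (\<Sum>y\<in>Y. c x (f y))"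
  by (rule hom_integer_finprod[OF comm c_hom])

lemma c_one: "x \<in> X \<Longrightarrow> c x \<one>\<^bsub>M\<^esub> = 0"
  using hom_one[OF c_hom is_group group_integer_group] by simp

text \<open>The identity and the reconstruction from coordinates are homomorphisms that agree on the
  generators \<open>b\<close>.\<close>

lemma expand:
  assumes m: "m \<in> carrier M"
  shows "m = finprod M (\<lambda>x. b x [^]\<^bsub>M\<^esub> c x m) X"
proof (rule hom_ext_generate[OF is_group is_group, where B = "b ` X" and f = "\<lambda>m. m"
      and g = "\<lambda>m. finprod M (\<lambda>x. b x [^]\<^bsub>M\<^esub> c x m) X"])
  show "(\<lambda>m. m) \<in> hom M M" by (auto simp: hom_def)
  show "(\<lambda>m. finprod M (\<lambda>x. b x [^]\<^bsub>M\<^esub> c x m) X) \<in> hom M M"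
  proof (rule homI)
    fix m m' assume m: "m \<in> carrier M" "m' \<in> carrier M"
    have "finprod M (\<lambda>x. b x [^]\<^bsub>M\<^esub> c x (m \<otimes>\<^bsub>M\<^esub> m')) X =
        finprod M (\<lambda>x. b x [^]\<^bsub>M\<^esub> c x m \<otimes>\<^bsub>M\<^esub> b x [^]\<^bsub>M\<^esub> c x m') X"
      using m b_closed by (intro finprod_cong') (auto simp: hom_mult[OF c_hom] int_pow_mult)
    then show "finprod M (\<lambda>x. b x [^]\<^bsub>M\<^esub> c x (m \<otimes>\<^bsub>M\<^esub> m')) X =
        finprod M (\<lambda>x. b x [^]\<^bsub>M\<^esub> c x m) X \<otimes>\<^bsub>M\<^esub> finprod M (\<lambda>x. b x [^]\<^bsub>M\<^esub> c x m') X"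
      using b_closed by (simp add: finprod_multf)
  qed (use b_closed in auto)
  fix y assume "y \<in> b ` X"
  then obtain z where z: "z \<in> X" and y: "y = b z" by blast
  have "finprod M (\<lambda>x. b x [^]\<^bsub>M\<^esub> c x y) X = finprod M (\<lambda>x. if z = x then b x else \<one>\<^bsub>M\<^esub>) X"
    using z b_closed by (intro finprod_cong') (auto simp: y c_b)
  also have "\<dots> = y" using z y b_closed fin by (subst finprod_singleton) auto
  finally show "y = finprod M (\<lambda>x. b x [^]\<^bsub>M\<^esub> c x y) X" by simp
qed (use b_closed m gen in auto)

lemma ext_coord:
  assumes "m \<in> carrier M" "m' \<in> carrier M" "\<And>x. x \<in> X \<Longrightarrow> c x m = c x m'"
  shows "m = m'"
proof -
  have "finprod M (\<lambda>x. b x [^]\<^bsub>M\<^esub> c x m) X = finprod M (\<lambda>x. b x [^]\<^bsub>M\<^esub> c x m') X"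
    using assms(3) b_closed by (intro finprod_cong') auto
  then show ?thesis using expand[OF assms(1)] expand[OF assms(2)] by simp
qed

text \<open>Passes from the definition of a homogeneous part by generators to its description by
  vanishing coordinates. The zeros form a subgroup that contains P; conversely, the expansion of
  such a zero involves only basis elements of degree d, and these lie in the span of P.\<close>

lemma generate_eq_zeros:
  fixes deg :: "'x \<Rightarrow> nat \<times> nat"
  assumes P: "\<And>m. m \<in> P \<Longrightarrow> m \<in> carrier M \<and> (\<forall>x\<in>X. deg x \<noteq> d \<longrightarrow> c x m = 0)"
    and bP: "\<And>x. x \<in> X \<Longrightarrow> deg x = d \<Longrightarrow> b x \<in> generate M P"
  shows "generate M P = {m \<in> carrier M. \<forall>x\<in>X. deg x \<noteq> d \<longrightarrow> c x m = 0}"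
proof -
  have e: "{m \<in> carrier M. \<forall>x\<in>X. deg x \<noteq> d \<longrightarrow> c x m = 0} =
      {m \<in> carrier M. \<forall>x\<in>{x\<in>X. deg x \<noteq> d}. c x m = 0}" by auto
  have sub: "subgroup {m \<in> carrier M. \<forall>x\<in>X. deg x \<noteq> d \<longrightarrow> c x m = 0} M"
    unfolding e by (rule subgroup_common_zeros[OF comm]) (use c_hom in auto)
  have subP: "subgroup (generate M P) M" using P by (intro generate_is_subgroup) auto
  show ?thesis
  proof (intro equalityI subsetI)
    fix m assume "m \<in> generate M P"
    then show "m \<in> {m \<in> carrier M. \<forall>x\<in>X. deg x \<noteq> d \<longrightarrow> c x m = 0}"
      using generate_subgroup_incl[OF _ sub, of P] P by blast
  next
    fix m assume m: "m \<in> {m \<in> carrier M. \<forall>x\<in>X. deg x \<noteq> d \<longrightarrow> c x m = 0}"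
    have "b x [^]\<^bsub>M\<^esub> c x m \<in> generate M P" if x: "x \<in> X" for x
    proof (cases "deg x = d")
      case True
      then show ?thesis using int_pow_in_subgroup[OF is_group subP bP[OF x]] by simp
    next
      case False
      then show ?thesis using m x subgroup.one_closed[OF subP] by simp
    qed
    then have "finprod M (\<lambda>x. b x [^]\<^bsub>M\<^esub> c x m) X \<in> generate M P"
      by (rule finprod_in_subgroup[OF comm subP])
    then show "m \<in> generate M P" using expand[of m] m by simp
  qed
qed

end

locale free_bigraded = free_basis M X b c
  for M :: "'a bigraded" and X :: "'x set" and b c +
  fixes deg :: "'x \<Rightarrow> nat \<times> nat"
  assumes grade_eq: "grade M d = {m \<in> carrier M. \<forall>x\<in>X. deg x \<noteq> d \<longrightarrow> c x m = 0}"
begin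

lemma b_grade: "x \<in> X \<Longrightarrow> b x \<in> grade M (deg x)"
  using b_closed c_b by (auto simp: grade_eq)

lemma grade_subgroup: "subgroup (grade M d) M"
proof -
  have e: "grade M d = {m \<in> carrier M. \<forall>x\<in>{x\<in>X. deg x \<noteq> d}. c x m = 0}"
    by (auto simp: grade_eq)
  show ?thesis unfolding e by (rule subgroup_common_zeros[OF comm]) (use c_hom in auto)
qed

lemma grade_closed: "m \<in> grade M d \<Longrightarrow> m \<in> carrier M"
  by (simp add: grade_eq)

lemma bigraded: "bigraded_module M"
proof -
  \<comment> \<open>The projection onto degree d keeps the terms of that degree in the basis
    expansion.\<close>
  define p where "p = (\<lambda>d m. finprod M (\<lambda>x. b x [^]\<^bsub>M\<^esub> c x m) {x\<in>X. deg x = d})"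
  have pc: "p d m \<in> carrier M" for d m
    unfolding p_def using b_closed by (intro finprod_closed) auto
  have cp: "c y (p d m) = (if deg y = d then c y m else 0)" if y: "y \<in> X" for y d m
  proof -
    have "c y (p d m) = (\<Sum>x\<in>{x\<in>X. deg x = d}. c y (b x [^]\<^bsub>M\<^esub> c x m))"
      unfolding p_def using y b_closed by (intro c_finprod) auto
    also have "\<dots> = (\<Sum>x\<in>{x\<in>X. deg x = d}. if y = x then c y m else 0)"
      using y by (intro sum.cong) (auto simp: c_pow b_closed c_b)
    also have "\<dots> = (if deg y = d then c y m else 0)"
      using y fin by (simp add: sum.delta')
    finally show ?thesis .
  qed
  have "grading_proj M p"
    unfolding grading_proj_def
  proof (intro conjI allI ballI)
    fix d
    show "p d \<in> hom M M"
    proof (rule homI)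
      fix m m' assume m: "m \<in> carrier M" "m' \<in> carrier M"
      show "p d (m \<otimes>\<^bsub>M\<^esub> m') = p d m \<otimes>\<^bsub>M\<^esub> p d m'"
        by (rule ext_coord) (use m pc in \<open>auto simp: cp hom_mult[OF c_hom]\<close>)
    qed (rule pc)
    show "p d m \<in> grade M d" for m using pc cp by (auto simp: grade_eq)
    show "p d m = (if d = e then m else \<one>\<^bsub>M\<^esub>)" if "m \<in> grade M e" for e m
      by (rule ext_coord) (use that pc in \<open>auto simp: grade_eq cp c_one\<close>)
    fix m assume m: "m \<in> carrier M"
    have "p d m = \<one>\<^bsub>M\<^esub>" if "d \<notin> deg ` X" for d
      by (rule ext_coord) (use pc that in \<open>auto simp: cp c_one\<close>)
    then have "{d. p d m \<noteq> \<one>\<^bsub>M\<^esub>} \<subseteq> deg ` X" by blast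
    then show f: "finite {d. p d m \<noteq> \<one>\<^bsub>M\<^esub>}" using fin finite_surj by blast
    show "gfinprod M (\<lambda>d. p d m) UNIV = m"
    proof (rule ext_coord)
      fix x assume x: "x \<in> X"
      have "c x (gfinprod M (\<lambda>d. p d m) UNIV) = (\<Sum>d\<in>{d. p d m \<noteq> \<one>\<^bsub>M\<^esub>}. c x (p d m))"
        using f by (simp add: gfinprod_def c_finprod[OF x] pc)
      also have "\<dots> = (\<Sum>d\<in>{d. p d m \<noteq> \<one>\<^bsub>M\<^esub>}. if deg x = d then c x m else 0)"
        by (simp add: cp[OF x])
      also have "\<dots> = c x m"
      proof (cases "p (deg x) m = \<one>\<^bsub>M\<^esub>")
        case True
        then have "c x m = 0" using cp[OF x, of "deg x" m] c_one[OF x] by simp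
        then show ?thesis by (intro trans[OF sum.neutral]) auto
      next
        case False
        then show ?thesis using f by (simp add: sum.delta')
      qed
      finally show "c x (gfinprod M (\<lambda>d. p d m) UNIV) = c x m" .
    qed (use m pc in \<open>auto intro!: gfinprod_closed\<close>)
  qed
  then show ?thesis by (rule bigraded_moduleI[OF comm grade_subgroup])
qed

end

section \<open>Homogeneous bases of tensor products, tensor powers and direct sums\<close>

lemma free_bigraded_tensor:
  assumes M: "free_bigraded M X b c dg" and N: "free_bigraded N Y b' c' dg'"
  shows "free_bigraded (tensor M N) (X \<times> Y) (\<lambda>(x, y). pure_tensor M N (b x) (b' y))
    (\<lambda>(x, y). tensor_lift M N integer_group (\<lambda>m n. c x m * c' y n)) (\<lambda>(x, y). dg x + dg' y)"
    (is "free_bigraded _ _ ?b ?c ?d")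
proof -
  interpret M: free_bigraded M X b c dg by (rule M)
  interpret N: free_bigraded N Y b' c' dg' by (rule N)
  let ?T = "tensor_group M N"
  interpret T: comm_group ?T by (rule comm_group_tensor_group[OF M.comm N.comm])
  note pc = pure_tensor_closed[OF M.comm N.comm]
  have al: "c x (m \<otimes>\<^bsub>M\<^esub> m') * c' y n = (c x m * c' y n) \<otimes>\<^bsub>integer_group\<^esub> (c x m' * c' y n)"
    if "x \<in> X" "m \<in> carrier M" "m' \<in> carrier M" for x y m m' n
    unfolding mult_integer_group hom_mult[OF M.c_hom[OF that(1)] that(2,3)] by (rule distrib_right)
  have ar: "c x m * c' y (n \<otimes>\<^bsub>N\<^esub> n') = (c x m * c' y n) \<otimes>\<^bsub>integer_group\<^esub> (c x m * c' y n')"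
    if "y \<in> Y" "n \<in> carrier N" "n' \<in> carrier N" for x y m n n'
    unfolding mult_integer_group hom_mult[OF N.c_hom[OF that(1)] that(2,3)] by (rule distrib_left)
  \<comment> \<open>The coordinate of a pair (x, y) is the product of the coordinates at x and at y,
    which is bilinear and hence defined on the tensor product.\<close>
  have lift1: "tensor_lift M N integer_group (\<lambda>m n. c x m * c' y n) \<in> hom ?T integer_group"
    if "x \<in> X" "y \<in> Y" for x y
    by (rule tensor_universal(1)[OF abelian_integer_group M.comm N.comm])
      (simp, rule al[OF that(1)], assumption+, rule ar[OF that(2)])
  have lift2: "tensor_lift M N integer_group (\<lambda>m n. c x m * c' y n) (pure_tensor M N m n) = c x m * c' y n"
    if "x \<in> X" "y \<in> Y" "m \<in> carrier M" "n \<in> carrier N" for x y m n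
    by (rule tensor_universal(2)[OF abelian_integer_group M.comm N.comm _ _ _ that(3,4)])
      (simp, rule al[OF that(1)], assumption+, rule ar[OF that(2)])
  define G where "G = generate ?T (?b ` (X \<times> Y))"
  have bG: "?b ` (X \<times> Y) \<subseteq> carrier ?T" using pc M.b_closed N.b_closed by auto
  have G: "subgroup G ?T" unfolding G_def by (rule T.generate_is_subgroup[OF bG])
  \<comment> \<open>Spanning is shown in one variable at a time: the left entry is a basis element
    here and becomes arbitrary in the next step.\<close>
  have 1: "pure_tensor M N (b x) n \<in> G" if x: "x \<in> X" and n: "n \<in> carrier N" for x n
  proof (rule hom_generate_subset[OF N.is_group T.is_group pure_tensor_right_hom[OF M.comm N.comm] G])
    show "pure_tensor M N (b x) z \<in> G" if "z \<in> b' ` Y" for z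
      unfolding G_def using that x by (intro generate.incl) auto
  qed (use M.b_closed N.b_closed x n N.gen in auto)
  have 2: "pure_tensor M N m n \<in> G" if m: "m \<in> carrier M" and n: "n \<in> carrier N" for m n
    by (rule hom_generate_subset[OF M.is_group T.is_group pure_tensor_left_hom[OF M.comm N.comm n] G, where B = "b ` X"])
      (use M.b_closed m M.gen 1 n in auto)
  have gen: "carrier ?T \<subseteq> G"
  proof (rule subset_trans[OF tensor_generated[OF M.comm N.comm] T.generate_subgroup_incl[OF _ G]], rule subsetI)
    fix z assume "z \<in> {pure_tensor M N x y | x y. x \<in> carrier M \<and> y \<in> carrier N}"
    then obtain x y where "z = pure_tensor M N x y" "x \<in> carrier M" "y \<in> carrier N"
      unfolding mem_Collect_eq by (elim exE conjE)
    then show "z \<in> G" using 2 by simp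
  qed
  have B: "free_basis (tensor M N) (X \<times> Y) ?b ?c"
  proof (rule free_basis.intro)
    show "comm_group (tensor M N)" using T.comm_group_axioms by (simp add: tensor_def)
    show "finite (X \<times> Y)" using M.fin N.fin by simp
    show "carrier (tensor M N) \<subseteq> generate (tensor M N) (?b ` (X \<times> Y))"
      using gen by (simp add: tensor_def G_def)
    fix x assume x: "x \<in> X \<times> Y"
    show "?b x \<in> carrier (tensor M N)" using bG x by auto
    obtain x1 x2 where x: "x = (x1, x2)" "x1 \<in> X" "x2 \<in> Y" using x by auto
    show "?c x \<in> hom (tensor M N) integer_group" using lift1[OF x(2,3)] by (simp add: tensor_def x(1))
    fix y assume y: "y \<in> X \<times> Y"
    obtain y1 y2 where y: "y = (y1, y2)" "y1 \<in> X" "y2 \<in> Y" using y by auto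
    show "?c x (?b y) = (if x = y then 1 else 0)"
      using lift2[OF x(2,3) M.b_closed[OF y(2)] N.b_closed[OF y(3)]] x y by (simp add: M.c_b N.c_b)
  qed
  interpret B: free_basis "tensor M N" "X \<times> Y" ?b ?c by (rule B)
  show ?thesis
  proof (rule free_bigraded.intro[OF B free_bigraded_axioms.intro])
    fix d
    let ?P = "{pure_tensor M N x y | x y a b. x \<in> grade M a \<and> y \<in> grade N b \<and>
           fst a + fst b = fst d \<and> snd a + snd b = snd d}"
    have "grade (tensor M N) d = generate (tensor M N) ?P"
      by (simp add: tensor_def)
    also have "\<dots> = {m \<in> carrier (tensor M N). \<forall>x\<in>X \<times> Y. ?d x \<noteq> d \<longrightarrow> ?c x m = 0}"
    proof (rule B.generate_eq_zeros)
      fix z assume "z \<in> ?P"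
      then obtain m n e f where z: "z = pure_tensor M N m n" and m: "m \<in> grade M e" and n: "n \<in> grade N f"
        and "fst e + fst f = fst d \<and> snd e + snd f = snd d" unfolding mem_Collect_eq by blast
      then have d: "d = e + f" by (simp add: prod_eq_iff)
      have mn: "m \<in> carrier M" "n \<in> carrier N" using m n M.grade_closed N.grade_closed by auto
      have zero: "?c (x, y) z = 0" if xy: "x \<in> X" "y \<in> Y" "dg x + dg' y \<noteq> d" for x y
      proof -
        \<comment> \<open>Since d = e + f, a pair of basis elements of another total degree has the
          wrong degree in at least one factor.\<close>
        have "dg x \<noteq> e \<or> dg' y \<noteq> f" using xy(3) d by blast
        then have "c x m = 0 \<or> c' y n = 0"
          using m n xy(1,2) unfolding M.grade_eq N.grade_eq by blast
        then show ?thesis unfolding prod.case z lift2[OF xy(1,2) mn] by auto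
      qed
      show "z \<in> carrier (tensor M N) \<and> (\<forall>x\<in>X \<times> Y. ?d x \<noteq> d \<longrightarrow> ?c x z = 0)"
      proof (intro conjI ballI impI)
        show "z \<in> carrier (tensor M N)" using pc[OF mn] z by simp
        fix x assume "x \<in> X \<times> Y" "?d x \<noteq> d"
        then show "?c x z = 0" using zero[of "fst x" "snd x"] by (cases x) simp
      qed
    next
      fix z assume zd: "z \<in> X \<times> Y" "?d z = d"
      obtain x y where xy: "z = (x, y)" by (rule prod.exhaust)
      have z: "z = (x, y)" "x \<in> X" "y \<in> Y" "d = dg x + dg' y"
        using zd unfolding xy mem_Sigma_iff prod.case by (blast intro: sym)+
      then have "?b z \<in> ?P" using M.b_grade[OF z(2)] N.b_grade[OF z(3)] unfolding mem_Collect_eq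
        by (intro exI[of _ "b x"] exI[of _ "b' y"] exI[of _ "dg x"] exI[of _ "dg' y"]) simp
      then show "?b z \<in> generate (tensor M N) ?P" by (rule generate.incl)
    qed
    finally show "grade (tensor M N) d = {m \<in> carrier (tensor M N). \<forall>x\<in>X \<times> Y. ?d x \<noteq> d \<longrightarrow> ?c x m = 0}" .
  qed
qed

lemma free_bigraded_tensor_power:
  assumes M: "free_bigraded M X b c dg" and I: "finite I"
  shows "free_bigraded (tensor_power I M) (I \<rightarrow>\<^sub>E X) (\<lambda>f. pure_power I M (\<lambda>i\<in>I. b (f i)))
    (\<lambda>f. power_lift I M integer_group (\<lambda>m. \<Prod>i\<in>I. c (f i) (m i))) (\<lambda>f. \<Sum>i\<in>I. dg (f i))"
    (is "free_bigraded _ _ ?b ?c ?d")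
proof -
  interpret M: free_bigraded M X b c dg by (rule M)
  let ?T = "power_group I M"
  interpret T: comm_group ?T by (rule comm_group_power_group[OF M.comm])
  note pc = pure_power_closed[OF M.comm]
  have add: "(\<Prod>j\<in>I. c (f j) ((g(i := x \<otimes>\<^bsub>M\<^esub> y)) j)) =
     (\<Prod>j\<in>I. c (f j) ((g(i := x)) j)) \<otimes>\<^bsub>integer_group\<^esub> (\<Prod>j\<in>I. c (f j) ((g(i := y)) j))"
    if f: "f \<in> (I \<rightarrow>\<^sub>E X)" and i: "i \<in> I" and x: "x \<in> carrier M" and y: "y \<in> carrier M"
    for f g i x y
  proof -
    \<comment> \<open>Only the factor at i depends on the entry that varies, and this factor is
      additive in it.\<close>
    have e: "(\<Prod>j\<in>I. c (f j) ((g(i := z)) j)) = c (f i) z * (\<Prod>j\<in>I - {i}. c (f j) (g j))" for z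
      unfolding prod.remove[OF I i] by (intro arg_cong2[where f = "(*)"] prod.cong) auto
    have "f i \<in> X" using f i by (rule PiE_mem)
    then have "c (f i) (x \<otimes>\<^bsub>M\<^esub> y) = c (f i) x + c (f i) y" using x y by (simp add: hom_mult[OF M.c_hom])
    then show ?thesis unfolding e mult_integer_group by (simp only: distrib_right)
  qed
  have lift1: "?c f \<in> hom ?T integer_group" if f: "f \<in> (I \<rightarrow>\<^sub>E X)" for f
    by (rule power_universal(1)[OF abelian_integer_group M.comm]) (simp, rule add[OF f])
  have lift2: "?c f (pure_power I M m) = (\<Prod>i\<in>I. c (f i) (m i))"
    if f: "f \<in> (I \<rightarrow>\<^sub>E X)" and m: "m \<in> (I \<rightarrow>\<^sub>E carrier M)" for f m
    by (rule power_universal(2)[OF abelian_integer_group M.comm _ _ m]) (simp, rule add[OF f])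
  have bPi: "(\<lambda>i\<in>I. b (f i)) \<in> (I \<rightarrow>\<^sub>E carrier M)" if "f \<in> (I \<rightarrow>\<^sub>E X)" for f
    using that M.b_closed by (auto simp: PiE_iff)
  define G where "G = generate ?T (?b ` (I \<rightarrow>\<^sub>E X))"
  have bG: "?b ` (I \<rightarrow>\<^sub>E X) \<subseteq> carrier ?T" by (intro image_subsetI pc bPi)
  have G: "subgroup G ?T" unfolding G_def by (rule T.generate_is_subgroup[OF bG])
  \<comment> \<open>Induction on the set J of positions that may still hold arbitrary entries.
    Additivity at j reduces an arbitrary entry there to basis elements, after which j leaves J. For
    J = I nothing is assumed about the entries.\<close>
  have step: "pure_power I M g \<in> G"
    if "J \<subseteq> I" "g \<in> (I \<rightarrow>\<^sub>E carrier M)" "\<forall>i\<in>I - J. g i \<in> b ` X" for J g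
    using finite_subset[OF that(1) I] that
  proof (induction J arbitrary: g rule: finite_induct)
    case empty
    then have "\<forall>i\<in>I. \<exists>x\<in>X. g i = b x" by auto
    then obtain f where f: "\<forall>i\<in>I. f i \<in> X \<and> g i = b (f i)" by metis
    have "g = (\<lambda>i\<in>I. b (restrict f I i))" using empty.prems(2) f by (auto simp: PiE_iff extensional_def fun_eq_iff)
    moreover have "restrict f I \<in> (I \<rightarrow>\<^sub>E X)" using f by auto
    ultimately show ?case unfolding G_def by (intro generate.incl) blast
  next
    case (insert j J)
    then have j: "j \<in> I" and gj: "g j \<in> carrier M" by auto
    have "pure_power I M (g(j := g j)) \<in> G"
    proof (rule hom_generate_subset[OF M.is_group T.is_group pure_power_hom[OF M.comm insert.prems(2) j] G, where B = "b ` X"])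
      show "pure_power I M (g(j := x)) \<in> G" if "x \<in> b ` X" for x
        using that insert.prems j M.b_closed by (intro insert.IH fun_upd_in_PiE) auto
    qed (use M.b_closed gj M.gen in auto)
    then show ?case by simp
  qed
  have gen: "carrier ?T \<subseteq> G"
    using power_generated[OF M.comm, of I] T.generate_subgroup_incl[OF _ G] step[of I] by blast
  have B: "free_basis (tensor_power I M) (I \<rightarrow>\<^sub>E X) ?b ?c"
  proof (rule free_basis.intro)
    show "comm_group (tensor_power I M)" using T.comm_group_axioms by (simp add: tensor_power_def)
    show "finite (I \<rightarrow>\<^sub>E X)" using M.fin I by (simp add: finite_PiE)
    show "carrier (tensor_power I M) \<subseteq> generate (tensor_power I M) (?b ` (I \<rightarrow>\<^sub>E X))"
      using gen by (simp add: tensor_power_def G_def)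
    fix f assume f: "f \<in> (I \<rightarrow>\<^sub>E X)"
    show "?b f \<in> carrier (tensor_power I M)" using bG f by auto
    show "?c f \<in> hom (tensor_power I M) integer_group" using lift1[OF f] by (simp add: tensor_power_def)
    fix g assume g: "g \<in> (I \<rightarrow>\<^sub>E X)"
    have "?c f (?b g) = (\<Prod>i\<in>I. if f i = g i then 1 else 0)"
      unfolding lift2[OF f bPi[OF g]] using f g by (intro prod.cong) (auto simp: M.c_b PiE_iff)
    \<comment> \<open>A product of Kronecker symbols vanishes as soon as the two index functions
      differ at one place.\<close>
    also have "\<dots> = (if f = g then 1 else 0)"
    proof (cases "f = g")
      case False
      then obtain i where "i \<in> I" "f i \<noteq> g i" using PiE_ext[OF f g] by blast
      then show ?thesis using False I by (auto intro: prod_zero)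
    qed simp
    finally show "?c f (?b g) = (if f = g then 1 else 0)" .
  qed
  interpret B: free_basis "tensor_power I M" "I \<rightarrow>\<^sub>E X" ?b ?c by (rule B)
  show ?thesis
  proof (rule free_bigraded.intro[OF B free_bigraded_axioms.intro])
    fix d
    let ?P = "{pure_power I M x | x a. x \<in> (\<Pi>\<^sub>E i\<in>I. grade M (a i)) \<and>
           (\<Sum>i\<in>I. fst (a i)) = fst d \<and> (\<Sum>i\<in>I. snd (a i)) = snd d}"
    have "grade (tensor_power I M) d = generate (tensor_power I M) ?P"
      by (simp add: tensor_power_def)
    also have "\<dots> = {m \<in> carrier (tensor_power I M). \<forall>x\<in>I \<rightarrow>\<^sub>E X. ?d x \<noteq> d \<longrightarrow> ?c x m = 0}"
    proof (rule B.generate_eq_zeros)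
      fix z assume "z \<in> ?P"
      then obtain m a where z: "z = pure_power I M m" and m: "m \<in> (\<Pi>\<^sub>E i\<in>I. grade M (a i))"
        and d: "d = (\<Sum>i\<in>I. a i)" by (auto simp: prod_eq_iff fst_sum snd_sum)
      have mc: "m \<in> (I \<rightarrow>\<^sub>E carrier M)"
        using PiE_mono[of I "\<lambda>i. grade M (a i)" "\<lambda>_. carrier M"] m M.grade_closed by blast
      have "?c f z = 0" if f: "f \<in> (I \<rightarrow>\<^sub>E X)" "?d f \<noteq> d" for f
      proof -
        \<comment> \<open>If the degrees agreed at each index, the total degrees would agree as
          well.\<close>
        obtain i where i: "i \<in> I" "dg (f i) \<noteq> a i"
          using f(2) d sum.cong[of I I "\<lambda>i. dg (f i)" a] by blast
        then have "c (f i) (m i) = 0" using m f(1) by (auto simp: M.grade_eq PiE_iff)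
        then show ?thesis using i I lift2[OF f(1) mc] z by (auto intro: prod_zero)
      qed
      then show "z \<in> carrier (tensor_power I M) \<and> (\<forall>x\<in>I \<rightarrow>\<^sub>E X. ?d x \<noteq> d \<longrightarrow> ?c x z = 0)"
        using pc[OF mc] z by simp
    next
      fix f assume f: "f \<in> (I \<rightarrow>\<^sub>E X)" "?d f = d"
      have "(\<lambda>i\<in>I. b (f i)) \<in> (\<Pi>\<^sub>E i\<in>I. grade M (dg (f i)))" using f M.b_grade by (auto simp: PiE_iff)
      then have "?b f \<in> ?P" using f(2) unfolding mem_Collect_eq
        by (intro exI[of _ "\<lambda>i\<in>I. b (f i)"] exI[of _ "\<lambda>i. dg (f i)"]) (auto simp: fst_sum snd_sum)
      then show "?b f \<in> generate (tensor_power I M) ?P" by (rule generate.incl)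
    qed
    finally show "grade (tensor_power I M) d =
      {m \<in> carrier (tensor_power I M). \<forall>x\<in>I \<rightarrow>\<^sub>E X. ?d x \<noteq> d \<longrightarrow> ?c x m = 0}" .
  qed
qed

lemma carrier_direct_sum:
  assumes "finite I" "\<And>i. i \<in> I \<Longrightarrow> comm_group (M i)"
  shows "carrier (direct_sum I M) = (\<Pi>\<^sub>E i\<in>I. carrier (M i))"
  using assms by (subst direct_sum_def, simp, subst carrier_sum_group) (auto dest: comm_group.axioms(2))

lemma direct_sum_simps [simp]:
  "x \<otimes>\<^bsub>direct_sum I M\<^esub> y = (\<lambda>i\<in>I. x i \<otimes>\<^bsub>M i\<^esub> y i)" "\<one>\<^bsub>direct_sum I M\<^esub> = (\<lambda>i\<in>I. \<one>\<^bsub>M i\<^esub>)"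
  by (simp_all add: direct_sum_def)

lemma comm_group_direct_sum:
  assumes I: "finite I" and M: "\<And>i. i \<in> I \<Longrightarrow> comm_group (M i)"
  shows "comm_group (direct_sum I M)"
proof -
  have g: "group (M i)" if "i \<in> I" for i using M[OF that] by (rule comm_group.axioms(2))
  have "group (direct_sum I M)" using g by (simp add: direct_sum_def)
  then show ?thesis
  proof (rule group.group_comm_groupI)
    fix x y assume x: "x \<in> carrier (direct_sum I M)" and y: "y \<in> carrier (direct_sum I M)"
    show "x \<otimes>\<^bsub>direct_sum I M\<^esub> y = y \<otimes>\<^bsub>direct_sum I M\<^esub> x"
      using x y by (auto simp: carrier_direct_sum[OF I M] intro!: restrict_ext comm_groupE(4)[OF M])
  qed
qed

lemma free_bigraded_direct_sum:
  assumes I: "finite I" and M: "\<And>i. i \<in> I \<Longrightarrow> free_bigraded (M i) (X i) (b i) (c i) (dg i)"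
  shows "free_bigraded (direct_sum I M) (Sigma I X)
    (\<lambda>(i, x). \<lambda>j\<in>I. if j = i then b i x else \<one>\<^bsub>M j\<^esub>) (\<lambda>(i, x) m. c i x (m i)) (\<lambda>(i, x). dg i x)"
    (is "free_bigraded _ _ ?b ?c ?d")
proof -
  have cg: "comm_group (M i)" if "i \<in> I" for i
    by (rule free_basis.comm[OF free_bigraded.axioms(1)[OF M[OF that]]])
  have g: "group (M i)" if "i \<in> I" for i using cg[OF that] by (rule comm_group.axioms(2))
  let ?D = "direct_sum I M"
  have cd: "carrier ?D = (\<Pi>\<^sub>E i\<in>I. carrier (M i))" by (rule carrier_direct_sum[OF I]) (rule cg)
  interpret D: comm_group ?D by (rule comm_group_direct_sum[OF I cg])
  have one: "\<one>\<^bsub>M i\<^esub> \<in> carrier (M i)" if "i \<in> I" for i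
    using g[OF that] by (simp add: group.is_monoid monoid.one_closed)
  have bc: "b i x \<in> carrier (M i)" if "i \<in> I" "x \<in> X i" for i x
    by (rule free_basis.b_closed[OF free_bigraded.axioms(1)[OF M[OF that(1)]] that(2)])
  have bD: "?b z \<in> carrier ?D" if "z \<in> Sigma I X" for z
    using that one bc by (auto simp: cd PiE_iff)
  define G where "G = generate ?D (?b ` Sigma I X)"
  have G: "subgroup G ?D" unfolding G_def using bD by (intro D.generate_is_subgroup) auto
  define single where "single = (\<lambda>i m. \<lambda>j\<in>I. if j = i then m else \<one>\<^bsub>M j\<^esub>)"
  have sh: "single i \<in> hom (M i) ?D" if i: "i \<in> I" for i
  proof (rule homI)
    fix m m' assume m: "m \<in> carrier (M i)" "m' \<in> carrier (M i)"
    show "single i (m \<otimes>\<^bsub>M i\<^esub> m') = single i m \<otimes>\<^bsub>?D\<^esub> single i m'"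
    proof (rule ext)
      fix j
      have "\<one>\<^bsub>M j\<^esub> \<otimes>\<^bsub>M j\<^esub> \<one>\<^bsub>M j\<^esub> = \<one>\<^bsub>M j\<^esub>" if "j \<in> I"
        using monoid.l_one[OF group.is_monoid[OF g[OF that]] one[OF that]] .
      then show "single i (m \<otimes>\<^bsub>M i\<^esub> m') j = (single i m \<otimes>\<^bsub>?D\<^esub> single i m') j"
        by (simp add: single_def)
    qed
  qed (use one in \<open>auto simp: single_def cd PiE_iff\<close>)
  have sG: "single i m \<in> G" if i: "i \<in> I" and m: "m \<in> carrier (M i)" for i m
  proof -
    interpret Mi: free_bigraded "M i" "X i" "b i" "c i" "dg i" by (rule M[OF i])
    show ?thesis
    proof (rule hom_generate_subset[OF Mi.is_group D.is_group sh[OF i] G, where B = "b i ` X i"])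
      show "single i x \<in> G" if "x \<in> b i ` X i" for x
        unfolding G_def single_def using that i by (intro generate.incl) force
    qed (use Mi.b_closed m Mi.gen in auto)
  qed
  have gen: "carrier ?D \<subseteq> G"
  proof
    fix v assume v: "v \<in> carrier ?D"
    \<comment> \<open>The components of v are switched on one index at a time, each by
      multiplication with an element supported at a single index.\<close>
    have "(\<lambda>j\<in>I. if j \<in> J then v j else \<one>\<^bsub>M j\<^esub>) \<in> G" if "J \<subseteq> I" for J
      using finite_subset[OF that I] that
    proof (induction J rule: finite_induct)
      case empty
      show ?case using subgroup.one_closed[OF G] unfolding direct_sum_simps by (simp only: empty_iff if_False)
    next
      case (insert i J)
      have eq: "(\<lambda>j\<in>I. if j \<in> insert i J then v j else \<one>\<^bsub>M j\<^esub>) =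
          single i (v i) \<otimes>\<^bsub>?D\<^esub> (\<lambda>j\<in>I. if j \<in> J then v j else \<one>\<^bsub>M j\<^esub>)"
      proof (rule ext)
        fix j
        have l: "\<one>\<^bsub>M j\<^esub> \<otimes>\<^bsub>M j\<^esub> x = x" and r: "x \<otimes>\<^bsub>M j\<^esub> \<one>\<^bsub>M j\<^esub> = x" if "j \<in> I" "x \<in> carrier (M j)" for x
          by (rule monoid.l_one[OF group.is_monoid[OF g[OF that(1)]] that(2)],
              rule monoid.r_one[OF group.is_monoid[OF g[OF that(1)]] that(2)])
        have "v j \<in> carrier (M j)" if "j \<in> I" using v that by (auto simp: cd)
        then show "(\<lambda>j\<in>I. if j \<in> insert i J then v j else \<one>\<^bsub>M j\<^esub>) j =
          (single i (v i) \<otimes>\<^bsub>?D\<^esub> (\<lambda>j\<in>I. if j \<in> J then v j else \<one>\<^bsub>M j\<^esub>)) j"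
          using insert.hyps l r one by (cases "j = i") (simp_all add: single_def)
      qed
      have "i \<in> I" "v i \<in> carrier (M i)" using insert.prems v unfolding cd by auto
      then show ?case unfolding eq using insert.prems by (intro subgroup.m_closed[OF G sG insert.IH]) auto
    qed
    from this[OF order_refl] have "(\<lambda>j\<in>I. if j \<in> I then v j else \<one>\<^bsub>M j\<^esub>) \<in> G" .
    moreover have "(\<lambda>j\<in>I. if j \<in> I then v j else \<one>\<^bsub>M j\<^esub>) = v"
      using v unfolding cd by (intro ext) (simp add: PiE_def extensional_def)
    ultimately show "v \<in> G" by simp
  qed
  show ?thesis
  proof (intro free_bigraded.intro[OF free_basis.intro free_bigraded_axioms.intro])
    show "comm_group ?D" by (rule D.comm_group_axioms)
    show "finite (Sigma I X)"
      by (rule finite_SigmaI[OF I free_basis.fin[OF free_bigraded.axioms(1)[OF M]]])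
    show "carrier ?D \<subseteq> generate ?D (?b ` Sigma I X)" using gen by (simp add: G_def)
    show "grade ?D d = {m \<in> carrier ?D. \<forall>x\<in>Sigma I X. ?d x \<noteq> d \<longrightarrow> ?c x m = 0}" for d
    proof -
      have "grade ?D d = {x \<in> carrier ?D. \<forall>i\<in>I. x i \<in> grade (M i) d}" by (simp add: direct_sum_def)
      also have "\<dots> = {m \<in> carrier ?D. \<forall>x\<in>Sigma I X. ?d x \<noteq> d \<longrightarrow> ?c x m = 0}"
        unfolding cd using free_bigraded.grade_eq[OF M] by (auto simp: PiE_iff)
      finally show ?thesis .
    qed
    fix z assume z: "z \<in> Sigma I X"
    show "?b z \<in> carrier ?D" by (rule bD[OF z])
    obtain i x where ix: "z = (i, x)" "i \<in> I" "x \<in> X i" using z by auto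
    interpret Mi: free_bigraded "M i" "X i" "b i" "c i" "dg i" by (rule M[OF ix(2)])
    show "?c z \<in> hom ?D integer_group"
      unfolding ix(1) prod.case
    proof (rule homI)
      fix v w assume "v \<in> carrier ?D" "w \<in> carrier ?D"
      then have "v i \<in> carrier (M i)" "w i \<in> carrier (M i)" using ix(2) by (auto simp: cd)
      then show "c i x ((v \<otimes>\<^bsub>?D\<^esub> w) i) = c i x (v i) \<otimes>\<^bsub>integer_group\<^esub> c i x (w i)"
        using ix(2) hom_mult[OF Mi.c_hom[OF ix(3)]] by simp
    qed simp
    fix y assume y: "y \<in> Sigma I X"
    show "?c z (?b y) = (if z = y then 1 else 0)"
    proof -
      obtain i' y' where y: "y = (i', y')" "i' \<in> I" "y' \<in> X i'" using y by auto
      show ?thesis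
      proof (cases "i' = i")
        case True
        then show ?thesis using y ix by (simp add: Mi.c_b)
      next
        case False
        then show ?thesis using y ix by (simp add: Mi.c_one)
      qed
    qed
  qed
qed

section \<open>Rank\<close>

definition int_comb :: "('a, 'm) monoid_scheme \<Rightarrow> ('x \<Rightarrow> 'a) \<Rightarrow> 'x set \<Rightarrow> ('x \<Rightarrow> int) \<Rightarrow> 'a" where
  "int_comb M b Y a = finprod M (\<lambda>x. b x [^]\<^bsub>M\<^esub> a x) Y"

definition indep :: "('a, 'm) monoid_scheme \<Rightarrow> ('x \<Rightarrow> 'a) \<Rightarrow> 'x set \<Rightarrow> bool" where
  "indep M b Y \<longleftrightarrow> (\<forall>a. int_comb M b Y a = \<one>\<^bsub>M\<^esub> \<longrightarrow> (\<forall>x\<in>Y. a x = 0))"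

text \<open>Equivalently, the members of b become a basis of the rationalization of M.\<close>

definition qbasis :: "('a, 'm) monoid_scheme \<Rightarrow> ('x \<Rightarrow> 'a) \<Rightarrow> 'x set \<Rightarrow> bool" where
  "qbasis M b X \<longleftrightarrow> comm_group M \<and> finite X \<and> (\<forall>x\<in>X. b x \<in> carrier M) \<and> indep M b X \<and>
     (\<forall>m\<in>carrier M. \<exists>k a. k \<noteq> 0 \<and> m [^]\<^bsub>M\<^esub> (k::int) = int_comb M b X a)"

context
  fixes M :: "('a, 'm) monoid_scheme" and b :: "'x \<Rightarrow> 'a" and Y :: "'x set"
  assumes M: "comm_group M" and bp: "b \<in> Y \<rightarrow> carrier M"
begin

interpretation comm_group M by (rule M)

lemma int_comb_mem: "x \<in> Y \<Longrightarrow> b x \<in> carrier M"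
  using bp by (rule Pi_mem)

lemma int_comb_closed: "int_comb M b Y a \<in> carrier M"
  unfolding int_comb_def using int_comb_mem by (intro finprod_closed) auto

lemma int_comb_add: "int_comb M b Y (\<lambda>x. a x + a' x) = int_comb M b Y a \<otimes>\<^bsub>M\<^esub> int_comb M b Y a'"
proof -
  have "int_comb M b Y (\<lambda>x. a x + a' x) = finprod M (\<lambda>x. b x [^]\<^bsub>M\<^esub> a x \<otimes>\<^bsub>M\<^esub> b x [^]\<^bsub>M\<^esub> a' x) Y"
    unfolding int_comb_def using int_comb_mem by (intro finprod_cong') (auto simp: int_pow_mult)
  then show ?thesis unfolding int_comb_def using int_comb_mem by (simp add: finprod_multf)
qed

lemma int_comb_scale: "int_comb M b Y (\<lambda>x. k * a x) = int_comb M b Y a [^]\<^bsub>M\<^esub> (k::int)"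
proof -
  have "int_comb M b Y a [^]\<^bsub>M\<^esub> k = finprod M (\<lambda>x. (b x [^]\<^bsub>M\<^esub> a x) [^]\<^bsub>M\<^esub> k) Y"
    unfolding int_comb_def using int_comb_mem by (intro hom_finprod[OF M M int_pow_hom[OF M]]) auto
  also have "\<dots> = int_comb M b Y (\<lambda>x. k * a x)"
    unfolding int_comb_def using int_comb_mem by (intro finprod_cong') (auto simp: int_pow_pow mult.commute)
  finally show ?thesis by simp
qed

lemma int_comb_hom:
  assumes "comm_group N" "f \<in> hom M N"
  shows "f (int_comb M b Y a) = int_comb N (\<lambda>x. f (b x)) Y a"
proof -
  interpret N: comm_group N by fact
  have fb: "f (b x) \<in> carrier N" if "x \<in> Y" for x using hom_in_carrier[OF assms(2) int_comb_mem[OF that]] .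
  have "f (int_comb M b Y a) = finprod N (\<lambda>x. f (b x [^]\<^bsub>M\<^esub> a x)) Y"
    unfolding int_comb_def using int_comb_mem by (intro hom_finprod[OF M assms]) auto
  also have "\<dots> = int_comb N (\<lambda>x. f (b x)) Y a"
    unfolding int_comb_def using int_comb_mem fb hom_int_pow[OF assms(2) _ is_group N.is_group]
    by (intro N.finprod_cong') auto
  finally show ?thesis .
qed

lemma int_comb_rat:
  assumes "f \<in> hom M rat_group"
  shows "f (int_comb M b Y a) = (\<Sum>x\<in>Y. of_int (a x) * f (b x))"
  unfolding int_comb_hom[OF comm_group_rat_group assms]
  by (simp add: int_comb_def finprod_rat_group)

lemma int_comb_cong: "(\<And>x. x \<in> Y \<Longrightarrow> a x = a' x) \<Longrightarrow> int_comb M b Y a = int_comb M b Y a'"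
  unfolding int_comb_def using int_comb_mem by (intro finprod_cong') auto

lemma int_comb_zero: "(\<And>x. x \<in> Y \<Longrightarrow> a x = 0) \<Longrightarrow> int_comb M b Y a = \<one>\<^bsub>M\<^esub>"
  unfolding int_comb_def by (rule finprod_one_eqI) simp

lemma int_comb_single:
  assumes "finite Y" "y \<in> Y"
  shows "int_comb M b Y (\<lambda>x. if x = y then k else 0) = b y [^]\<^bsub>M\<^esub> k"
proof -
  have "int_comb M b Y (\<lambda>x. if x = y then k else 0) =
      finprod M (\<lambda>x. if y = x then b x [^]\<^bsub>M\<^esub> k else \<one>\<^bsub>M\<^esub>) Y"
    unfolding int_comb_def using int_comb_mem by (intro finprod_cong') auto
  also have "\<dots> = b y [^]\<^bsub>M\<^esub> k" using assms int_comb_mem by (intro finprod_singleton) auto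
  finally show ?thesis .
qed

lemma int_comb_mono_neutral:
  assumes "finite Y" "Z \<subseteq> Y" "\<And>x. x \<in> Y - Z \<Longrightarrow> a x = 0"
  shows "int_comb M b Y a = int_comb M b Z a"
  unfolding int_comb_def
  by (rule finprod_mono_neutral_cong_right) (use assms int_comb_mem in auto)

lemma subgroup_int_combs: "subgroup (range (int_comb M b Y)) M"
proof (rule subgroupI)
  show "range (int_comb M b Y) \<subseteq> carrier M" using int_comb_closed by auto
  fix m m' assume m: "m \<in> range (int_comb M b Y)" and "m' \<in> range (int_comb M b Y)"
  then obtain a a' where a: "m = int_comb M b Y a" "m' = int_comb M b Y a'" by auto
  have "m [^]\<^bsub>M\<^esub> (-1::int) \<in> range (int_comb M b Y)" unfolding a int_comb_scale[symmetric] by (rule rangeI)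
  then show "inv\<^bsub>M\<^esub> m \<in> range (int_comb M b Y)" using a int_comb_closed by (simp add: int_pow_neg)
  show "m \<otimes>\<^bsub>M\<^esub> m' \<in> range (int_comb M b Y)" unfolding a int_comb_add[symmetric] by (rule rangeI)
qed simp

end

text \<open>Raising m to the power kk' in two ways gives a vanishing combination with coefficients
  k'a - ka', and independence applies. The rational coordinate a/k is therefore well
  defined.\<close>

lemma qbasis_unique:
  assumes q: "qbasis M b X" and m: "m \<in> carrier M" and x: "x \<in> X"
    and a: "m [^]\<^bsub>M\<^esub> k = int_comb M b X a" and a': "m [^]\<^bsub>M\<^esub> k' = int_comb M b X a'"
  shows "k' * a x = k * (a' x :: int)"
proof -
  have M: "comm_group M" and b: "\<And>x. x \<in> X \<Longrightarrow> b x \<in> carrier M" and i: "indep M b X"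
    and bp: "b \<in> X \<rightarrow> carrier M" using q by (auto simp: qbasis_def)
  interpret comm_group M by (rule M)
  note c = int_comb_closed[OF M bp]
  have "int_comb M b X (\<lambda>x. k' * a x + (- k) * a' x) =
      int_comb M b X (\<lambda>x. k' * a x) \<otimes>\<^bsub>M\<^esub> int_comb M b X (\<lambda>x. (- k) * a' x)"
    by (rule int_comb_add[OF M bp])
  also have "\<dots> = (m [^]\<^bsub>M\<^esub> k) [^]\<^bsub>M\<^esub> k' \<otimes>\<^bsub>M\<^esub> (m [^]\<^bsub>M\<^esub> k') [^]\<^bsub>M\<^esub> (- k)"
    unfolding a a' by (simp only: int_comb_scale[OF M bp])
  also have "\<dots> = m [^]\<^bsub>M\<^esub> (k * k' + k' * (- k))"
    unfolding int_pow_pow[OF m] int_pow_mult[OF m] by (rule refl)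
  also have "\<dots> = \<one>\<^bsub>M\<^esub>" by (simp add: mult.commute)
  finally have "k' * a x + (- k) * a' x = 0" using i x unfolding indep_def by blast
  then show ?thesis by simp
qed

text \<open>The dual functionals take rational values because only a multiple of m need be an
  integral combination. They annihilate torsion and so remain available for groups that are not
  free.\<close>

lemma qbasis_coord:
  assumes q: "qbasis M b X"
  shows "\<exists>c. (\<forall>x\<in>X. c x \<in> hom M rat_group) \<and>
    (\<forall>x\<in>X. \<forall>y\<in>X. c x (b y) = (if x = y then 1 else 0)) \<and>
    (\<forall>x\<in>X. \<forall>m\<in>carrier M. \<forall>k a. m [^]\<^bsub>M\<^esub> k = int_comb M b X a \<longrightarrow> of_int k * c x m = of_int (a x))"
proof -
  have M: "comm_group M" and b: "\<And>x. x \<in> X \<Longrightarrow> b x \<in> carrier M" and fin: "finite X"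
    and bp: "b \<in> X \<rightarrow> carrier M" using q by (auto simp: qbasis_def)
  interpret comm_group M by (rule M)
  have "\<forall>m\<in>carrier M. \<exists>p. fst p \<noteq> 0 \<and> m [^]\<^bsub>M\<^esub> (fst p :: int) = int_comb M b X (snd p)"
    using q unfolding qbasis_def by (metis fst_conv snd_conv)
  then obtain p where p: "\<And>m. m \<in> carrier M \<Longrightarrow> fst (p m) \<noteq> 0"
      "\<And>m. m \<in> carrier M \<Longrightarrow> m [^]\<^bsub>M\<^esub> (fst (p m) :: int) = int_comb M b X (snd (p m))"
    by metis
  define c where "c = (\<lambda>x m. of_int (snd (p m) x) / (of_int (fst (p m)) :: rat))"
  have key: "of_int k * c x m = of_int (a x)"
    if x: "x \<in> X" and m: "m \<in> carrier M" and a: "m [^]\<^bsub>M\<^esub> k = int_comb M b X a" for x m k a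
  proof -
    have "fst (p m) * a x = k * snd (p m) x" by (rule qbasis_unique[OF q m x a p(2)[OF m]])
    then have "(of_int (fst (p m)) :: rat) * of_int (a x) = of_int k * of_int (snd (p m) x)"
      by (metis of_int_mult)
    then show ?thesis using p(1)[OF m] by (simp add: c_def field_simps)
  qed
  show ?thesis
  proof (intro exI[of _ c] conjI ballI allI impI)
    show "c x \<in> hom M rat_group" if x: "x \<in> X" for x
    proof (rule homI)
      fix m m' assume m: "m \<in> carrier M" and m': "m' \<in> carrier M"
      let ?k = "fst (p m)" and ?a = "snd (p m)" and ?k' = "fst (p m')" and ?a' = "snd (p m')"
      \<comment> \<open>The product of the denominators of m and m' serves as a denominator for
        their product.\<close>
      have "(m \<otimes>\<^bsub>M\<^esub> m') [^]\<^bsub>M\<^esub> (?k * ?k') = m [^]\<^bsub>M\<^esub> (?k * ?k') \<otimes>\<^bsub>M\<^esub> m' [^]\<^bsub>M\<^esub> (?k' * ?k)"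
        using m m' by (simp add: int_pow_distrib mult.commute)
      also have "\<dots> = (m [^]\<^bsub>M\<^esub> ?k) [^]\<^bsub>M\<^esub> ?k' \<otimes>\<^bsub>M\<^esub> (m' [^]\<^bsub>M\<^esub> ?k') [^]\<^bsub>M\<^esub> ?k"
        using m m' by (simp add: int_pow_pow)
      also have "\<dots> = int_comb M b X (\<lambda>x. ?k' * ?a x + ?k * ?a' x)"
        unfolding p(2)[OF m] p(2)[OF m'] by (simp only: int_comb_scale[OF M bp] int_comb_add[OF M bp])
      finally have "of_int (?k * ?k') * c x (m \<otimes>\<^bsub>M\<^esub> m') = of_int (?k' * ?a x + ?k * ?a' x)"
        by (rule key[OF x m_closed[OF m m']])
      then show "c x (m \<otimes>\<^bsub>M\<^esub> m') = c x m \<otimes>\<^bsub>rat_group\<^esub> c x m'"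
        using p(1)[OF m] p(1)[OF m'] by (simp add: c_def field_simps)
    qed simp
    show "c x (b y) = (if x = y then 1 else 0)" if "x \<in> X" "y \<in> X" for x y
      using key[OF that(1) b[OF that(2)], where k = 1 and a = "\<lambda>x. if x = y then 1 else 0"]
        int_comb_single[OF M bp fin that(2), of 1] b[OF that(2)] that by simp
  qed (rule key)
qed

text \<open>A diagonal matrix of values with nonzero diagonal is enough for independence. The kernel
  elements constructed for rank-nullity have diagonal values that need not be 1.\<close>

lemma qbasisI_coord:
  assumes M: "comm_group M" and fin: "finite X" and bp: "b \<in> X \<rightarrow> carrier M"
    and c: "\<And>x. x \<in> X \<Longrightarrow> c x \<in> hom M rat_group"
    and cb: "\<And>x y. x \<in> X \<Longrightarrow> y \<in> X \<Longrightarrow> x \<noteq> y \<Longrightarrow> c x (b y) = 0"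
    and cb': "\<And>x. x \<in> X \<Longrightarrow> c x (b x) \<noteq> 0"
    and span: "\<And>m. m \<in> carrier M \<Longrightarrow> \<exists>k a. k \<noteq> 0 \<and> m [^]\<^bsub>M\<^esub> (k::int) = int_comb M b X a"
  shows "qbasis M b X"
  unfolding qbasis_def indep_def
proof (intro conjI ballI allI impI M fin span bp[unfolded Pi_iff, rule_format])
  fix a x assume a: "int_comb M b X a = \<one>\<^bsub>M\<^esub>" and x: "x \<in> X"
  have "c x (int_comb M b X a) = 0"
    using a hom_one[OF c[OF x] comm_group.axioms(2)[OF M] comm_group.axioms(2)[OF comm_group_rat_group]] by simp
  moreover have "c x (int_comb M b X a) = (\<Sum>y\<in>X. if y = x then of_int (a x) * c x (b x) else 0)"
    unfolding int_comb_rat[OF M bp c[OF x]] using cb x by (intro sum.cong) auto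
  ultimately show "a x = 0" using x fin cb'[OF x] by simp
qed

lemma qbasis_same:
  assumes "carrier M = carrier N" "monoid.mult M = monoid.mult N" "one M = one N"
  shows "qbasis M b X = qbasis N b X"
proof -
  have e: "int_comb M b X = int_comb N b X"
    unfolding int_comb_def same_finprod[OF assms] same_int_pow[OF assms] by (rule refl)
  show ?thesis
    unfolding qbasis_def indep_def e same_comm_group[OF assms] same_int_pow[OF assms] assms by (rule refl)
qed

text \<open>A subfamily of b whose image is maximal independent is a basis of the
  image, and every other member of b has a relation modulo that subfamily, which yields an
  element of the kernel.\<close>

lemma qbasis_rank_nullity:
  assumes q: "qbasis M b X" and N: "comm_group N" and f: "f \<in> hom M N"
    and surj: "f ` carrier M = carrier N"
  obtains Y n where "Y \<subseteq> X" "qbasis N (\<lambda>x. f (b x)) Y" "qbasis (M\<lparr>carrier := kernel M N f\<rparr>) n (X - Y)"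
proof -
  have M: "comm_group M" and b: "\<And>x. x \<in> X \<Longrightarrow> b x \<in> carrier M" and fin: "finite X"
    and span: "\<And>m. m \<in> carrier M \<Longrightarrow> \<exists>k a. k \<noteq> 0 \<and> m [^]\<^bsub>M\<^esub> (k::int) = int_comb M b X a"
    and bp: "b \<in> X \<rightarrow> carrier M" using q by (auto simp: qbasis_def)
  interpret M: comm_group M by (rule M)
  interpret N: comm_group N by (rule N)
  interpret f: group_hom M N f by unfold_locales (rule f)
  obtain c where c: "(\<forall>x\<in>X. c x \<in> hom M rat_group) \<and>
    (\<forall>x\<in>X. \<forall>y\<in>X. c x (b y) = (if x = y then 1 else 0)) \<and>
    (\<forall>x\<in>X. \<forall>m\<in>carrier M. \<forall>k a. m [^]\<^bsub>M\<^esub> k = int_comb M b X a \<longrightarrow> of_int k * c x m = of_int (a x))"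
    using qbasis_coord[OF q] by (rule exE)
  note ck = c[THEN conjunct2, THEN conjunct2, rule_format]
    and cb = c[THEN conjunct2, THEN conjunct1, rule_format] and c = c[THEN conjunct1, rule_format]
  let ?fb = "\<lambda>x. f (b x)"
  have fb: "f (b x) \<in> carrier N" if "x \<in> X" for x using b[OF that] by simp
  let ?Q = "{Y. Y \<subseteq> X \<and> indep N ?fb Y}"
  have "finite ?Q" using fin by simp
  moreover have "{} \<in> ?Q" by (simp add: indep_def)
  ultimately have "\<exists>Y\<in>?Q. \<forall>Z\<in>?Q. Y \<subseteq> Z \<longrightarrow> Y = Z"
    by (intro finite_has_maximal) auto
  then obtain Y where Y: "Y \<in> ?Q" and max: "\<forall>Z\<in>?Q. Y \<subseteq> Z \<longrightarrow> Y = Z" by (rule bexE)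
  note max = max[rule_format]
  have YX: "Y \<subseteq> X" and iY: "indep N ?fb Y" using Y by auto
  have finY: "finite Y" using YX fin finite_subset by blast
  have bY: "\<And>x. x \<in> Y \<Longrightarrow> b x \<in> carrier M" and fbY: "\<And>x. x \<in> Y \<Longrightarrow> f (b x) \<in> carrier N"
    using YX b fb by auto
  have bYp: "b \<in> Y \<rightarrow> carrier M" and fbYp: "?fb \<in> Y \<rightarrow> carrier N" using bY fbY by auto
  have "\<exists>a. int_comb N ?fb (insert x Y) a = \<one>\<^bsub>N\<^esub> \<and> a x \<noteq> 0" if x: "x \<in> X - Y" for x
  proof -
    have "insert x Y \<notin> ?Q" using max[of "insert x Y"] x by blast
    then have "\<not> indep N ?fb (insert x Y)" using x YX by blast
    then obtain a z where a: "int_comb N ?fb (insert x Y) a = \<one>\<^bsub>N\<^esub>" and z: "z \<in> insert x Y" "a z \<noteq> 0"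
      unfolding indep_def by blast
    \<comment> \<open>A relation without x would be a relation among the independent images of
      Y.\<close>
    have "a x \<noteq> 0"
    proof
      assume a0: "a x = 0"
      have "int_comb N ?fb (insert x Y) a = int_comb N ?fb Y a"
        by (rule int_comb_mono_neutral[OF N]) (use fb x fbY finY a0 in auto)
      then have "\<forall>z\<in>Y. a z = 0" using iY a unfolding indep_def by simp
      then show False using z a0 by auto
    qed
    then show ?thesis using a by blast
  qed
  then obtain A where A: "\<And>x. x \<in> X - Y \<Longrightarrow> int_comb N ?fb (insert x Y) (A x) = \<one>\<^bsub>N\<^esub>"
    and Ax: "\<And>x. x \<in> X - Y \<Longrightarrow> A x x \<noteq> 0"
    by metis
  \<comment> \<open>The relation between images, read in M before f is applied, gives an element of
    the kernel whose only coordinate outside Y is the one at x.\<close>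
  define n where "n = (\<lambda>x. int_comb M b (insert x Y) (A x))"
  have nc: "n x \<in> carrier M" if "x \<in> X - Y" for x
    unfolding n_def using that b bY by (intro int_comb_closed[OF M]) auto
  have ncp: "n \<in> X - Y \<rightarrow> carrier M" using nc by auto
  have fn: "f (n x) = \<one>\<^bsub>N\<^esub>" if x: "x \<in> X - Y" for x
    unfolding n_def by (subst int_comb_hom[OF M _ N f]) (use x b bY A[OF x] in auto)
  have cn: "c x (n y) = (if x = y then of_int (A x x) else 0)" if x: "x \<in> X - Y" and y: "y \<in> X - Y" for x y
  proof -
    have "c x (n y) = (\<Sum>z\<in>insert y Y. of_int (A y z) * c x (b z))"
      unfolding n_def by (rule int_comb_rat[OF M]) (use y x b bY c in auto)
    also have "\<dots> = (\<Sum>z\<in>insert y Y. if z = x then of_int (A y x) else 0)"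
      using x y YX by (intro sum.cong) (auto simp: cb)
    also have "\<dots> = (if x = y then of_int (A x x) else 0)"
      using x finY by (simp add: sum.delta)
    finally show ?thesis .
  qed
  \<comment> \<open>A common multiple of the coefficients \<open>A x x\<close>, which allows the
    coordinates outside Y to be cleared without fractions.\<close>
  define K where "K = (\<Prod>x\<in>X - Y. A x x)"
  have K: "K \<noteq> 0" unfolding K_def using fin Ax by simp
  have Kdiv: "A x x dvd K" if "x \<in> X - Y" for x
    unfolding K_def using fin that by (intro dvd_prodI) auto
  have red: "\<exists>k s a. k \<noteq> 0 \<and>
      m [^]\<^bsub>M\<^esub> (k::int) = int_comb M n (X - Y) s \<otimes>\<^bsub>M\<^esub> int_comb M b Y a"
    if m: "m \<in> carrier M" for m
  proof -
    obtain k a where k: "k \<noteq> 0" and ma: "m [^]\<^bsub>M\<^esub> (k::int) = int_comb M b X a" using span[OF m] by blast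
    \<comment> \<open>Chosen so that \<open>s x * A x x = K * a x\<close>: removing the combination
      of kernel elements with these coefficients from the power kK of m clears all coordinates
      outside Y.\<close>
    define s where "s = (\<lambda>x. (K div A x x) * a x)"
    have sA: "s x * A x x = K * a x" if "x \<in> X - Y" for x
      unfolding s_def using Kdiv[OF that] by (metis dvd_div_mult_self mult.assoc mult.commute)
    define r where "r = m [^]\<^bsub>M\<^esub> (k * K) \<otimes>\<^bsub>M\<^esub> int_comb M n (X - Y) (\<lambda>x. - s x)"
    have nC: "int_comb M n (X - Y) t \<in> carrier M" for t by (rule int_comb_closed[OF M ncp])
    have rc: "r \<in> carrier M" unfolding r_def using m nC by simp
    have cr: "c x r = 0" if x: "x \<in> X - Y" for x
    proof -
      have xX: "x \<in> X" using x by simp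
      have "c x r = of_int (k * K) * c x m + c x (int_comb M n (X - Y) (\<lambda>x. - s x))"
        unfolding r_def using hom_mult[OF c[OF xX]] hom_rat_pow[OF M.is_group c[OF xX]] m nC by simp
      also have "c x (int_comb M n (X - Y) (\<lambda>x. - s x)) = (\<Sum>y\<in>X - Y. of_int (- s y) * c x (n y))"
        by (rule int_comb_rat[OF M ncp c[OF xX]])
      also have "\<dots> = (\<Sum>y\<in>X - Y. if y = x then of_int (- (s x * A x x)) else 0)"
        using x by (intro sum.cong) (auto simp: cn)
      also have "\<dots> = of_int (- (K * a x))" using x fin sA[OF x] by (simp add: sum.delta)
      also have "of_int (k * K) * c x m = of_int K * (of_int k * c x m)" by simp
      also have "of_int k * c x m = of_int (a x)" by (rule ck[OF xX m ma])
      finally show ?thesis by simp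
    qed
    \<comment> \<open>The coordinates of r outside Y vanish, so some multiple of r is a combination
      of members of Y alone.\<close>
    obtain l u where l: "l \<noteq> 0" and ru: "r [^]\<^bsub>M\<^esub> (l::int) = int_comb M b X u" using span[OF rc] by blast
    have "u x = 0" if x: "x \<in> X - Y" for x
      using ck[of x r l u] rc ru cr[OF x] x by simp
    then have "int_comb M b X u = int_comb M b Y u"
      by (intro int_comb_mono_neutral[OF M bp fin YX]) auto
    then have rl: "r [^]\<^bsub>M\<^esub> l = int_comb M b Y u" using ru by simp
    have inv: "int_comb M n (X - Y) s \<otimes>\<^bsub>M\<^esub> int_comb M n (X - Y) (\<lambda>x. - s x) = \<one>\<^bsub>M\<^esub>"
      unfolding int_comb_add[OF M ncp, symmetric] by (rule int_comb_zero[OF M ncp]) auto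
    have "m [^]\<^bsub>M\<^esub> (k * K) = int_comb M n (X - Y) s \<otimes>\<^bsub>M\<^esub> r"
    proof -
      have "int_comb M n (X - Y) s \<otimes>\<^bsub>M\<^esub> r =
        m [^]\<^bsub>M\<^esub> (k * K) \<otimes>\<^bsub>M\<^esub> (int_comb M n (X - Y) s \<otimes>\<^bsub>M\<^esub> int_comb M n (X - Y) (\<lambda>x. - s x))"
        unfolding r_def using m nC by (simp add: M.m_lcomm)
      then show ?thesis unfolding inv using m by simp
    qed
    then have "m [^]\<^bsub>M\<^esub> (k * K * l) = (int_comb M n (X - Y) s \<otimes>\<^bsub>M\<^esub> r) [^]\<^bsub>M\<^esub> l"
      using m by (metis M.int_pow_pow)
    also have "\<dots> = int_comb M n (X - Y) (\<lambda>x. l * s x) \<otimes>\<^bsub>M\<^esub> int_comb M b Y u"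
      unfolding int_comb_scale[OF M ncp] rl[symmetric] using nC rc by (rule M.int_pow_distrib)
    finally show ?thesis using k K l by (intro exI[of _ "k * K * l"] exI conjI) auto
  qed
  have f_red: "f (int_comb M n (X - Y) s \<otimes>\<^bsub>M\<^esub> int_comb M b Y a) = int_comb N ?fb Y a" for s a
  proof -
    have nC: "int_comb M n (X - Y) s \<in> carrier M" by (rule int_comb_closed[OF M ncp])
    have bC: "int_comb M b Y a \<in> carrier M" by (rule int_comb_closed[OF M bYp])
    have "f (int_comb M n (X - Y) s) = int_comb N (\<lambda>x. f (n x)) (X - Y) s"
      by (rule int_comb_hom[OF M ncp N f])
    also have "\<dots> = \<one>\<^bsub>N\<^esub>" unfolding int_comb_def by (rule N.finprod_one_eqI) (simp add: fn)
    finally have "f (int_comb M n (X - Y) s) = \<one>\<^bsub>N\<^esub>" .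
    moreover have "f (int_comb M b Y a) = int_comb N ?fb Y a" by (rule int_comb_hom[OF M bYp N f])
    ultimately show ?thesis using nC bC int_comb_closed[OF N fbYp] by simp
  qed
  have qN: "qbasis N ?fb Y"
    unfolding qbasis_def
  proof (intro conjI ballI N finY fbY iY)
    fix y assume "y \<in> carrier N"
    then obtain m where m: "m \<in> carrier M" "y = f m" using surj by auto
    obtain k s a where k: "k \<noteq> 0" and "m [^]\<^bsub>M\<^esub> (k::int) = int_comb M n (X - Y) s \<otimes>\<^bsub>M\<^esub> int_comb M b Y a"
      using red[OF m(1)] by blast
    then have "y [^]\<^bsub>N\<^esub> k = int_comb N ?fb Y a"
      using f_red f.hom_int_pow[OF m(1), of k] m(2) by simp
    then show "\<exists>k a. k \<noteq> 0 \<and> y [^]\<^bsub>N\<^esub> (k::int) = int_comb N ?fb Y a" using k by blast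
  qed
  let ?K = "M\<lparr>carrier := kernel M N f\<rparr>"
  have sK: "subgroup (kernel M N f) M" by (rule f.subgroup_kernel)
  have cK: "comm_group ?K" by (rule M.comm_group_subgroup[OF sK])
  have iK: "(\<lambda>x. x) \<in> hom ?K M" using subgroup.subset[OF sK] by (auto simp: hom_def)
  have nK: "n x \<in> carrier ?K" if "x \<in> X - Y" for x using nc[OF that] fn[OF that] by (simp add: kernel_def)
  have nKp: "n \<in> X - Y \<rightarrow> carrier ?K" using nK by auto
  have ic: "int_comb ?K n (X - Y) s = int_comb M n (X - Y) s" for s
    using int_comb_hom[OF cK nKp M iK] by simp
  have qK: "qbasis ?K n (X - Y)"
  proof (rule qbasisI_coord[OF cK, where c = c])
    show "c x \<in> hom ?K rat_group" if "x \<in> X - Y" for x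
      using c[of x] that subgroup.subset[OF sK] by (auto simp: hom_def)
    show "c x (n y) = 0" if "x \<in> X - Y" "y \<in> X - Y" "x \<noteq> y" for x y using cn[OF that(1,2)] that(3) by simp
    show "c x (n x) \<noteq> 0" if "x \<in> X - Y" for x using cn[OF that that] Ax[OF that] by simp
    fix m assume "m \<in> carrier ?K"
    then have m: "m \<in> carrier M" "f m = \<one>\<^bsub>N\<^esub>" by (auto simp: kernel_def)
    obtain k s a where k: "k \<noteq> 0" and e: "m [^]\<^bsub>M\<^esub> (k::int) = int_comb M n (X - Y) s \<otimes>\<^bsub>M\<^esub> int_comb M b Y a"
      using red[OF m(1)] by blast
    have "f (m [^]\<^bsub>M\<^esub> k) = \<one>\<^bsub>N\<^esub>" using f.hom_int_pow[OF m(1), of k] m(2) by simp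
    then have "int_comb N ?fb Y a = \<one>\<^bsub>N\<^esub>" unfolding e f_red .
    then have "\<forall>x\<in>Y. a x = 0" using iY unfolding indep_def by blast
    then have "int_comb M b Y a = \<one>\<^bsub>M\<^esub>" by (intro int_comb_zero[OF M bYp]) auto
    then have "m [^]\<^bsub>M\<^esub> k = int_comb M n (X - Y) s" using e int_comb_closed[OF M ncp] by simp
    moreover have "m [^]\<^bsub>?K\<^esub> k = m [^]\<^bsub>M\<^esub> k"
      using M.int_pow_consistent[OF sK, of m k] m by (simp add: kernel_def)
    ultimately show "\<exists>k a. k \<noteq> 0 \<and> m [^]\<^bsub>?K\<^esub> (k::int) = int_comb ?K n (X - Y) a"
      using k ic by metis
  qed (use fin nK in auto)
  show ?thesis by (rule that[OF YX qN qK])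
qed

section \<open>The rationalization and its dimension\<close>

lemma rat_field_simps [simp]: "carrier rat_field = UNIV" "x \<otimes>\<^bsub>rat_field\<^esub> y = x * y"
    "x \<oplus>\<^bsub>rat_field\<^esub> y = x + y" "\<one>\<^bsub>rat_field\<^esub> = 1" "\<zero>\<^bsub>rat_field\<^esub> = 0"
  by (simp_all add: rat_field_def)

lemma field_rat_field: "field rat_field"
proof (rule cring.cring_fieldI2)
  show "cring rat_field"
  proof (rule cringI)
    show "abelian_group rat_field"
    proof (rule abelian_groupI)
      show "\<exists>y\<in>carrier rat_field. y \<oplus>\<^bsub>rat_field\<^esub> x = \<zero>\<^bsub>rat_field\<^esub>" for x
        by (rule bexI[of _ "- x"]) auto
    qed auto
    show "comm_monoid rat_field" by (rule comm_monoidI) auto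
  qed (auto simp: algebra_simps)
  show "\<exists>b\<in>carrier rat_field. a \<otimes>\<^bsub>rat_field\<^esub> b = \<one>\<^bsub>rat_field\<^esub>" if "a \<noteq> \<zero>\<^bsub>rat_field\<^esub>" for a
    using that by (intro bexI[of _ "1 / a"]) auto
qed auto

context
  fixes M :: "('a, 'm) monoid_scheme"
  assumes M: "comm_group M"
begin

interpretation M: comm_group M by (rule M)

interpretation T: comm_group "tensor_group M rat_group"
  by (rule comm_group_tensor_group[OF M comm_group_rat_group])

lemma rationalization_simps:
  "carrier (rationalization M) = carrier (tensor_group M rat_group)"
  "x \<oplus>\<^bsub>rationalization M\<^esub> y = x \<otimes>\<^bsub>tensor_group M rat_group\<^esub> y"
  "\<zero>\<^bsub>rationalization M\<^esub> = \<one>\<^bsub>tensor_group M rat_group\<^esub>"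
  by (simp_all add: rationalization_def)

lemma add_monoid_rationalization:
  "carrier (add_monoid (rationalization M)) = carrier (tensor_group M rat_group)"
  "monoid.mult (add_monoid (rationalization M)) = monoid.mult (tensor_group M rat_group)"
  "\<one>\<^bsub>add_monoid (rationalization M)\<^esub> = \<one>\<^bsub>tensor_group M rat_group\<^esub>"
  by (simp_all add: rationalization_def)

lemma rat_smult:
  shows rat_smult_hom: "(\<lambda>v. q \<odot>\<^bsub>rationalization M\<^esub> v) \<in> hom (tensor_group M rat_group) (tensor_group M rat_group)"
    and rat_smult_pure: "x \<in> carrier M \<Longrightarrow>
      q \<odot>\<^bsub>rationalization M\<^esub> pure_tensor M rat_group x r = pure_tensor M rat_group x (q * r)"
proof -
  note pl = hom_mult[OF pure_tensor_left_hom[OF M comm_group_rat_group]]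
    and pr = hom_mult[OF pure_tensor_right_hom[OF M comm_group_rat_group]]
  have e: "(\<lambda>v. q \<odot>\<^bsub>rationalization M\<^esub> v) = tensor_lift M rat_group (tensor_group M rat_group)
                     (\<lambda>x r. pure_tensor M rat_group x (q * r))"
    by (simp add: rationalization_def)
  show "(\<lambda>v. q \<odot>\<^bsub>rationalization M\<^esub> v) \<in> hom (tensor_group M rat_group) (tensor_group M rat_group)"
    unfolding e
    by (rule tensor_universal(1)[OF T.comm_group_axioms M comm_group_rat_group])
      (use pl pr in \<open>auto simp: pure_tensor_closed[OF M comm_group_rat_group] distrib_left\<close>)
  assume x: "x \<in> carrier M"
  have "tensor_lift M rat_group (tensor_group M rat_group) (\<lambda>x r. pure_tensor M rat_group x (q * r))
      (pure_tensor M rat_group x r) = pure_tensor M rat_group x (q * r)"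
    by (rule tensor_universal(2)[OF T.comm_group_axioms M comm_group_rat_group])
      (use pl pr x in \<open>auto simp: pure_tensor_closed[OF M comm_group_rat_group] distrib_left\<close>)
  then show "q \<odot>\<^bsub>rationalization M\<^esub> pure_tensor M rat_group x r = pure_tensor M rat_group x (q * r)"
    using fun_cong[OF e] by simp
qed

lemma rat_ext:
  assumes "group T" "f \<in> hom (tensor_group M rat_group) T" "g \<in> hom (tensor_group M rat_group) T"
    and "\<And>x r. x \<in> carrier M \<Longrightarrow> f (pure_tensor M rat_group x r) = g (pure_tensor M rat_group x r)"
    and "z \<in> carrier (tensor_group M rat_group)"
  shows "f z = g z"
  by (rule tensor_hom_ext[OF M comm_group_rat_group assms(1,2,3) _ assms(5)]) (rule assms(4))

text \<open>Scalar multiplication comes from the universal property, so the module axioms reduce to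
  its additivity and to identities on pure tensors.\<close>

lemma vectorspace_rationalization: "vectorspace rat_field (rationalization M)"
proof -
  let ?T = "tensor_group M rat_group" and ?V = "rationalization M"
  note cl = hom_in_carrier[OF rat_smult_hom]
  note pr = hom_mult[OF pure_tensor_right_hom[OF M comm_group_rat_group]]
  have id: "(\<lambda>v. v) \<in> hom ?T ?T" by (auto simp: hom_def)
  have "Module.module rat_field ?V"
  proof (rule moduleI)
    show "cring rat_field" using field_rat_field by (simp add: field_def domain_def)
    show "abelian_group ?V"
      by (rule comm_group_abelian_groupI) (unfold same_comm_group[OF add_monoid_rationalization], rule T.comm_group_axioms)
    fix q r x
    assume "x \<in> carrier ?V"
    then have x: "x \<in> carrier ?T" by (simp add: rationalization_simps)
    show "q \<odot>\<^bsub>?V\<^esub> x \<in> carrier ?V" using cl[OF x] by (simp add: rationalization_simps)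
    show "\<one>\<^bsub>rat_field\<^esub> \<odot>\<^bsub>?V\<^esub> x = x"
      by (rule rat_ext[OF T.is_group rat_smult_hom id _ x]) (simp add: rat_smult_pure)
    show "(q \<otimes>\<^bsub>rat_field\<^esub> r) \<odot>\<^bsub>?V\<^esub> x = q \<odot>\<^bsub>?V\<^esub> (r \<odot>\<^bsub>?V\<^esub> x)"
    proof (rule rat_ext[OF T.is_group rat_smult_hom _ _ x])
      show "(\<lambda>v. q \<odot>\<^bsub>?V\<^esub> (r \<odot>\<^bsub>?V\<^esub> v)) \<in> hom ?T ?T"
        using hom_compose[OF rat_smult_hom rat_smult_hom] by (simp add: comp_def)
    qed (simp add: rat_smult_pure mult.assoc)
    show "(q \<oplus>\<^bsub>rat_field\<^esub> r) \<odot>\<^bsub>?V\<^esub> x = q \<odot>\<^bsub>?V\<^esub> x \<oplus>\<^bsub>?V\<^esub> r \<odot>\<^bsub>?V\<^esub> x"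
      unfolding rationalization_simps
    proof (rule rat_ext[OF T.is_group rat_smult_hom _ _ x])
      show "(\<lambda>v. (q \<odot>\<^bsub>?V\<^esub> v) \<otimes>\<^bsub>?T\<^esub> (r \<odot>\<^bsub>?V\<^esub> v)) \<in> hom ?T ?T"
        by (rule T.hom_group_mult[OF rat_smult_hom rat_smult_hom])
    qed (use pr in \<open>simp add: rat_smult_pure distrib_right\<close>)
    fix y assume "y \<in> carrier ?V"
    then show "q \<odot>\<^bsub>?V\<^esub> (x \<oplus>\<^bsub>?V\<^esub> y) = q \<odot>\<^bsub>?V\<^esub> x \<oplus>\<^bsub>?V\<^esub> q \<odot>\<^bsub>?V\<^esub> y"
      using hom_mult[OF rat_smult_hom x] by (simp add: rationalization_simps)
  qed
  then show ?thesis using field_rat_field by (simp add: vectorspace_def)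
qed

text \<open>The tensors of the basis elements with 1 span because denominators can be moved into the
  rational factor. They are independent because the rational coordinates of
  \<open>qbasis_coord\<close> extend linearly to the rationalization.\<close>

lemma rank_qbasis:
  assumes q: "qbasis M b X"
  shows "rank_Q M = card X" and "vectorspace.fin_dim rat_field (rationalization M)"
proof -
  let ?T = "tensor_group M rat_group" and ?V = "rationalization M"
  have fin: "finite X" and bp: "b \<in> X \<rightarrow> carrier M"
    and span: "\<forall>m\<in>carrier M. \<exists>k a. k \<noteq> 0 \<and> m [^]\<^bsub>M\<^esub> (k::int) = int_comb M b X a"
    using q by (auto simp: qbasis_def)
  have b: "b x \<in> carrier M" if "x \<in> X" for x using bp that by auto
  obtain c where c: "(\<forall>x\<in>X. c x \<in> hom M rat_group) \<and>
    (\<forall>x\<in>X. \<forall>y\<in>X. c x (b y) = (if x = y then 1 else 0)) \<and>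
    (\<forall>x\<in>X. \<forall>m\<in>carrier M. \<forall>k a. m [^]\<^bsub>M\<^esub> k = int_comb M b X a \<longrightarrow> of_int k * c x m = of_int (a x))"
    using qbasis_coord[OF q] by (rule exE)
  note ck = c[THEN conjunct2, THEN conjunct2, rule_format]
    and cb = c[THEN conjunct2, THEN conjunct1, rule_format] and c = c[THEN conjunct1, rule_format]
  interpret V: vectorspace rat_field ?V by (rule vectorspace_rationalization)
  note pc = pure_tensor_closed[OF M comm_group_rat_group]
  note ph = pure_tensor_left_hom[OF M comm_group_rat_group]
  define e where "e = (\<lambda>x. pure_tensor M rat_group (b x) 1)"
  have e: "e x \<in> carrier ?T" if "x \<in> X" for x unfolding e_def by (rule pc) (use b that in auto)
  define K where "K = (\<lambda>x. tensor_lift M rat_group rat_group (\<lambda>m r. r * c x m))"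
  have Kh: "K x \<in> hom ?T rat_group" if x: "x \<in> X" for x
    unfolding K_def
    by (rule tensor_universal(1)[OF comm_group_rat_group M comm_group_rat_group])
      (use hom_mult[OF c[OF x]] in \<open>auto simp: algebra_simps\<close>)
  have Kp: "K x (pure_tensor M rat_group m r) = r * c x m" if x: "x \<in> X" and m: "m \<in> carrier M" for x m r
    unfolding K_def
    by (rule tensor_universal(2)[OF comm_group_rat_group M comm_group_rat_group _ _ _ m])
      (use hom_mult[OF c[OF x]] in \<open>auto simp: algebra_simps\<close>)
  have Ks: "K x (q \<odot>\<^bsub>?V\<^esub> v) = q * K x v" if x: "x \<in> X" and v: "v \<in> carrier ?T" for x q v
  proof (rule rat_ext[OF comm_group.axioms(2)[OF comm_group_rat_group] _ _ _ v])
    show "(\<lambda>v. K x (q \<odot>\<^bsub>?V\<^esub> v)) \<in> hom ?T rat_group"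
      using hom_compose[OF rat_smult_hom Kh[OF x]] by (simp add: comp_def)
    show "(\<lambda>v. q * K x v) \<in> hom ?T rat_group"
      using hom_mult[OF Kh[OF x]] by (auto simp: hom_def distrib_left)
  qed (simp add: rat_smult_pure Kp[OF x])
  have Ke: "K x (e y) = (if x = y then 1 else 0)" if "x \<in> X" "y \<in> X" for x y
    unfolding e_def using Kp[OF that(1) b[OF that(2)], of 1] cb[OF that] by simp
  have inj: "inj_on e X"
  proof (rule inj_onI)
    fix x y assume xy: "x \<in> X" "y \<in> X" "e x = e y"
    have "K x (e y) = 1" using Ke[OF xy(1) xy(1)] xy(3) by simp
    then show "x = y" using Ke[OF xy(1,2)] by (simp split: if_splits)
  qed
  have exp: "v = finprod ?T (\<lambda>x. K x v \<odot>\<^bsub>?V\<^esub> e x) X" if v: "v \<in> carrier ?T" for v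
  proof (rule rat_ext[OF T.is_group _ _ _ v])
    show "(\<lambda>v. v) \<in> hom ?T ?T" by (auto simp: hom_def)
    have se: "q \<odot>\<^bsub>?V\<^esub> e x \<in> carrier ?T" if "x \<in> X" for q x
      using hom_in_carrier[OF rat_smult_hom e[OF that]] .
    show "(\<lambda>v. finprod ?T (\<lambda>x. K x v \<odot>\<^bsub>?V\<^esub> e x) X) \<in> hom ?T ?T"
    proof (rule homI)
      fix v w assume vw: "v \<in> carrier ?T" "w \<in> carrier ?T"
      have "finprod ?T (\<lambda>x. K x (v \<otimes>\<^bsub>?T\<^esub> w) \<odot>\<^bsub>?V\<^esub> e x) X =
          finprod ?T (\<lambda>x. (K x v \<odot>\<^bsub>?V\<^esub> e x) \<otimes>\<^bsub>?T\<^esub> (K x w \<odot>\<^bsub>?V\<^esub> e x)) X"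
      proof (rule T.finprod_cong')
        fix x assume x: "x \<in> X"
        show "K x (v \<otimes>\<^bsub>?T\<^esub> w) \<odot>\<^bsub>?V\<^esub> e x = (K x v \<odot>\<^bsub>?V\<^esub> e x) \<otimes>\<^bsub>?T\<^esub> (K x w \<odot>\<^bsub>?V\<^esub> e x)"
          using V.smult_l_distr[of "K x v" "K x w" "e x"] e[OF x] hom_mult[OF Kh[OF x] vw]
          by (simp add: rationalization_simps)
      qed (use se in auto)
      then show "finprod ?T (\<lambda>x. K x (v \<otimes>\<^bsub>?T\<^esub> w) \<odot>\<^bsub>?V\<^esub> e x) X =
          finprod ?T (\<lambda>x. K x v \<odot>\<^bsub>?V\<^esub> e x) X \<otimes>\<^bsub>?T\<^esub> finprod ?T (\<lambda>x. K x w \<odot>\<^bsub>?V\<^esub> e x) X"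
        using se by (simp add: T.finprod_multf)
    qed (use se in \<open>auto intro!: T.finprod_closed\<close>)
    fix m r assume m: "m \<in> carrier M"
    obtain k a where k: "k \<noteq> 0" and ma: "m [^]\<^bsub>M\<^esub> (k::int) = int_comb M b X a" using span m by blast
    \<comment> \<open>Writing r as k times r/k moves the factor k to the left of the tensor sign,
      where the multiple of m becomes an integral combination of the basis.\<close>
    have "pure_tensor M rat_group m (of_int k * (r / of_int k)) =
        pure_tensor M rat_group m (r / of_int k) [^]\<^bsub>?T\<^esub> k"
      using hom_int_pow[OF pure_tensor_right_hom[OF M comm_group_rat_group m], of "r / of_int k" k]
        T.is_group comm_group.axioms(2)[OF comm_group_rat_group] by simp
    also have "\<dots> = pure_tensor M rat_group (m [^]\<^bsub>M\<^esub> k) (r / of_int k)"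
      using hom_int_pow[OF ph[of "r / of_int k"] m M.is_group T.is_group, of k] by simp
    also have "\<dots> = int_comb ?T (\<lambda>x. pure_tensor M rat_group (b x) (r / of_int k)) X a"
      unfolding ma using int_comb_hom[OF M bp T.comm_group_axioms ph[of "r / of_int k"]] by simp
    also have "\<dots> = finprod ?T (\<lambda>x. K x (pure_tensor M rat_group m r) \<odot>\<^bsub>?V\<^esub> e x) X"
      unfolding int_comb_def
    proof (rule T.finprod_cong')
      fix x assume x: "x \<in> X"
      have "pure_tensor M rat_group (b x) (r / of_int k) [^]\<^bsub>?T\<^esub> a x =
          pure_tensor M rat_group (b x) (of_int (a x) * (r / of_int k))"
        using hom_int_pow[OF pure_tensor_right_hom[OF M comm_group_rat_group b[OF x]], of "r / of_int k" "a x"]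
          T.is_group comm_group.axioms(2)[OF comm_group_rat_group] by simp
      also have "of_int (a x) * (r / of_int k) = r * c x m"
        using ck[OF x m ma] k by (simp add: field_simps)
      also have "pure_tensor M rat_group (b x) (r * c x m) = (r * c x m) \<odot>\<^bsub>?V\<^esub> e x"
        unfolding e_def using rat_smult_pure[OF b[OF x], of "r * c x m" 1] by simp
      finally show "pure_tensor M rat_group (b x) (r / of_int k) [^]\<^bsub>?T\<^esub> a x =
          K x (pure_tensor M rat_group m r) \<odot>\<^bsub>?V\<^esub> e x"
        by (simp add: Kp[OF x m])
    qed (use se in auto)
    finally show "pure_tensor M rat_group m r = finprod ?T (\<lambda>x. K x (pure_tensor M rat_group m r) \<odot>\<^bsub>?V\<^esub> e x) X"
      using k by simp
  qed
  have lc: "V.lincomb a (e ` X) = finprod ?T (\<lambda>x. a (e x) \<odot>\<^bsub>?V\<^esub> e x) X" for a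
  proof -
    have "V.lincomb a (e ` X) = finprod ?T (\<lambda>v. a v \<odot>\<^bsub>?V\<^esub> v) (e ` X)"
      unfolding V.lincomb_def finsum_def same_finprod[OF add_monoid_rationalization] by (rule refl)
    also have "\<dots> = finprod ?T (\<lambda>x. a (e x) \<odot>\<^bsub>?V\<^esub> e x) X"
      by (rule T.finprod_reindex[OF _ inj]) (use e hom_in_carrier[OF rat_smult_hom] in auto)
    finally show ?thesis .
  qed
  have eV: "e ` X \<subseteq> carrier ?V" using e by (auto simp: rationalization_simps)
  have gen: "V.span (e ` X) = carrier ?V"
  proof (intro equalityI subsetI)
    fix v assume "v \<in> carrier ?V"
    then have v: "v \<in> carrier ?T" by (simp add: rationalization_simps)
    \<comment> \<open>The coefficients of a linear combination are indexed by vectors, so the index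
      is recovered from the vector by injectivity of e.\<close>
    have "v = V.lincomb (\<lambda>w. K (inv_into X e w) v) (e ` X)"
      unfolding lc
    proof (subst exp[OF v], rule T.finprod_cong')
      fix x assume x: "x \<in> X"
      show "K x v \<odot>\<^bsub>?V\<^esub> e x = K (inv_into X e (e x)) v \<odot>\<^bsub>?V\<^esub> e x"
        using inv_into_f_f[OF inj x] by simp
    qed (use e hom_in_carrier[OF rat_smult_hom] in auto)
    then show "v \<in> V.span (e ` X)" unfolding V.span_def using fin by auto
  next
    fix v assume "v \<in> V.span (e ` X)"
    then show "v \<in> carrier ?V" using V.span_is_subset2[OF eV] by blast
  qed
  have li: "V.lin_indpt (e ` X)"
  proof (rule V.finite_lin_indpt2)
    fix a assume a: "V.lincomb a (e ` X) = \<zero>\<^bsub>?V\<^esub>"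
    show "\<forall>v\<in>e ` X. a v = \<zero>\<^bsub>rat_field\<^esub>"
    proof
      fix v assume "v \<in> e ` X"
      then obtain x where x: "x \<in> X" "v = e x" by blast
      have "K x (V.lincomb a (e ` X)) = (\<Sum>y\<in>X. K x (a (e y) \<odot>\<^bsub>?V\<^esub> e y))"
        unfolding lc
        by (rule hom_rat_finprod[OF T.comm_group_axioms Kh[OF x(1)]])
          (rule hom_in_carrier[OF rat_smult_hom e])
      also have "\<dots> = (\<Sum>y\<in>X. if y = x then a (e x) else 0)"
        using x(1) by (intro sum.cong) (auto simp: Ks e Ke)
      also have "\<dots> = a v" using x fin by simp
      finally show "a v = \<zero>\<^bsub>rat_field\<^esub>"
        using a hom_one[OF Kh[OF x(1)] T.is_group comm_group.axioms(2)[OF comm_group_rat_group]]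
        by (simp add: rationalization_simps)
    qed
  qed (use fin eV in auto)
  have "V.basis (e ` X)" unfolding V.basis_def using gen li eV by simp
  then have "V.dim = card (e ` X)" using fin by (intro V.dim_basis) auto
  then show "rank_Q M = card X" unfolding rank_Q_def using card_image[OF inj] by simp
  show "V.fin_dim" unfolding V.fin_dim_def using fin eV gen by (intro exI[of _ "e ` X"]) auto
qed

end

section \<open>Submodules, quotients and products of bigraded modules\<close>

lemma bigraded_module_comm: "bigraded_module M \<Longrightarrow> comm_group M"
  and bigraded_module_grade: "bigraded_module M \<Longrightarrow> subgroup (grade M d) M"
  by (simp_all add: bigraded_module_def)

lemma grading_projD:
  assumes "grading_proj M p"
  shows "p d \<in> hom M M" and "x \<in> carrier M \<Longrightarrow> p d x \<in> grade M d"
    and "x \<in> grade M e \<Longrightarrow> p d x = (if d = e then x else \<one>\<^bsub>M\<^esub>)"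
    and "x \<in> carrier M \<Longrightarrow> finite {d. p d x \<noteq> \<one>\<^bsub>M\<^esub>}"
    and "x \<in> carrier M \<Longrightarrow> gfinprod M (\<lambda>d. p d x) UNIV = x"
  using assms unfolding grading_proj_def by blast+

text \<open>The support of a family may shrink under a homomorphism, so products over all bidegrees
  are compared over a common finite set.\<close>

lemma gfinprod_superset:
  assumes M: "comm_group M" and D: "finite D" and f: "\<And>d. f d \<in> carrier M"
    and 1: "\<And>d. d \<notin> D \<Longrightarrow> f d = \<one>\<^bsub>M\<^esub>"
  shows "gfinprod M f UNIV = finprod M f D"
proof -
  interpret comm_group M by (rule M)
  have s: "{d. f d \<noteq> \<one>\<^bsub>M\<^esub>} \<subseteq> D" using 1 by blast
  then have "finite {d. f d \<noteq> \<one>\<^bsub>M\<^esub>}" using D finite_subset by blast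
  then have "gfinprod M f UNIV = finprod M f {d. f d \<noteq> \<one>\<^bsub>M\<^esub>}" by (simp add: gfinprod_def)
  also have "\<dots> = finprod M f D"
    using s D f by (intro finprod_mono_neutral_cong_left) auto
  finally show ?thesis .
qed

lemma grading_proj_decomp:
  assumes M: "comm_group M" and p: "grading_proj M p" and x: "x \<in> carrier M" and D: "finite D"
    and sD: "\<And>d. d \<notin> D \<Longrightarrow> p d x = \<one>\<^bsub>M\<^esub>"
  shows "finprod M (\<lambda>d. p d x) D = x"
proof -
  have "finprod M (\<lambda>d. p d x) D = gfinprod M (\<lambda>d. p d x) UNIV"
    by (rule gfinprod_superset[OF M D _ sD, symmetric]) (rule hom_in_carrier[OF grading_projD(1)[OF p] x])
  then show ?thesis using grading_projD(5)[OF p x] by simp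
qed

text \<open>The images of the components of x are homogeneous and sum to \<open>f x\<close>, so they
  are the components of \<open>f x\<close>.\<close>

lemma bigraded_hom_proj:
  assumes f: "bigraded_hom M N f" and p: "grading_proj M p" and q: "grading_proj N q"
    and x: "x \<in> carrier M"
  shows "q d (f x) = f (p d x)"
proof -
  have bM: "bigraded_module M" and bN: "bigraded_module N" and fh: "f \<in> hom M N"
    and fg: "\<And>d x. x \<in> grade M d \<Longrightarrow> f x \<in> grade N d"
    using f unfolding bigraded_hom_def by blast+
  note M = bigraded_module_comm[OF bM] and N = bigraded_module_comm[OF bN]
  interpret M: comm_group M by (rule M)
  interpret N: comm_group N by (rule N)
  have pc: "p e x \<in> carrier M" for e by (rule hom_in_carrier[OF grading_projD(1)[OF p] x])
  let ?D = "{d. p d x \<noteq> \<one>\<^bsub>M\<^esub>}"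
  have fD: "finite ?D" by (rule grading_projD(4)[OF p x])
  have f1: "f \<one>\<^bsub>M\<^esub> = \<one>\<^bsub>N\<^esub>" by (rule hom_one[OF fh M.is_group N.is_group])
  have out: "f (p e x) = \<one>\<^bsub>N\<^esub>" if "e \<notin> ?D" for e using that f1 by simp
  have "{e. f (p e x) \<noteq> \<one>\<^bsub>N\<^esub>} \<subseteq> ?D" using out by blast
  then have fin: "finite {e. f (p e x) \<noteq> \<one>\<^bsub>N\<^esub>}" using fD finite_subset by blast
  have "f x = f (finprod M (\<lambda>e. p e x) ?D)"
    by (subst grading_proj_decomp[OF M p x fD]) auto
  also have "\<dots> = finprod N (\<lambda>e. f (p e x)) ?D"
    by (rule hom_finprod[OF M N fh]) (rule pc)
  also have "\<dots> = gfinprod N (\<lambda>e. f (p e x)) UNIV"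
    by (rule gfinprod_superset[OF N fD _ out, symmetric]) (rule hom_in_carrier[OF fh pc])
  also have "q d \<dots> = f (p d x)"
    by (rule gfinprod_homog[OF N bigraded_module_grade[OF bN] q _ fin])
      (rule fg[OF grading_projD(2)[OF p x]])
  finally show ?thesis .
qed

section \<open>Submodules stable under the homogeneous projections\<close>

definition submodule_on :: "'a bigraded \<Rightarrow> 'a set \<Rightarrow> 'a bigraded" where
  "submodule_on M S = with_grading (M\<lparr>carrier := S\<rparr>) (\<lambda>d. S \<inter> grade M d)"

lemma submodule_on_simps [simp]:
  "carrier (submodule_on M S) = S" "monoid.mult (submodule_on M S) = monoid.mult M"
  "\<one>\<^bsub>submodule_on M S\<^esub> = \<one>\<^bsub>M\<^esub>" "grade (submodule_on M S) = (\<lambda>d. S \<inter> grade M d)"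
  by (simp_all add: submodule_on_def)

lemma submodule_on_comm:
  assumes "comm_group M" "subgroup S M"
  shows "comm_group (submodule_on M S)"
  unfolding submodule_on_def same_with_grading by (rule comm_group.comm_group_subgroup[OF assms])

lemma submodule_on_incl: "S \<subseteq> carrier M \<Longrightarrow> (\<lambda>x. x) \<in> hom (submodule_on M S) M"
  by (auto simp: hom_def)

lemma submodule_on_subgroup:
  assumes M: "comm_group M" and S: "subgroup S M" and K: "subgroup K M" "K \<subseteq> S"
  shows "subgroup K (submodule_on M S)"
  unfolding submodule_on_def same_with_grading
  by (rule group.subgroup_incl[OF comm_group.axioms(2)[OF M] K(1) S K(2)])

lemma submodule_on_proj:
  assumes b: "bigraded_module M" and p: "grading_proj M p" and S: "subgroup S M"
    and st: "\<And>d x. x \<in> S \<Longrightarrow> p d x \<in> S"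
  shows "grading_proj (submodule_on M S) p"
  unfolding grading_proj_def
proof (intro conjI allI ballI)
  note M = bigraded_module_comm[OF b]
  have SM: "x \<in> carrier M" if "x \<in> S" for x using subgroup.subset[OF S] that by blast
  note cS = submodule_on_comm[OF M S]
  fix d
  show "p d \<in> hom (submodule_on M S) (submodule_on M S)"
    by (rule homI) (use st SM hom_mult[OF grading_projD(1)[OF p]] in auto)
  show "p d x \<in> grade (submodule_on M S) d" if "x \<in> carrier (submodule_on M S)" for x
    using that st SM grading_projD(2)[OF p] by simp
  show "p d x = (if d = e then x else \<one>\<^bsub>submodule_on M S\<^esub>)" if "x \<in> grade (submodule_on M S) e" for e x
  proof -
    have "x \<in> grade M e" using that by simp
    then show ?thesis using grading_projD(3)[OF p, of x e d] by simp
  qed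
  fix x assume "x \<in> carrier (submodule_on M S)"
  then have x: "x \<in> S" by simp
  let ?D = "{d. p d x \<noteq> \<one>\<^bsub>M\<^esub>}"
  have fD: "finite ?D" by (rule grading_projD(4)[OF p SM[OF x]])
  then show "finite {d. p d x \<noteq> \<one>\<^bsub>submodule_on M S\<^esub>}" by simp
  have "gfinprod (submodule_on M S) (\<lambda>d. p d x) UNIV = finprod (submodule_on M S) (\<lambda>d. p d x) ?D"
    by (rule gfinprod_superset[OF cS fD]) (use st x in auto)
  also have "\<dots> = finprod M (\<lambda>d. p d x) ?D"
    by (rule hom_finprod[OF cS M submodule_on_incl]) (use st x SM in auto)
  also have "\<dots> = x" by (rule grading_proj_decomp[OF M p SM[OF x] fD]) simp
  finally show "gfinprod (submodule_on M S) (\<lambda>d. p d x) UNIV = x" .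
qed

lemma bigraded_submodule_on:
  assumes b: "bigraded_module M" and p: "grading_proj M p" and S: "subgroup S M"
    and st: "\<And>d x. x \<in> S \<Longrightarrow> p d x \<in> S"
  shows "bigraded_module (submodule_on M S)"
proof (rule bigraded_moduleI[OF submodule_on_comm[OF bigraded_module_comm[OF b] S] _ submodule_on_proj[OF b p S st]])
  fix d
  have "subgroup (S \<inter> grade M d) M"
    by (rule group.subgroups_Inter_pair[OF comm_group.axioms(2)[OF bigraded_module_comm[OF b]] S bigraded_module_grade[OF b]])
  then show "subgroup (grade (submodule_on M S) d) (submodule_on M S)"
    using submodule_on_subgroup[OF bigraded_module_comm[OF b] S] by simp
qed

section \<open>Quotients by stable subgroups\<close>

definition quotient_by :: "'a bigraded \<Rightarrow> 'a set \<Rightarrow> 'a set bigraded" where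
  "quotient_by M K = with_grading (M Mod K) (\<lambda>d. (\<lambda>z. K #>\<^bsub>M\<^esub> z) ` grade M d)"

text \<open>A union over the coset describes the induced map without a choice of representative; all
  cosets that enter the union coincide. \<open>cohomology_map\<close> has this form.\<close>

lemma coset_map:
  assumes M: "comm_group M" and N: "comm_group N" and K: "subgroup K M" and L: "subgroup L N"
    and f: "f \<in> hom M N" and fK: "\<And>x. x \<in> K \<Longrightarrow> f x \<in> L" and z: "z \<in> carrier M"
  shows "(\<Union>x\<in>K #>\<^bsub>M\<^esub> z. L #>\<^bsub>N\<^esub> f x) = L #>\<^bsub>N\<^esub> f z"
proof -
  interpret M: comm_group M by (rule M)
  interpret N: comm_group N by (rule N)
  interpret K: subgroup K M by (rule K)
  interpret L: subgroup L N by (rule L)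
  have "L #>\<^bsub>N\<^esub> f x = L #>\<^bsub>N\<^esub> f z" if x: "x \<in> K #>\<^bsub>M\<^esub> z" for x
  proof -
    obtain k where k: "k \<in> K" and xk: "x = k \<otimes>\<^bsub>M\<^esub> z" using x unfolding r_coset_def by auto
    have kM: "k \<in> carrier M" using k K.subset by blast
    have fz: "f z \<in> carrier N" and fk: "f k \<in> carrier N" using hom_in_carrier[OF f] z kM by auto
    have "L #>\<^bsub>N\<^esub> f x = (L #>\<^bsub>N\<^esub> f k) #>\<^bsub>N\<^esub> f z"
      unfolding xk hom_mult[OF f kM z] by (rule N.coset_mult_assoc[OF L.subset fk fz, symmetric])
    also have "L #>\<^bsub>N\<^esub> f k = L" by (rule N.coset_join2[OF fk L fK[OF k]])
    finally show ?thesis .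
  qed
  then have "(\<Union>x\<in>K #>\<^bsub>M\<^esub> z. L #>\<^bsub>N\<^esub> f x) = (\<Union>x\<in>K #>\<^bsub>M\<^esub> z. L #>\<^bsub>N\<^esub> f z)"
    by (intro SUP_cong refl)
  also have "\<dots> = L #>\<^bsub>N\<^esub> f z" using M.rcos_self[OF z K] by (simp only: UN_constant split: if_split) blast
  finally show ?thesis .
qed

context
  fixes M :: "'a bigraded" and K :: "'a set"
  assumes M: "comm_group M" and K: "subgroup K M"
begin

interpretation M: comm_group M by (rule M)
interpretation K: normal K M using M.subgroup_imp_normal[OF K] .

lemma quotient_by_simps:
  "carrier (quotient_by M K) = (\<lambda>z. K #>\<^bsub>M\<^esub> z) ` carrier M"
  "\<one>\<^bsub>quotient_by M K\<^esub> = K" "grade (quotient_by M K) d = (\<lambda>z. K #>\<^bsub>M\<^esub> z) ` grade M d"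
  by (simp_all add: quotient_by_def carrier_FactGroup)

lemma quotient_by_comm: "comm_group (quotient_by M K)"
  unfolding quotient_by_def same_with_grading by (rule M.abelian_FactGroup[OF K])

lemma quotient_by_proj: "(\<lambda>z. K #>\<^bsub>M\<^esub> z) \<in> hom M (quotient_by M K)"
  unfolding quotient_by_def hom_with_grading by (rule K.r_coset_hom_Mod)

lemma quotient_by_one:
  assumes z: "z \<in> carrier M"
  shows "K #>\<^bsub>M\<^esub> z = K \<longleftrightarrow> z \<in> K"
proof
  assume "K #>\<^bsub>M\<^esub> z = K"
  then show "z \<in> K" using z M.coset_join1[OF _ _ K] by simp
next
  assume "z \<in> K"
  then show "K #>\<^bsub>M\<^esub> z = K" by (intro M.coset_join2[OF z K])
qed

lemma quotient_by_map:
  assumes T: "group T" and F: "\<And>z. z \<in> carrier M \<Longrightarrow> F (K #>\<^bsub>M\<^esub> z) = f z" and f: "f \<in> hom M T"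
  shows "F \<in> hom (quotient_by M K) T"
proof (rule homI)
  fix X assume "X \<in> carrier (quotient_by M K)"
  then show "F X \<in> carrier T" using F hom_in_carrier[OF f] by (auto simp: quotient_by_simps)
next
  fix X Y assume "X \<in> carrier (quotient_by M K)" "Y \<in> carrier (quotient_by M K)"
  then obtain x y where x: "x \<in> carrier M" "X = K #>\<^bsub>M\<^esub> x" and y: "y \<in> carrier M" "Y = K #>\<^bsub>M\<^esub> y"
    by (auto simp: quotient_by_simps)
  have "X \<otimes>\<^bsub>quotient_by M K\<^esub> Y = K #>\<^bsub>M\<^esub> (x \<otimes>\<^bsub>M\<^esub> y)"
    using hom_mult[OF quotient_by_proj x(1) y(1)] x(2) y(2) by simp
  then show "F (X \<otimes>\<^bsub>quotient_by M K\<^esub> Y) = F X \<otimes>\<^bsub>T\<^esub> F Y"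
    using F x y hom_mult[OF f x(1) y(1)] by simp
qed

end

lemma bigraded_quotient_by:
  assumes b: "bigraded_module M" and p: "grading_proj M p" and K: "subgroup K M"
    and st: "\<And>d x. x \<in> K \<Longrightarrow> p d x \<in> K"
  shows "bigraded_module (quotient_by M K)"
proof -
  note M = bigraded_module_comm[OF b]
  note H = quotient_by_comm[OF M K] and pr = quotient_by_proj[OF M K] and simps = quotient_by_simps[OF M K]
  interpret M: comm_group M by (rule M)
  interpret H: comm_group "quotient_by M K" by (rule H)
  \<comment> \<open>The projections of M descend to the quotient because K is stable under
    them.\<close>
  define q where "q = (\<lambda>d X. \<Union>x\<in>X. K #>\<^bsub>M\<^esub> p d x)"
  have qz: "q d (K #>\<^bsub>M\<^esub> z) = K #>\<^bsub>M\<^esub> p d z" if "z \<in> carrier M" for d z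
    unfolding q_def by (rule coset_map[OF M M K K grading_projD(1)[OF p] st that])
  have gM: "grade M d \<subseteq> carrier M" for d by (rule subgroup.subset[OF bigraded_module_grade[OF b]])
  have one: "K #>\<^bsub>M\<^esub> \<one>\<^bsub>M\<^esub> = K" using quotient_by_one[OF M K, of "\<one>\<^bsub>M\<^esub>"] subgroup.one_closed[OF K] by simp
  show ?thesis
  proof (rule bigraded_moduleI[OF H])
    fix d
    interpret pr: group_hom M "quotient_by M K" "\<lambda>z. K #>\<^bsub>M\<^esub> z" by unfold_locales (rule pr)
    show "subgroup (grade (quotient_by M K) d) (quotient_by M K)"
      unfolding simps by (rule pr.subgroup_img_is_subgroup[OF bigraded_module_grade[OF b]])
  next
    show "grading_proj (quotient_by M K) q"
      unfolding grading_proj_def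
    proof (intro conjI allI ballI)
      fix d
      have "(\<lambda>z. K #>\<^bsub>M\<^esub> p d z) \<in> hom M (quotient_by M K)"
        using hom_compose[OF grading_projD(1)[OF p] pr] by (simp add: comp_def)
      then show "q d \<in> hom (quotient_by M K) (quotient_by M K)"
        by (intro quotient_by_map[OF M K H.is_group, where f = "\<lambda>z. K #>\<^bsub>M\<^esub> p d z"] qz)
      show "q d X \<in> grade (quotient_by M K) d" if X: "X \<in> carrier (quotient_by M K)" for X
      proof -
        obtain z where z: "z \<in> carrier M" "X = K #>\<^bsub>M\<^esub> z" using X by (auto simp: simps)
        show ?thesis
          unfolding z(2) qz[OF z(1)] simps by (rule imageI[OF grading_projD(2)[OF p z(1)]])
      qed
      show "q d X = (if d = e then X else \<one>\<^bsub>quotient_by M K\<^esub>)" if X: "X \<in> grade (quotient_by M K) e" for e X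
      proof -
        obtain z where z: "z \<in> grade M e" "X = K #>\<^bsub>M\<^esub> z" using X by (auto simp: simps)
        show ?thesis using qz[of z d] gM[of e] grading_projD(3)[OF p z(1), of d] z one by (auto simp: simps)
      qed
      fix X assume "X \<in> carrier (quotient_by M K)"
      then obtain z where z: "z \<in> carrier M" "X = K #>\<^bsub>M\<^esub> z" by (auto simp: simps)
      let ?D = "{d. p d z \<noteq> \<one>\<^bsub>M\<^esub>}"
      have fD: "finite ?D" by (rule grading_projD(4)[OF p z(1)])
      have pc: "p e z \<in> carrier M" for e by (rule hom_in_carrier[OF grading_projD(1)[OF p] z(1)])
      have out: "q e X = \<one>\<^bsub>quotient_by M K\<^esub>" if "e \<notin> ?D" for e
        using that qz[OF z(1), of e] one z(2) by (simp add: simps)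
      have "{d. q d X \<noteq> \<one>\<^bsub>quotient_by M K\<^esub>} \<subseteq> ?D" using out by blast
      then show "finite {d. q d X \<noteq> \<one>\<^bsub>quotient_by M K\<^esub>}" using fD finite_subset by blast
      have qe: "q e X = K #>\<^bsub>M\<^esub> p e z" for e using qz[OF z(1)] z(2) by simp
      have "gfinprod (quotient_by M K) (\<lambda>d. q d X) UNIV = finprod (quotient_by M K) (\<lambda>d. q d X) ?D"
        by (rule gfinprod_superset[OF H fD _ out]) (use qe pc simps in auto)
      also have "\<dots> = finprod (quotient_by M K) (\<lambda>d. K #>\<^bsub>M\<^esub> p d z) ?D" unfolding qe by (rule refl)
      also have "\<dots> = K #>\<^bsub>M\<^esub> finprod M (\<lambda>d. p d z) ?D"
        by (rule hom_finprod[OF M H pr, symmetric]) (rule pc)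
      also have "\<dots> = X" using grading_proj_decomp[OF M p z(1) fD] z(2) by simp
      finally show "gfinprod (quotient_by M K) (\<lambda>d. q d X) UNIV = X" .
    qed
  qed
qed

section \<open>Products, kernels and retracts\<close>

lemma bigraded_prod_simps [simp]:
  "carrier (bigraded_prod M N) = carrier M \<times> carrier N"
  "x \<otimes>\<^bsub>bigraded_prod M N\<^esub> y = (fst x \<otimes>\<^bsub>M\<^esub> fst y, snd x \<otimes>\<^bsub>N\<^esub> snd y)"
  "\<one>\<^bsub>bigraded_prod M N\<^esub> = (\<one>\<^bsub>M\<^esub>, \<one>\<^bsub>N\<^esub>)"
  "grade (bigraded_prod M N) d = grade M d \<times> grade N d"
  by (simp_all add: bigraded_prod_def DirProd_def case_prod_beta)

lemma comm_group_bigraded_prod: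
  assumes M: "comm_group M" and N: "comm_group N"
  shows "comm_group (bigraded_prod M N)"
proof -
  have "group (M \<times>\<times> N)" by (rule DirProd_group) (use M N in \<open>auto dest: comm_group.axioms(2)\<close>)
  then have "group (bigraded_prod M N)" by (simp add: bigraded_prod_def)
  then show ?thesis
  proof (rule group.group_comm_groupI)
    fix x y assume "x \<in> carrier (bigraded_prod M N)" "y \<in> carrier (bigraded_prod M N)"
    then show "x \<otimes>\<^bsub>bigraded_prod M N\<^esub> y = y \<otimes>\<^bsub>bigraded_prod M N\<^esub> x"
      using comm_groupE(4)[OF M] comm_groupE(4)[OF N] by (auto simp: mem_Times_iff)
  qed
qed

lemma bigraded_prod_module:
  assumes bM: "bigraded_module M" and bN: "bigraded_module N"
  shows "bigraded_module (bigraded_prod M N)"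
proof -
  note M = bigraded_module_comm[OF bM] and N = bigraded_module_comm[OF bN]
  let ?P = "bigraded_prod M N"
  note P = comm_group_bigraded_prod[OF M N]
  interpret M: comm_group M by (rule M)
  interpret N: comm_group N by (rule N)
  interpret P: comm_group ?P by (rule P)
  obtain p where p: "grading_proj M p" by (rule bigraded_module_proj[OF bM])
  obtain q where q: "grading_proj N q" by (rule bigraded_module_proj[OF bN])
  have h: "fst \<in> hom ?P M" "snd \<in> hom ?P N" by (auto simp: hom_def)
  have pc: "p e x \<in> carrier M" if "x \<in> carrier M" for e x by (rule hom_in_carrier[OF grading_projD(1)[OF p] that])
  have qc: "q e x \<in> carrier N" if "x \<in> carrier N" for e x by (rule hom_in_carrier[OF grading_projD(1)[OF q] that])
  show ?thesis
  proof (rule bigraded_moduleI[OF P, where p = "\<lambda>d. map_prod (p d) (q d)"])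
    fix d
    have "subgroup (grade M d \<times> grade N d) (M \<times>\<times> N)"
      by (rule DirProd_subgroups[OF M.is_group bigraded_module_grade[OF bM] N.is_group bigraded_module_grade[OF bN]])
    then show "subgroup (grade ?P d) ?P" by (simp add: bigraded_prod_def)
  next
    show "grading_proj ?P (\<lambda>d. map_prod (p d) (q d))"
      unfolding grading_proj_def
    proof (intro conjI allI ballI)
      fix d
      show "map_prod (p d) (q d) \<in> hom ?P ?P"
        by (rule homI)
          (auto simp: pc qc mem_Times_iff hom_mult[OF grading_projD(1)[OF p]] hom_mult[OF grading_projD(1)[OF q]])
      show "map_prod (p d) (q d) x \<in> grade ?P d" if "x \<in> carrier ?P" for x
        using that grading_projD(2)[OF p, of "fst x" d] grading_projD(2)[OF q, of "snd x" d]
        by (cases x) simp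
      show "map_prod (p d) (q d) x = (if d = e then x else \<one>\<^bsub>?P\<^esub>)" if "x \<in> grade ?P e" for e x
        using that grading_projD(3)[OF p, of "fst x" e d] grading_projD(3)[OF q, of "snd x" e d]
        by (cases x) auto
      fix x assume x: "x \<in> carrier ?P"
      then have x1: "fst x \<in> carrier M" and x2: "snd x \<in> carrier N" by auto
      let ?D = "{d. p d (fst x) \<noteq> \<one>\<^bsub>M\<^esub>} \<union> {d. q d (snd x) \<noteq> \<one>\<^bsub>N\<^esub>}"
      have fD: "finite ?D" using grading_projD(4)[OF p x1] grading_projD(4)[OF q x2] by simp
      have out: "map_prod (p e) (q e) x = \<one>\<^bsub>?P\<^esub>" if "e \<notin> ?D" for e using that by (cases x) auto
      have "{d. map_prod (p d) (q d) x \<noteq> \<one>\<^bsub>?P\<^esub>} \<subseteq> ?D" using out by blast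
      then show "finite {d. map_prod (p d) (q d) x \<noteq> \<one>\<^bsub>?P\<^esub>}" using fD finite_subset by blast
      have mc: "map_prod (p e) (q e) x \<in> carrier ?P" for e using pc[OF x1] qc[OF x2] by (cases x) auto
      have e: "gfinprod ?P (\<lambda>d. map_prod (p d) (q d) x) UNIV = finprod ?P (\<lambda>d. map_prod (p d) (q d) x) ?D"
        by (rule gfinprod_superset[OF P fD mc out])
      have "fst (finprod ?P (\<lambda>d. map_prod (p d) (q d) x) ?D) = finprod M (\<lambda>d. p d (fst x)) ?D"
        by (subst hom_finprod[OF P M h(1) mc]) (simp add: map_prod_def split_beta)
      moreover have "finprod M (\<lambda>d. p d (fst x)) ?D = fst x"
        by (rule grading_proj_decomp[OF M p x1 fD]) auto
      moreover have "snd (finprod ?P (\<lambda>d. map_prod (p d) (q d) x) ?D) = finprod N (\<lambda>d. q d (snd x)) ?D"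
        by (subst hom_finprod[OF P N h(2) mc]) (simp add: map_prod_def split_beta)
      moreover have "finprod N (\<lambda>d. q d (snd x)) ?D = snd x"
        by (rule grading_proj_decomp[OF N q x2 fD]) auto
      ultimately show "gfinprod ?P (\<lambda>d. map_prod (p d) (q d) x) UNIV = x"
        unfolding e by (simp add: prod_eq_iff)
    qed
  qed
qed

lemma bigraded_isoI:
  assumes f: "bigraded_hom M N f" and g: "bigraded_hom N M g"
    and gf: "\<And>x. x \<in> carrier M \<Longrightarrow> g (f x) = x" and fg: "\<And>y. y \<in> carrier N \<Longrightarrow> f (g y) = y"
  shows "bigraded_iso M N f"
proof -
  have bM: "bigraded_module M" and bN: "bigraded_module N" and fh: "f \<in> hom M N" and gh: "g \<in> hom N M"
    and fd: "\<And>d. f ` grade M d \<subseteq> grade N d" and gd: "\<And>d. g ` grade N d \<subseteq> grade M d"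
    using f g unfolding bigraded_hom_def by blast+
  have "bij_betw f (carrier M) (carrier N)"
    by (rule bij_betw_byWitness[where f' = g]) (use gf fg hom_carrier[OF fh] hom_carrier[OF gh] in auto)
  moreover have "f ` grade M d = grade N d" for d
  proof (intro equalityI fd subsetI)
    fix y assume y: "y \<in> grade N d"
    then have "y = f (g y)" using fg[of y] subsetD[OF subgroup.subset[OF bigraded_module_grade[OF bN]] y] by simp
    moreover have "g y \<in> grade M d" using gd y by blast
    ultimately show "y \<in> f ` grade M d" by (rule image_eqI)
  qed
  ultimately show ?thesis using bM bN fh unfolding bigraded_iso_def iso_def by blast
qed

text \<open>Graded maps commute with the projections, so the components of a kernel element are
  mapped to components of the neutral element.\<close>

lemma kernel_proj_stable:
  assumes g: "bigraded_hom N M g" and q: "grading_proj N q" and x: "x \<in> kernel N M g"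
  shows "q d x \<in> kernel N M g"
proof -
  have bM: "bigraded_module M" using g by (simp add: bigraded_hom_def)
  obtain p where p: "grading_proj M p" by (rule bigraded_module_proj[OF bM])
  note M = bigraded_module_comm[OF bM]
  have x': "x \<in> carrier N" "g x = \<one>\<^bsub>M\<^esub>" using x by (auto simp: kernel_def)
  have "g (q d x) = p d (g x)" by (rule bigraded_hom_proj[OF g q p x'(1), symmetric])
  also have "\<dots> = \<one>\<^bsub>M\<^esub>"
    unfolding x'(2) by (rule hom_one[OF grading_projD(1)[OF p] comm_group.axioms(2)[OF M] comm_group.axioms(2)[OF M]])
  finally show ?thesis using hom_in_carrier[OF grading_projD(1)[OF q] x'(1)] by (simp add: kernel_def)
qed

lemma bigraded_kernel:
  assumes g: "bigraded_hom N M g"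
  shows "bigraded_module (submodule_on N (kernel N M g))"
proof -
  have bM: "bigraded_module M" and bN: "bigraded_module N" and gh: "g \<in> hom N M"
    using g unfolding bigraded_hom_def by blast+
  obtain q where q: "grading_proj N q" by (rule bigraded_module_proj[OF bN])
  interpret M: comm_group M by (rule bigraded_module_comm[OF bM])
  interpret N: comm_group N by (rule bigraded_module_comm[OF bN])
  interpret g: group_hom N M g by unfold_locales (rule gh)
  show ?thesis
    by (rule bigraded_submodule_on[OF bN q g.subgroup_kernel]) (rule kernel_proj_stable[OF g q])
qed

text \<open>The inverse splits y into \<open>g y\<close> and the difference between y and
  \<open>f (g y)\<close>, which g annihilates because it undoes f. Both pieces depend additively on
  y and keep its degree.\<close>

lemma retract_iso:
  assumes f: "bigraded_hom M N f" and g: "bigraded_hom N M g"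
    and gf: "\<And>x. x \<in> carrier M \<Longrightarrow> g (f x) = x"
  shows "bigraded_iso (bigraded_prod M (submodule_on N (kernel N M g))) N (\<lambda>(x, y). f x \<otimes>\<^bsub>N\<^esub> y)"
proof -
  have bM: "bigraded_module M" and bN: "bigraded_module N" and fh: "f \<in> hom M N" and gh: "g \<in> hom N M"
    and fd: "\<And>d x. x \<in> grade M d \<Longrightarrow> f x \<in> grade N d" and gd: "\<And>d x. x \<in> grade N d \<Longrightarrow> g x \<in> grade M d"
    using f g unfolding bigraded_hom_def by blast+
  interpret M: comm_group M by (rule bigraded_module_comm[OF bM])
  interpret N: comm_group N by (rule bigraded_module_comm[OF bN])
  interpret f: group_hom M N f by unfold_locales (rule fh)
  interpret g: group_hom N M g by unfold_locales (rule gh)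
  let ?K = "submodule_on N (kernel N M g)" and ?h = "\<lambda>(x, y). f x \<otimes>\<^bsub>N\<^esub> y"
  let ?k = "\<lambda>y. (g y, y \<otimes>\<^bsub>N\<^esub> inv\<^bsub>N\<^esub> f (g y))"
  have bK: "bigraded_module ?K" by (rule bigraded_kernel[OF g])
  have bP: "bigraded_module (bigraded_prod M ?K)" by (rule bigraded_prod_module[OF bM bK])
  have gr: "x \<in> carrier M" if "x \<in> grade M d" for x d
    using subgroup.subset[OF bigraded_module_grade[OF bM]] that by blast
  have gr': "x \<in> carrier N" if "x \<in> grade N d" for x d
    using subgroup.subset[OF bigraded_module_grade[OF bN]] that by blast
  have kc: "y \<otimes>\<^bsub>N\<^esub> inv\<^bsub>N\<^esub> f (g y) \<in> kernel N M g" if "y \<in> carrier N" for y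
    using that by (simp add: kernel_def gf)
  have exch: "(w \<otimes>\<^bsub>N\<^esub> x) \<otimes>\<^bsub>N\<^esub> (y \<otimes>\<^bsub>N\<^esub> z) = (w \<otimes>\<^bsub>N\<^esub> y) \<otimes>\<^bsub>N\<^esub> (x \<otimes>\<^bsub>N\<^esub> z)"
    if "w \<in> carrier N" "x \<in> carrier N" "y \<in> carrier N" "z \<in> carrier N" for w x y z
    using that by (simp add: N.m_assoc N.m_lcomm)
  show ?thesis
  proof (rule bigraded_isoI)
    show "bigraded_hom (bigraded_prod M ?K) N ?h"
      unfolding bigraded_hom_def
    proof (intro conjI allI bP bN)
      show "?h \<in> hom (bigraded_prod M ?K) N"
      proof (rule homI)
        fix x y assume "x \<in> carrier (bigraded_prod M ?K)" "y \<in> carrier (bigraded_prod M ?K)"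
        then obtain a b a' b' where x: "x = (a, b)" "a \<in> carrier M" "b \<in> carrier N"
          and y: "y = (a', b')" "a' \<in> carrier M" "b' \<in> carrier N"
          by (cases x, cases y) (simp add: kernel_def)
        show "?h x \<in> carrier N" using x by simp
        show "?h (x \<otimes>\<^bsub>bigraded_prod M ?K\<^esub> y) = ?h x \<otimes>\<^bsub>N\<^esub> ?h y"
          using x y exch[of "f a" "f a'" b b'] by simp
      qed
      show "?h ` grade (bigraded_prod M ?K) d \<subseteq> grade N d" for d
      proof (rule image_subsetI)
        fix x assume "x \<in> grade (bigraded_prod M ?K) d"
        then obtain a b where x: "x = (a, b)" "a \<in> grade M d" "b \<in> grade N d" by (cases x) simp
        show "?h x \<in> grade N d"
          using subgroup.m_closed[OF bigraded_module_grade[OF bN] fd[OF x(2)] x(3)] x(1) by simp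
      qed
    qed
    show "bigraded_hom N (bigraded_prod M ?K) ?k"
      unfolding bigraded_hom_def
    proof (intro conjI allI bP bN)
      show "?k \<in> hom N (bigraded_prod M ?K)"
      proof (rule homI)
        fix x y assume x: "x \<in> carrier N" and y: "y \<in> carrier N"
        show "?k x \<in> carrier (bigraded_prod M ?K)" using x kc[OF x] by simp
        show "?k (x \<otimes>\<^bsub>N\<^esub> y) = ?k x \<otimes>\<^bsub>bigraded_prod M ?K\<^esub> ?k y"
          using x y exch[of x y "inv\<^bsub>N\<^esub> f (g x)" "inv\<^bsub>N\<^esub> f (g y)"] by (simp add: N.inv_mult)
      qed
      show "?k ` grade N d \<subseteq> grade (bigraded_prod M ?K) d" for d
      proof (rule image_subsetI)
        fix y assume y: "y \<in> grade N d"
        interpret G: subgroup "grade N d" N by (rule bigraded_module_grade[OF bN])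
        show "?k y \<in> grade (bigraded_prod M ?K) d"
          using kc[OF gr'[OF y]] gd[OF y] G.m_closed[OF y G.m_inv_closed[OF fd[OF gd[OF y]]]] by simp
      qed
    qed
    show "?k (?h x) = x" if xP: "x \<in> carrier (bigraded_prod M ?K)" for x
    proof -
      obtain a b where x: "x = (a, b)" "a \<in> carrier M" "b \<in> carrier N" "g b = \<one>\<^bsub>M\<^esub>"
        using xP by (cases x) (simp add: kernel_def)
      have "f a \<otimes>\<^bsub>N\<^esub> b \<otimes>\<^bsub>N\<^esub> inv\<^bsub>N\<^esub> f a = b \<otimes>\<^bsub>N\<^esub> (f a \<otimes>\<^bsub>N\<^esub> inv\<^bsub>N\<^esub> f a)"
        using x N.m_comm[of "f a" b] N.m_assoc[of b "f a" "inv\<^bsub>N\<^esub> f a"] by simp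
      then show ?thesis using x gf[OF x(2)] by simp
    qed
    show "?h (?k y) = y" if y: "y \<in> carrier N" for y
    proof -
      have "f (g y) \<otimes>\<^bsub>N\<^esub> (y \<otimes>\<^bsub>N\<^esub> inv\<^bsub>N\<^esub> f (g y)) = y \<otimes>\<^bsub>N\<^esub> (f (g y) \<otimes>\<^bsub>N\<^esub> inv\<^bsub>N\<^esub> f (g y))"
        using y by (intro N.m_lcomm) auto
      then show ?thesis using y by simp
    qed
  qed
qed

lemma direct_summandI:
  assumes f: "bigraded_hom M N f" and g: "bigraded_hom N M g"
    and gf: "\<And>x. x \<in> carrier M \<Longrightarrow> g (f x) = x"
  shows "direct_summand M N"
  unfolding direct_summand_def bigraded_isomorphic_def
  using bigraded_kernel[OF g] retract_iso[OF f g gf] by blast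

section \<open>Cochain complexes\<close>

lemma bigraded_homD:
  assumes "bigraded_hom M N f"
  shows "bigraded_module M" "bigraded_module N" "f \<in> hom M N" "x \<in> grade M d \<Longrightarrow> f x \<in> grade N d"
  using assms unfolding bigraded_hom_def by auto

lemma bigraded_hom_closed: "bigraded_hom M N f \<Longrightarrow> x \<in> carrier M \<Longrightarrow> f x \<in> carrier N"
  by (rule hom_in_carrier[OF bigraded_homD(3)])

lemma bigraded_hom_one:
  assumes "bigraded_hom M N f" shows "f \<one>\<^bsub>M\<^esub> = \<one>\<^bsub>N\<^esub>"
  by (rule hom_one[OF bigraded_homD(3)[OF assms] comm_group.axioms(2)[OF bigraded_module_comm[OF
    bigraded_homD(1)[OF assms]]] comm_group.axioms(2)[OF bigraded_module_comm[OF bigraded_homD(2)[OF assms]]]])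

lemma cochain_complexD:
  assumes "cochain_complex C"
  shows "bigraded_hom (obj C i) (obj C (Suc i)) (diff C i)"
    and "x \<in> carrier (obj C i) \<Longrightarrow> diff C (Suc i) (diff C i x) = \<one>\<^bsub>obj C (Suc (Suc i))\<^esub>"
    and "bigraded_module (obj C i)" and "comm_group (obj C i)"
proof -
  show h: "bigraded_hom (obj C i) (obj C (Suc i)) (diff C i)"
    and "x \<in> carrier (obj C i) \<Longrightarrow> diff C (Suc i) (diff C i x) = \<one>\<^bsub>obj C (Suc (Suc i))\<^esub>"
    using assms unfolding cochain_complex_def by auto
  show "bigraded_module (obj C i)" by (rule bigraded_homD(1)[OF h])
  then show "comm_group (obj C i)" by (rule bigraded_module_comm)
qed

lemma chain_mapD:
  assumes "chain_map C D f"
  shows "cochain_complex C" "cochain_complex D" "bigraded_hom (obj C i) (obj D i) (f i)"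
    and "x \<in> carrier (obj C i) \<Longrightarrow> f (Suc i) (diff C i x) = diff D i (f i x)"
  using assms unfolding chain_map_def by auto

lemma r_coset_submodule_on: "K #>\<^bsub>submodule_on M S\<^esub> z = K #>\<^bsub>M\<^esub> z"
  by (simp add: r_coset_def)

text \<open>Exhibits cohomology as a quotient of a graded submodule, from which its grading and the
  maps out of it are inherited.\<close>

lemma cohomology_eq:
  assumes "subgroup (coboundaries C i) (obj C i)"
  shows "cohomology C i = quotient_by (submodule_on (obj C i) (cocycles C i)) (coboundaries C i)"
  unfolding cohomology_def quotient_by_def submodule_on_def with_grading_def FactGroup_def
    RCOSETS_def r_coset_def set_mult_def by simp

context
  fixes C :: "'a complex_data" and i :: nat
  assumes C: "cochain_complex C"
begin

lemma cocycles_subgroup: "subgroup (cocycles C i) (obj C i)"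
proof -
  interpret M: comm_group "obj C i" by (rule cochain_complexD[OF C])
  interpret N: comm_group "obj C (Suc i)" by (rule cochain_complexD[OF C])
  interpret g: group_hom "obj C i" "obj C (Suc i)" "diff C i"
    by unfold_locales (rule bigraded_homD(3)[OF cochain_complexD(1)[OF C]])
  show ?thesis unfolding cocycles_def by (rule g.subgroup_kernel)
qed

lemma coboundaries_subgroup: "subgroup (coboundaries C i) (obj C i)"
proof (cases i)
  case 0
  interpret M: comm_group "obj C 0" by (rule cochain_complexD[OF C])
  show ?thesis unfolding 0 coboundaries_def by (simp add: M.triv_subgroup)
next
  case (Suc j)
  interpret M: comm_group "obj C j" by (rule cochain_complexD[OF C])
  interpret N: comm_group "obj C (Suc j)" by (rule cochain_complexD[OF C])
  interpret g: group_hom "obj C j" "obj C (Suc j)" "diff C j"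
    by unfold_locales (rule bigraded_homD(3)[OF cochain_complexD(1)[OF C]])
  show ?thesis unfolding Suc coboundaries_def by (simp add: g.img_is_subgroup)
qed

lemma coboundaries_cocycles: "coboundaries C i \<subseteq> cocycles C i"
proof (cases i)
  case 0
  interpret M: comm_group "obj C 0" by (rule cochain_complexD[OF C])
  show ?thesis
    using bigraded_hom_one[OF cochain_complexD(1)[OF C, of 0]]
    unfolding 0 coboundaries_def cocycles_def kernel_def by simp
next
  case (Suc j)
  show ?thesis
    unfolding Suc coboundaries_def cocycles_def kernel_def
    using cochain_complexD(2)[OF C] bigraded_hom_closed[OF cochain_complexD(1)[OF C, of j]] by auto
qed

text \<open>The differential commutes with the projections, so a component of a coboundary is the
  coboundary of a component. This is what lets the grading descend to cohomology.\<close>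

lemma coboundaries_proj:
  assumes p: "grading_proj (obj C i) p" and x: "x \<in> coboundaries C i"
  shows "p d x \<in> coboundaries C i"
proof (cases i)
  case 0
  interpret M: comm_group "obj C 0" by (rule cochain_complexD[OF C])
  have "p d \<one>\<^bsub>obj C 0\<^esub> = \<one>\<^bsub>obj C 0\<^esub>"
    using hom_one[OF grading_projD(1)[OF p] ] M.is_group unfolding 0 by simp
  then show ?thesis using x unfolding 0 coboundaries_def by simp
next
  case (Suc j)
  obtain y where y: "y \<in> carrier (obj C j)" "x = diff C j y" using x unfolding Suc coboundaries_def by auto
  obtain q where q: "grading_proj (obj C j) q" by (rule bigraded_module_proj[OF cochain_complexD(3)[OF C]])
  have "p d x = diff C j (q d y)"
    unfolding y(2) by (rule bigraded_hom_proj[OF cochain_complexD(1)[OF C] q p[unfolded Suc] y(1)])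
  then show ?thesis
    using hom_in_carrier[OF grading_projD(1)[OF q] y(1)] unfolding Suc coboundaries_def by simp
qed

lemma cohomology_quotient:
  "cohomology C i = quotient_by (submodule_on (obj C i) (cocycles C i)) (coboundaries C i)"
  by (rule cohomology_eq[OF coboundaries_subgroup])

lemma cocycles_submodule: "bigraded_module (submodule_on (obj C i) (cocycles C i))"
  unfolding cocycles_def by (rule bigraded_kernel[OF cochain_complexD(1)[OF C]])

lemma coboundaries_subgroup_cocycles:
  "subgroup (coboundaries C i) (submodule_on (obj C i) (cocycles C i))"
  by (rule submodule_on_subgroup[OF cochain_complexD(4)[OF C] cocycles_subgroup coboundaries_subgroup
    coboundaries_cocycles])

lemma bigraded_cohomology: "bigraded_module (cohomology C i)"
proof -
  obtain p where p: "grading_proj (obj C i) p" by (rule bigraded_module_proj[OF cochain_complexD(3)[OF C]])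
  have st: "p d x \<in> cocycles C i" if "x \<in> cocycles C i" for d x
    unfolding cocycles_def
    by (rule kernel_proj_stable[OF cochain_complexD(1)[OF C] p that[unfolded cocycles_def]])
  show ?thesis
    unfolding cohomology_quotient
    by (rule bigraded_quotient_by[OF cocycles_submodule submodule_on_proj[OF cochain_complexD(3)[OF C] p
        cocycles_subgroup st] coboundaries_subgroup_cocycles coboundaries_proj[OF p]])
qed

lemma carrier_cohomology:
  "carrier (cohomology C i) = (\<lambda>z. coboundaries C i #>\<^bsub>obj C i\<^esub> z) ` cocycles C i"
  unfolding cohomology_quotient
    quotient_by_simps[OF bigraded_module_comm[OF cocycles_submodule] coboundaries_subgroup_cocycles]
  by (simp add: r_coset_submodule_on)

lemma grade_cohomology:
  "grade (cohomology C i) d = (\<lambda>z. coboundaries C i #>\<^bsub>obj C i\<^esub> z) ` (cocycles C i \<inter> grade (obj C i) d)"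
  by (simp add: cohomology_def)

lemma cohomology_proj:
  "(\<lambda>z. coboundaries C i #>\<^bsub>obj C i\<^esub> z) \<in> hom (submodule_on (obj C i) (cocycles C i)) (cohomology C i)"
  using quotient_by_proj[OF bigraded_module_comm[OF cocycles_submodule] coboundaries_subgroup_cocycles]
  unfolding cohomology_quotient r_coset_submodule_on .

lemma cohomology_one: "\<one>\<^bsub>cohomology C i\<^esub> = coboundaries C i"
  by (simp add: cohomology_def FactGroup_def)

lemma coset_eq_coboundaries:
  "z \<in> cocycles C i \<Longrightarrow> coboundaries C i #>\<^bsub>obj C i\<^esub> z = coboundaries C i \<longleftrightarrow> z \<in> coboundaries C i"
  using quotient_by_one[OF bigraded_module_comm[OF cocycles_submodule] coboundaries_subgroup_cocycles, of z]
  unfolding r_coset_submodule_on by simp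

end

section \<open>Maps induced on cohomology\<close>

context
  fixes C :: "'a complex_data" and D :: "'b complex_data" and f
  assumes f: "chain_map C D f"
begin

lemma chain_map_cocycles: "z \<in> cocycles C i \<Longrightarrow> f i z \<in> cocycles D i"
  unfolding cocycles_def kernel_def
  using chain_mapD(4)[OF f, of z i] bigraded_hom_one[OF chain_mapD(3)[OF f, of "Suc i"]]
    bigraded_hom_closed[OF chain_mapD(3)[OF f, of i]] by simp

lemma chain_map_coboundaries: "z \<in> coboundaries C i \<Longrightarrow> f i z \<in> coboundaries D i"
proof (cases i)
  case 0
  then show "z \<in> coboundaries C i \<Longrightarrow> f i z \<in> coboundaries D i"
    using bigraded_hom_one[OF chain_mapD(3)[OF f, of 0]] by (simp add: coboundaries_def)
next
  case (Suc j)
  then show "z \<in> coboundaries C i \<Longrightarrow> f i z \<in> coboundaries D i"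
    using chain_mapD(4)[OF f, of _ j] bigraded_hom_closed[OF chain_mapD(3)[OF f, of j]]
    by (auto simp: coboundaries_def)
qed

lemma cohomology_map_coset:
  assumes z: "z \<in> cocycles C i"
  shows "cohomology_map C D f i (coboundaries C i #>\<^bsub>obj C i\<^esub> z) = coboundaries D i #>\<^bsub>obj D i\<^esub> f i z"
proof -
  note C = chain_mapD(1)[OF f] and D = chain_mapD(2)[OF f]
  have "coboundaries C i #>\<^bsub>obj C i\<^esub> z \<in> carrier (cohomology C i)"
    unfolding carrier_cohomology[OF C] by (rule imageI[OF z])
  then have "cohomology_map C D f i (coboundaries C i #>\<^bsub>obj C i\<^esub> z) =
      (\<Union>x\<in>coboundaries C i #>\<^bsub>obj C i\<^esub> z. coboundaries D i #>\<^bsub>obj D i\<^esub> f i x)"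
    unfolding cohomology_map_def by (rule restrict_apply')
  also have "\<dots> = coboundaries D i #>\<^bsub>obj D i\<^esub> f i z"
    by (rule coset_map[OF cochain_complexD(4)[OF C] cochain_complexD(4)[OF D] coboundaries_subgroup[OF C]
        coboundaries_subgroup[OF D] bigraded_homD(3)[OF chain_mapD(3)[OF f]] chain_map_coboundaries
        subsetD[OF subgroup.subset[OF cocycles_subgroup[OF C]] z]])
  finally show ?thesis .
qed

lemma bigraded_hom_cohomology_map:
  "bigraded_hom (cohomology C i) (cohomology D i) (cohomology_map C D f i)"
proof -
  note C = chain_mapD(1)[OF f] and D = chain_mapD(2)[OF f]
  have "f i \<in> hom (submodule_on (obj C i) (cocycles C i)) (submodule_on (obj D i) (cocycles D i))"
  proof (rule homI)
    fix x y assume "x \<in> carrier (submodule_on (obj C i) (cocycles C i))"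
      "y \<in> carrier (submodule_on (obj C i) (cocycles C i))"
    then have xy: "x \<in> carrier (obj C i)" "y \<in> carrier (obj C i)"
      using subgroup.subset[OF cocycles_subgroup[OF C, of i]] by auto
    show "f i (x \<otimes>\<^bsub>submodule_on (obj C i) (cocycles C i)\<^esub> y) =
        f i x \<otimes>\<^bsub>submodule_on (obj D i) (cocycles D i)\<^esub> f i y"
      using hom_mult[OF bigraded_homD(3)[OF chain_mapD(3)[OF f, of i]] xy] by simp
  qed (simp add: chain_map_cocycles)
  from hom_compose[OF this cohomology_proj[OF D]]
  have "(\<lambda>z. coboundaries D i #>\<^bsub>obj D i\<^esub> f i z) \<in> hom (submodule_on (obj C i) (cocycles C i)) (cohomology D i)"
    by (simp add: comp_def)
  then have h: "cohomology_map C D f i \<in> hom (cohomology C i) (cohomology D i)"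
    unfolding cohomology_quotient[OF C]
    by (intro quotient_by_map[OF bigraded_module_comm[OF cocycles_submodule[OF C]]
          coboundaries_subgroup_cocycles[OF C] comm_group.axioms(2)[OF bigraded_module_comm[OF bigraded_cohomology[OF D]]],
          where f = "\<lambda>z. coboundaries D i #>\<^bsub>obj D i\<^esub> f i z"])
      (simp_all add: r_coset_submodule_on cohomology_map_coset)
  have "cohomology_map C D f i ` grade (cohomology C i) d \<subseteq> grade (cohomology D i) d" for d
  proof (rule image_subsetI)
    fix X assume "X \<in> grade (cohomology C i) d"
    then obtain z where z: "z \<in> cocycles C i" "z \<in> grade (obj C i) d" "X = coboundaries C i #>\<^bsub>obj C i\<^esub> z"
      unfolding grade_cohomology[OF C] by auto
    show "cohomology_map C D f i X \<in> grade (cohomology D i) d"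
      unfolding z(3) cohomology_map_coset[OF z(1)] grade_cohomology[OF D]
      by (intro imageI IntI chain_map_cocycles[OF z(1)] bigraded_homD(4)[OF chain_mapD(3)[OF f] z(2)])
  qed
  then show ?thesis
    unfolding bigraded_hom_def using h bigraded_cohomology[OF C] bigraded_cohomology[OF D] by simp
qed

text \<open>The induced maps act on representatives, and g after f returns the representing cocycle
  itself.\<close>

lemma cohomology_map_retract:
  assumes g: "chain_map D C g" and gf: "\<And>x. x \<in> carrier (obj C i) \<Longrightarrow> g i (f i x) = x"
    and X: "X \<in> carrier (cohomology C i)"
  shows "cohomology_map D C g i (cohomology_map C D f i X) = X"
proof -
  note C = chain_mapD(1)[OF f] and D = chain_mapD(2)[OF f]
  obtain z where z: "z \<in> cocycles C i" "X = coboundaries C i #>\<^bsub>obj C i\<^esub> z"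
    using X unfolding carrier_cohomology[OF C] by auto
  have "z \<in> carrier (obj C i)" using z(1) subgroup.subset[OF cocycles_subgroup[OF C]] by auto
  then have e: "g i (f i z) = z" by (rule gf)
  have "cohomology_map D C g i (coboundaries D i #>\<^bsub>obj D i\<^esub> f i z) = coboundaries C i #>\<^bsub>obj C i\<^esub> g i (f i z)"
  proof -
    have "coboundaries D i #>\<^bsub>obj D i\<^esub> f i z \<in> carrier (cohomology D i)"
      unfolding carrier_cohomology[OF D] by (rule imageI[OF chain_map_cocycles[OF z(1)]])
    then have "cohomology_map D C g i (coboundaries D i #>\<^bsub>obj D i\<^esub> f i z) =
        (\<Union>x\<in>coboundaries D i #>\<^bsub>obj D i\<^esub> f i z. coboundaries C i #>\<^bsub>obj C i\<^esub> g i x)"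
      unfolding cohomology_map_def by (rule restrict_apply')
    also have "\<dots> = coboundaries C i #>\<^bsub>obj C i\<^esub> g i (f i z)"
    proof (rule coset_map[OF cochain_complexD(4)[OF D] cochain_complexD(4)[OF C] coboundaries_subgroup[OF D]
        coboundaries_subgroup[OF C] bigraded_homD(3)[OF chain_mapD(3)[OF g]]])
      show "f i z \<in> carrier (obj D i)"
        using chain_map_cocycles[OF z(1)] subgroup.subset[OF cocycles_subgroup[OF D]] by auto
      fix x assume "x \<in> coboundaries D i"
      then show "g i x \<in> coboundaries C i"
      proof (cases i)
        case 0
        then show ?thesis
          using \<open>x \<in> coboundaries D i\<close> bigraded_hom_one[OF chain_mapD(3)[OF g, of 0]] by (simp add: coboundaries_def)
      next
        case (Suc j)
        then show ?thesis
          using \<open>x \<in> coboundaries D i\<close> chain_mapD(4)[OF g, of _ j] bigraded_hom_closed[OF chain_mapD(3)[OF g, of j]]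
          by (auto simp: coboundaries_def)
      qed
    qed
    finally show ?thesis .
  qed
  then show ?thesis unfolding z(2) cohomology_map_coset[OF z(1)] e .
qed

end

section \<open>Isomorphisms and direct summands of complexes\<close>

lemma complex_isoI:
  assumes f: "chain_map C D f" and g: "chain_map D C g"
    and gf: "\<And>i x. x \<in> carrier (obj C i) \<Longrightarrow> g i (f i x) = x"
    and fg: "\<And>i y. y \<in> carrier (obj D i) \<Longrightarrow> f i (g i y) = y"
  shows "complex_isomorphic C D" and "bigraded_isomorphic (cohomology C i) (cohomology D i)"
proof -
  have iso: "bigraded_iso (obj C i) (obj D i) (f i)" for i
    by (rule bigraded_isoI[OF chain_mapD(3)[OF f] chain_mapD(3)[OF g] gf fg])
  then show "complex_isomorphic C D" unfolding complex_isomorphic_def by (intro exI[of _ f] conjI allI f iso)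
  have "bigraded_iso (cohomology C i) (cohomology D i) (cohomology_map C D f i)"
    by (rule bigraded_isoI[OF bigraded_hom_cohomology_map[OF f] bigraded_hom_cohomology_map[OF g]
        cohomology_map_retract[OF f g gf] cohomology_map_retract[OF g f fg]])
  then show "bigraded_isomorphic (cohomology C i) (cohomology D i)" unfolding bigraded_isomorphic_def
    by (rule exI[of _ "cohomology_map C D f i"])
qed

lemma complex_summandI:
  assumes f: "chain_map C D f" and g: "chain_map D C g"
    and gf: "\<And>i x. x \<in> carrier (obj C i) \<Longrightarrow> g i (f i x) = x"
  shows "complex_summand C D" and "direct_summand (cohomology C i) (cohomology D i)"
proof -
  note C = chain_mapD(1)[OF f] and D = chain_mapD(2)[OF f]
  show "direct_summand (cohomology C i) (cohomology D i)"
    by (rule direct_summandI[OF bigraded_hom_cohomology_map[OF f] bigraded_hom_cohomology_map[OF g]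
        cohomology_map_retract[OF f g gf]])
  \<comment> \<open>The complement is the kernel of the retraction, which is a subcomplex because g
    commutes with the differentials.\<close>
  define K where "K = \<lparr>obj = (\<lambda>i. submodule_on (obj D i) (kernel (obj D i) (obj C i) (g i))), diff = diff D\<rparr>"
  have oK: "obj K i = submodule_on (obj D i) (kernel (obj D i) (obj C i) (g i))" and dK: "diff K = diff D" for i
    by (simp_all add: K_def)
  have bK: "bigraded_module (obj K i)" for i unfolding oK by (rule bigraded_kernel[OF chain_mapD(3)[OF g]])
  have KD: "x \<in> carrier (obj D i)" "g i x = \<one>\<^bsub>obj C i\<^esub>" if "x \<in> carrier (obj K i)" for x i
    using that unfolding oK by (simp_all add: kernel_def)
  have hK: "bigraded_hom (obj K i) (obj K (Suc i)) (diff K i)" for i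
    unfolding bigraded_hom_def
  proof (intro conjI allI bK)
    have mem: "diff D i x \<in> carrier (obj K (Suc i))" if x: "x \<in> carrier (obj K i)" for x
      using chain_mapD(4)[OF g KD(1)[OF x]] KD(2)[OF x] bigraded_hom_closed[OF cochain_complexD(1)[OF D] KD(1)[OF x]]
        bigraded_hom_one[OF cochain_complexD(1)[OF C, of i]]
      unfolding oK by (simp add: kernel_def)
    show "diff K i \<in> hom (obj K i) (obj K (Suc i))"
    proof (rule homI)
      fix x y assume x: "x \<in> carrier (obj K i)" and y: "y \<in> carrier (obj K i)"
      show "diff K i x \<in> carrier (obj K (Suc i))" unfolding dK by (rule mem[OF x])
      show "diff K i (x \<otimes>\<^bsub>obj K i\<^esub> y) = diff K i x \<otimes>\<^bsub>obj K (Suc i)\<^esub> diff K i y"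
        using hom_mult[OF bigraded_homD(3)[OF cochain_complexD(1)[OF D]] KD(1)[OF x] KD(1)[OF y]]
        unfolding dK oK by simp
    qed
    show "diff K i ` grade (obj K i) d \<subseteq> grade (obj K (Suc i)) d" for d
    proof (rule image_subsetI)
      fix x assume x: "x \<in> grade (obj K i) d"
      then have "x \<in> carrier (obj K i)" "x \<in> grade (obj D i) d" unfolding oK by simp_all
      then show "diff K i x \<in> grade (obj K (Suc i)) d"
        using mem bigraded_homD(4)[OF cochain_complexD(1)[OF D]] unfolding dK oK by simp
    qed
  qed
  have cK: "cochain_complex K"
    unfolding cochain_complex_def
  proof (intro conjI allI ballI hK)
    show "diff K (Suc i) (diff K i x) = \<one>\<^bsub>obj K (Suc (Suc i))\<^esub>" if "x \<in> carrier (obj K i)" for i x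
      using cochain_complexD(2)[OF D KD(1)[OF that]] unfolding dK oK by simp
  qed
  let ?P = "complex_prod C K"
  have oP: "obj ?P i = bigraded_prod (obj C i) (obj K i)" and dP: "diff ?P i = map_prod (diff C i) (diff K i)" for i
    by (simp_all add: complex_prod_def)
  have bP: "bigraded_module (obj ?P i)" for i
    unfolding oP by (rule bigraded_prod_module[OF cochain_complexD(3)[OF C] bK])
  have cP: "cochain_complex ?P"
    unfolding cochain_complex_def
  proof (intro conjI allI ballI)
    fix i
    show "bigraded_hom (obj ?P i) (obj ?P (Suc i)) (diff ?P i)"
      unfolding bigraded_hom_def
    proof (intro conjI allI bP)
      show "diff ?P i \<in> hom (obj ?P i) (obj ?P (Suc i))"
      proof (rule homI)
        fix x y assume "x \<in> carrier (obj ?P i)" "y \<in> carrier (obj ?P i)"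
        then obtain a b a' b' where x: "x = (a, b)" "a \<in> carrier (obj C i)" "b \<in> carrier (obj K i)"
          and y: "y = (a', b')" "a' \<in> carrier (obj C i)" "b' \<in> carrier (obj K i)"
          unfolding oP by (cases x, cases y) simp
        show "diff ?P i x \<in> carrier (obj ?P (Suc i))"
          using bigraded_hom_closed[OF cochain_complexD(1)[OF C] x(2)] bigraded_hom_closed[OF hK x(3)]
          unfolding oP dP x(1) by simp
        show "diff ?P i (x \<otimes>\<^bsub>obj ?P i\<^esub> y) = diff ?P i x \<otimes>\<^bsub>obj ?P (Suc i)\<^esub> diff ?P i y"
          using hom_mult[OF bigraded_homD(3)[OF cochain_complexD(1)[OF C]] x(2) y(2)]
            hom_mult[OF bigraded_homD(3)[OF hK] x(3) y(3)]
          unfolding oP dP x(1) y(1) by simp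
      qed
      show "diff ?P i ` grade (obj ?P i) d \<subseteq> grade (obj ?P (Suc i)) d" for d
      proof (rule image_subsetI)
        fix x assume "x \<in> grade (obj ?P i) d"
        then obtain a b where x: "x = (a, b)" "a \<in> grade (obj C i) d" "b \<in> grade (obj K i) d"
          unfolding oP by (cases x) simp
        show "diff ?P i x \<in> grade (obj ?P (Suc i)) d"
          using bigraded_homD(4)[OF cochain_complexD(1)[OF C] x(2)] bigraded_homD(4)[OF hK x(3)]
          unfolding oP dP x(1) by simp
      qed
    qed
    fix x assume "x \<in> carrier (obj ?P i)"
    then obtain a b where x: "x = (a, b)" "a \<in> carrier (obj C i)" "b \<in> carrier (obj K i)"
      unfolding oP by (cases x) simp
    show "diff ?P (Suc i) (diff ?P i x) = \<one>\<^bsub>obj ?P (Suc (Suc i))\<^esub>"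
      using cochain_complexD(2)[OF C x(2)] cochain_complexD(2)[OF cK x(3)] unfolding oP dP x(1) by simp
  qed
  \<comment> \<open>Degree by degree this is the isomorphism of a retract. It respects the
    differentials because K carries that of D, which is additive, and f is a chain map.\<close>
  let ?h = "\<lambda>i (x, y). f i x \<otimes>\<^bsub>obj D i\<^esub> y"
  have iso: "bigraded_iso (obj ?P i) (obj D i) (?h i)" for i
    unfolding oP oK by (rule retract_iso[OF chain_mapD(3)[OF f] chain_mapD(3)[OF g] gf])
  have ch: "chain_map ?P D ?h"
    unfolding chain_map_def
  proof (intro conjI allI ballI cP D)
    fix i
    show "bigraded_hom (obj ?P i) (obj D i) (?h i)"
      using iso[of i] unfolding bigraded_iso_def bigraded_hom_def iso_def by auto
    fix x assume "x \<in> carrier (obj ?P i)"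
    then obtain a b where x: "x = (a, b)" "a \<in> carrier (obj C i)" "b \<in> carrier (obj K i)"
      unfolding oP by (cases x) simp
    show "?h (Suc i) (diff ?P i x) = diff D i (?h i x)"
      using hom_mult[OF bigraded_homD(3)[OF cochain_complexD(1)[OF D]]
          bigraded_hom_closed[OF chain_mapD(3)[OF f] x(2)] KD(1)[OF x(3)]]
        chain_mapD(4)[OF f x(2)]
      unfolding dP dK x(1) by simp
  qed
  have "complex_isomorphic ?P D" unfolding complex_isomorphic_def by (intro exI[of _ ?h] conjI allI ch iso)
  then show "complex_summand C D" unfolding complex_summand_def by (intro exI[of _ K] conjI cK)
qed

section \<open>Ranks in complexes\<close>

text \<open>Indexing by an initial segment of the natural numbers removes the index type of a basis
  from the statement, so that the ranks of unrelated modules can be compared.\<close>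

definition has_rank :: "('a, 'm) monoid_scheme \<Rightarrow> nat \<Rightarrow> bool" where
  "has_rank M n \<longleftrightarrow> (\<exists>b :: nat \<Rightarrow> 'a. qbasis M b {..<n})"

lemma qbasis_reindex:
  assumes q: "qbasis M b X" and h: "bij_betw h I X"
  shows "qbasis M (\<lambda>i. b (h i)) I"
proof -
  have M: "comm_group M" and fin: "finite X" and bp: "b \<in> X \<rightarrow> carrier M" and i: "indep M b X"
    and span: "\<forall>m\<in>carrier M. \<exists>k a. k \<noteq> 0 \<and> m [^]\<^bsub>M\<^esub> (k::int) = int_comb M b X a"
    using q by (auto simp: qbasis_def)
  interpret M: comm_group M by (rule M)
  have inj: "inj_on h I" and im: "h ` I = X" using h by (auto simp: bij_betw_def)
  have b: "b x \<in> carrier M" if "x \<in> X" for x using bp that by auto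
  have hX: "h j \<in> X" if "j \<in> I" for j using im that by auto
  have e: "int_comb M b X a = int_comb M (\<lambda>i. b (h i)) I (\<lambda>i. a (h i))" for a
    unfolding int_comb_def im[symmetric] by (rule M.finprod_reindex[OF _ inj]) (use b hX in auto)
  have bI: "(\<lambda>i. b (h i)) \<in> I \<rightarrow> carrier M" by (intro Pi_I b hX)
  have e': "int_comb M (\<lambda>i. b (h i)) I a = int_comb M b X (\<lambda>x. a (inv_into I h x))" for a
    unfolding e by (rule int_comb_cong[OF M bI]) (use inj in auto)
  show ?thesis
    unfolding qbasis_def indep_def
  proof (intro conjI ballI allI impI M b hX)
    show "finite I" using fin h bij_betw_finite by blast
    fix a j assume a: "int_comb M (\<lambda>i. b (h i)) I a = \<one>\<^bsub>M\<^esub>" and j: "j \<in> I"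
    have "a (inv_into I h (h j)) = 0" using a j i im unfolding e' indep_def by blast
    then show "a j = 0" using inj j by simp
  next
    fix m assume "m \<in> carrier M"
    then obtain k a where k: "k \<noteq> 0" "m [^]\<^bsub>M\<^esub> (k::int) = int_comb M b X a" using span by blast
    show "\<exists>k a. k \<noteq> 0 \<and> m [^]\<^bsub>M\<^esub> (k::int) = int_comb M (\<lambda>i. b (h i)) I a"
      using k unfolding e by (intro exI[of _ k] exI[of _ "\<lambda>i. a (h i)"]) simp
  qed
qed

lemma has_rank_qbasis:
  assumes "qbasis M b X"
  shows "has_rank M (card X)"
proof -
  have "finite X" using assms by (simp add: qbasis_def)
  then obtain h where "bij_betw h {0..<card X} X" using ex_bij_betw_nat_finite by blast
  then have "bij_betw h {..<card X} X" by (simp add: atLeast0LessThan)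
  from qbasis_reindex[OF assms this] show ?thesis unfolding has_rank_def by (rule exI[of _ "\<lambda>i. b (h i)"])
qed

lemma has_rank_rank:
  assumes "has_rank M n"
  shows "rank_Q M = n" and "vectorspace.fin_dim rat_field (rationalization M)"
proof -
  obtain b :: "nat \<Rightarrow> 'a" where q: "qbasis M b {..<n}" using assms unfolding has_rank_def by (rule exE)
  have M: "comm_group M" using q by (simp add: qbasis_def)
  show "rank_Q M = n" using rank_qbasis(1)[OF M q] by simp
  show "vectorspace.fin_dim rat_field (rationalization M)" by (rule rank_qbasis(2)[OF M q])
qed

text \<open>Uniqueness is inherited from the dimension of the rationalization. It identifies ranks
  that were obtained from different exact sequences.\<close>

lemma has_rank_unique: "has_rank M n \<Longrightarrow> has_rank M m \<Longrightarrow> n = m"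
  using has_rank_rank(1) by metis

lemma has_rank_same:
  assumes "carrier M = carrier N" "monoid.mult M = monoid.mult N" "one M = one N"
  shows "has_rank M n = has_rank N n"
  unfolding has_rank_def qbasis_same[OF assms] by (rule refl)

lemma has_rank_nullity:
  assumes r: "has_rank M n" and N: "comm_group N" and f: "f \<in> hom M N" and s: "f ` carrier M = carrier N"
  shows "\<exists>k l. has_rank N k \<and> has_rank (M\<lparr>carrier := kernel M N f\<rparr>) l \<and> k + l = n"
proof -
  obtain b :: "nat \<Rightarrow> 'a" where q: "qbasis M b {..<n}" using r unfolding has_rank_def by (rule exE)
  obtain Y m where Y: "Y \<subseteq> {..<n}" and qN: "qbasis N (\<lambda>x. f (b x)) Y"
    and qK: "qbasis (M\<lparr>carrier := kernel M N f\<rparr>) m ({..<n} - Y)"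
    by (rule qbasis_rank_nullity[OF q N f s])
  have "card Y + card ({..<n} - Y) = n"
    using Y card_Un_disjoint[of Y "{..<n} - Y"] finite_subset[OF Y] by (simp add: Un_absorb1)
  then show ?thesis using has_rank_qbasis[OF qN] has_rank_qbasis[OF qK] by (intro exI conjI)
qed

lemma has_rank_trivial:
  assumes "comm_group M" "carrier M = {\<one>\<^bsub>M\<^esub>}"
  shows "has_rank M 0"
proof -
  interpret comm_group M by fact
  have "qbasis M (\<lambda>i::nat. \<one>\<^bsub>M\<^esub>) {..<0}"
    unfolding qbasis_def indep_def
    using assms by (auto simp: int_comb_def intro!: exI[of _ "1::int"])
  then show ?thesis unfolding has_rank_def by (rule exI[of _ "\<lambda>i. \<one>\<^bsub>M\<^esub>"])
qed

lemma (in free_bigraded) has_rank_graded_part: "has_rank (graded_part M d) (card {x \<in> X. deg x = d})"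
proof -
  let ?G = "graded_part M d" and ?X = "{x \<in> X. deg x = d}"
  have G: "comm_group ?G" by (rule comm_group_graded_part[OF comm grade_subgroup])
  interpret G: comm_group ?G by (rule G)
  have incl: "(\<lambda>x. x) \<in> hom ?G M" using grade_closed by (auto simp: hom_def)
  have bG: "b \<in> ?X \<rightarrow> carrier ?G" using b_grade by auto
  have ic: "int_comb ?G b ?X a = int_comb M b ?X a" for a
    using int_comb_hom[OF G bG comm incl] by simp
  have "qbasis ?G b ?X"
  proof (rule qbasisI_coord[OF G _ bG, where c = "\<lambda>x m. of_int (c x m)"])
    show "(\<lambda>m. of_int (c x m)) \<in> hom ?G rat_group" if "x \<in> ?X" for x
    proof (rule homI)
      fix m m' assume "m \<in> carrier ?G" "m' \<in> carrier ?G"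
      then show "rat_of_int (c x (m \<otimes>\<^bsub>?G\<^esub> m')) = of_int (c x m) \<otimes>\<^bsub>rat_group\<^esub> of_int (c x m')"
        using hom_mult[OF c_hom, of x m m'] grade_closed that by simp
    qed simp
    fix m assume m: "m \<in> carrier ?G"
    then have mM: "m \<in> carrier M" and z: "c x m = 0" if "x \<in> X" "deg x \<noteq> d" for x
      using that by (auto simp: grade_eq)
    have mM: "m \<in> carrier M" using m grade_closed by simp
    have "m = finprod M (\<lambda>x. b x [^]\<^bsub>M\<^esub> c x m) X" by (rule expand[OF mM])
    also have "\<dots> = finprod M (\<lambda>x. b x [^]\<^bsub>M\<^esub> c x m) ?X"
      by (rule finprod_mono_neutral_cong_right) (use fin b_closed z in auto)
    finally have "m = int_comb ?G b ?X (\<lambda>x. c x m)" unfolding ic unfolding int_comb_def .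
    then show "\<exists>k a. k \<noteq> 0 \<and> m [^]\<^bsub>?G\<^esub> (k::int) = int_comb ?G b ?X a"
      using m by (intro exI[of _ 1] exI[of _ "\<lambda>x. c x m"]) simp
  qed (use fin c_b in auto)
  then show ?thesis by (rule has_rank_qbasis)
qed

text \<open>Homogeneous cocycles, coboundaries and cochains are all brought to this form, so that
  the kernel of one map can be matched with the image of another.\<close>

definition sub_rec :: "('a, 'm) monoid_scheme \<Rightarrow> 'a set \<Rightarrow> 'a monoid" where
  "sub_rec M S = \<lparr>carrier = S, monoid.mult = monoid.mult M, one = \<one>\<^bsub>M\<^esub>\<rparr>"

lemma sub_rec_simps [simp]: "carrier (sub_rec M S) = S" "monoid.mult (sub_rec M S) = monoid.mult M"
    "\<one>\<^bsub>sub_rec M S\<^esub> = \<one>\<^bsub>M\<^esub>" "(sub_rec M S)\<lparr>carrier := S'\<rparr> = sub_rec M S'"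
  by (simp_all add: sub_rec_def)

lemma graded_part_sub_rec: "graded_part M d = sub_rec M (grade M d)"
  by (simp add: graded_part_def sub_rec_def)

lemma sub_rec_comm:
  assumes "comm_group M" "subgroup S M"
  shows "comm_group (sub_rec M S)"
proof -
  have "comm_group (sub_rec M S) = comm_group (submodule_on (with_grading M (\<lambda>_. {})) S)"
    by (rule same_comm_group) (simp_all add: with_grading_def)
  then show ?thesis using submodule_on_comm[of "with_grading M (\<lambda>_. {})" S] assms by simp
qed

text \<open>In each degree z, b, h and c are the ranks of cocycles, coboundaries, cohomology and
  cochains; c = z + b (shifted) and z = b + h.\<close>

lemma euler_characteristic_degree:
  assumes C: "cochain_complex C" and c: "\<And>i. has_rank (graded_part (obj C i) d) (c i)"
    and n: "c (Suc n) = 0"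
  shows "\<exists>h. (\<forall>i. has_rank (graded_part (cohomology C i) d) (h i)) \<and>
    (\<Sum>i=0..n. (-1) ^ i * int (h i)) = (\<Sum>i=0..n. (-1) ^ i * int (c i))"
proof -
  note bM = cochain_complexD(3)[OF C] and cM = cochain_complexD(4)[OF C] and dh = cochain_complexD(1)[OF C]
  have gsub: "subgroup (grade (obj C i) d) (obj C i)" for i by (rule bigraded_module_grade[OF bM])
  have Bsub: "subgroup (coboundaries C i \<inter> grade (obj C i) d) (obj C i)" for i
    by (rule group.subgroups_Inter_pair[OF comm_group.axioms(2)[OF cM] coboundaries_subgroup[OF C] gsub])
  have Zsub: "subgroup (cocycles C i \<inter> grade (obj C i) d) (obj C i)" for i
    by (rule group.subgroups_Inter_pair[OF comm_group.axioms(2)[OF cM] cocycles_subgroup[OF C] gsub])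
  have img: "diff C i ` grade (obj C i) d = coboundaries C (Suc i) \<inter> grade (obj C (Suc i)) d" for i
  proof (intro equalityI subsetI)
    fix y assume "y \<in> diff C i ` grade (obj C i) d"
    then obtain x where x: "x \<in> grade (obj C i) d" "y = diff C i x" by auto
    have "x \<in> carrier (obj C i)" using x(1) subgroup.subset[OF gsub] by auto
    then show "y \<in> coboundaries C (Suc i) \<inter> grade (obj C (Suc i)) d"
      using x bigraded_homD(4)[OF dh x(1)] by (simp add: coboundaries_def)
  next
    fix y assume y: "y \<in> coboundaries C (Suc i) \<inter> grade (obj C (Suc i)) d"
    then obtain x where x: "x \<in> carrier (obj C i)" "y = diff C i x" by (auto simp: coboundaries_def)
    \<comment> \<open>A preimage of a homogeneous coboundary may be replaced by its component of
      degree d.\<close>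
    obtain p where p: "grading_proj (obj C i) p" by (rule bigraded_module_proj[OF bM])
    obtain q where q: "grading_proj (obj C (Suc i)) q" by (rule bigraded_module_proj[OF bM])
    have "y = q d y" using grading_projD(3)[OF q, of y d d] y by simp
    also have "\<dots> = diff C i (p d x)" unfolding x(2) by (rule bigraded_hom_proj[OF dh p q x(1)])
    finally show "y \<in> diff C i ` grade (obj C i) d" using grading_projD(2)[OF p x(1)] by (rule image_eqI)
  qed
  have s1: "\<exists>b z. has_rank (sub_rec (obj C (Suc i)) (coboundaries C (Suc i) \<inter> grade (obj C (Suc i)) d)) b \<and>
      has_rank (sub_rec (obj C i) (cocycles C i \<inter> grade (obj C i) d)) z \<and> b + z = c i" for i
  proof -
    let ?M = "sub_rec (obj C i) (grade (obj C i) d)"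
    let ?N = "sub_rec (obj C (Suc i)) (coboundaries C (Suc i) \<inter> grade (obj C (Suc i)) d)"
    have r: "has_rank ?M (c i)" using c[of i] by (simp only: graded_part_sub_rec)
    have N: "comm_group ?N" by (rule sub_rec_comm[OF cM Bsub])
    have f: "diff C i \<in> hom ?M ?N"
    proof (rule homI)
      show "diff C i x \<in> carrier ?N" if "x \<in> carrier ?M" for x using that img by auto
      fix x y assume "x \<in> carrier ?M" "y \<in> carrier ?M"
      then have "x \<in> carrier (obj C i)" "y \<in> carrier (obj C i)" using subgroup.subset[OF gsub] by auto
      then show "diff C i (x \<otimes>\<^bsub>?M\<^esub> y) = diff C i x \<otimes>\<^bsub>?N\<^esub> diff C i y"
        using hom_mult[OF bigraded_homD(3)[OF dh]] by simp
    qed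
    have "kernel ?M ?N (diff C i) = cocycles C i \<inter> grade (obj C i) d"
      using subgroup.subset[OF gsub, of i] by (auto simp: kernel_def cocycles_def)
    then show ?thesis using has_rank_nullity[OF r N f] img by simp
  qed
  have s2: "\<exists>h b. has_rank (graded_part (cohomology C i) d) h \<and>
      has_rank (sub_rec (obj C i) (coboundaries C i \<inter> grade (obj C i) d)) b \<and> h + b = z"
    if r: "has_rank (sub_rec (obj C i) (cocycles C i \<inter> grade (obj C i) d)) z" for i z
  proof -
    let ?M = "sub_rec (obj C i) (cocycles C i \<inter> grade (obj C i) d)"
    let ?N = "graded_part (cohomology C i) d" and ?f = "\<lambda>z. coboundaries C i #>\<^bsub>obj C i\<^esub> z"
    have N: "comm_group ?N"
      by (rule comm_group_graded_part) (use bigraded_cohomology[OF C] in \<open>simp_all add: bigraded_module_def\<close>)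
    have s: "?f ` carrier ?M = carrier ?N" by (simp add: grade_cohomology[OF C])
    have f: "?f \<in> hom ?M ?N"
    proof (rule homI)
      show "?f x \<in> carrier ?N" if "x \<in> carrier ?M" for x using that s by auto
      show "?f (x \<otimes>\<^bsub>?M\<^esub> y) = ?f x \<otimes>\<^bsub>?N\<^esub> ?f y" if "x \<in> carrier ?M" "y \<in> carrier ?M" for x y
        using hom_mult[OF cohomology_proj[OF C, of i]] that by simp
    qed
    have "kernel ?M ?N ?f = coboundaries C i \<inter> grade (obj C i) d"
    proof -
      have "x \<in> kernel ?M ?N ?f \<longleftrightarrow> x \<in> coboundaries C i \<inter> grade (obj C i) d" for x
        using coset_eq_coboundaries[OF C, of x i] coboundaries_cocycles[OF C, of i]
        unfolding kernel_def by (auto simp: cohomology_one[OF C])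
      then show ?thesis by auto
    qed
    then show ?thesis using has_rank_nullity[OF r N f s] by simp
  qed
  from s1 have "\<exists>B Z. \<forall>i. has_rank (sub_rec (obj C (Suc i)) (coboundaries C (Suc i) \<inter> grade (obj C (Suc i)) d)) (B i) \<and>
      has_rank (sub_rec (obj C i) (cocycles C i \<inter> grade (obj C i) d)) (Z i) \<and> B i + Z i = c i"
    by metis
  then obtain B Z where B: "\<And>i. has_rank (sub_rec (obj C (Suc i)) (coboundaries C (Suc i) \<inter> grade (obj C (Suc i)) d)) (B i)"
    and Z: "\<And>i. has_rank (sub_rec (obj C i) (cocycles C i \<inter> grade (obj C i) d)) (Z i)"
    and BZ: "\<And>i. B i + Z i = c i" by auto
  from s2[OF Z] have "\<exists>h b. \<forall>i. has_rank (graded_part (cohomology C i) d) (h i) \<and>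
      has_rank (sub_rec (obj C i) (coboundaries C i \<inter> grade (obj C i) d)) (b i) \<and> h i + b i = Z i"
    by metis
  then obtain h b where h: "\<And>i. has_rank (graded_part (cohomology C i) d) (h i)"
    and b: "\<And>i. has_rank (sub_rec (obj C i) (coboundaries C i \<inter> grade (obj C i) d)) (b i)"
    and hb: "\<And>i. h i + b i = Z i" by auto
  \<comment> \<open>The coboundaries in degree i + 1 have been counted twice, as the image of the
    differential and as the kernel of the passage to cohomology.\<close>
  have bB: "b (Suc i) = B i" for i by (rule has_rank_unique[OF b B])
  have "has_rank (sub_rec (obj C 0) (coboundaries C 0 \<inter> grade (obj C 0) d)) 0"
    by (rule has_rank_trivial[OF sub_rec_comm[OF cM Bsub]])
      (use subgroup.one_closed[OF gsub, of 0] in \<open>auto simp: coboundaries_def\<close>)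
  then have b0: "b 0 = 0" by (rule has_rank_unique[OF b])
  \<comment> \<open>\<open>B n\<close> counts coboundaries in degree n + 1, where the cochains have
    rank 0; the telescoping sum thus leaves no remainder.\<close>
  have "B n = 0" using BZ[of "Suc n"] hb[of "Suc n"] bB[of n] n by simp
  \<comment> \<open>Each rank of cochains is the rank of cohomology plus the ranks of the
    coboundaries in its own degree and in the next one, so the partial alternating sums differ only
    by the last of these.\<close>
  moreover have "(\<Sum>i=0..k. (-1) ^ i * int (c i)) = (\<Sum>i=0..k. (-1) ^ i * int (h i)) + (-1) ^ k * int (B k)" for k
  proof (induction k)
    case 0
    then show ?case using BZ[of 0] hb[of 0] b0 by simp
  next
    case (Suc k)
    have "int (c (Suc k)) = int (B (Suc k)) + int (h (Suc k)) + int (B k)"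
      using BZ[of "Suc k"] hb[of "Suc k"] bB[of k] by simp
    then show ?case using Suc by (simp add: algebra_simps)
  qed
  ultimately have "(\<Sum>i=0..n. (-1) ^ i * int (h i)) = (\<Sum>i=0..n. (-1) ^ i * int (c i))" by simp
  then show ?thesis using h by (intro exI[of _ h] conjI allI)
qed

section \<open>The dual numbers\<close>

interpretation PZ: UP_cring "\<Z>" "UP \<Z>"
  by (rule UP_cring.intro[OF int_is_cring])

lemma UPZ_coeff: "p \<in> carrier (UP \<Z>) \<Longrightarrow> up_ring.coeff (UP \<Z>) p n = p n"
  by (simp add: UP_def)

lemma UPZ_monom: "up_ring.monom (UP \<Z>) a m = (\<lambda>n. if n = m then a else 0)"
  by (rule ext) (auto simp: UP_def)

lemma UPZ_monom_closed: "up_ring.monom (UP \<Z>) a m \<in> carrier (UP \<Z>)"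
  by (rule PZ.monom_closed) simp

lemma UPZ_mult:
  assumes "p \<in> carrier (UP \<Z>)" "q \<in> carrier (UP \<Z>)"
  shows "(p \<otimes>\<^bsub>UP \<Z>\<^esub> q) n = (\<Sum>i\<le>n. p i * q (n - i))"
  using PZ.coeff_mult[OF assms, of n] assms
  by (simp add: UPZ_coeff PZ.UP_mult_closed)

lemma UPZ_add:
  assumes "p \<in> carrier (UP \<Z>)" "q \<in> carrier (UP \<Z>)"
  shows "(p \<oplus>\<^bsub>UP \<Z>\<^esub> q) n = p n + q n"
  using PZ.coeff_add[OF assms, of n] assms by (simp add: UPZ_coeff PZ.UP_a_closed)

lemma UPZ_one: "\<one>\<^bsub>UP \<Z>\<^esub> n = (if n = 0 then 1 else 0)"
  by (simp add: UP_def)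

lemma dual_ideal_ideal: "ideal dual_ideal (UP \<Z>)"
  unfolding dual_ideal_def by (rule PZ.P.cgenideal_ideal[OF UPZ_monom_closed])

lemma in_dual_ideal:
  assumes p: "p \<in> carrier (UP \<Z>)"
  shows "p \<in> dual_ideal \<longleftrightarrow> p 0 = 0 \<and> p 1 = 0"
proof
  assume "p \<in> dual_ideal"
  then obtain q where q: "q \<in> carrier (UP \<Z>)" "p = q \<otimes>\<^bsub>UP \<Z>\<^esub> up_ring.monom (UP \<Z>) 1 2"
    unfolding dual_ideal_def cgenideal_def by auto
  have "p n = 0" if "n < 2" for n
    unfolding q(2) UPZ_mult[OF q(1) UPZ_monom_closed] unfolding UPZ_monom using that by (intro sum.neutral) auto
  then show "p 0 = 0 \<and> p 1 = 0" by simp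
next
  assume p0: "p 0 = 0 \<and> p 1 = 0"
  \<comment> \<open>Division by the square of the indeterminate shifts the coefficients by two
    places.\<close>
  define q where "q = (\<lambda>n. p (n + 2))"
  obtain m where m: "bound \<zero>\<^bsub>\<Z>\<^esub> m p" using p by (auto simp: UP_def up_def)
  have "bound \<zero>\<^bsub>\<Z>\<^esub> m q" unfolding q_def using m by (auto simp: bound_def)
  then have q: "q \<in> carrier (UP \<Z>)" by (auto simp: UP_def up_def)
  have "p n = (q \<otimes>\<^bsub>UP \<Z>\<^esub> up_ring.monom (UP \<Z>) 1 2) n" for n
  proof -
    have "(q \<otimes>\<^bsub>UP \<Z>\<^esub> up_ring.monom (UP \<Z>) 1 2) n = (\<Sum>i\<le>n. if i = n - 2 \<and> 2 \<le> n then q i else 0)"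
      unfolding UPZ_mult[OF q UPZ_monom_closed] unfolding UPZ_monom by (intro sum.cong) auto
    also have "\<dots> = (if 2 \<le> n then q (n - 2) else 0)" by simp
    also have "\<dots> = p n"
    proof (cases "2 \<le> n")
      case True
      then obtain k where "n = 2 + k" using le_Suc_ex by blast
      then show ?thesis by (simp add: q_def add.commute)
    next
      case False
      then have "n = 0 \<or> n = 1" by auto
      then show ?thesis using p0 by auto
    qed
    finally show ?thesis by simp
  qed
  then have "p = q \<otimes>\<^bsub>UP \<Z>\<^esub> up_ring.monom (UP \<Z>) 1 2" by (rule ext)
  then show "p \<in> dual_ideal" unfolding dual_ideal_def cgenideal_def using q by blast
qed

lemma dual_ideal_subgroup: "abelian_subgroup dual_ideal (UP \<Z>)"
  by (rule abelian_subgroupI3[OF ideal.axioms(1)[OF dual_ideal_ideal] PZ.P.abelian_group_axioms])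

lemma dual_cring: "cring dual_ring"
  unfolding dual_ring_def by (rule ideal.quotient_is_cring[OF dual_ideal_ideal PZ.UP_cring])

interpretation DR: cring dual_ring by (rule dual_cring)

definition dual_class :: "(nat \<Rightarrow> int) \<Rightarrow> dual" where
  "dual_class p = dual_ideal +>\<^bsub>UP \<Z>\<^esub> p"

text \<open>The first two coefficients are constant on a residue class, so for k < 2 the value does
  not depend on the chosen representative.\<close>

definition dual_coeff :: "nat \<Rightarrow> dual \<Rightarrow> int" where
  "dual_coeff k x = (SOME p. p \<in> x) k"

lemma dual_class_hom: "dual_class \<in> ring_hom (UP \<Z>) dual_ring"
  unfolding dual_class_def dual_ring_def by (rule ideal.rcos_ring_hom[OF dual_ideal_ideal])

lemma dual_carrier: "carrier dual_ring = dual_class ` carrier (UP \<Z>)"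
  by (auto simp: dual_ring_def FactRing_def A_RCOSETS_def RCOSETS_def a_r_coset_def dual_class_def)

lemma dual_class_mem: "q \<in> dual_class p \<Longrightarrow> p \<in> carrier (UP \<Z>) \<Longrightarrow> k < 2 \<Longrightarrow> q k = p k"
proof -
  assume q: "q \<in> dual_class p" and p: "p \<in> carrier (UP \<Z>)" and k: "k < 2"
  obtain i where i: "i \<in> dual_ideal" "q = i \<oplus>\<^bsub>UP \<Z>\<^esub> p"
    using q unfolding dual_class_def by (auto simp: a_r_coset_def r_coset_def)
  have iP: "i \<in> carrier (UP \<Z>)" using i(1) ideal.Icarr[OF dual_ideal_ideal] by blast
  have "k = 0 \<or> k = 1" using k by auto
  then show "q k = p k" using i in_dual_ideal[OF iP] UPZ_add[OF iP p, of k] by auto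
qed

lemma dual_coeff_class:
  assumes p: "p \<in> carrier (UP \<Z>)" and k: "k < 2"
  shows "dual_coeff k (dual_class p) = p k"
proof -
  have "p \<in> dual_class p" unfolding dual_class_def by (rule abelian_subgroup.a_rcos_self[OF dual_ideal_subgroup p])
  then have "(SOME q. q \<in> dual_class p) \<in> dual_class p" by (rule someI[of "\<lambda>q. q \<in> dual_class p"])
  then show ?thesis unfolding dual_coeff_def by (rule dual_class_mem[OF _ p k])
qed

lemma dual_class_eq:
  assumes p: "p \<in> carrier (UP \<Z>)" and q: "q \<in> carrier (UP \<Z>)" and e: "p 0 = q 0" "p 1 = q 1"
  shows "dual_class p = dual_class q"
proof -
  have "\<ominus>\<^bsub>UP \<Z>\<^esub> q \<in> carrier (UP \<Z>)" using q by simp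
  then have d: "p \<oplus>\<^bsub>UP \<Z>\<^esub> \<ominus>\<^bsub>UP \<Z>\<^esub> q \<in> carrier (UP \<Z>)" using p by simp
  have n: "(\<ominus>\<^bsub>UP \<Z>\<^esub> q) n + q n = 0" for n
    using UPZ_add[OF \<open>\<ominus>\<^bsub>UP \<Z>\<^esub> q \<in> _\<close> q, of n] q PZ.P.l_neg[OF q] by (simp add: UP_def)
  have "p \<oplus>\<^bsub>UP \<Z>\<^esub> \<ominus>\<^bsub>UP \<Z>\<^esub> q \<in> dual_ideal"
    unfolding in_dual_ideal[OF d] UPZ_add[OF p \<open>\<ominus>\<^bsub>UP \<Z>\<^esub> q \<in> _\<close>] using n[of 0] n[of 1] e by simp
  then have "p \<in> dual_ideal +>\<^bsub>UP \<Z>\<^esub> q"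
    using abelian_subgroup.a_rcos_module[OF dual_ideal_subgroup q p] by simp
  then show ?thesis
    unfolding dual_class_def by (rule abelian_subgroup.a_repr_independence'[OF dual_ideal_subgroup _ q, symmetric])
qed

lemma dual_coeff_add:
  assumes "x \<in> carrier dual_ring" "y \<in> carrier dual_ring" "k < 2"
  shows "dual_coeff k (x \<oplus>\<^bsub>dual_ring\<^esub> y) = dual_coeff k x + dual_coeff k y"
proof -
  obtain p q where p: "p \<in> carrier (UP \<Z>)" "x = dual_class p" and q: "q \<in> carrier (UP \<Z>)" "y = dual_class q"
    using assms(1,2) unfolding dual_carrier by auto
  show ?thesis
    unfolding p(2) q(2) ring_hom_add[OF dual_class_hom p(1) q(1), symmetric]
    using p q assms(3) by (simp add: dual_coeff_class UPZ_add)
qed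

lemma dual_coeff_mult:
  assumes "x \<in> carrier dual_ring" "y \<in> carrier dual_ring"
  shows "dual_coeff 0 (x \<otimes>\<^bsub>dual_ring\<^esub> y) = dual_coeff 0 x * dual_coeff 0 y"
    and "dual_coeff 1 (x \<otimes>\<^bsub>dual_ring\<^esub> y) = dual_coeff 0 x * dual_coeff 1 y + dual_coeff 1 x * dual_coeff 0 y"
proof -
  obtain p q where p: "p \<in> carrier (UP \<Z>)" "x = dual_class p" and q: "q \<in> carrier (UP \<Z>)" "y = dual_class q"
    using assms(1,2) unfolding dual_carrier by auto
  have "dual_coeff k (x \<otimes>\<^bsub>dual_ring\<^esub> y) = (\<Sum>i\<le>k. p i * q (k - i))" if "k < 2" for k
    unfolding p(2) q(2) ring_hom_mult[OF dual_class_hom p(1) q(1), symmetric]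
    using p q that by (simp add: dual_coeff_class UPZ_mult)
  then show "dual_coeff 0 (x \<otimes>\<^bsub>dual_ring\<^esub> y) = dual_coeff 0 x * dual_coeff 0 y"
    and "dual_coeff 1 (x \<otimes>\<^bsub>dual_ring\<^esub> y) = dual_coeff 0 x * dual_coeff 1 y + dual_coeff 1 x * dual_coeff 0 y"
    using dual_coeff_class[OF p(1)] dual_coeff_class[OF q(1)] p(2) q(2) by simp_all
qed

lemma dual_one: "\<one>\<^bsub>dual_ring\<^esub> = dual_class \<one>\<^bsub>UP \<Z>\<^esub>"
  using ring_hom_one[OF dual_class_hom] by simp

lemma dual_gen: "dual_gen = dual_class (up_ring.monom (UP \<Z>) 1 1)"
  by (simp add: dual_gen_def dual_class_def)

lemma dual_gen_closed: "dual_gen \<in> carrier dual_ring"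
  unfolding dual_gen dual_carrier by (rule imageI[OF UPZ_monom_closed])

lemma dual_coeff_one: "k < 2 \<Longrightarrow> dual_coeff k \<one>\<^bsub>dual_ring\<^esub> = (if k = 0 then 1 else 0)"
  unfolding dual_one by (simp add: dual_coeff_class UPZ_one)

lemma dual_coeff_gen: "k < 2 \<Longrightarrow> dual_coeff k dual_gen = (if k = 1 then 1 else 0)"
  unfolding dual_gen using dual_coeff_class[OF UPZ_monom_closed, of k 1 1]
  by (simp add: UPZ_monom)

lemma graded_dual_simps [simp]:
  "carrier (graded_dual d) = carrier dual_ring" "monoid.mult (graded_dual d) = add dual_ring"
  "\<one>\<^bsub>graded_dual d\<^esub> = \<zero>\<^bsub>dual_ring\<^esub>"
  by (simp_all add: graded_dual_def)

lemma dual_coeff_hom: "k < 2 \<Longrightarrow> dual_coeff k \<in> hom (graded_dual d) integer_group"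
  by (rule homI) (simp_all add: dual_coeff_add)

text \<open>Booleans index the two basis elements, with \<open>True\<close> for the class of the
  indeterminate. Basis elements of a tensor power are then Boolean functions on its index
  set.\<close>

definition dual_basis :: "bool \<Rightarrow> dual" where
  "dual_basis x = (if x then dual_gen else \<one>\<^bsub>dual_ring\<^esub>)"

definition dual_coord :: "bool \<Rightarrow> dual \<Rightarrow> int" where
  "dual_coord x = dual_coeff (if x then 1 else 0)"

text \<open>For fixed m the class of a monomial is additive in its coefficient, hence an integer
  power of the class with coefficient 1 in the multiplicative notation.\<close>

lemma dual_pow:
  assumes m: "m < 2"
  shows "dual_class (up_ring.monom (UP \<Z>) a m) = dual_class (up_ring.monom (UP \<Z>) 1 m) [^]\<^bsub>add_monoid dual_ring\<^esub> (a :: int)"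
proof -
  let ?h = "\<lambda>a. dual_class (up_ring.monom (UP \<Z>) a m)"
  have h: "?h \<in> hom integer_group (add_monoid dual_ring)"
  proof (rule homI)
    fix a b :: int
    have "up_ring.monom (UP \<Z>) (a + b) m = up_ring.monom (UP \<Z>) a m \<oplus>\<^bsub>UP \<Z>\<^esub> up_ring.monom (UP \<Z>) b m"
      using PZ.monom_add[of a b m] by simp
    then show "?h (a \<otimes>\<^bsub>integer_group\<^esub> b) = ?h a \<otimes>\<^bsub>add_monoid dual_ring\<^esub> ?h b"
      using ring_hom_add[OF dual_class_hom UPZ_monom_closed UPZ_monom_closed] by simp
  qed (simp add: dual_carrier UPZ_monom_closed)
  have "?h (1 [^]\<^bsub>integer_group\<^esub> a) = ?h 1 [^]\<^bsub>add_monoid dual_ring\<^esub> a"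
    by (rule hom_int_pow[OF h _ group_integer_group comm_group.axioms(2)[OF DR.a_comm_group]]) simp
  then show ?thesis by simp
qed

lemma free_bigraded_dual: "free_bigraded (graded_dual d) UNIV dual_basis dual_coord (\<lambda>x. if x then d else 0)"
proof -
  have cg: "comm_group (add_monoid dual_ring)" by (rule DR.a_comm_group)
  have gA: "group (add_monoid dual_ring)" using cg by (rule comm_group.axioms(2))
  have B: "free_basis (graded_dual d) UNIV dual_basis dual_coord"
  proof (rule free_basis.intro)
    show "comm_group (graded_dual d)" unfolding graded_dual_def same_with_grading by (rule cg)
    show "dual_basis x \<in> carrier (graded_dual d)" for x by (simp add: dual_basis_def dual_gen_closed)
    show "dual_coord x \<in> hom (graded_dual d) integer_group" for x
      unfolding dual_coord_def by (rule dual_coeff_hom) simp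
    show "dual_coord x (dual_basis y) = (if x = y then 1 else 0)" for x y
      by (simp add: dual_coord_def dual_basis_def dual_coeff_one dual_coeff_gen)
    show "carrier (graded_dual d) \<subseteq> generate (graded_dual d) (dual_basis ` UNIV)"
    proof
      fix x assume "x \<in> carrier (graded_dual d)"
      then obtain p where p: "p \<in> carrier (UP \<Z>)" "x = dual_class p" by (auto simp: dual_carrier)
      let ?G = "generate (add_monoid dual_ring) (dual_basis ` UNIV)"
      have G: "subgroup ?G (add_monoid dual_ring)"
        by (rule group.generate_is_subgroup[OF gA]) (auto simp: dual_basis_def dual_gen_closed)
      \<comment> \<open>Every class contains the linear part of each of its representatives.\<close>
      let ?r = "up_ring.monom (UP \<Z>) (p 0) 0 \<oplus>\<^bsub>UP \<Z>\<^esub> up_ring.monom (UP \<Z>) (p 1) 1"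
      have "x = dual_class ?r"
        unfolding p(2)
        by (rule dual_class_eq[OF p(1)]) (simp_all add: UPZ_monom_closed UPZ_add[OF UPZ_monom_closed UPZ_monom_closed], simp_all add: UPZ_monom)
      also have "\<dots> = dual_class (up_ring.monom (UP \<Z>) (p 0) 0) \<oplus>\<^bsub>dual_ring\<^esub> dual_class (up_ring.monom (UP \<Z>) (p 1) 1)"
        by (rule ring_hom_add[OF dual_class_hom UPZ_monom_closed UPZ_monom_closed])
      also have "\<dots> \<in> ?G"
      proof -
        have o: "dual_class (up_ring.monom (UP \<Z>) 1 0) = dual_basis False"
          using PZ.monom_one by (simp add: dual_basis_def dual_one)
        have t: "dual_class (up_ring.monom (UP \<Z>) 1 1) = dual_basis True"
          by (simp add: dual_basis_def dual_gen)
        have i: "dual_basis x [^]\<^bsub>add_monoid dual_ring\<^esub> (k :: int) \<in> ?G" for x k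
          by (rule int_pow_in_subgroup[OF gA G generate.incl]) simp
        have "(0::nat) < 2" "(1::nat) < 2" by simp_all
        then have "dual_class (up_ring.monom (UP \<Z>) (p 0) 0) \<in> ?G"
          "dual_class (up_ring.monom (UP \<Z>) (p 1) 1) \<in> ?G"
          using dual_pow[of 0 "p 0"] dual_pow[of 1 "p 1"] i by (simp_all only: o t)
        then show ?thesis using subgroup.m_closed[OF G] by simp
      qed
      finally show "x \<in> generate (graded_dual d) (dual_basis ` UNIV)" by (simp add: graded_dual_def)
    qed
  qed simp
  interpret B: free_basis "graded_dual d" UNIV dual_basis dual_coord by (rule B)
  show ?thesis
  proof (rule free_bigraded.intro[OF B free_bigraded_axioms.intro])
    fix e
    let ?P = "(if e = (0, 0) then {\<one>\<^bsub>dual_ring\<^esub>} else {}) \<union> (if e = d then {dual_gen} else {})"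
    have "grade (graded_dual d) e = generate (graded_dual d) ?P" by (simp add: graded_dual_def)
    also have "\<dots> = {m \<in> carrier (graded_dual d). \<forall>x\<in>UNIV. (if x then d else 0) \<noteq> e \<longrightarrow> dual_coord x m = 0}"
    proof (rule B.generate_eq_zeros)
      fix m assume "m \<in> ?P"
      then consider "e = 0" "m = \<one>\<^bsub>dual_ring\<^esub>" | "e = d" "m = dual_gen"
        by (auto simp: zero_prod_def split: if_splits)
      then show "m \<in> carrier (graded_dual d) \<and> (\<forall>x\<in>UNIV. (if x then d else 0) \<noteq> e \<longrightarrow> dual_coord x m = 0)"
        by cases (auto simp: dual_gen_closed dual_coord_def dual_coeff_one dual_coeff_gen)
    next
      fix x assume "(if x then d else 0) = e"
      then have "dual_basis x \<in> ?P" by (auto simp: dual_basis_def zero_prod_def)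
      then show "dual_basis x \<in> generate (graded_dual d) ?P" by (rule generate.incl)
    qed
    finally show "grade (graded_dual d) e =
      {m \<in> carrier (graded_dual d). \<forall>x\<in>UNIV. (if x then d else 0) \<noteq> e \<longrightarrow> dual_coord x m = 0}" .
  qed
qed

lemma graded_dual_one: "\<one>\<^bsub>dual_ring\<^esub> \<in> grade (graded_dual d) 0"
  using free_bigraded.b_grade[OF free_bigraded_dual, of False d] by (simp add: dual_basis_def)

lemma graded_dual_iff:
  "x \<in> grade (graded_dual d) e \<longleftrightarrow>
     x \<in> carrier dual_ring \<and> (e \<noteq> 0 \<longrightarrow> dual_coeff 0 x = 0) \<and> (e \<noteq> d \<longrightarrow> dual_coeff 1 x = 0)"
proof -
  have "x \<in> grade (graded_dual d) e \<longleftrightarrow>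
      x \<in> carrier dual_ring \<and> (\<forall>b. (if b then d else 0) \<noteq> e \<longrightarrow> dual_coord b x = 0)"
    by (simp add: free_bigraded.grade_eq[OF free_bigraded_dual])
  also have "(\<forall>b. (if b then d else 0) \<noteq> e \<longrightarrow> dual_coord b x = 0) \<longleftrightarrow>
      (e \<noteq> 0 \<longrightarrow> dual_coeff 0 x = 0) \<and> (e \<noteq> d \<longrightarrow> dual_coeff 1 x = 0)"
    by (auto simp: dual_coord_def all_bool_eq)
  finally show ?thesis .
qed

text \<open>Coefficient 0 of a product needs both coefficients 0, and coefficient 1 needs one of
  each kind. No product of two coefficients 1 occurs because the square of the generator
  vanishes.\<close>

lemma graded_dual_mult:
  assumes x: "x \<in> grade (graded_dual d) e" and y: "y \<in> grade (graded_dual d) f"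
  shows "x \<otimes>\<^bsub>dual_ring\<^esub> y \<in> grade (graded_dual d) (e + f)"
proof -
  have xy: "x \<in> carrier dual_ring" "y \<in> carrier dual_ring" using x y by (simp_all add: graded_dual_iff)
  have "dual_coeff 0 x * dual_coeff 0 y = 0" if "e + f \<noteq> 0"
  proof -
    have "e \<noteq> 0 \<or> f \<noteq> 0" using that by auto
    then show ?thesis using x y unfolding graded_dual_iff by auto
  qed
  moreover have "dual_coeff 0 x * dual_coeff 1 y + dual_coeff 1 x * dual_coeff 0 y = 0" if "e + f \<noteq> d"
  proof -
    have "e \<noteq> 0 \<or> f \<noteq> d" "e \<noteq> d \<or> f \<noteq> 0" using that by auto
    then show ?thesis using x y unfolding graded_dual_iff by auto
  qed
  ultimately show ?thesis
    unfolding graded_dual_iff using xy dual_coeff_mult[OF xy] by simp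
qed

text \<open>A homomorphism on A is determined by its values on 1 and on the generator, which makes
  the description unique; the restriction to the carrier is needed only for extensionality.\<close>

lemma eta_A_eq:
  assumes x: "x \<in> carrier dual_ring"
  shows "eta_A x = dual_coeff 0 x"
proof -
  interpret A: free_bigraded alg_A UNIV dual_basis dual_coord "\<lambda>x. if x then (1, 0) else 0"
    unfolding alg_A_def by (rule free_bigraded_dual)
  let ?P = "\<lambda>h. h \<in> hom alg_A integer_group \<and> h \<in> extensional (carrier alg_A) \<and>
                   h \<one>\<^bsub>dual_ring\<^esub> = 1 \<and> h dual_gen = 0"
  let ?h = "restrict (dual_coeff 0) (carrier alg_A)"
  have ca: "carrier alg_A = carrier dual_ring" by (simp add: alg_A_def)
  have h0: "dual_coeff 0 \<in> hom alg_A integer_group" unfolding alg_A_def by (rule dual_coeff_hom) simp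
  have h: "?P ?h"
  proof (intro conjI)
    show "?h \<in> hom alg_A integer_group" by (rule A.hom_restrict[OF h0]) simp
  qed (simp_all add: ca dual_gen_closed dual_coeff_one dual_coeff_gen)
  have "eta_A = ?h"
    unfolding eta_A_def
  proof (rule the_equality[where P = ?P, OF h])
    fix k assume k: "?P k"
    show "k = ?h"
    proof (rule extensionalityI[of _ "carrier alg_A"])
      fix y assume y: "y \<in> carrier alg_A"
      have "k y = ?h y"
      proof (rule hom_ext_generate[OF A.is_group group_integer_group conjunct1[OF k] conjunct1[OF h], where B = "dual_basis ` UNIV"])
        show "k z = ?h z" if "z \<in> dual_basis ` UNIV" for z
          using that k h by (auto simp: dual_basis_def)
      qed (use y A.gen A.b_closed in auto)
      then show "k y = ?h y" .
    qed (use k h in auto)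
  qed
  then have "eta_A x = ?h x" by (rule arg_cong)
  then show ?thesis using x ca by simp
qed

lemma eta_A_hom: "eta_A \<in> hom alg_A integer_group"
proof (rule homI)
  fix x y assume "x \<in> carrier alg_A" "y \<in> carrier alg_A"
  then have "x \<in> carrier dual_ring" "y \<in> carrier dual_ring" by (simp_all add: alg_A_def)
  then show "eta_A (x \<otimes>\<^bsub>alg_A\<^esub> y) = eta_A x \<otimes>\<^bsub>integer_group\<^esub> eta_A y"
    by (simp add: eta_A_eq alg_A_def dual_coeff_add)
qed simp

lemma eta_A_one: "eta_A \<one>\<^bsub>dual_ring\<^esub> = 1"
  by (simp add: eta_A_eq dual_coeff_one)

lemma eta_A_grade: "x \<in> grade alg_A e \<Longrightarrow> e \<noteq> 0 \<Longrightarrow> eta_A x = 0"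
  unfolding alg_A_def graded_dual_iff by (simp add: eta_A_eq)

section \<open>Spanning subgraphs\<close>

locale fin_graph =
  fixes G :: "('v, 'e) multigraph"
  assumes fg: "finite_graph G"
begin

abbreviation V where "V \<equiv> verts G"

lemma finite_V: "finite V" and finite_E: "finite (edges G)"
  using fg by (simp_all add: finite_graph_def)

lemma endpoints_ends:
  assumes "e \<in> edges G"
  shows "ends G e = {fst (endpoints G e), snd (endpoints G e)}"
proof -
  have "card (ends G e) \<in> {1, 2}" using fg assms by (auto simp: finite_graph_def)
  then have "\<exists>p. ends G e = {fst p, snd p}"
  proof (elim insertE emptyE)
    assume "card (ends G e) = 1"
    then obtain x where "ends G e = {x}" by (rule card_1_singletonE)
    then show ?thesis by (intro exI[of _ "(x, x)"]) simp
  next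
    assume "card (ends G e) = 2"
    then obtain x y where "ends G e = {x, y}" by (auto simp: card_2_iff)
    then show ?thesis by (intro exI[of _ "(x, y)"]) simp
  qed
  then show ?thesis unfolding endpoints_def by (rule someI_ex)
qed

lemma endpoints_V: "e \<in> edges G \<Longrightarrow> fst (endpoints G e) \<in> V \<and> snd (endpoints G e) \<in> V"
  using endpoints_ends[of e] fg by (auto simp: finite_graph_def)

lemma reachable_refl: "x \<in> V \<Longrightarrow> (x, x) \<in> reachable G S"
  by (simp add: reachable_def)

lemma reachable_V: "(x, y) \<in> reachable G S \<Longrightarrow> x \<in> V \<and> y \<in> V"
  by (simp add: reachable_def)

lemma reachable_trans: "(x, y) \<in> reachable G S \<Longrightarrow> (y, z) \<in> reachable G S \<Longrightarrow> (x, z) \<in> reachable G S"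
  by (auto simp: reachable_def)

lemma reachable_sym: "(x, y) \<in> reachable G S \<Longrightarrow> (y, x) \<in> reachable G S"
proof -
  have "sym {(x, y). \<exists>e\<in>S. ends G e = {x, y}}" by (auto intro!: symI simp: insert_commute)
  then show "(x, y) \<in> reachable G S \<Longrightarrow> (y, x) \<in> reachable G S"
    using sym_rtrancl by (auto simp: reachable_def dest: symD)
qed

lemma reachable_mono: "S \<subseteq> S' \<Longrightarrow> (x, y) \<in> reachable G S \<Longrightarrow> (x, y) \<in> reachable G S'"
  using rtrancl_mono[of "{(x, y). \<exists>e\<in>S. ends G e = {x, y}}" "{(x, y). \<exists>e\<in>S'. ends G e = {x, y}}"]
  by (auto simp: reachable_def)

lemma reachable_edge:
  assumes "e \<in> S" "S \<subseteq> edges G"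
  shows "(fst (endpoints G e), snd (endpoints G e)) \<in> reachable G S"
proof -
  have e: "e \<in> edges G" using assms by auto
  have "(fst (endpoints G e), snd (endpoints G e)) \<in> {(x, y). \<exists>e\<in>S. ends G e = {x, y}}"
    unfolding mem_Collect_eq prod.case using endpoints_ends[OF e] assms(1) by (rule bexI)
  then show ?thesis using endpoints_V[OF e] by (simp add: reachable_def r_into_rtrancl mem_Times_iff)
qed

lemma reachable_induct [consumes 2, case_names refl step]:
  assumes r: "(x, y) \<in> reachable G S" and S: "S \<subseteq> edges G"
    and refl: "x \<in> V \<Longrightarrow> P x"
    and step: "\<And>y z e. (x, y) \<in> reachable G S \<Longrightarrow> P y \<Longrightarrow> e \<in> S \<Longrightarrow> ends G e = {y, z} \<Longrightarrow>
      y \<in> V \<Longrightarrow> z \<in> V \<Longrightarrow> P z"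
  shows "P y"
proof -
  have xV: "x \<in> V" and r: "(x, y) \<in> {(x, y). \<exists>e\<in>S. ends G e = {x, y}}\<^sup>*"
    using r by (auto simp: reachable_def)
  from r have "(x, y) \<in> reachable G S \<and> P y"
  proof (induction rule: rtrancl_induct)
    case base
    then show ?case using refl[OF xV] reachable_refl[OF xV] by simp
  next
    case (step y z)
    then obtain e where e: "e \<in> S" "ends G e = {y, z}" by auto
    then have yz: "y \<in> V" "z \<in> V" using S fg by (auto simp: finite_graph_def subset_iff)
    have "(y, z) \<in> reachable G S" using e yz by (auto simp: reachable_def)
    then show ?case using step e yz assms(4) reachable_trans by blast
  qed
  then show ?thesis by simp
qed

lemma mem_component: "y \<in> component_of G S x \<longleftrightarrow> (x, y) \<in> reachable G S"
  by (simp add: component_of_def)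

lemma component_self: "x \<in> V \<Longrightarrow> x \<in> component_of G S x"
  by (simp add: mem_component reachable_refl)

lemma component_subset: "component_of G S x \<subseteq> V"
  using reachable_V by (auto simp: mem_component)

lemma component_eq_iff:
  assumes "x \<in> V"
  shows "component_of G S x = component_of G S y \<longleftrightarrow> (x, y) \<in> reachable G S"
proof
  assume "component_of G S x = component_of G S y"
  then have "(y, x) \<in> reachable G S" using component_self[OF assms] mem_component by blast
  then show "(x, y) \<in> reachable G S" by (rule reachable_sym)
next
  assume "(x, y) \<in> reachable G S"
  then show "component_of G S x = component_of G S y"
    using reachable_trans reachable_sym unfolding set_eq_iff mem_component by blast
qed

lemma components_image: "components G S = component_of G S ` V"
  by (auto simp: components_def quotient_def component_of_def)

lemma finite_components: "finite (components G S)"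
  using finite_V by (simp add: components_image)

lemma component_in: "x \<in> V \<Longrightarrow> component_of G S x \<in> components G S"
  by (simp add: components_image)

lemma component_eqI: "C \<in> components G S \<Longrightarrow> x \<in> C \<Longrightarrow> C = component_of G S x"
proof -
  assume "C \<in> components G S" and x: "x \<in> C"
  then obtain y where y: "y \<in> V" "C = component_of G S y" by (auto simp: components_image)
  then show "C = component_of G S x" using component_eq_iff[OF y(1), of S x] x mem_component by blast
qed

lemma component_nonempty: "C \<in> components G S \<Longrightarrow> \<exists>x\<in>V. x \<in> C \<and> C = component_of G S x"
  using component_self by (auto simp: components_image)

lemma components_disjoint:
  assumes "C \<in> components G S" "D \<in> components G S" "x \<in> C" "x \<in> D"
  shows "C = D"
  using component_eqI[OF assms(1,3)] component_eqI[OF assms(2,4)] by simp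

lemma component_refines: "S \<subseteq> S' \<Longrightarrow> component_of G S x \<subseteq> component_of G S' x"
  using reachable_mono by (auto simp: mem_component)

text \<open>If C is a component of a larger spanning subgraph, these are the components of [G:S]
  that unite to C, that is, the fibre over C of the map between the sets of components.\<close>

definition parts :: "'e set \<Rightarrow> 'v set \<Rightarrow> 'v set set" where
  "parts S C = {c \<in> components G S. c \<subseteq> C}"

lemma parts_self: "C \<in> components G S \<Longrightarrow> parts S C = {C}"
proof -
  assume C: "C \<in> components G S"
  have "c = C" if "c \<in> components G S" "c \<subseteq> C" for c
    using component_nonempty[OF that(1)] components_disjoint[OF that(1) C] that(2) by blast
  then show ?thesis using C by (auto simp: parts_def)
qed

context
  fixes S e
  assumes S: "S \<subseteq> edges G" and e: "e \<in> edges G"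
begin

text \<open>A walk either stays in [G:S] or crosses the new edge, and from then on it remains in the
  union of the components of the two ends. Loops and edges inside one component need no separate
  treatment.\<close>

lemma reachable_insert:
  "(x, y) \<in> reachable G (insert e S) \<longleftrightarrow> (x, y) \<in> reachable G S \<or>
    x \<in> component_of G S (fst (endpoints G e)) \<union> component_of G S (snd (endpoints G e)) \<and>
    y \<in> component_of G S (fst (endpoints G e)) \<union> component_of G S (snd (endpoints G e))"
  (is "_ \<longleftrightarrow> _ \<or> x \<in> ?E \<and> y \<in> ?E")
proof -
  let ?u = "fst (endpoints G e)" and ?v = "snd (endpoints G e)"
  have uv: "?u \<in> V" "?v \<in> V" using endpoints_V[OF e] by auto
  have S': "insert e S \<subseteq> edges G" using S e by simp
  have cl: "z \<in> ?E" if "y \<in> ?E" "(y, z) \<in> reachable G S" for y z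
    using that reachable_trans by (auto simp: mem_component)
  show ?thesis
  proof
    assume "(x, y) \<in> reachable G (insert e S)"
    then show "(x, y) \<in> reachable G S \<or> x \<in> ?E \<and> y \<in> ?E"
      using S'
    proof (induction rule: reachable_induct)
      case refl
      then show ?case by (simp add: reachable_refl)
    next
      case (step y z f)
      show ?case
      proof (cases "f \<in> S")
        case True
        then have "(y, z) \<in> reachable G S" using step.hyps by (auto simp: reachable_def)
        then show ?thesis using step.IH reachable_trans cl by blast
      next
        case False
        \<comment> \<open>An edge outside S must be e, so y and z are its ends in one of the two
          orders, possibly equal.\<close>
        then have "{y, z} = {?u, ?v}" using step.hyps endpoints_ends[OF e] by auto
        then have yz: "y \<in> ?E" "z \<in> ?E" using uv component_self by (auto simp: doubleton_eq_iff)
        have "x \<in> ?E" using step.IH cl[OF yz(1)] reachable_sym by blast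
        then show ?thesis using yz by simp
      qed
    qed
  next
    assume "(x, y) \<in> reachable G S \<or> x \<in> ?E \<and> y \<in> ?E"
    then show "(x, y) \<in> reachable G (insert e S)"
    proof
      assume "(x, y) \<in> reachable G S"
      then show ?thesis by (rule reachable_mono[OF subset_insertI])
    next
      assume xy: "x \<in> ?E \<and> y \<in> ?E"
      have uv': "(?u, ?v) \<in> reachable G (insert e S)" by (rule reachable_edge[OF insertI1 S'])
      have "(?u, z) \<in> reachable G (insert e S)" if "z \<in> ?E" for z
        using that reachable_mono[OF subset_insertI] reachable_trans[OF uv'] by (auto simp: mem_component)
      then show ?thesis using xy reachable_trans reachable_sym by blast
    qed
  qed
qed

lemma component_insert:
  "component_of G (insert e S) x =
    (if x \<in> component_of G S (fst (endpoints G e)) \<union> component_of G S (snd (endpoints G e))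
     then component_of G S (fst (endpoints G e)) \<union> component_of G S (snd (endpoints G e))
     else component_of G S x)"
  (is "_ = (if x \<in> ?E then ?E else _)")
proof -
  have "z \<in> ?E" if "x \<in> ?E" "(x, z) \<in> reachable G S" for z
    using that reachable_trans by (auto simp: mem_component)
  then show ?thesis
    unfolding set_eq_iff mem_component[of _ "insert e S"] reachable_insert by (auto simp: mem_component)
qed

lemma component_endpoint_eq:
  "y \<in> component_of G S x \<Longrightarrow> component_of G S y = component_of G S x"
  using component_eq_iff[of x S y] reachable_V[of x y S] by (simp add: mem_component)

lemma components_insert_same:
  assumes "component_of G S (fst (endpoints G e)) = component_of G S (snd (endpoints G e))"
  shows "components G (insert e S) = components G S"
proof -
  have "component_of G (insert e S) x = component_of G S x" for x
    unfolding component_insert using assms component_endpoint_eq by auto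
  then show ?thesis by (simp add: components_image)
qed

lemma components_insert_different:
  assumes ne: "component_of G S (fst (endpoints G e)) \<noteq> component_of G S (snd (endpoints G e))"
  shows "components G (insert e S) = components G S -
      {component_of G S (fst (endpoints G e)), component_of G S (snd (endpoints G e))} \<union>
      {component_of G S (fst (endpoints G e)) \<union> component_of G S (snd (endpoints G e))}"
    and "C \<in> components G (insert e S) \<Longrightarrow> parts S C =
      (if C = component_of G S (fst (endpoints G e)) \<union> component_of G S (snd (endpoints G e))
       then {component_of G S (fst (endpoints G e)), component_of G S (snd (endpoints G e))} else {C})"
proof -
  let ?u = "fst (endpoints G e)" and ?v = "snd (endpoints G e)"
  let ?A = "component_of G S ?u" and ?B = "component_of G S ?v"
  have uv: "?u \<in> V" "?v \<in> V" using endpoints_V[OF e] by auto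
  have AB: "?A \<in> components G S" "?B \<in> components G S" using uv component_in by auto
  show 1: "components G (insert e S) = components G S - {?A, ?B} \<union> {?A \<union> ?B}"
  proof (intro equalityI subsetI)
    fix C assume "C \<in> components G (insert e S)"
    then obtain x where x: "x \<in> V" "C = component_of G (insert e S) x" by (auto simp: components_image)
    show "C \<in> components G S - {?A, ?B} \<union> {?A \<union> ?B}"
    proof (cases "x \<in> ?A \<union> ?B")
      case True
      then show ?thesis unfolding x(2) component_insert by simp
    next
      case False
      then have C: "C = component_of G S x" unfolding x(2) component_insert by simp
      have "x \<in> C" using component_self[OF x(1)] C by simp
      then have "C \<noteq> ?A" "C \<noteq> ?B" using False by auto
      then show ?thesis using component_in[OF x(1)] C by simp
    qed
  next
    fix C assume C: "C \<in> components G S - {?A, ?B} \<union> {?A \<union> ?B}"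
    show "C \<in> components G (insert e S)"
    proof (cases "C = ?A \<union> ?B")
      case True
      have "?u \<in> ?A" by (rule component_self[OF uv(1)])
      then have "C = component_of G (insert e S) ?u" unfolding component_insert True by simp
      then show ?thesis using component_in[OF uv(1)] by simp
    next
      case False
      then have C': "C \<in> components G S" "C \<noteq> ?A" "C \<noteq> ?B" using C by auto
      obtain x where x: "x \<in> V" "x \<in> C" "C = component_of G S x" using component_nonempty[OF C'(1)] by auto
      have "x \<notin> ?A \<union> ?B" using C' components_disjoint[OF C'(1) AB(1) x(2)] components_disjoint[OF C'(1) AB(2) x(2)] by auto
      then have "C = component_of G (insert e S) x" unfolding component_insert using x(3) by simp
      then show ?thesis using component_in[OF x(1)] by simp
    qed
  qed
  assume C: "C \<in> components G (insert e S)"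
  show "parts S C = (if C = ?A \<union> ?B then {?A, ?B} else {C})"
  proof (cases "C = ?A \<union> ?B")
    case True
    have "c = ?A \<or> c = ?B" if c: "c \<in> components G S" "c \<subseteq> ?A \<union> ?B" for c
    proof -
      obtain x where "x \<in> c" using component_nonempty[OF c(1)] by auto
      then show ?thesis
        using c components_disjoint[OF c(1) AB(1), of x] components_disjoint[OF c(1) AB(2), of x] by auto
    qed
    then have "parts S C = {?A, ?B}" using True AB by (auto simp: parts_def)
    then show ?thesis using True by simp
  next
    case False
    then have "C \<in> components G S" using C unfolding 1 by auto
    then show ?thesis using False parts_self by simp
  qed
qed

end

end

section \<open>Betti numbers\<close>

lemma has_rank_free_Abelian:
  assumes fin: "finite X"
  shows "has_rank (free_Abelian_group X) (card X)"
proof (rule has_rank_qbasis)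
  let ?F = "free_Abelian_group X"
  note F = abelian_free_Abelian_group[of X]
  interpret F: comm_group ?F by (rule F)
  have b: "frag_of \<in> X \<rightarrow> carrier ?F" by auto
  show "qbasis ?F frag_of X"
  proof (rule qbasisI_coord[OF F fin b, where c = "\<lambda>x m. of_int (Poly_Mapping.lookup m x)"])
    show "(\<lambda>m. of_int (Poly_Mapping.lookup m x)) \<in> hom ?F rat_group" for x
      by (rule homI) (simp_all add: lookup_add)
    fix m assume m: "m \<in> carrier ?F"
    note sub = subgroup_int_combs[OF F b]
    interpret R: subgroup "range (int_comb ?F frag_of X)" ?F by (rule sub)
    have "Poly_Mapping.keys m \<subseteq> X \<and> m \<in> range (int_comb ?F frag_of X)"
      using m[unfolded carrier_free_Abelian_group_iff]
    proof (induction rule: frag_induction)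
      case zero
      then show ?case using R.one_closed by simp
    next
      case (one x)
      have "frag_of x = int_comb ?F frag_of X (\<lambda>y. if y = x then 1 else 0)"
        using int_comb_single[OF F b fin one, of 1] one by simp
      then have "frag_of x \<in> range (int_comb ?F frag_of X)" by (simp only: rangeI)
      then show ?case using one by simp
    next
      case (diff x y)
      then have "x \<otimes>\<^bsub>?F\<^esub> inv\<^bsub>?F\<^esub> y \<in> range (int_comb ?F frag_of X)" by (intro R.m_closed R.m_inv_closed) auto
      then show ?case using diff keys_diff[of x y] by auto
    qed
    then obtain a where "m = int_comb ?F frag_of X a" by auto
    then show "\<exists>k a. k \<noteq> 0 \<and> m [^]\<^bsub>?F\<^esub> (k::int) = int_comb ?F frag_of X a"
      using m F.int_pow_1[OF m] by (intro exI[of _ "1::int"] exI[of _ a]) simp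
  qed (auto simp: lookup_frag_of)
qed

lemma frag_extend_hom:
  assumes "\<And>x. x \<in> X \<Longrightarrow> Poly_Mapping.keys (f x) \<subseteq> Y"
  shows "frag_extend f \<in> hom (free_Abelian_group X) (free_Abelian_group Y)"
proof (rule homI)
  fix x assume "x \<in> carrier (free_Abelian_group X)"
  then show "frag_extend f x \<in> carrier (free_Abelian_group Y)"
    using keys_frag_extend[of f x] assms by auto
qed (simp add: frag_extend_add)

context fin_graph
begin

text \<open>Euler's relation for [G:S]. Rank-nullity is applied to the boundary map and to the map
  from vertices to components; the two counts are linked because the image of the first map is the
  kernel of the second.\<close>

lemma betti1_rank:
  assumes S: "S \<subseteq> edges G"
  shows "betti1 G S + card V = card S + betti0 G S"
proof -
  let ?S = "free_Abelian_group S" and ?V = "free_Abelian_group V" and ?C = "free_Abelian_group (components G S)"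
  let ?d = "boundary G" and ?co = "component_of G S"
  have finS: "finite S" using S finite_E finite_subset by blast
  have d1: "?d (frag_of e) = frag_of (snd (endpoints G e)) - frag_of (fst (endpoints G e))" for e
    by (simp add: boundary_def)
  have dh: "?d \<in> hom ?S ?V"
    unfolding boundary_def
  proof (rule frag_extend_hom)
    fix e assume "e \<in> S"
    then have "fst (endpoints G e) \<in> V" "snd (endpoints G e) \<in> V" using endpoints_V S by auto
    then show "Poly_Mapping.keys (frag_of (snd (endpoints G e)) - frag_of (fst (endpoints G e))) \<subseteq> V"
      by (auto dest!: subsetD[OF keys_diff])
  qed
  interpret dS: comm_group ?S by (rule abelian_free_Abelian_group)
  interpret dV: comm_group ?V by (rule abelian_free_Abelian_group)
  interpret d: group_hom ?S ?V ?d by unfold_locales (rule dh)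
  define I where "I = ?d ` carrier ?S"
  have I: "subgroup I ?V" unfolding I_def by (rule d.img_is_subgroup)
  interpret I: subgroup I ?V by (rule I)
  let ?N = "sub_rec ?V I"
  have N: "comm_group ?N" by (rule sub_rec_comm[OF abelian_free_Abelian_group I])
  have dN: "?d \<in> hom ?S ?N"
    by (rule homI) (use d.hom_mult in \<open>auto simp: I_def simp del: carrier_free_Abelian_group_iff\<close>)
  have "?d ` carrier ?S = carrier ?N" by (simp add: I_def)
  from has_rank_nullity[OF has_rank_free_Abelian[OF finS] N dN this]
  obtain k l where k: "has_rank ?N k" and l: "has_rank (?S\<lparr>carrier := kernel ?S ?N ?d\<rparr>) l" and kl: "k + l = card S"
    by auto
  have "kernel ?S ?N ?d = kernel ?S ?V ?d" by (simp add: kernel_def)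
  then have b1: "betti1 G S = l"
    using has_rank_rank(1)[OF l] by (simp add: betti1_def homology1_def)
  let ?g = "frag_extend (\<lambda>v. frag_of (?co v))"
  have gh: "?g \<in> hom ?V ?C" by (rule frag_extend_hom) (use component_in in auto)
  interpret dC: comm_group ?C by (rule abelian_free_Abelian_group)
  interpret g: group_hom ?V ?C ?g by unfold_locales (rule gh)
  have gs: "?g ` carrier ?V = carrier ?C"
  proof (intro equalityI subsetI)
    fix w assume "w \<in> carrier ?C"
    then have "Poly_Mapping.keys w \<subseteq> components G S" by simp
    then have "Poly_Mapping.keys w \<subseteq> components G S \<and> (\<exists>m. Poly_Mapping.keys m \<subseteq> V \<and> ?g m = w)"
    proof (induction rule: frag_induction)
      case zero
      then show ?case by (auto intro!: exI[of _ 0])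
    next
      case (one C)
      then obtain x where "x \<in> V" "C = ?co x" by (auto simp: components_image)
      then show ?case using one by (auto intro!: exI[of _ "frag_of x"])
    next
      case (diff a b)
      then obtain m n where mn: "Poly_Mapping.keys m \<subseteq> V" "?g m = a" "Poly_Mapping.keys n \<subseteq> V" "?g n = b" by auto
      have "Poly_Mapping.keys (m - n) \<subseteq> V \<and> ?g (m - n) = a - b"
        using mn keys_diff[of m n] by (auto simp: frag_extend_diff)
      then show ?case using diff keys_diff[of a b] by blast
    qed
    then obtain m where "Poly_Mapping.keys m \<subseteq> V" "?g m = w" by auto
    then show "w \<in> ?g ` carrier ?V" by auto
  qed (use g.hom_closed in blast)
  have diff_I: "x - y \<in> I" if "x \<in> I" "y \<in> I" for x y
    using I.m_closed[OF that(1) I.m_inv_closed[OF that(2)]] I.mem_carrier[OF that(2)] by simp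
  \<comment> \<open>Along a walk the differences of consecutive vertices are boundaries up to sign,
    and they telescope.\<close>
  have reach_I: "frag_of x - frag_of y \<in> I" if "(x, y) \<in> reachable G S" for x y
    using that S
  proof (induction rule: reachable_induct)
    case refl
    then show ?case using I.one_closed by simp
  next
    case (step y z e)
    have "?d (frag_of e) \<in> I" unfolding I_def using step.hyps by (intro imageI) simp
    then have de: "frag_of (snd (endpoints G e)) - frag_of (fst (endpoints G e)) \<in> I" unfolding d1 .
    have "{y, z} = {fst (endpoints G e), snd (endpoints G e)}"
      using step.hyps S endpoints_ends[of e] by auto
    then have "frag_of z - frag_of y \<in> I"
      using de diff_I[OF I.one_closed de] by (auto simp: doubleton_eq_iff)
    from diff_I[OF step.IH this] show ?case by simp
  qed
  \<comment> \<open>r selects one vertex in each component. A chain m and the chain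
    \<open>r (?g m)\<close> differ by differences of vertices of the same component, so they agree
    modulo boundaries.\<close>
  define r where "r = frag_extend (\<lambda>C. frag_of (SOME x. x \<in> C) :: 'v \<Rightarrow>\<^sub>0 int)"
  have "kernel ?V ?C ?g = I"
  proof (intro equalityI subsetI)
    fix m assume m: "m \<in> kernel ?V ?C ?g"
    then have "Poly_Mapping.keys m \<subseteq> V" by (simp add: kernel_def)
    then have "Poly_Mapping.keys m \<subseteq> V \<and> m - r (?g m) \<in> I"
    proof (induction rule: frag_induction)
      case zero
      then show ?case using I.one_closed by (simp add: r_def)
    next
      case (one x)
      have "(SOME y. y \<in> ?co x) \<in> ?co x" using component_self[OF one] by (rule someI)
      then show ?case using one reach_I by (simp add: r_def mem_component)
    next
      case (diff a b)
      have "a - b - r (?g (a - b)) = (a - r (?g a)) - (b - r (?g b))"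
        by (simp add: r_def frag_extend_diff)
      also have "\<dots> \<in> I" by (rule diff_I) (use diff in simp_all)
      finally show ?case using diff keys_diff[of a b] by auto
    qed
    moreover have "r (?g m) = 0" using m by (simp add: kernel_def r_def)
    ultimately show "m \<in> I" by simp
  next
    fix m assume m: "m \<in> I"
    then obtain c where c: "Poly_Mapping.keys c \<subseteq> S" "m = ?d c" by (auto simp: I_def)
    from c(1) have "Poly_Mapping.keys c \<subseteq> S \<and> ?g (?d c) = 0"
    proof (induction rule: frag_induction)
      case zero
      then show ?case by (simp add: boundary_def)
    next
      case (one e)
      then have "?co (fst (endpoints G e)) = ?co (snd (endpoints G e))"
        using component_eq_iff[of "fst (endpoints G e)" S "snd (endpoints G e)"] reachable_edge[OF one S] endpoints_V[of e] S by auto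
      then show ?case using one by (simp add: d1 frag_extend_diff)
    next
      case (diff a b)
      then show ?case using keys_diff[of a b] by (auto simp: boundary_def frag_extend_diff)
    qed
    then show "m \<in> kernel ?V ?C ?g" using c(2) I.mem_carrier[OF m] by (simp add: kernel_def)
  qed
  then obtain k' l' where k': "has_rank ?C k'" and l': "has_rank (?V\<lparr>carrier := I\<rparr>) l'" and kl': "k' + l' = card V"
    using has_rank_nullity[OF has_rank_free_Abelian[OF finite_V] abelian_free_Abelian_group gh gs] by auto
  have "has_rank ?N l'" using l' by (subst (asm) has_rank_same[of _ ?N]) simp_all
  then have "l' = k" using k by (rule has_rank_unique)
  moreover have "k' = betti0 G S"
    unfolding betti0_def by (rule has_rank_unique[OF k' has_rank_free_Abelian[OF finite_components]])
  ultimately show ?thesis using kl kl' b1 by simp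
qed

text \<open>A new edge increases the number of edges by one. The number of components is unchanged
  if the ends were already connected and drops by one otherwise, so Euler's relation decides the
  change of the first Betti number.\<close>

lemma betti_insert:
  assumes S: "S \<subseteq> edges G" and e: "e \<in> edges G" "e \<notin> S"
  shows "component_of G S (fst (endpoints G e)) = component_of G S (snd (endpoints G e)) \<Longrightarrow>
      betti1 G (insert e S) = Suc (betti1 G S)"
    and "component_of G S (fst (endpoints G e)) \<noteq> component_of G S (snd (endpoints G e)) \<Longrightarrow>
      betti1 G (insert e S) = betti1 G S"
proof -
  have finS: "finite S" using S finite_E finite_subset by blast
  have c: "card (insert e S) = Suc (card S)" using finS e by simp
  have S': "insert e S \<subseteq> edges G" using S e by simp
  note f = betti1_rank[OF S] betti1_rank[OF S']
  {
    assume eq: "component_of G S (fst (endpoints G e)) = component_of G S (snd (endpoints G e))"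
    have "betti0 G (insert e S) = betti0 G S"
      unfolding betti0_def components_insert_same[OF S e(1) eq] by (rule refl)
    then show "betti1 G (insert e S) = Suc (betti1 G S)" using f c by simp
  next
    assume ne: "component_of G S (fst (endpoints G e)) \<noteq> component_of G S (snd (endpoints G e))"
    let ?A = "component_of G S (fst (endpoints G e))" and ?B = "component_of G S (snd (endpoints G e))"
    have AB: "?A \<in> components G S" "?B \<in> components G S" using endpoints_V[OF e(1)] component_in by auto
    \<comment> \<open>Were the union already a component, both end components would coincide with
      it.\<close>
    have "?A \<union> ?B \<notin> components G S"
    proof
      assume AuB: "?A \<union> ?B \<in> components G S"
      have "parts S (?A \<union> ?B) = {?A \<union> ?B}" by (rule parts_self[OF AuB])
      then have "?A = ?A \<union> ?B" "?B = ?A \<union> ?B" using AB by (auto simp: parts_def)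
      then show False using ne by simp
    qed
    then have "betti0 G (insert e S) = Suc (card (components G S - {?A, ?B}))"
      unfolding betti0_def components_insert_different(1)[OF S e(1) ne] using finite_components[of S] by simp
    also have "card (components G S - {?A, ?B}) = card (components G S) - 2"
      using AB ne finite_components[of S] by (subst card_Diff_subset) auto
    finally have "Suc (betti0 G (insert e S)) = betti0 G S"
      using card_mono[of "components G S" "{?A, ?B}"] AB ne finite_components[of S] by (simp add: betti0_def)
    then show "betti1 G (insert e S) = betti1 G S" using f c by simp
  }
qed

end

section \<open>Cubes\<close>

definition cube_pos :: "'e list \<Rightarrow> 'e \<Rightarrow> nat" where
  "cube_pos es e = (THE j. j < length es \<and> es ! j = e)"

lemma cube_pos:
  assumes "distinct es" "e \<in> set es"
  shows "cube_pos es e < length es" "es ! cube_pos es e = e"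
proof -
  from theI'[OF distinct_Ex1[OF assms]] show "cube_pos es e < length es" "es ! cube_pos es e = e"
    by (simp_all add: cube_pos_def)
qed

lemma cube_pos_inj:
  assumes "distinct es" "e \<in> set es" "f \<in> set es" "cube_pos es e = cube_pos es f"
  shows "e = f"
proof -
  have "e = es ! cube_pos es e" by (rule cube_pos(2)[OF assms(1,2), symmetric])
  also have "\<dots> = es ! cube_pos es f" unfolding assms(4) by (rule refl)
  also have "\<dots> = f" by (rule cube_pos(2)[OF assms(1,3)])
  finally show ?thesis .
qed

lemma cube_pos_nth:
  assumes d: "distinct es" and i: "i < length es"
  shows "cube_pos es (es ! i) = i"
proof -
  have m: "es ! i \<in> set es" using i by (rule nth_mem)
  show ?thesis
    using nth_eq_iff_index_eq[OF d cube_pos(1)[OF d m] i] cube_pos(2)[OF d m] by (rule iffD1)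
qed

definition cube_below :: "'e list \<Rightarrow> 'e set \<Rightarrow> 'e \<Rightarrow> 'e set" where
  "cube_below es S e = {f \<in> S. cube_pos es f < cube_pos es e}"

text \<open>Counting edges of S instead of positions makes the effect of enlarging S by one edge
  visible.\<close>

lemma cube_sign_eq:
  assumes d: "distinct es" and S: "S \<subseteq> set es" and e: "e \<in> set es"
  shows "cube_sign es S e = (-1) ^ card (cube_below es S e)"
proof -
  have "bij_betw (\<lambda>f. cube_pos es f) (cube_below es S e) {i. i < cube_pos es e \<and> es ! i \<in> S}"
  proof (rule bij_betw_imageI)
    show "inj_on (cube_pos es) (cube_below es S e)"
      using cube_pos_inj[OF d] S by (auto intro!: inj_onI simp: cube_below_def)
    show "cube_pos es ` cube_below es S e = {i. i < cube_pos es e \<and> es ! i \<in> S}"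
    proof (intro equalityI subsetI)
      fix i assume "i \<in> cube_pos es ` cube_below es S e"
      then obtain f where f: "f \<in> S" "cube_pos es f < cube_pos es e" "i = cube_pos es f" by (auto simp: cube_below_def)
      then have "es ! i = f" using cube_pos(2)[OF d] S by auto
      then show "i \<in> {i. i < cube_pos es e \<and> es ! i \<in> S}" using f by simp
    next
      fix i assume i: "i \<in> {i. i < cube_pos es e \<and> es ! i \<in> S}"
      then have "cube_pos es (es ! i) = i" using cube_pos(1)[OF d e] by (intro cube_pos_nth[OF d]) auto
      then show "i \<in> cube_pos es ` cube_below es S e" using i by (auto simp: cube_below_def intro!: image_eqI[of _ _ "es ! i"])
    qed
  qed
  from bij_betw_same_card[OF this] show ?thesis
    unfolding cube_sign_def Let_def cube_pos_def[symmetric] by simp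
qed

lemma cube_below_insert:
  "cube_below es (insert f S) e = (if cube_pos es f < cube_pos es e then insert f (cube_below es S e) else cube_below es S e)"
  by (auto simp: cube_below_def)

text \<open>Of two distinct edges exactly one precedes the other, so enlarging the edge set by the
  respective other edge reverses exactly one of the two signs. Commuting squares of edge maps
  thereby become anticommuting ones.\<close>

lemma cube_sign_swap:
  assumes d: "distinct es" and S: "S \<subseteq> set es" and e: "e \<in> set es - S" and f: "f \<in> set es - S" and ne: "e \<noteq> f"
  shows "cube_sign es (insert f S) e * cube_sign es S f = - (cube_sign es (insert e S) f * cube_sign es S e)"
proof -
  have fin: "finite S" using S finite_subset by blast
  then have fb: "finite (cube_below es S x)" for x by (simp add: cube_below_def)
  have ni: "f \<notin> cube_below es S e" "e \<notin> cube_below es S f" using e f by (auto simp: cube_below_def)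
  have "cube_pos es e \<noteq> cube_pos es f" using cube_pos_inj[OF d, of e f] e f ne by auto
  then consider "cube_pos es f < cube_pos es e" | "cube_pos es e < cube_pos es f" by linarith
  then show ?thesis
    using S e f fb ni by cases (simp_all add: cube_sign_eq[OF d] cube_below_insert)
qed

lemma minus_one_power_card:
  "finite S \<Longrightarrow> (-1) ^ card {f \<in> S. P f} = (\<Prod>f\<in>S. if P f then -1 else 1 :: int)"
proof (induction S rule: finite_induct)
  case (insert x S)
  have "{f \<in> insert x S. P f} = (if P x then insert x {f \<in> S. P f} else {f \<in> S. P f})" by auto
  then show ?case using insert by (simp add: insert.IH[symmetric])
qed simp

text \<open>The sign of the permutation of S that h induces: one factor -1 for every pair that h
  reorders.\<close>

definition reorder_sign :: "'e list \<Rightarrow> 'x list \<Rightarrow> ('e \<Rightarrow> 'x) \<Rightarrow> 'e set \<Rightarrow> int" where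
  "reorder_sign es es' h S = (\<Prod>a\<in>S. \<Prod>b\<in>S.
     if cube_pos es a < cube_pos es b \<and> cube_pos es' (h b) < cube_pos es' (h a) then -1 else 1)"

text \<open>Here p and q stand for the positions in two orders. For each f in S the factors of the
  pairs (e, f) and (f, e), multiplied by the comparison of f with e in the first order, give the
  comparison in the second order; the remaining pairs form the product over S.\<close>

lemma inversion_sign_insert:
  fixes p q :: "'e \<Rightarrow> nat"
  assumes S: "finite S" "e \<notin> S" and p: "\<And>x. x \<in> S \<Longrightarrow> p x \<noteq> p e" and q: "\<And>x. x \<in> S \<Longrightarrow> q x \<noteq> q e"
  shows "(\<Prod>a\<in>insert e S. \<Prod>b\<in>insert e S. if p a < p b \<and> q b < q a then -1 else 1 :: int) *
      (\<Prod>f\<in>S. if p f < p e then -1 else 1) =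
    (\<Prod>f\<in>S. if q f < q e then -1 else 1) * (\<Prod>a\<in>S. \<Prod>b\<in>S. if p a < p b \<and> q b < q a then -1 else 1)"
proof -
  let ?s = "\<lambda>a b. if p a < p b \<and> q b < q a then -1 else 1 :: int"
  have 1: "(\<Prod>a\<in>insert e S. \<Prod>b\<in>insert e S. ?s a b) =
      (\<Prod>b\<in>S. ?s e b) * ((\<Prod>a\<in>S. ?s a e) * (\<Prod>a\<in>S. \<Prod>b\<in>S. ?s a b))"
    by (simp only: prod.insert[OF S] prod.distrib) simp
  have 2: "(\<Prod>b\<in>S. ?s e b) * (\<Prod>a\<in>S. ?s a e) * (\<Prod>f\<in>S. if p f < p e then -1 else 1) =
      (\<Prod>f\<in>S. if q f < q e then -1 else 1)"
    unfolding prod.distrib[symmetric]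
  proof (rule prod.cong[OF refl])
    fix f assume f: "f \<in> S"
    show "?s e f * ?s f e * (if p f < p e then -1 else 1) = (if q f < q e then -1 else 1)"
      by (cases "p f < p e"; cases "q f < q e") (use p[OF f] q[OF f] in auto)
  qed
  show ?thesis unfolding 1 2[symmetric] by (simp only: mult_ac)
qed

text \<open>This is the identity by which maps that commute with the edge maps become a chain map
  after twisting each summand by \<open>reorder_sign\<close>.\<close>

lemma reorder_sign_insert:
  assumes d: "distinct es" "distinct es'" and S: "S \<subseteq> set es" and e: "e \<in> set es - S"
    and h: "bij_betw h (set es) (set es')"
  shows "reorder_sign es es' h (insert e S) * cube_sign es S e =
    cube_sign es' (h ` S) (h e) * reorder_sign es es' h S"
proof -
  have fin: "finite S" using S finite_subset by blast
  have inj: "inj_on h (set es)" and im: "h ` set es = set es'" using h by (auto simp: bij_betw_def)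
  have p: "cube_pos es x \<noteq> cube_pos es e" and q: "cube_pos es' (h x) \<noteq> cube_pos es' (h e)" if "x \<in> S" for x
  proof -
    have x: "x \<in> set es" "x \<noteq> e" "e \<in> set es" using that S e by auto
    show "cube_pos es x \<noteq> cube_pos es e" using cube_pos_inj[OF d(1) x(1,3)] x(2) by blast
    have "h x \<noteq> h e" using inj_onD[OF inj _ x(1,3)] x(2) by blast
    moreover have "h x \<in> set es'" "h e \<in> set es'" using x im by auto
    ultimately show "cube_pos es' (h x) \<noteq> cube_pos es' (h e)" using cube_pos_inj[OF d(2)] by blast
  qed
  have hS: "h ` S \<subseteq> set es'" and he: "h e \<in> set es'" using S e im by auto
  have injS: "inj_on h S" by (rule inj_on_subset[OF inj S])
  have 1: "cube_sign es S e = (\<Prod>f\<in>S. if cube_pos es f < cube_pos es e then -1 else 1)"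
    unfolding cube_sign_eq[OF d(1) S DiffD1[OF e]] cube_below_def by (rule minus_one_power_card[OF fin])
  have 2: "cube_sign es' (h ` S) (h e) = (\<Prod>f\<in>S. if cube_pos es' (h f) < cube_pos es' (h e) then -1 else 1)"
    unfolding cube_sign_eq[OF d(2) hS he] cube_below_def minus_one_power_card[OF finite_imageI[OF fin]]
    by (rule prod.reindex_cong[OF injS]) auto
  show ?thesis
    unfolding 1 2 reorder_sign_def
    by (rule inversion_sign_insert[where p = "cube_pos es" and q = "\<lambda>x. cube_pos es' (h x)"])
      (use fin e p q in auto)
qed

text \<open>Homomorphisms to the integers separate the elements of a free module, so identities in
  the complex are checked on integer sums.\<close>

lemma hom_int_finprod_pow:
  assumes M: "comm_group M" and k: "k \<in> hom M integer_group" and f: "\<And>x. x \<in> A \<Longrightarrow> f x \<in> carrier M"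
  shows "k (finprod M (\<lambda>x. f x [^]\<^bsub>M\<^esub> (s x :: int)) A) = (\<Sum>x\<in>A. s x * k (f x))"
proof -
  have g: "group M" by (rule comm_group.axioms(2)[OF M])
  have "k (finprod M (\<lambda>x. f x [^]\<^bsub>M\<^esub> s x) A) = (\<Sum>x\<in>A. k (f x [^]\<^bsub>M\<^esub> s x))"
    by (rule hom_integer_finprod[OF M k]) (rule group.int_pow_closed[OF g f])
  also have "\<dots> = (\<Sum>x\<in>A. s x * k (f x))"
    by (intro sum.cong refl hom_integer_pow[OF g k f])
  finally show ?thesis .
qed

definition int_separated :: "('a, 'm) monoid_scheme \<Rightarrow> bool" where
  "int_separated M \<longleftrightarrow> (\<forall>x\<in>carrier M. \<forall>y\<in>carrier M.
     (\<forall>k\<in>hom M integer_group. k x = k y) \<longrightarrow> x = y)"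

lemma int_separatedD:
  assumes "int_separated M" "x \<in> carrier M" "y \<in> carrier M"
    "\<And>k. k \<in> hom M integer_group \<Longrightarrow> k x = k y"
  shows "x = y"
  using assms unfolding int_separated_def by blast

lemma (in free_bigraded) int_separated: "int_separated M"
  unfolding int_separated_def
proof (intro ballI impI)
  fix x y assume "x \<in> carrier M" "y \<in> carrier M" "\<forall>k\<in>hom M integer_group. k x = k y"
  then show "x = y" using c_hom by (intro ext_coord) auto
qed

text \<open>The basis itself is forgotten. Its index set and degrees remain, since they determine
  the graded ranks and hence the Euler characteristic.\<close>

definition free_graded :: "'a bigraded \<Rightarrow> 'x set \<Rightarrow> ('x \<Rightarrow> nat \<times> nat) \<Rightarrow> bool" where
  "free_graded M X dg \<longleftrightarrow> (\<exists>b c. free_bigraded M X b c dg)"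

lemma free_gradedD:
  assumes "free_graded M X dg"
  shows "comm_group M" "int_separated M" "bigraded_module M" "subgroup (grade M n) M" "finite X"
    and "has_rank (graded_part M n) (card {x \<in> X. dg x = n})"
proof -
  obtain b c where "free_bigraded M X b c dg" using assms unfolding free_graded_def by blast
  then interpret free_bigraded M X b c dg .
  show "comm_group M" by (rule comm)
  show "int_separated M" by (rule int_separated)
  show "bigraded_module M" by (rule bigraded)
  show "subgroup (grade M n) M" by (rule grade_subgroup)
  show "finite X" by (rule fin)
  show "has_rank (graded_part M n) (card {x \<in> X. dg x = n})" by (rule has_rank_graded_part)
qed

lemma free_graded_tensor:
  assumes "free_graded M X dg" "free_graded N Y dg'"
  shows "free_graded (tensor M N) (X \<times> Y) (\<lambda>(x, y). dg x + dg' y)"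
proof -
  obtain b c b' c' where "free_bigraded M X b c dg" "free_bigraded N Y b' c' dg'"
    using assms unfolding free_graded_def by blast
  from free_bigraded_tensor[OF this] show ?thesis unfolding free_graded_def by blast
qed

lemma free_graded_tensor_power:
  assumes "free_graded M X dg" "finite I"
  shows "free_graded (tensor_power I M) (I \<rightarrow>\<^sub>E X) (\<lambda>f. \<Sum>i\<in>I. dg (f i))"
proof -
  obtain b c where "free_bigraded M X b c dg" using assms(1) unfolding free_graded_def by blast
  from free_bigraded_tensor_power[OF this assms(2)] show ?thesis unfolding free_graded_def by blast
qed

lemma free_graded_direct_sum:
  assumes I: "finite I" and M: "\<And>i. i \<in> I \<Longrightarrow> free_graded (M i) (X i) (dg i)"
  shows "free_graded (direct_sum I M) (Sigma I X) (\<lambda>(i, x). dg i x)"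
proof -
  have "\<forall>i\<in>I. \<exists>bc. free_bigraded (M i) (X i) (fst bc) (snd bc) (dg i)"
  proof
    fix i assume "i \<in> I"
    then obtain b c where "free_bigraded (M i) (X i) b c (dg i)" using M unfolding free_graded_def by blast
    then have "free_bigraded (M i) (X i) (fst (b, c)) (snd (b, c)) (dg i)" by simp
    then show "\<exists>bc. free_bigraded (M i) (X i) (fst bc) (snd bc) (dg i)" by (rule exI)
  qed
  then obtain bc where bc: "\<forall>i\<in>I. free_bigraded (M i) (X i) (fst (bc i)) (snd (bc i)) (dg i)"
    using bchoice[of I "\<lambda>i bc. free_bigraded (M i) (X i) (fst bc) (snd bc) (dg i)"] by blast
  show ?thesis
    unfolding free_graded_def
    by (rule exI, rule exI,
        rule free_bigraded_direct_sum[OF I, where b = "\<lambda>i. fst (bc i)" and c = "\<lambda>i. snd (bc i)"], rule bspec[OF bc])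
qed

section \<open>Complexes assembled from commuting cubes of free modules\<close>

locale cube =
  fixes es :: "'e list" and M :: "'e set \<Rightarrow> 'a bigraded" and d :: "'e set \<Rightarrow> 'e \<Rightarrow> 'a \<Rightarrow> 'a"
    and X :: "'e set \<Rightarrow> 'x set" and dg
  assumes dist: "distinct es"
    and free: "S \<subseteq> set es \<Longrightarrow> free_graded (M S) (X S) (dg S)"
    and d_hom: "S \<subseteq> set es \<Longrightarrow> e \<in> set es - S \<Longrightarrow> bigraded_hom (M S) (M (insert e S)) (d S e)"
    and d_comm: "S \<subseteq> set es \<Longrightarrow> e \<in> set es - S \<Longrightarrow> f \<in> set es - S \<Longrightarrow> e \<noteq> f \<Longrightarrow> x \<in> carrier (M S) \<Longrightarrow>
      d (insert f S) e (d S f x) = d (insert e S) f (d S e x)"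
begin

abbreviation C where "C \<equiv> cube_complex es M d"

lemma comm: "S \<subseteq> set es \<Longrightarrow> comm_group (M S)"
  by (rule free_gradedD(1)[OF free])

lemma sep: "S \<subseteq> set es \<Longrightarrow> int_separated (M S)"
  by (rule free_gradedD(2)[OF free])

lemma finite_level: "finite (cube_level es i)"
  by (rule finite_subset[of _ "Pow (set es)"]) (auto simp: cube_level_def)

lemma levelD: "S \<in> cube_level es i \<Longrightarrow> S \<subseteq> set es" "S \<in> cube_level es i \<Longrightarrow> card S = i"
  "S \<in> cube_level es i \<Longrightarrow> finite S"
  unfolding cube_level_def using finite_subset[of S "set es"] by auto

lemma level_remove: "T \<in> cube_level es (Suc i) \<Longrightarrow> e \<in> T \<Longrightarrow> T - {e} \<in> cube_level es i"
  unfolding cube_level_def by (auto simp: card_Diff_singleton)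

lemma obj_C: "obj C i = direct_sum (cube_level es i) M"
  by (simp add: cube_complex_def)

lemma carrier_C: "carrier (obj C i) = (\<Pi>\<^sub>E S\<in>cube_level es i. carrier (M S))"
  unfolding obj_C by (rule carrier_direct_sum[OF finite_level comm[OF levelD(1)]])

lemma free_C: "free_graded (obj C i) (Sigma (cube_level es i) X) (\<lambda>(S, x). dg S x)"
  unfolding obj_C by (rule free_graded_direct_sum[OF finite_level free[OF levelD(1)]])

lemma bigraded_C: "bigraded_module (obj C i)"
  by (rule free_gradedD(3)[OF free_C])

lemma grade_C: "grade (obj C i) n = {x \<in> carrier (obj C i). \<forall>S\<in>cube_level es i. x S \<in> grade (M S) n}"
  unfolding obj_C direct_sum_def by simp

lemma diff_C:
  assumes "v \<in> carrier (obj C i)"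
  shows "diff C i v = (\<lambda>T\<in>cube_level es (Suc i).
        finprod (M T) (\<lambda>e. d (T - {e}) e (v (T - {e})) [^]\<^bsub>M T\<^esub> cube_sign es (T - {e}) e) T)"
  using assms by (simp add: cube_complex_def)

lemma d_closed:
  assumes v: "v \<in> carrier (obj C i)" and T: "T \<in> cube_level es (Suc i)" and e: "e \<in> T"
  shows "d (T - {e}) e (v (T - {e})) \<in> carrier (M T)" and "v (T - {e}) \<in> carrier (M (T - {e}))"
    and "bigraded_hom (M (T - {e})) (M T) (d (T - {e}) e)"
proof -
  note S = level_remove[OF T e]
  show vS: "v (T - {e}) \<in> carrier (M (T - {e}))" using v S unfolding carrier_C by auto
  show h: "bigraded_hom (M (T - {e})) (M T) (d (T - {e}) e)"
    using d_hom[OF levelD(1)[OF S], of e] levelD(1)[OF T] e by (auto simp: insert_absorb)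
  show "d (T - {e}) e (v (T - {e})) \<in> carrier (M T)" by (rule bigraded_hom_closed[OF h vS])
qed

lemma diff_closed:
  assumes v: "v \<in> carrier (obj C i)" and T: "T \<in> cube_level es (Suc i)"
  shows "diff C i v T \<in> carrier (M T)"
proof -
  interpret T: comm_group "M T" by (rule comm[OF levelD(1)[OF T]])
  show ?thesis
    unfolding diff_C[OF v] restrict_apply'[OF T]
    by (intro T.finprod_closed Pi_I T.int_pow_closed d_closed(1)[OF v T])
qed

lemma k_diff:
  assumes v: "v \<in> carrier (obj C i)" and T: "T \<in> cube_level es (Suc i)" and k: "k \<in> hom (M T) integer_group"
  shows "k (diff C i v T) = (\<Sum>e\<in>T. cube_sign es (T - {e}) e * k (d (T - {e}) e (v (T - {e}))))"
  unfolding diff_C[OF v] restrict_apply'[OF T]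
  by (rule hom_int_finprod_pow[OF comm[OF levelD(1)[OF T]] k d_closed(1)[OF v T]])

lemma diff_hom: "bigraded_hom (obj C i) (obj C (Suc i)) (diff C i)"
  unfolding bigraded_hom_def
proof (intro conjI allI bigraded_C)
  have cl: "diff C i v \<in> carrier (obj C (Suc i))" if v: "v \<in> carrier (obj C i)" for v
    unfolding carrier_C
  proof (rule PiE_I)
    show "diff C i v T \<in> carrier (M T)" if "T \<in> cube_level es (Suc i)" for T by (rule diff_closed[OF v that])
    show "diff C i v T = undefined" if "T \<notin> cube_level es (Suc i)" for T using that unfolding diff_C[OF v] by simp
  qed
  show "diff C i \<in> hom (obj C i) (obj C (Suc i))"
  proof (rule homI)
    fix v w assume v: "v \<in> carrier (obj C i)" and w: "w \<in> carrier (obj C i)"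
    have vw: "v \<otimes>\<^bsub>obj C i\<^esub> w \<in> carrier (obj C i)"
      by (rule comm_groupE(1)[OF bigraded_module_comm[OF bigraded_C] v w])
    show "diff C i (v \<otimes>\<^bsub>obj C i\<^esub> w) = diff C i v \<otimes>\<^bsub>obj C (Suc i)\<^esub> diff C i w"
    proof (rule ext)
      fix T
      show "diff C i (v \<otimes>\<^bsub>obj C i\<^esub> w) T = (diff C i v \<otimes>\<^bsub>obj C (Suc i)\<^esub> diff C i w) T"
      proof (cases "T \<in> cube_level es (Suc i)")
        case False
        then show ?thesis unfolding diff_C[OF vw] unfolding obj_C by simp
      next
        case T: True
        interpret T: comm_group "M T" by (rule comm[OF levelD(1)[OF T]])
        have "diff C i (v \<otimes>\<^bsub>obj C i\<^esub> w) T = diff C i v T \<otimes>\<^bsub>M T\<^esub> diff C i w T"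
        proof (rule int_separatedD[OF sep[OF levelD(1)[OF T]]])
          fix k assume k: "k \<in> hom (M T) integer_group"
          have kvw: "k (d (T - {e}) e ((v \<otimes>\<^bsub>obj C i\<^esub> w) (T - {e}))) =
              k (d (T - {e}) e (v (T - {e}))) + k (d (T - {e}) e (w (T - {e})))" if e: "e \<in> T" for e
          proof -
            have "(v \<otimes>\<^bsub>obj C i\<^esub> w) (T - {e}) = v (T - {e}) \<otimes>\<^bsub>M (T - {e})\<^esub> w (T - {e})"
              unfolding obj_C using level_remove[OF T e] by simp
            then have "d (T - {e}) e ((v \<otimes>\<^bsub>obj C i\<^esub> w) (T - {e})) =
                d (T - {e}) e (v (T - {e})) \<otimes>\<^bsub>M T\<^esub> d (T - {e}) e (w (T - {e}))"
              using hom_mult[OF bigraded_homD(3)[OF d_closed(3)[OF v T e]] d_closed(2)[OF v T e] d_closed(2)[OF w T e]] by simp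
            then show ?thesis
              using hom_mult[OF k d_closed(1)[OF v T e] d_closed(1)[OF w T e]] by simp
          qed
          have "k (diff C i (v \<otimes>\<^bsub>obj C i\<^esub> w) T) = (\<Sum>e\<in>T. cube_sign es (T - {e}) e * k (d (T - {e}) e (v (T - {e})))
              + cube_sign es (T - {e}) e * k (d (T - {e}) e (w (T - {e}))))"
            unfolding k_diff[OF vw T k]
          proof (rule sum.cong[OF refl])
            fix e assume e: "e \<in> T"
            show "cube_sign es (T - {e}) e * k (d (T - {e}) e ((v \<otimes>\<^bsub>obj C i\<^esub> w) (T - {e}))) =
              cube_sign es (T - {e}) e * k (d (T - {e}) e (v (T - {e})))
              + cube_sign es (T - {e}) e * k (d (T - {e}) e (w (T - {e})))"
              unfolding kvw[OF e] by (rule distrib_left)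
          qed
          also have "\<dots> = k (diff C i v T) + k (diff C i w T)"
            unfolding k_diff[OF v T k] k_diff[OF w T k] by (rule sum.distrib)
          also have "\<dots> = k (diff C i v T \<otimes>\<^bsub>M T\<^esub> diff C i w T)"
            using hom_mult[OF k diff_closed[OF v T] diff_closed[OF w T]] by simp
          finally show "k (diff C i (v \<otimes>\<^bsub>obj C i\<^esub> w) T) = k (diff C i v T \<otimes>\<^bsub>M T\<^esub> diff C i w T)" .
        qed (rule diff_closed[OF vw T] T.m_closed[OF diff_closed[OF v T] diff_closed[OF w T]])+
        then show ?thesis unfolding obj_C using T by simp
      qed
    qed
  qed (rule cl)
  show "diff C i ` grade (obj C i) n \<subseteq> grade (obj C (Suc i)) n" for n
  proof (rule image_subsetI)
    fix v assume "v \<in> grade (obj C i) n"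
    then have v: "v \<in> carrier (obj C i)" and vg: "\<And>S. S \<in> cube_level es i \<Longrightarrow> v S \<in> grade (M S) n"
      unfolding grade_C by auto
    have "diff C i v T \<in> grade (M T) n" if T: "T \<in> cube_level es (Suc i)" for T
    proof -
      have g: "subgroup (grade (M T) n) (M T)" by (rule free_gradedD(4)[OF free[OF levelD(1)[OF T]]])
      show ?thesis
        unfolding diff_C[OF v] restrict_apply'[OF T]
      proof (rule finprod_in_subgroup[OF comm[OF levelD(1)[OF T]] g])
        fix e assume e: "e \<in> T"
        have "d (T - {e}) e (v (T - {e})) \<in> grade (M T) n"
          by (rule bigraded_homD(4)[OF d_closed(3)[OF v T e] vg[OF level_remove[OF T e]]])
        then show "d (T - {e}) e (v (T - {e})) [^]\<^bsub>M T\<^esub> cube_sign es (T - {e}) e \<in> grade (M T) n"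
          by (rule int_pow_in_subgroup[OF comm_group.axioms(2)[OF comm[OF levelD(1)[OF T]]] g])
      qed
    qed
    then show "diff C i v \<in> grade (obj C (Suc i)) n" unfolding grade_C using cl[OF v] by simp
  qed
qed

lemma diff_diff:
  assumes v: "v \<in> carrier (obj C i)"
  shows "diff C (Suc i) (diff C i v) = \<one>\<^bsub>obj C (Suc (Suc i))\<^esub>"
proof (rule ext)
  fix T
  have dv: "diff C i v \<in> carrier (obj C (Suc i))" by (rule bigraded_hom_closed[OF diff_hom v])
  show "diff C (Suc i) (diff C i v) T = \<one>\<^bsub>obj C (Suc (Suc i))\<^esub> T"
  proof (cases "T \<in> cube_level es (Suc (Suc i))")
    case False
    then show ?thesis unfolding diff_C[OF dv] unfolding obj_C direct_sum_simps by simp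
  next
    case T: True
    note Ts = levelD(1)[OF T]
    have fT: "finite T" by (rule levelD(3)[OF T])
    interpret T: comm_group "M T" by (rule comm[OF Ts])
    have "diff C (Suc i) (diff C i v) T = \<one>\<^bsub>M T\<^esub>"
    proof (rule int_separatedD[OF sep[OF Ts] diff_closed[OF dv T] T.one_closed])
      fix k assume k: "k \<in> hom (M T) integer_group"
      \<comment> \<open>\<open>g e f\<close> is the signed contribution of the path from T - {e} -
        {f} to T that adds f before e.\<close>
      define g where "g = (\<lambda>e f. cube_sign es (T - {e}) e * cube_sign es (T - {e} - {f}) f *
         k (d (T - {e}) e (d (T - {e} - {f}) f (v (T - {e} - {f})))))"
      have 1: "k (d (T - {e}) e (diff C i v (T - {e}))) =
          (\<Sum>f\<in>T - {e}. cube_sign es (T - {e} - {f}) f * k (d (T - {e}) e (d (T - {e} - {f}) f (v (T - {e} - {f})))))"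
        if e: "e \<in> T" for e
      proof -
        have "(\<lambda>x. k (d (T - {e}) e x)) \<in> hom (M (T - {e})) integer_group"
          using hom_compose[OF bigraded_homD(3)[OF d_closed(3)[OF dv T e]] k] by (simp add: comp_def)
        from k_diff[OF v level_remove[OF T e] this] show ?thesis .
      qed
      have "k (diff C (Suc i) (diff C i v) T) = (\<Sum>e\<in>T. \<Sum>f\<in>T - {e}. g e f)"
        unfolding k_diff[OF dv T k] g_def
      proof (rule sum.cong[OF refl])
        fix e assume e: "e \<in> T"
        show "cube_sign es (T - {e}) e * k (d (T - {e}) e (diff C i v (T - {e}))) =
          (\<Sum>f\<in>T - {e}. cube_sign es (T - {e}) e * cube_sign es (T - {e} - {f}) f *
            k (d (T - {e}) e (d (T - {e} - {f}) f (v (T - {e} - {f})))))"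
          unfolding 1[OF e] sum_distrib_left mult.assoc by (rule refl)
      qed
      \<comment> \<open>Zero entries on the diagonal make the index set a full square, over which
        the order of summation can be exchanged.\<close>
      also have "\<dots> = (\<Sum>e\<in>T. \<Sum>f\<in>T. if e = f then 0 else g e f)"
      proof (rule sum.cong[OF refl])
        fix e assume e: "e \<in> T"
        have "(\<Sum>f\<in>T. if e = f then 0 else g e f) = (if e = e then 0 else g e e) + (\<Sum>f\<in>T - {e}. if e = f then 0 else g e f)"
          by (rule sum.remove[OF fT e])
        also have "(\<Sum>f\<in>T - {e}. if e = f then 0 else g e f) = (\<Sum>f\<in>T - {e}. g e f)"
          by (rule sum.cong) auto
        finally show "(\<Sum>f\<in>T - {e}. g e f) = (\<Sum>f\<in>T. if e = f then 0 else g e f)" by simp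
      qed
      also have "\<dots> = 0"
      proof -
        \<comment> \<open>The entries are antisymmetric, so the double sum equals its own negative,
          and over the integers it must be zero.\<close>
        let ?s = "\<Sum>e\<in>T. \<Sum>f\<in>T. if e = f then 0 else g e f"
        have anti: "g e f = - g f e" if ef: "e \<in> T" "f \<in> T" "e \<noteq> f" for e f
        proof -
          define S where "S = T - {e} - {f}"
          have S: "T - {f} - {e} = S" "T - {e} = insert f S" "T - {f} = insert e S" using ef by (auto simp: S_def)
          have Ss: "S \<subseteq> set es" "e \<in> set es - S" "f \<in> set es - S" using Ts ef by (auto simp: S_def)
          have "S \<in> cube_level es i" unfolding S_def
            by (rule level_remove[OF level_remove[OF T ef(1)]]) (use ef in simp)
          then have "v S \<in> carrier (M S)" using v unfolding carrier_C by auto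
          then have dd: "d (insert f S) e (d S f (v S)) = d (insert e S) f (d S e (v S))" by (rule d_comm[OF Ss ef(3)])
          have sw: "cube_sign es (insert f S) e * cube_sign es S f = - (cube_sign es (insert e S) f * cube_sign es S e)"
            by (rule cube_sign_swap[OF dist Ss ef(3)])
          show ?thesis
            unfolding g_def S(1) S_def[symmetric] unfolding S(2,3) dd sw by (rule mult_minus_left)
        qed
        have "?s = (\<Sum>f\<in>T. \<Sum>e\<in>T. if e = f then 0 else g e f)" by (rule sum.swap)
        also have "\<dots> = (\<Sum>e\<in>T. \<Sum>f\<in>T. - (if e = f then 0 else g e f))"
        proof (rule sum.cong[OF refl], rule sum.cong[OF refl])
          fix a b assume "a \<in> T" "b \<in> T"
          then show "(if b = a then 0 else g b a) = - (if a = b then 0 else g a b)"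
            using anti[of a b] by (cases "a = b") simp_all
        qed
        also have "\<dots> = - ?s" unfolding sum_negf by (rule refl)
        finally have s: "?s = - ?s" .
        have "x = 0" if "x = - x" for x :: int using that by simp
        from this[OF s] show ?thesis .
      qed
      finally show "k (diff C (Suc i) (diff C i v) T) = k \<one>\<^bsub>M T\<^esub>"
        using hom_one[OF k T.is_group group_integer_group] by simp
    qed
    then show ?thesis unfolding obj_C direct_sum_simps restrict_apply'[OF T] .
  qed
qed

lemma cochain_complex_C: "cochain_complex C"
  unfolding cochain_complex_def by (intro conjI allI ballI diff_hom diff_diff)

lemma trivial_obj: "i > length es \<Longrightarrow> trivial_group (obj C i)"
proof -
  assume "i > length es"
  then have "card S \<noteq> i" if "S \<subseteq> set es" for S
    using card_mono[OF _ that] card_length[of es] by simp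
  then have e: "cube_level es i = {}" unfolding cube_level_def by simp
  \<comment> \<open>There is exactly one extensional function on the empty index set.\<close>
  have "carrier (obj C i) = {\<lambda>_. undefined}" unfolding carrier_C e by simp
  moreover have "\<one>\<^bsub>obj C i\<^esub> \<in> carrier (obj C i)"
    by (rule comm_groupE(2)[OF bigraded_module_comm[OF bigraded_C]])
  ultimately have "carrier (obj C i) = {\<one>\<^bsub>obj C i\<^esub>}" by simp
  then show ?thesis
    using comm_group.axioms(2)[OF bigraded_module_comm[OF bigraded_C]] by (simp add: trivial_group_def)
qed

end

lemma bigraded_hom_int_pow:
  assumes M: "comm_group M" "\<And>d. subgroup (grade M d) M" and f: "bigraded_hom N M f"
  shows "bigraded_hom N M (\<lambda>x. f x [^]\<^bsub>M\<^esub> (k::int))"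
  unfolding bigraded_hom_def
proof (intro conjI allI bigraded_homD(1,2)[OF f])
  show "(\<lambda>x. f x [^]\<^bsub>M\<^esub> k) \<in> hom N M"
    using hom_compose[OF bigraded_homD(3)[OF f] int_pow_hom[OF M(1), of k]] by (simp add: comp_def)
  show "(\<lambda>x. f x [^]\<^bsub>M\<^esub> k) ` grade N d \<subseteq> grade M d" for d
    by (rule image_subsetI) (rule int_pow_in_subgroup[OF comm_group.axioms(2)[OF M(1)] M(2) bigraded_homD(4)[OF f]])
qed

text \<open>A morphism of cubes along a bijection h of the edges; g is the inverse of h and the signs
  correct for the change of order.\<close>

locale cube_morphism =
  A: cube es M d X dg + B: cube es' M' d' X' dg'
  for es :: "'e list" and M :: "'e set \<Rightarrow> 'a bigraded" and d and X :: "'e set \<Rightarrow> 'x set" and dg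
    and es' :: "'f list" and M' :: "'f set \<Rightarrow> 'm bigraded" and d' and X' :: "'f set \<Rightarrow> 'y set" and dg' +
  fixes h :: "'e \<Rightarrow> 'f" and g :: "'f \<Rightarrow> 'e" and F :: "'e set \<Rightarrow> 'a \<Rightarrow> 'm"
  assumes h: "bij_betw h (set es) (set es')" and gh: "\<And>e. e \<in> set es \<Longrightarrow> g (h e) = e"
    and F_hom: "S \<subseteq> set es \<Longrightarrow> bigraded_hom (M S) (M' (h ` S)) (F S)"
    and F_nat: "S \<subseteq> set es \<Longrightarrow> e \<in> set es - S \<Longrightarrow> x \<in> carrier (M S) \<Longrightarrow>
      F (insert e S) (d S e x) = d' (h ` S) (h e) (F S x)"
begin

definition cube_map :: "nat \<Rightarrow> ('e set \<Rightarrow> 'a) \<Rightarrow> 'f set \<Rightarrow> 'm" where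
  "cube_map i v = (\<lambda>T\<in>cube_level es' i. F (g ` T) (v (g ` T)) [^]\<^bsub>M' T\<^esub> reorder_sign es es' h (g ` T))"

lemma level_image:
  assumes T: "T \<in> cube_level es' i"
  shows "g ` T \<in> cube_level es i" and "h ` g ` T = T"
proof -
  have im: "h ` set es = set es'" and inj: "inj_on h (set es)" using h by (auto simp: bij_betw_def)
  have hg: "h (g x) = x" "g x \<in> set es" if x: "x \<in> T" for x
  proof -
    obtain e where "e \<in> set es" "x = h e" using x B.levelD(1)[OF T] im by auto
    then show "h (g x) = x" "g x \<in> set es" using gh by auto
  qed
  show hT: "h ` g ` T = T" unfolding image_image using hg(1) by (simp cong: image_cong)
  have "inj_on g T" by (rule inj_on_inverseI[of _ h]) (rule hg(1))
  then have "card (g ` T) = i" using B.levelD(2)[OF T] by (simp add: card_image)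
  then show "g ` T \<in> cube_level es i" using hg(2) by (auto simp: cube_level_def)
qed

lemma cube_map_apply:
  assumes T: "T \<in> cube_level es' i"
  shows "cube_map i v T = F (g ` T) (v (g ` T)) [^]\<^bsub>M' T\<^esub> reorder_sign es es' h (g ` T)"
  unfolding cube_map_def by (rule restrict_apply'[OF T])

lemma F_hom_level:
  assumes T: "T \<in> cube_level es' i"
  shows "bigraded_hom (M (g ` T)) (M' T) (F (g ` T))"
  using F_hom[OF A.levelD(1)[OF level_image(1)[OF T]]] unfolding level_image(2)[OF T] .

lemma v_level: "v \<in> carrier (obj A.C i) \<Longrightarrow> T \<in> cube_level es' i \<Longrightarrow> v (g ` T) \<in> carrier (M (g ` T))"
  using level_image(1) unfolding A.carrier_C by auto

lemma twisted_hom: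
  assumes T: "T \<in> cube_level es' i"
  shows "bigraded_hom (M (g ` T)) (M' T) (\<lambda>x. F (g ` T) x [^]\<^bsub>M' T\<^esub> reorder_sign es es' h (g ` T))"
  by (rule bigraded_hom_int_pow[OF B.comm[OF B.levelD(1)[OF T]]
    free_gradedD(4)[OF B.free[OF B.levelD(1)[OF T]]] F_hom_level[OF T]])

lemma cube_map_hom: "bigraded_hom (obj A.C i) (obj B.C i) (cube_map i)"
  unfolding bigraded_hom_def
proof (intro conjI allI A.bigraded_C B.bigraded_C)
  have cl: "cube_map i v \<in> carrier (obj B.C i)" if v: "v \<in> carrier (obj A.C i)" for v
    unfolding B.carrier_C
  proof (rule PiE_I)
    show "cube_map i v T \<in> carrier (M' T)" if T: "T \<in> cube_level es' i" for T
      unfolding cube_map_apply[OF T] by (rule bigraded_hom_closed[OF twisted_hom[OF T] v_level[OF v T]])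
    show "cube_map i v T = undefined" if "T \<notin> cube_level es' i" for T using that unfolding cube_map_def by simp
  qed
  show "cube_map i \<in> hom (obj A.C i) (obj B.C i)"
  proof (rule homI, rule cl)
    fix v w assume v: "v \<in> carrier (obj A.C i)" and w: "w \<in> carrier (obj A.C i)"
    show "cube_map i (v \<otimes>\<^bsub>obj A.C i\<^esub> w) = cube_map i v \<otimes>\<^bsub>obj B.C i\<^esub> cube_map i w"
    proof (rule ext)
      fix T
      show "cube_map i (v \<otimes>\<^bsub>obj A.C i\<^esub> w) T = (cube_map i v \<otimes>\<^bsub>obj B.C i\<^esub> cube_map i w) T"
      proof (cases "T \<in> cube_level es' i")
        case False
        then show ?thesis unfolding B.obj_C direct_sum_simps cube_map_def by simp
      next
        case T: True
        have "(v \<otimes>\<^bsub>obj A.C i\<^esub> w) (g ` T) = v (g ` T) \<otimes>\<^bsub>M (g ` T)\<^esub> w (g ` T)"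
          unfolding A.obj_C direct_sum_simps by (rule restrict_apply'[OF level_image(1)[OF T]])
        then have "cube_map i (v \<otimes>\<^bsub>obj A.C i\<^esub> w) T = cube_map i v T \<otimes>\<^bsub>M' T\<^esub> cube_map i w T"
          unfolding cube_map_apply[OF T]
          using hom_mult[OF bigraded_homD(3)[OF twisted_hom[OF T]] v_level[OF v T] v_level[OF w T]] by simp
        then show ?thesis unfolding B.obj_C direct_sum_simps restrict_apply'[OF T] .
      qed
    qed
  qed
  show "cube_map i ` grade (obj A.C i) n \<subseteq> grade (obj B.C i) n" for n
  proof (rule image_subsetI)
    fix v assume "v \<in> grade (obj A.C i) n"
    then have v: "v \<in> carrier (obj A.C i)" and vg: "\<And>S. S \<in> cube_level es i \<Longrightarrow> v S \<in> grade (M S) n"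
      unfolding A.grade_C by auto
    have "cube_map i v T \<in> grade (M' T) n" if T: "T \<in> cube_level es' i" for T
      unfolding cube_map_apply[OF T]
      by (rule bigraded_homD(4)[OF twisted_hom[OF T] vg[OF level_image(1)[OF T]]])
    then show "cube_map i v \<in> grade (obj B.C i) n" unfolding B.grade_C using cl[OF v] by simp
  qed
qed

text \<open>Under a functional, the summand of e in S matches the summand of \<open>h e\<close> in
  T: naturality moves F past the edge map, and \<open>reorder_sign_insert\<close> exchanges the
  signs.\<close>

lemma cube_map_diff:
  assumes v: "v \<in> carrier (obj A.C i)"
  shows "cube_map (Suc i) (diff A.C i v) = diff B.C i (cube_map i v)"
proof (rule ext)
  fix T
  have cv: "cube_map i v \<in> carrier (obj B.C i)" by (rule bigraded_hom_closed[OF cube_map_hom v])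
  have dv: "diff A.C i v \<in> carrier (obj A.C (Suc i))" by (rule bigraded_hom_closed[OF A.diff_hom v])
  show "cube_map (Suc i) (diff A.C i v) T = diff B.C i (cube_map i v) T"
  proof (cases "T \<in> cube_level es' (Suc i)")
    case False
    then show ?thesis unfolding B.diff_C[OF cv] unfolding cube_map_def by simp
  next
    case T: True
    note Ts = B.levelD(1)[OF T] and hom = F_hom_level[OF T]
    define S where "S = g ` T"
    have S: "S \<in> cube_level es (Suc i)" and hS: "h ` S = T" unfolding S_def by (rule level_image[OF T])+
    have Ss: "S \<subseteq> set es" by (rule A.levelD(1)[OF S])
    have injS: "inj_on h S" using h Ss by (auto simp: bij_betw_def intro: inj_on_subset)
    have FS: "bigraded_hom (M S) (M' T) (F S)" using hom unfolding S_def .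
    let ?\<epsilon> = "reorder_sign es es' h"
    show ?thesis
    proof (rule int_separatedD[OF B.sep[OF Ts]])
      show "cube_map (Suc i) (diff A.C i v) T \<in> carrier (M' T)"
        unfolding cube_map_apply[OF T] by (rule bigraded_hom_closed[OF twisted_hom[OF T] v_level[OF dv T]])
      show "diff B.C i (cube_map i v) T \<in> carrier (M' T)" by (rule B.diff_closed[OF cv T])
      fix k assume k: "k \<in> hom (M' T) integer_group"
      have gT: "group (M' T)" by (rule comm_group.axioms(2)[OF B.comm[OF Ts]])
      have kF: "(\<lambda>x. k (F S x)) \<in> hom (M S) integer_group"
        using hom_compose[OF bigraded_homD(3)[OF FS] k] by (simp add: comp_def)
      have Fdv: "F S (diff A.C i v S) \<in> carrier (M' T)"
        by (rule bigraded_hom_closed[OF FS A.diff_closed[OF v S]])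
      have "k (cube_map (Suc i) (diff A.C i v) T) = ?\<epsilon> S * k (F S (diff A.C i v S))"
        unfolding cube_map_apply[OF T] S_def[symmetric] by (rule hom_integer_pow[OF gT k Fdv])
      also have "\<dots> = (\<Sum>e\<in>S. ?\<epsilon> S * (cube_sign es (S - {e}) e * k (F S (d (S - {e}) e (v (S - {e}))))))"
        unfolding A.k_diff[OF v S kF] by (rule sum_distrib_left)
      also have "\<dots> = (\<Sum>e\<in>S. cube_sign es' (T - {h e}) (h e) * k (d' (T - {h e}) (h e) (cube_map i v (T - {h e}))))"
      proof (rule sum.cong[OF refl])
        fix e assume e: "e \<in> S"
        have hT: "T - {h e} = h ` (S - {e})" unfolding hS[symmetric] using injS e by (auto dest: inj_onD)
        have heT: "h e \<in> T" using e hS by auto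
        have lT: "T - {h e} \<in> cube_level es' i" by (rule B.level_remove[OF T heT])
        have gS: "g ` (T - {h e}) = S - {e}"
        proof -
          have "g ` (T - {h e}) = (\<lambda>x. g (h x)) ` (S - {e})" unfolding hT by (simp add: image_image)
          also have "\<dots> = (\<lambda>x. x) ` (S - {e})" by (rule image_cong[OF refl]) (use gh Ss in auto)
          finally show ?thesis by simp
        qed
        have sub: "S - {e} \<subseteq> set es" "e \<in> set es - (S - {e})" "insert e (S - {e}) = S" using Ss e by auto
        have vS: "v (S - {e}) \<in> carrier (M (S - {e}))" by (rule A.d_closed(2)[OF v S e])
        have nat: "F S (d (S - {e}) e (v (S - {e}))) = d' (T - {h e}) (h e) (F (S - {e}) (v (S - {e})))"
          using F_nat[OF sub(1,2) vS] unfolding sub(3) hT .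
        have sg: "?\<epsilon> S * cube_sign es (S - {e}) e = cube_sign es' (T - {h e}) (h e) * ?\<epsilon> (S - {e})"
          using reorder_sign_insert[OF A.dist B.dist sub(1,2) h] unfolding sub(3) hT .
        have Fv: "F (S - {e}) (v (S - {e})) \<in> carrier (M' (T - {h e}))"
          using bigraded_hom_closed[OF F_hom[OF sub(1)] vS] unfolding hT .
        have d'h: "d' (T - {h e}) (h e) \<in> hom (M' (T - {h e})) (M' T)"
          by (rule bigraded_homD(3)[OF B.d_closed(3)[OF cv T heT]])
        have cm: "cube_map i v (T - {h e}) = F (S - {e}) (v (S - {e})) [^]\<^bsub>M' (T - {h e})\<^esub> ?\<epsilon> (S - {e})"
          unfolding cube_map_apply[OF lT] gS by (rule refl)
        have gT': "group (M' (T - {h e}))" by (rule comm_group.axioms(2)[OF B.comm[OF B.levelD(1)[OF lT]]])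
        have "(\<lambda>x. k (d' (T - {h e}) (h e) x)) \<in> hom (M' (T - {h e})) integer_group"
          using hom_compose[OF d'h k] by (simp add: comp_def)
        from hom_integer_pow[OF gT' this Fv]
        have "k (d' (T - {h e}) (h e) (cube_map i v (T - {h e}))) =
            ?\<epsilon> (S - {e}) * k (d' (T - {h e}) (h e) (F (S - {e}) (v (S - {e}))))"
          unfolding cm .
        then show "?\<epsilon> S * (cube_sign es (S - {e}) e * k (F S (d (S - {e}) e (v (S - {e}))))) =
            cube_sign es' (T - {h e}) (h e) * k (d' (T - {h e}) (h e) (cube_map i v (T - {h e})))"
          unfolding nat mult.assoc[symmetric] sg by (simp only: mult.assoc)
      qed
      also have "\<dots> = (\<Sum>f\<in>T. cube_sign es' (T - {f}) f * k (d' (T - {f}) f (cube_map i v (T - {f}))))"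
        by (rule sum.reindex_cong[OF injS hS[symmetric], symmetric]) (rule refl)
      also have "\<dots> = k (diff B.C i (cube_map i v) T)" by (rule B.k_diff[OF cv T k, symmetric])
      finally show "k (cube_map (Suc i) (diff A.C i v) T) = k (diff B.C i (cube_map i v) T)" .
    qed
  qed
qed

lemma chain_map_cube_map: "chain_map A.C B.C cube_map"
  unfolding chain_map_def
  by (intro conjI allI ballI A.cochain_complex_C B.cochain_complex_C cube_map_hom cube_map_diff)

end

text \<open>\<open>phi\<close> and \<open>psi\<close> are only required to agree with a general map
  of cubes on cochains, and being a chain map depends on nothing else.\<close>

lemma chain_map_cong:
  assumes f: "chain_map C D f" and fg: "\<And>i x. x \<in> carrier (obj C i) \<Longrightarrow> g i x = f i x"
  shows "chain_map C D g"
  unfolding chain_map_def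
proof (intro conjI allI ballI chain_mapD(1,2)[OF f])
  note C = chain_mapD(1)[OF f]
  fix i
  note h = chain_mapD(3)[OF f, of i]
  show "bigraded_hom (obj C i) (obj D i) (g i)"
    unfolding bigraded_hom_def
  proof (intro conjI allI bigraded_homD(1,2)[OF h])
    show "g i \<in> hom (obj C i) (obj D i)"
    proof (rule homI)
      fix x y assume x: "x \<in> carrier (obj C i)" and y: "y \<in> carrier (obj C i)"
      show "g i x \<in> carrier (obj D i)" unfolding fg[OF x] by (rule bigraded_hom_closed[OF h x])
      show "g i (x \<otimes>\<^bsub>obj C i\<^esub> y) = g i x \<otimes>\<^bsub>obj D i\<^esub> g i y"
        unfolding fg[OF x] fg[OF y] fg[OF comm_groupE(1)[OF cochain_complexD(4)[OF C] x y]]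
        by (rule hom_mult[OF bigraded_homD(3)[OF h] x y])
    qed
    show "g i ` grade (obj C i) d \<subseteq> grade (obj D i) d" for d
    proof (rule image_subsetI)
      fix x assume x: "x \<in> grade (obj C i) d"
      then have "x \<in> carrier (obj C i)"
        by (rule subsetD[OF subgroup.subset[OF bigraded_module_grade[OF bigraded_homD(1)[OF h]]]])
      then show "g i x \<in> grade (obj D i) d" using fg bigraded_homD(4)[OF h x] by simp
    qed
  qed
  fix x assume x: "x \<in> carrier (obj C i)"
  show "g (Suc i) (diff C i x) = diff D i (g i x)"
    unfolding fg[OF x] fg[OF bigraded_hom_closed[OF cochain_complexD(1)[OF C] x]] by (rule chain_mapD(4)[OF f x])
qed

lemma reorder_sign_id: "reorder_sign es es (\<lambda>x. x) S = 1"
  unfolding reorder_sign_def by (intro prod.neutral ballI) auto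

section \<open>Graded maps between tensor modules\<close>

lemma pure_tensor_grade:
  assumes "x \<in> grade M a" "y \<in> grade N b"
  shows "pure_tensor M N x y \<in> grade (tensor M N) (a + b)"
  unfolding tensor_def with_grading_simps
  by (rule generate.incl) (use assms in \<open>auto simp: fst_add snd_add\<close>)

lemma pure_power_grade:
  assumes "x \<in> (\<Pi>\<^sub>E i\<in>I. grade M (a i))"
  shows "pure_power I M x \<in> grade (tensor_power I M) (\<Sum>i\<in>I. a i)"
proof -
  have "fst (\<Sum>i\<in>I. a i) = (\<Sum>i\<in>I. fst (a i))" "snd (\<Sum>i\<in>I. a i) = (\<Sum>i\<in>I. snd (a i))"
    by (induction I rule: infinite_finite_induct) simp_all
  then show ?thesis
    unfolding tensor_power_def with_grading_simps by (intro generate.incl CollectI exI conjI) (use assms in simp_all)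
qed

lemma bigraded_hom_tensor:
  assumes M: "bigraded_module M" and N: "bigraded_module N"
    and MN: "bigraded_module (tensor M N)" and T: "bigraded_module T" and f: "f \<in> hom (tensor_group M N) T"
    and gr: "\<And>x y a b. x \<in> grade M a \<Longrightarrow> y \<in> grade N b \<Longrightarrow> f (pure_tensor M N x y) \<in> grade T (a + b)"
  shows "bigraded_hom (tensor M N) T f"
  unfolding bigraded_hom_def
proof (intro conjI allI MN T)
  show "f \<in> hom (tensor M N) T" unfolding tensor_def hom_with_grading by (rule f)
  fix d
  let ?P = "{pure_tensor M N x y | x y a b. x \<in> grade M a \<and> y \<in> grade N b \<and>
           fst a + fst b = fst d \<and> snd a + snd b = snd d}"
  show "f ` grade (tensor M N) d \<subseteq> grade T d"
  proof (rule image_subsetI)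
    fix z assume "z \<in> grade (tensor M N) d"
    then have z: "z \<in> generate (tensor_group M N) ?P" unfolding tensor_def with_grading_simps .
    note cM = bigraded_module_comm[OF M] and cN = bigraded_module_comm[OF N]
    show "f z \<in> grade T d"
    proof (rule hom_generate_subset[OF _ _ f bigraded_module_grade[OF T] _ _ z])
      show "group (tensor_group M N)" by (rule comm_group.axioms(2)[OF comm_group_tensor_group[OF cM cN]])
      show "group T" by (rule comm_group.axioms(2)[OF bigraded_module_comm[OF T]])
      show "?P \<subseteq> carrier (tensor_group M N)"
      proof
        fix p assume "p \<in> ?P"
        then obtain x y a b where p: "p = pure_tensor M N x y" "x \<in> grade M a" "y \<in> grade N b" by blast
        show "p \<in> carrier (tensor_group M N)" unfolding p(1)
          by (rule pure_tensor_closed[OF cM cN subsetD[OF subgroup.subset[OF bigraded_module_grade[OF M]] p(2)]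
             subsetD[OF subgroup.subset[OF bigraded_module_grade[OF N]] p(3)]])
      qed
      fix p assume "p \<in> ?P"
      then obtain x y a b where p: "p = pure_tensor M N x y" "x \<in> grade M a" "y \<in> grade N b"
        and d: "fst a + fst b = fst d" "snd a + snd b = snd d" by blast
      have "a + b = d" by (rule prod_eqI) (simp_all add: d)
      then show "f p \<in> grade T d" unfolding p(1) using gr[OF p(2,3)] by simp
    qed
  qed
qed

lemma bigraded_hom_power:
  assumes M: "bigraded_module M" and MN: "bigraded_module (tensor_power I M)" and T: "bigraded_module T"
    and f: "f \<in> hom (power_group I M) T"
    and gr: "\<And>x a. x \<in> (\<Pi>\<^sub>E i\<in>I. grade M (a i)) \<Longrightarrow> f (pure_power I M x) \<in> grade T (\<Sum>i\<in>I. a i)"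
  shows "bigraded_hom (tensor_power I M) T f"
  unfolding bigraded_hom_def
proof (intro conjI allI MN T)
  show "f \<in> hom (tensor_power I M) T" unfolding tensor_power_def hom_with_grading by (rule f)
  fix d
  let ?P = "{pure_power I M x | x a. x \<in> (\<Pi>\<^sub>E i\<in>I. grade M (a i)) \<and>
           (\<Sum>i\<in>I. fst (a i)) = fst d \<and> (\<Sum>i\<in>I. snd (a i)) = snd d}"
  show "f ` grade (tensor_power I M) d \<subseteq> grade T d"
  proof (rule image_subsetI)
    fix z assume "z \<in> grade (tensor_power I M) d"
    then have z: "z \<in> generate (power_group I M) ?P" unfolding tensor_power_def with_grading_simps .
    note cM = bigraded_module_comm[OF M]
    show "f z \<in> grade T d"
    proof (rule hom_generate_subset[OF _ _ f bigraded_module_grade[OF T] _ _ z])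
      show "group (power_group I M)" by (rule comm_group.axioms(2)[OF comm_group_power_group[OF cM]])
      show "group T" by (rule comm_group.axioms(2)[OF bigraded_module_comm[OF T]])
      show "?P \<subseteq> carrier (power_group I M)"
      proof
        fix p assume "p \<in> ?P"
        then obtain x a where p: "p = pure_power I M x" "x \<in> (\<Pi>\<^sub>E i\<in>I. grade M (a i))" by blast
        have "x \<in> I \<rightarrow>\<^sub>E carrier M"
          by (rule subsetD[OF PiE_mono p(2)]) (rule subgroup.subset[OF bigraded_module_grade[OF M]])
        then show "p \<in> carrier (power_group I M)" unfolding p(1) by (rule pure_power_closed[OF cM])
      qed
      fix p assume "p \<in> ?P"
      then obtain x a where p: "p = pure_power I M x" "x \<in> (\<Pi>\<^sub>E i\<in>I. grade M (a i))"
        and d: "(\<Sum>i\<in>I. fst (a i)) = fst d" "(\<Sum>i\<in>I. snd (a i)) = snd d" by blast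
      have "fst (\<Sum>i\<in>I. a i) = (\<Sum>i\<in>I. fst (a i))" "snd (\<Sum>i\<in>I. a i) = (\<Sum>i\<in>I. snd (a i))"
        by (induction I rule: infinite_finite_induct) simp_all
      then have "(\<Sum>i\<in>I. a i) = d" by (intro prod_eqI) (simp_all add: d)
      then show "f p \<in> grade T d" unfolding p(1) using gr[OF p(2)] by simp
    qed
  qed
qed

lemma tensor_map_cong:
  assumes "\<And>x. x \<in> carrier M \<Longrightarrow> f x = f' x" "\<And>y. y \<in> carrier N \<Longrightarrow> g y = g' y"
  shows "tensor_map M N M' N' f g = tensor_map M N M' N' f' g'"
  unfolding tensor_map_def tensor_lift_def presented_lift_def using assms by (simp cong: conj_cong)

lemma power_lift_cong:
  assumes "\<And>x. x \<in> (I \<rightarrow>\<^sub>E carrier M) \<Longrightarrow> b x = b' x"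
  shows "power_lift I M T b = power_lift I M T b'"
  unfolding power_lift_def presented_lift_def using assms by (simp cong: conj_cong)

context
  fixes M :: "'a bigraded" and N :: "'b bigraded" and M' :: "'c bigraded" and N' :: "'d bigraded" and f g
  assumes f: "bigraded_hom M M' f" and g: "bigraded_hom N N' g"
begin

lemma tensor_map_hom: "tensor_map M N M' N' f g \<in> hom (tensor_group M N) (tensor_group M' N')"
    and tensor_map_pure: "x \<in> carrier M \<Longrightarrow> y \<in> carrier N \<Longrightarrow>
      tensor_map M N M' N' f g (pure_tensor M N x y) = pure_tensor M' N' (f x) (g y)"
proof -
  note c = bigraded_module_comm[OF bigraded_homD(1)[OF f]] bigraded_module_comm[OF bigraded_homD(1)[OF g]]
    bigraded_module_comm[OF bigraded_homD(2)[OF f]] bigraded_module_comm[OF bigraded_homD(2)[OF g]]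
  note T = comm_group_tensor_group[OF c(3,4)]
  note cl = bigraded_hom_closed[OF f] bigraded_hom_closed[OF g]
  have 1: "pure_tensor M' N' (f x) (g y) \<in> carrier (tensor_group M' N')"
    if "x \<in> carrier M" "y \<in> carrier N" for x y
    by (rule pure_tensor_closed[OF c(3,4) cl(1)[OF that(1)] cl(2)[OF that(2)]])
  have 2: "pure_tensor M' N' (f (x \<otimes>\<^bsub>M\<^esub> x')) (g y) =
      pure_tensor M' N' (f x) (g y) \<otimes>\<^bsub>tensor_group M' N'\<^esub> pure_tensor M' N' (f x') (g y)"
    if "x \<in> carrier M" "x' \<in> carrier M" "y \<in> carrier N" for x x' y
    unfolding hom_mult[OF bigraded_homD(3)[OF f] that(1,2)]
    by (rule hom_mult[OF pure_tensor_left_hom[OF c(3,4) cl(2)[OF that(3)]] cl(1)[OF that(1)] cl(1)[OF that(2)]])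
  have 3: "pure_tensor M' N' (f x) (g (y \<otimes>\<^bsub>N\<^esub> y')) =
      pure_tensor M' N' (f x) (g y) \<otimes>\<^bsub>tensor_group M' N'\<^esub> pure_tensor M' N' (f x) (g y')"
    if "x \<in> carrier M" "y \<in> carrier N" "y' \<in> carrier N" for x y y'
    unfolding hom_mult[OF bigraded_homD(3)[OF g] that(2,3)]
    by (rule hom_mult[OF pure_tensor_right_hom[OF c(3,4) cl(1)[OF that(1)]] cl(2)[OF that(2)] cl(2)[OF that(3)]])
  show "tensor_map M N M' N' f g \<in> hom (tensor_group M N) (tensor_group M' N')"
    unfolding tensor_map_def by (rule tensor_universal(1)[OF T c(1,2)]; (rule 1 2 3; assumption))
  show "tensor_map M N M' N' f g (pure_tensor M N x y) = pure_tensor M' N' (f x) (g y)"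
    if "x \<in> carrier M" "y \<in> carrier N"
    unfolding tensor_map_def
    by (rule tensor_universal(2)[OF T c(1,2)]; (rule 1 2 3 that; assumption?))
qed

lemma bigraded_hom_tensor_map:
  assumes MN: "bigraded_module (tensor M N)" and MN': "bigraded_module (tensor M' N')"
  shows "bigraded_hom (tensor M N) (tensor M' N') (tensor_map M N M' N' f g)"
proof (rule bigraded_hom_tensor[OF bigraded_homD(1)[OF f] bigraded_homD(1)[OF g] MN MN'])
  show "tensor_map M N M' N' f g \<in> hom (tensor_group M N) (tensor M' N')"
    unfolding tensor_def[of M' N'] hom_with_grading by (rule tensor_map_hom)
  fix x y a b assume x: "x \<in> grade M a" and y: "y \<in> grade N b"
  have "x \<in> carrier M" "y \<in> carrier N"
    by (rule subsetD[OF subgroup.subset[OF bigraded_module_grade[OF bigraded_homD(1)[OF f]]] x])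
      (rule subsetD[OF subgroup.subset[OF bigraded_module_grade[OF bigraded_homD(1)[OF g]]] y])
  then show "tensor_map M N M' N' f g (pure_tensor M N x y) \<in> grade (tensor M' N') (a + b)"
    using pure_tensor_grade[OF bigraded_homD(4)[OF f x] bigraded_homD(4)[OF g y]] by (simp add: tensor_map_pure)
qed

text \<open>The composite is given by separate maps f'' and g'' because composites of lifts are
  known only on the carriers, not as functions on the whole type.\<close>

lemma tensor_map_comp:
  assumes f': "bigraded_hom M' M'' f'" and g': "bigraded_hom N' N'' g'"
    and fg: "bigraded_hom M M'' f''" "bigraded_hom N N'' g''"
    and f'': "\<And>x. x \<in> carrier M \<Longrightarrow> f' (f x) = f'' x" and g'': "\<And>y. y \<in> carrier N \<Longrightarrow> g' (g y) = g'' y"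
    and z: "z \<in> carrier (tensor_group M N)"
  shows "tensor_map M' N' M'' N'' f' g' (tensor_map M N M' N' f g z) = tensor_map M N M'' N'' f'' g'' z"
proof (rule tensor_hom_ext[OF _ _ _ _ _ _ z])
  note c = bigraded_module_comm[OF bigraded_homD(1)[OF f]] bigraded_module_comm[OF bigraded_homD(1)[OF g]]
    bigraded_module_comm[OF bigraded_homD(2)[OF f']] bigraded_module_comm[OF bigraded_homD(2)[OF g']]
  show "comm_group M" "comm_group N" by (rule c)+
  show "group (tensor_group M'' N'')" by (rule comm_group.axioms(2)[OF comm_group_tensor_group[OF c(3,4)]])
  show "(\<lambda>z. tensor_map M' N' M'' N'' f' g' (tensor_map M N M' N' f g z)) \<in> hom (tensor_group M N) (tensor_group M'' N'')"
    using hom_compose[OF tensor_map_hom Submission.tensor_map_hom[OF f' g']] by (simp add: comp_def)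
  show "tensor_map M N M'' N'' f'' g'' \<in> hom (tensor_group M N) (tensor_group M'' N'')"
    by (rule Submission.tensor_map_hom[OF fg])
  fix x y assume x: "x \<in> carrier M" and y: "y \<in> carrier N"
  show "tensor_map M' N' M'' N'' f' g' (tensor_map M N M' N' f g (pure_tensor M N x y)) =
      tensor_map M N M'' N'' f'' g'' (pure_tensor M N x y)"
    unfolding tensor_map_pure[OF x y] Submission.tensor_map_pure[OF fg x y]
      Submission.tensor_map_pure[OF f' g' bigraded_hom_closed[OF f x] bigraded_hom_closed[OF g y]] f''[OF x] g''[OF y]
    by (rule refl)
qed

end

lemma tensor_map_id:
  assumes M: "bigraded_hom M M f" and N: "bigraded_hom N N g"
    and f: "\<And>x. x \<in> carrier M \<Longrightarrow> f x = x" and g: "\<And>y. y \<in> carrier N \<Longrightarrow> g y = y"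
    and z: "z \<in> carrier (tensor_group M N)"
  shows "tensor_map M N M N f g z = z"
proof (rule tensor_hom_ext[OF _ _ _ _ _ _ z])
  note c = bigraded_module_comm[OF bigraded_homD(1)[OF M]] bigraded_module_comm[OF bigraded_homD(1)[OF N]]
  show "comm_group M" "comm_group N" by (rule c)+
  show "group (tensor_group M N)" by (rule comm_group.axioms(2)[OF comm_group_tensor_group[OF c]])
  show "tensor_map M N M N f g \<in> hom (tensor_group M N) (tensor_group M N)" by (rule tensor_map_hom[OF M N])
  show "(\<lambda>z. z) \<in> hom (tensor_group M N) (tensor_group M N)" by (simp add: hom_def)
  fix x y assume x: "x \<in> carrier M" and y: "y \<in> carrier N"
  show "tensor_map M N M N f g (pure_tensor M N x y) = pure_tensor M N x y"
    unfolding tensor_map_pure[OF M N x y] f[OF x] g[OF y] by (rule refl)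
qed

text \<open>A map p of index sets induces a map of tensor powers of a ring that multiplies the factors
  over each index; over an index outside the image of p the factor is 1. The maps m, u and f of the
  construction and the reindexing of the factors along an isomorphism of graphs are of this kind.\<close>

definition push :: "('i \<Rightarrow> 'j) \<Rightarrow> 'i set \<Rightarrow> 'j set \<Rightarrow> ('i \<Rightarrow> dual) \<Rightarrow> 'j \<Rightarrow> dual" where
  "push p I J x = (\<lambda>j\<in>J. finprod dual_ring x {i \<in> I. p i = j})"

definition power_push :: "dual bigraded \<Rightarrow> ('i \<Rightarrow> 'j) \<Rightarrow> 'i set \<Rightarrow> 'j set \<Rightarrow>
    (('i \<Rightarrow> dual) \<Rightarrow>\<^sub>0 int) set \<Rightarrow> (('j \<Rightarrow> dual) \<Rightarrow>\<^sub>0 int) set" where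
  "power_push M p I J = power_lift I M (power_group J M) (\<lambda>x. pure_power J M (push p I J x))"

lemma push_closed: "x \<in> (I \<rightarrow>\<^sub>E carrier dual_ring) \<Longrightarrow> push p I J x \<in> (J \<rightarrow>\<^sub>E carrier dual_ring)"
  unfolding push_def by (intro restrict_PiE_iff[THEN iffD2] ballI DR.finprod_closed Pi_I) (auto dest: PiE_mem)

text \<open>The entry at i occurs only in the product over \<open>p i\<close>, where it is
  multiplied by the other entries of its fibre. Distributivity of the ring then makes the push
  multilinear.\<close>

lemma push_upd:
  assumes f: "f \<in> (I \<rightarrow>\<^sub>E carrier dual_ring)" and i: "i \<in> I" and x: "x \<in> carrier dual_ring"
    and p: "p \<in> I \<rightarrow> J" and I: "finite I"
  shows "push p I J (f(i := x)) =
    (push p I J f)(p i := x \<otimes>\<^bsub>dual_ring\<^esub> finprod dual_ring f ({k \<in> I. p k = p i} - {i}))"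
proof (rule ext)
  fix j
  have fc: "f k \<in> carrier dual_ring" if "k \<in> I" for k using f that by (rule PiE_mem)
  show "push p I J (f(i := x)) j =
    ((push p I J f)(p i := x \<otimes>\<^bsub>dual_ring\<^esub> finprod dual_ring f ({k \<in> I. p k = p i} - {i}))) j"
  proof (cases "j = p i")
    case True
    let ?A = "{k \<in> I. p k = p i} - {i}"
    have A: "{k \<in> I. p k = p i} = insert i ?A" using i by auto
    have "finprod dual_ring (f(i := x)) (insert i ?A) = (f(i := x)) i \<otimes>\<^bsub>dual_ring\<^esub> finprod dual_ring (f(i := x)) ?A"
      by (rule DR.finprod_insert) (use I fc x in auto)
    also have "finprod dual_ring (f(i := x)) ?A = finprod dual_ring f ?A"
      by (rule DR.finprod_cong') (use fc in auto)
    finally have "finprod dual_ring (f(i := x)) {k \<in> I. p k = p i} = x \<otimes>\<^bsub>dual_ring\<^esub> finprod dual_ring f ?A"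
      unfolding A[symmetric] fun_upd_same .
    then show ?thesis using True p i by (auto simp: push_def)
  next
    case False
    have "finprod dual_ring (f(i := x)) {k \<in> I. p k = j} = finprod dual_ring f {k \<in> I. p k = j}"
      by (rule DR.finprod_cong') (use fc False in auto)
    then show ?thesis using False by (simp add: push_def)
  qed
qed

text \<open>The fibre of the composite over k is the disjoint union of the fibres of p over the
  points j with \<open>q j = k\<close>, and a product in a commutative ring may be taken fibre by
  fibre.\<close>

lemma push_comp:
  assumes x: "x \<in> (I \<rightarrow>\<^sub>E carrier dual_ring)" and p: "p \<in> I \<rightarrow> J" and I: "finite I" and J: "finite J"
  shows "push q J K (push p I J x) = push (\<lambda>i. q (p i)) I K x"
proof -
  have xc: "x i \<in> carrier dual_ring" if "i \<in> I" for i using x that by (rule PiE_mem)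
  have "finprod dual_ring (push p I J x) {j \<in> J. q j = k} = finprod dual_ring x {i \<in> I. q (p i) = k}" for k
  proof -
    have "finprod dual_ring (push p I J x) {j \<in> J. q j = k} =
        finprod dual_ring (\<lambda>j. finprod dual_ring x {i \<in> I. p i = j}) {j \<in> J. q j = k}"
      by (rule DR.finprod_cong') (use xc in \<open>auto simp: push_def intro!: DR.finprod_closed\<close>)
    also have "\<dots> = finprod dual_ring x (\<Union>j\<in>{j \<in> J. q j = k}. {i \<in> I. p i = j})"
      by (rule DR.finprod_UN_disjoint[symmetric]) (use I J xc in \<open>auto simp: pairwise_def disjnt_def\<close>)
    also have "(\<Union>j\<in>{j \<in> J. q j = k}. {i \<in> I. p i = j}) = {i \<in> I. q (p i) = k}" using p by auto
    finally show ?thesis .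
  qed
  then show ?thesis by (simp add: push_def[of q] push_def[of "\<lambda>i. q (p i)"])
qed

lemma push_inj:
  assumes x: "x \<in> (I \<rightarrow>\<^sub>E carrier dual_ring)" and p: "inj_on p I"
  shows "i \<in> I \<Longrightarrow> p i \<in> J \<Longrightarrow> push p I J x (p i) = x i"
    and "j \<in> J \<Longrightarrow> j \<notin> p ` I \<Longrightarrow> push p I J x j = \<one>\<^bsub>dual_ring\<^esub>"
proof -
  assume i: "i \<in> I" "p i \<in> J"
  have s: "{k \<in> I. p k = p i} = {i}" using i p by (auto dest: inj_onD)
  have "finprod dual_ring x (insert i {}) = x i \<otimes>\<^bsub>dual_ring\<^esub> finprod dual_ring x {}"
    by (rule DR.finprod_insert) (use PiE_mem[OF x i(1)] in auto)
  then show "push p I J x (p i) = x i" using i(2) PiE_mem[OF x i(1)] by (simp add: push_def s)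
next
  assume j: "j \<in> J" "j \<notin> p ` I"
  have e: "{k \<in> I. p k = j} = {}" using j by auto
  show "push p I J x j = \<one>\<^bsub>dual_ring\<^esub>" unfolding push_def restrict_apply'[OF j(1)] e by simp
qed

lemma push_id: "x \<in> (I \<rightarrow>\<^sub>E carrier dual_ring) \<Longrightarrow> push (\<lambda>i. i) I I x = x"
proof (rule ext)
  fix i assume x: "x \<in> (I \<rightarrow>\<^sub>E carrier dual_ring)"
  show "push (\<lambda>i. i) I I x i = x i"
  proof (cases "i \<in> I")
    case True
    then show ?thesis using push_inj(1)[OF x, of "\<lambda>i. i" i I] by simp
  next
    case False
    then show ?thesis using PiE_arb[OF x False] by (simp add: push_def)
  qed
qed

lemma push_one: "push p I J (\<lambda>i\<in>I. \<one>\<^bsub>dual_ring\<^esub>) = (\<lambda>j\<in>J. \<one>\<^bsub>dual_ring\<^esub>)"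
  unfolding push_def by (intro restrict_ext DR.finprod_one_eqI) simp

lemma power_push_cong:
  assumes "\<And>i. i \<in> I \<Longrightarrow> p i = p' i"
  shows "power_push M p I J = power_push M p' I J"
proof -
  have "{i \<in> I. p i = j} = {i \<in> I. p' i = j}" for j using assms by auto
  then show ?thesis unfolding power_push_def push_def by simp
qed

context
  fixes M :: "dual bigraded"
  assumes M: "\<exists>d. M = graded_dual d"
begin

lemma dual_free: "\<exists>d. free_bigraded M UNIV dual_basis dual_coord (\<lambda>x. if x then d else 0)"
  using M free_bigraded_dual by auto

lemma dual_comm: "comm_group M" and dual_bigraded: "bigraded_module M"
  using free_basis.comm[OF free_bigraded.axioms(1)] free_bigraded.bigraded dual_free by auto

lemma dual_carrier_eq: "carrier M = carrier dual_ring" and dual_mult_eq: "x \<otimes>\<^bsub>M\<^esub> y = x \<oplus>\<^bsub>dual_ring\<^esub> y"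
  using M by auto

lemma dual_power_bigraded: "finite I \<Longrightarrow> bigraded_module (tensor_power I M)"
  using free_bigraded.bigraded[OF free_bigraded_tensor_power] dual_free by blast

lemma finprod_grade:
  assumes "finite A" "\<And>i. i \<in> A \<Longrightarrow> x i \<in> grade M (a i)"
  shows "finprod dual_ring x A \<in> grade M (\<Sum>i\<in>A. a i)"
  using assms
proof (induction A rule: finite_induct)
  case empty
  then show ?case using M graded_dual_one by auto
next
  case (insert i A)
  have cl: "x j \<in> carrier dual_ring" if "j \<in> insert i A" for j
    using subsetD[OF subgroup.subset[OF bigraded_module_grade[OF dual_bigraded]] insert.prems[OF that]]
    unfolding dual_carrier_eq .
  have e: "finprod dual_ring x (insert i A) = x i \<otimes>\<^bsub>dual_ring\<^esub> finprod dual_ring x A"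
    by (rule DR.finprod_insert) (use insert.hyps cl in auto)
  obtain d where d: "M = graded_dual d" using M by blast
  have "x i \<in> grade M (a i)" by (rule insert.prems) simp
  moreover have "finprod dual_ring x A \<in> grade M (\<Sum>i\<in>A. a i)" by (rule insert.IH) (rule insert.prems, simp)
  ultimately have "x i \<otimes>\<^bsub>dual_ring\<^esub> finprod dual_ring x A \<in> grade M (a i + (\<Sum>i\<in>A. a i))"
    unfolding d by (rule graded_dual_mult)
  then show ?case unfolding e sum.insert[OF insert.hyps] .
qed

context
  fixes p :: "'i \<Rightarrow> 'j" and I J
  assumes p: "p \<in> I \<rightarrow> J" and I: "finite I" and J: "finite J"
begin

lemma power_push_hom: "power_push M p I J \<in> hom (power_group I M) (power_group J M)"
    and power_push_pure: "x \<in> (I \<rightarrow>\<^sub>E carrier M) \<Longrightarrow>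
      power_push M p I J (pure_power I M x) = pure_power J M (push p I J x)"
proof -
  note T = comm_group_power_group[OF dual_comm, of J]
  have 1: "(\<lambda>x. pure_power J M (push p I J x)) \<in> (I \<rightarrow>\<^sub>E carrier M) \<rightarrow> carrier (power_group J M)"
    using pure_power_closed[OF dual_comm, of "push p I J _" J] push_closed[of _ I p J] unfolding dual_carrier_eq by auto
  have 2: "pure_power J M (push p I J (f(i := x \<otimes>\<^bsub>M\<^esub> y))) =
      pure_power J M (push p I J (f(i := x))) \<otimes>\<^bsub>power_group J M\<^esub> pure_power J M (push p I J (f(i := y)))"
    if fM: "f \<in> (I \<rightarrow>\<^sub>E carrier M)" and i: "i \<in> I" and xM: "x \<in> carrier M" and yM: "y \<in> carrier M" for f i x y
  proof -
    note f = fM[unfolded dual_carrier_eq] and x = xM[unfolded dual_carrier_eq] and y = yM[unfolded dual_carrier_eq]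
    let ?r = "finprod dual_ring f ({k \<in> I. p k = p i} - {i})"
    have r: "?r \<in> carrier dual_ring" using f by (intro DR.finprod_closed) auto
    have xy: "x \<oplus>\<^bsub>dual_ring\<^esub> y \<in> carrier dual_ring" by (rule DR.a_closed[OF x y])
    have pi: "p i \<in> J" using p i by auto
    have pf: "push p I J f \<in> (J \<rightarrow>\<^sub>E carrier M)" unfolding dual_carrier_eq by (rule push_closed[OF f])
    have "pure_power J M (push p I J (f(i := x \<otimes>\<^bsub>M\<^esub> y))) =
        pure_power J M ((push p I J f)(p i := (x \<otimes>\<^bsub>dual_ring\<^esub> ?r) \<otimes>\<^bsub>M\<^esub> (y \<otimes>\<^bsub>dual_ring\<^esub> ?r)))"
      unfolding dual_mult_eq push_upd[OF f i xy p I] DR.l_distr[OF x y r] by (rule refl)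
    also have "\<dots> = pure_power J M ((push p I J f)(p i := x \<otimes>\<^bsub>dual_ring\<^esub> ?r)) \<otimes>\<^bsub>power_group J M\<^esub>
        pure_power J M ((push p I J f)(p i := y \<otimes>\<^bsub>dual_ring\<^esub> ?r))"
      by (rule hom_mult[OF pure_power_hom[OF dual_comm pf pi]])
        (unfold dual_carrier_eq, rule DR.m_closed[OF x r], rule DR.m_closed[OF y r])
    finally show ?thesis unfolding push_upd[OF f i x p I] push_upd[OF f i y p I] .
  qed
  show "power_push M p I J \<in> hom (power_group I M) (power_group J M)"
    unfolding power_push_def by (rule power_universal(1)[OF T dual_comm 1 2])
  show "power_push M p I J (pure_power I M x) = pure_power J M (push p I J x)" if "x \<in> (I \<rightarrow>\<^sub>E carrier M)"
    unfolding power_push_def by (rule power_universal(2)[OF T dual_comm 1 2 that])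
qed

lemma power_push_bigraded: "bigraded_hom (tensor_power I M) (tensor_power J M) (power_push M p I J)"
proof (rule bigraded_hom_power[OF dual_bigraded dual_power_bigraded[OF I] dual_power_bigraded[OF J]])
  show "power_push M p I J \<in> hom (power_group I M) (tensor_power J M)"
    unfolding tensor_power_def hom_with_grading by (rule power_push_hom)
  fix x a assume x: "x \<in> (\<Pi>\<^sub>E i\<in>I. grade M (a i))"
  have xc: "x \<in> (I \<rightarrow>\<^sub>E carrier M)"
    by (rule subsetD[OF PiE_mono x]) (rule subgroup.subset[OF bigraded_module_grade[OF dual_bigraded]])
  \<comment> \<open>The degree at j is the sum of the degrees over the fibre of j. The fibres
    partition I, so the total degree is preserved.\<close>
  have "push p I J x \<in> (\<Pi>\<^sub>E j\<in>J. grade M (\<Sum>i\<in>{i \<in> I. p i = j}. a i))"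
    unfolding push_def restrict_PiE_iff by (intro ballI finprod_grade) (use I x in \<open>auto dest: PiE_mem\<close>)
  from pure_power_grade[OF this]
  show "power_push M p I J (pure_power I M x) \<in> grade (tensor_power J M) (\<Sum>i\<in>I. a i)"
    unfolding power_push_pure[OF xc] sum.group[OF I J funcset_image[OF p]] .
qed

lemma power_push_comp:
  assumes q: "q \<in> J \<rightarrow> K" and K: "finite K" and z: "z \<in> carrier (power_group I M)"
  shows "power_push M q J K (power_push M p I J z) = power_push M (\<lambda>i. q (p i)) I K z"
proof (rule power_hom_ext[OF dual_comm _ _ _ _ z])
  have qp: "(\<lambda>i. q (p i)) \<in> I \<rightarrow> K" using p q by auto
  show "group (power_group K M)" by (rule comm_group.axioms(2)[OF comm_group_power_group[OF dual_comm]])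
  show "(\<lambda>z. power_push M q J K (power_push M p I J z)) \<in> hom (power_group I M) (power_group K M)"
    using hom_compose[OF power_push_hom Submission.power_push_hom[OF M q J K]] by (simp add: comp_def)
  show "power_push M (\<lambda>i. q (p i)) I K \<in> hom (power_group I M) (power_group K M)"
    by (rule Submission.power_push_hom[OF M qp I K])
  fix x assume xM: "x \<in> (I \<rightarrow>\<^sub>E carrier M)"
  note x = xM[unfolded dual_carrier_eq]
  have px: "push p I J x \<in> (J \<rightarrow>\<^sub>E carrier M)" unfolding dual_carrier_eq by (rule push_closed[OF x])
  show "power_push M q J K (power_push M p I J (pure_power I M x)) = power_push M (\<lambda>i. q (p i)) I K (pure_power I M x)"
    unfolding power_push_pure[OF xM] Submission.power_push_pure[OF M q J K px] Submission.power_push_pure[OF M qp I K xM]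
      push_comp[OF x p I J] by (rule refl)
qed

end

lemma power_push_id:
  assumes I: "finite I" and z: "z \<in> carrier (power_group I M)"
  shows "power_push M (\<lambda>i. i) I I z = z"
proof (rule power_hom_ext[OF dual_comm _ _ _ _ z])
  have id: "(\<lambda>i. i) \<in> I \<rightarrow> I" by simp
  show "group (power_group I M)" by (rule comm_group.axioms(2)[OF comm_group_power_group[OF dual_comm]])
  show "power_push M (\<lambda>i. i) I I \<in> hom (power_group I M) (power_group I M)" by (rule power_push_hom[OF id I I])
  show "(\<lambda>z. z) \<in> hom (power_group I M) (power_group I M)" by (simp add: hom_def)
  fix x assume xM: "x \<in> (I \<rightarrow>\<^sub>E carrier M)"
  show "power_push M (\<lambda>i. i) I I (pure_power I M x) = pure_power I M x"
    unfolding power_push_pure[OF id I I xM] push_id[OF xM[unfolded dual_carrier_eq]] by (rule refl)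
qed

end

text \<open>The inclusion of S has an empty fibre over e, and the empty product is 1. This is why
  the insertion of a unit is the map of an inclusion.\<close>

lemma push_insert:
  assumes x: "x \<in> (S \<rightarrow>\<^sub>E carrier dual_ring)" and e: "e \<notin> S"
  shows "push (\<lambda>i. i) S (insert e S) x = x(e := \<one>\<^bsub>dual_ring\<^esub>)"
proof (rule ext)
  fix j
  have i: "inj_on (\<lambda>i. i) S" by simp
  consider "j = e" | "j \<in> S" | "j \<notin> insert e S" by blast
  then show "push (\<lambda>i. i) S (insert e S) x j = (x(e := \<one>\<^bsub>dual_ring\<^esub>)) j"
  proof cases
    case 1
    then show ?thesis using push_inj(2)[OF x i, of j "insert e S"] e by simp
  next
    case 2
    then have "j \<noteq> e" using e by blast
    then show ?thesis using push_inj(1)[OF x i 2, of "insert e S"] 2 by simp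
  next
    case 3
    then have "x j = undefined" using PiE_arb[OF x, of j] by simp
    then show ?thesis using 3 by (simp add: push_def)
  qed
qed

lemma dual_algebras: "\<exists>d. alg_A = graded_dual d" "\<exists>d. alg_B = graded_dual d"
  unfolding alg_A_def alg_B_def by blast+

lemma alg_simps [simp]: "carrier alg_A = carrier dual_ring" "carrier alg_B = carrier dual_ring"
  unfolding alg_A_def alg_B_def by simp_all

lemma insert_unit_A_push: "e \<notin> S \<Longrightarrow> insert_unit_A S e = power_push alg_A (\<lambda>i. i) S (insert e S)"
  unfolding insert_unit_A_def power_push_def by (rule power_lift_cong) (simp add: push_insert)

lemma append_unit_B_push: "append_unit_B k = power_push alg_B (\<lambda>i. i) {..<k} {..<Suc k}"
  unfolding append_unit_B_def power_push_def lessThan_Suc by (rule power_lift_cong) (simp add: push_insert)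

lemma free_alg: "free_graded alg_A UNIV (\<lambda>x. if x then (1, 0) else 0)" "free_graded alg_B UNIV (\<lambda>x. if x then (0, 1) else 0)"
  unfolding free_graded_def alg_A_def alg_B_def using free_bigraded_dual by blast+

section \<open>The modules and maps as functors of their index sets\<close>

definition modT :: "'c set \<Rightarrow> nat \<Rightarrow> _" where
  "modT I k = tensor (tensor_power I alg_A) (tensor_power {..<k} alg_B)"

text \<open>The B-factors carry no label besides their position, so for k at most l the map between
  them is always that of the initial inclusion, which appends l - k units.\<close>

definition mapT where
  "mapT p I J k l = tensor_map (tensor_power I alg_A) (tensor_power {..<k :: nat} alg_B)
     (tensor_power J alg_A) (tensor_power {..<l :: nat} alg_B)
     (power_push alg_A p I J) (power_push alg_B (\<lambda>i. i) {..<k} {..<l})"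

definition basisT :: "'c set \<Rightarrow> nat \<Rightarrow> (('c \<Rightarrow> bool) \<times> (nat \<Rightarrow> bool)) set" where
  "basisT I k = (I \<rightarrow>\<^sub>E UNIV) \<times> ({..<k} \<rightarrow>\<^sub>E UNIV)"

definition degT :: "'c set \<Rightarrow> nat \<Rightarrow> ('c \<Rightarrow> bool) \<times> (nat \<Rightarrow> bool) \<Rightarrow> nat \<times> nat" where
  "degT I k = (\<lambda>(f, g). (\<Sum>i\<in>I. if f i then (1, 0) else 0) + (\<Sum>i\<in>{..<k}. if g i then (0, 1) else 0))"

definition modY :: "'s set \<Rightarrow> 'c set \<Rightarrow> nat \<Rightarrow> _" where
  "modY S I k = tensor (tensor_power S alg_A) (modT I k)"

definition mapY where
  "mapY h S S' p I J k l = tensor_map (tensor_power S alg_A) (modT I k)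
     (tensor_power S' alg_A) (modT J l) (power_push alg_A h S S') (mapT p I J k l)"

definition basisY :: "'s set \<Rightarrow> 'c set \<Rightarrow> nat \<Rightarrow> (('s \<Rightarrow> bool) \<times> ('c \<Rightarrow> bool) \<times> (nat \<Rightarrow> bool)) set" where
  "basisY S I k = (S \<rightarrow>\<^sub>E UNIV) \<times> basisT I k"

definition degY :: "'s set \<Rightarrow> 'c set \<Rightarrow> nat \<Rightarrow> ('s \<Rightarrow> bool) \<times> ('c \<Rightarrow> bool) \<times> (nat \<Rightarrow> bool) \<Rightarrow> nat \<times> nat" where
  "degY S I k = (\<lambda>(f, z). (\<Sum>i\<in>S. if f i then (1, 0) else 0) + degT I k z)"

lemma free_modT: "finite I \<Longrightarrow> free_graded (modT I k) (basisT I k) (degT I k)"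
  unfolding modT_def basisT_def degT_def
  by (intro free_graded_tensor free_graded_tensor_power free_alg finite_lessThan)

lemma free_modY: "finite S \<Longrightarrow> finite I \<Longrightarrow> free_graded (modY S I k) (basisY S I k) (degY S I k)"
  unfolding modY_def basisY_def degY_def
  by (intro free_graded_tensor free_graded_tensor_power free_alg free_modT)

lemma carrier_modT: "carrier (modT I k) = carrier (tensor_group (tensor_power I alg_A) (tensor_power {..<k} alg_B))"
  by (simp add: modT_def)

lemma carrier_modY: "carrier (modY S I k) = carrier (tensor_group (tensor_power S alg_A) (modT I k))"
  by (simp add: modY_def)

lemma mapT_cong: "(\<And>i. i \<in> I \<Longrightarrow> p i = p' i) \<Longrightarrow> mapT p I J k l = mapT p' I J k l"
  unfolding mapT_def by (simp cong: power_push_cong)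

lemma mapY_cong:
  "(\<And>e. e \<in> S \<Longrightarrow> h e = h' e) \<Longrightarrow> (\<And>i. i \<in> I \<Longrightarrow> p i = p' i) \<Longrightarrow>
    mapY h S S' p I J k l = mapY h' S S' p' I J k l"
  unfolding mapY_def by (simp cong: power_push_cong mapT_cong)

lemma push_B_hom:
  fixes k l :: nat
  shows "k \<le> l \<Longrightarrow> bigraded_hom (tensor_power {..<k} alg_B) (tensor_power {..<l} alg_B) (power_push alg_B (\<lambda>i. i) {..<k} {..<l})"
  by (rule power_push_bigraded[OF dual_algebras(2) _ finite_lessThan finite_lessThan]) auto

lemma push_A_hom:
  "p \<in> I \<rightarrow> J \<Longrightarrow> finite I \<Longrightarrow> finite J \<Longrightarrow>
    bigraded_hom (tensor_power I alg_A) (tensor_power J alg_A) (power_push alg_A p I J)"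
  by (rule power_push_bigraded[OF dual_algebras(1)])

context
  fixes p :: "'i \<Rightarrow> 'j" and I J and k l :: nat
  assumes p: "p \<in> I \<rightarrow> J" and I: "finite I" and J: "finite J" and kl: "k \<le> l"
begin

lemma mapT_hom: "bigraded_hom (modT I k) (modT J l) (mapT p I J k l)"
  unfolding modT_def mapT_def
  by (rule bigraded_hom_tensor_map[OF push_A_hom[OF p I J] push_B_hom[OF kl]
    free_gradedD(3)[OF free_modT[OF I, unfolded modT_def]] free_gradedD(3)[OF free_modT[OF J, unfolded modT_def]]])

end

lemma mapT_comp:
  assumes p: "p \<in> I \<rightarrow> J" and q: "q \<in> J \<rightarrow> K" and fin: "finite I" "finite J" "finite K" and kl: "k \<le> l" "l \<le> m"
    and z: "z \<in> carrier (modT I k)"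
  shows "mapT q J K l m (mapT p I J k l z) = mapT (\<lambda>i. q (p i)) I K k m z"
proof -
  have qp: "(\<lambda>i. q (p i)) \<in> I \<rightarrow> K" using p q by auto
  have km: "k \<le> m" using kl by simp
  have b: "(\<lambda>i. i) \<in> {..<k} \<rightarrow> {..<l}" "(\<lambda>i. i) \<in> {..<l} \<rightarrow> {..<m}" using kl by auto
  show ?thesis
    unfolding mapT_def
    by (rule tensor_map_comp[OF push_A_hom[OF p fin(1,2)] push_B_hom[OF kl(1)]
        push_A_hom[OF q fin(2,3)] push_B_hom[OF kl(2)] push_A_hom[OF qp fin(1,3)] push_B_hom[OF km]
        power_push_comp[OF dual_algebras(1) p fin(1,2) q fin(3)]
        power_push_comp[OF dual_algebras(2) b(1) finite_lessThan finite_lessThan b(2) finite_lessThan]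
        z[unfolded carrier_modT]])
      simp_all
qed

lemma mapT_id:
  assumes I: "finite I" and z: "z \<in> carrier (modT I k)" and p: "\<And>i. i \<in> I \<Longrightarrow> p i = i"
  shows "mapT p I I k k z = z"
proof -
  have id: "(\<lambda>i. i) \<in> I \<rightarrow> I" by simp
  have "mapT p I I k k = mapT (\<lambda>i. i) I I k k" by (rule mapT_cong) (rule p)
  moreover have "mapT (\<lambda>i. i) I I k k z = z"
    unfolding mapT_def
    by (rule tensor_map_id[OF push_A_hom[OF id I I] push_B_hom[OF order_refl]
        power_push_id[OF dual_algebras(1) I] power_push_id[OF dual_algebras(2) finite_lessThan] z[unfolded carrier_modT]])
      simp_all
  ultimately show ?thesis by simp
qed

context
  fixes h :: "'s \<Rightarrow> 'r" and S S' and p :: "'i \<Rightarrow> 'j" and I J and k l :: nat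
  assumes h: "h \<in> S \<rightarrow> S'" and S: "finite S" and S': "finite S'"
    and p: "p \<in> I \<rightarrow> J" and I: "finite I" and J: "finite J" and kl: "k \<le> l"
begin

lemma mapY_hom: "bigraded_hom (modY S I k) (modY S' J l) (mapY h S S' p I J k l)"
  unfolding modY_def mapY_def
  by (rule bigraded_hom_tensor_map[OF push_A_hom[OF h S S'] mapT_hom[OF p I J kl]
    free_gradedD(3)[OF free_modY[OF S I, unfolded modY_def]] free_gradedD(3)[OF free_modY[OF S' J, unfolded modY_def]]])

lemma mapY_pure:
  assumes "x \<in> carrier (power_group S alg_A)" "z \<in> carrier (modT I k)"
  shows "mapY h S S' p I J k l (pure_tensor (tensor_power S alg_A) (modT I k) x z) =
    pure_tensor (tensor_power S' alg_A) (modT J l) (power_push alg_A h S S' x) (mapT p I J k l z)"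
  unfolding mapY_def by (rule tensor_map_pure[OF push_A_hom[OF h S S'] mapT_hom[OF p I J kl]]) (use assms in simp_all)

end

lemma mapY_comp:
  assumes h: "h \<in> S \<rightarrow> S'" and h': "h' \<in> S' \<rightarrow> S''" and fS: "finite S" "finite S'" "finite S''"
    and p: "p \<in> I \<rightarrow> J" and q: "q \<in> J \<rightarrow> K" and fin: "finite I" "finite J" "finite K" and kl: "k \<le> l" "l \<le> m"
    and z: "z \<in> carrier (modY S I k)"
  shows "mapY h' S' S'' q J K l m (mapY h S S' p I J k l z) = mapY (\<lambda>e. h' (h e)) S S'' (\<lambda>i. q (p i)) I K k m z"
proof -
  have qp: "(\<lambda>i. q (p i)) \<in> I \<rightarrow> K" "(\<lambda>e. h' (h e)) \<in> S \<rightarrow> S''" using p q h h' by auto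
  have km: "k \<le> m" using kl by simp
  show ?thesis
    unfolding mapY_def
    by (rule tensor_map_comp[OF push_A_hom[OF h fS(1,2)] mapT_hom[OF p fin(1,2) kl(1)]
        push_A_hom[OF h' fS(2,3)] mapT_hom[OF q fin(2,3) kl(2)] push_A_hom[OF qp(2) fS(1,3)] mapT_hom[OF qp(1) fin(1,3) km]
        power_push_comp[OF dual_algebras(1) h fS(1,2) h' fS(3)] mapT_comp[OF p q fin kl] z[unfolded carrier_modY]])
      simp_all
qed

lemma mapY_id:
  assumes S: "finite S" and I: "finite I" and z: "z \<in> carrier (modY S I k)"
    and h: "\<And>e. e \<in> S \<Longrightarrow> h e = e" and p: "\<And>i. i \<in> I \<Longrightarrow> p i = i"
  shows "mapY h S S p I I k k z = z"
proof -
  have id: "(\<lambda>i. i) \<in> S \<rightarrow> S" "(\<lambda>i. i) \<in> I \<rightarrow> I" by simp_all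
  have "mapY h S S p I I k k = mapY (\<lambda>i. i) S S (\<lambda>i. i) I I k k" by (rule mapY_cong) (rule h p; assumption)+
  moreover have "mapY (\<lambda>i. i) S S (\<lambda>i. i) I I k k z = z"
    unfolding mapY_def
    by (rule tensor_map_id[OF push_A_hom[OF id(1) S S] mapT_hom[OF id(2) I I order_refl]
        power_push_id[OF dual_algebras(1) S] mapT_id[OF I] z[unfolded carrier_modY]])
      simp_all
  ultimately show ?thesis by simp
qed

lemma mod_T_eq: "mod_T G S = modT (components G S) (betti1 G S)"
  unfolding mod_T_def modT_def by (rule refl)

lemma mod_Y_eq: "mod_Y G S = modY S (components G S) (betti1 G S)"
  unfolding mod_Y_def modY_def mod_T_eq by (rule refl)

section \<open>Edge maps as maps induced by inclusions of edge sets\<close>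

context fin_graph
begin

text \<open>On a component of a smaller spanning subgraph all members of the union coincide, so this
  is the map of components induced by the inclusion of edge sets. The smaller edge set does not
  enter, which makes composites easy to compare.\<close>

definition coarse :: "'e set \<Rightarrow> 'v set \<Rightarrow> 'v set" where
  "coarse S C = \<Union> (component_of G S ` C)"

lemma coarse_component:
  assumes "x \<in> V" "S \<subseteq> S'"
  shows "coarse S' (component_of G S x) = component_of G S' x"
proof -
  have "component_of G S' y = component_of G S' x" if y: "y \<in> component_of G S x" for y
  proof -
    have "(x, y) \<in> reachable G S'" using y reachable_mono[OF assms(2)] unfolding mem_component by blast
    then show ?thesis using component_eq_iff[OF assms(1)] by metis
  qed
  moreover have "x \<in> component_of G S x" by (rule component_self[OF assms(1)])
  ultimately show ?thesis unfolding coarse_def by blast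
qed

lemma coarse_in: "S \<subseteq> S' \<Longrightarrow> coarse S' \<in> components G S \<rightarrow> components G S'"
proof (rule funcsetI)
  fix C assume S: "S \<subseteq> S'" and "C \<in> components G S"
  then obtain x where x: "x \<in> V" "C = component_of G S x" using component_nonempty by blast
  show "coarse S' C \<in> components G S'" unfolding x(2) coarse_component[OF x(1) S] by (rule component_in[OF x(1)])
qed

lemma coarse_coarse:
  assumes S: "S \<subseteq> S'" "S' \<subseteq> S''" and C: "C \<in> components G S"
  shows "coarse S'' (coarse S' C) = coarse S'' C"
proof -
  obtain x where x: "x \<in> V" "C = component_of G S x" using component_nonempty C by blast
  have "S \<subseteq> S''" using S by blast
  then show ?thesis
    unfolding x(2) coarse_component[OF x(1) S(1)] coarse_component[OF x(1) S(2)] by (simp add: coarse_component[OF x(1)])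
qed

lemma coarse_eq_iff:
  assumes S: "S \<subseteq> S'" and c: "c \<in> components G S" and C: "C \<in> components G S'"
  shows "coarse S' c = C \<longleftrightarrow> c \<subseteq> C"
proof -
  obtain x where x: "x \<in> V" "x \<in> c" "c = component_of G S x" using component_nonempty c by blast
  have e: "coarse S' c = component_of G S' x" unfolding x(3) by (rule coarse_component[OF x(1) S])
  show ?thesis
  proof
    assume "coarse S' c = C"
    then have "C = component_of G S' x" using e by simp
    then show "c \<subseteq> C" using component_refines[OF S, of x] x(3) by simp
  next
    assume "c \<subseteq> C"
    then have "x \<in> C" using x(2) by blast
    then show "coarse S' c = C" unfolding e by (rule component_eqI[OF C, symmetric])
  qed
qed

lemma coarse_self: "C \<in> components G S \<Longrightarrow> coarse S C = C"
  using coarse_eq_iff[of S S C C] by simp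

lemma betti1_insert_le: "S \<subseteq> edges G \<Longrightarrow> e \<in> edges G - S \<Longrightarrow> betti1 G S \<le> betti1 G (insert e S)"
  using betti_insert[of S e] by (cases "component_of G S (fst (endpoints G e)) = component_of G S (snd (endpoints G e))") auto

text \<open>The fibre of \<open>coarse\<close> over the united component consists of the two end
  components, and every other fibre has one element. The product over fibres is thus the
  multiplication of exactly two factors.\<close>

lemma merge_A_push:
  assumes S: "S \<subseteq> edges G" and e: "e \<in> edges G"
    and ne: "component_of G S (fst (endpoints G e)) \<noteq> component_of G S (snd (endpoints G e))" (is "?A \<noteq> ?B")
  shows "merge_A (components G S) (components G (insert e S)) ?A ?B (?A \<union> ?B) =
    power_push alg_A (coarse (insert e S)) (components G S) (components G (insert e S))"
  unfolding merge_A_def power_push_def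
proof (rule power_lift_cong)
  fix x assume x: "x \<in> (components G S \<rightarrow>\<^sub>E carrier alg_A)"
  have xc: "x c \<in> carrier dual_ring" if "c \<in> components G S" for c using PiE_mem[OF x that] by simp
  have AB: "?A \<in> components G S" "?B \<in> components G S"
    using component_in endpoints_V[OF e] by blast+
  have "(if C = ?A \<union> ?B then x ?A \<otimes>\<^bsub>dual_ring\<^esub> x ?B else x C) =
      finprod dual_ring x {c \<in> components G S. coarse (insert e S) c = C}" if C: "C \<in> components G (insert e S)" for C
  proof -
    have "{c \<in> components G S. coarse (insert e S) c = C} = parts S C"
      unfolding parts_def using coarse_eq_iff[OF subset_insertI _ C] by blast
    also have "parts S C = (if C = ?A \<union> ?B then {?A, ?B} else {C})"
      by (rule components_insert_different(2)[OF S e ne C])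
    finally have p: "{c \<in> components G S. coarse (insert e S) c = C} = (if C = ?A \<union> ?B then {?A, ?B} else {C})" .
    have one: "finprod dual_ring x {c} = x c" if "c \<in> components G S" for c
      using DR.finprod_insert[of "{}" c x] xc[OF that] by simp
    show ?thesis
    proof (cases "C = ?A \<union> ?B")
      case True
      have "finprod dual_ring x (insert ?A {?B}) = x ?A \<otimes>\<^bsub>dual_ring\<^esub> finprod dual_ring x {?B}"
        by (rule DR.finprod_insert) (use ne xc AB in auto)
      then show ?thesis unfolding p using True one[OF AB(2)] by simp
    next
      case False
      then have pC: "{c \<in> components G S. coarse (insert e S) c = C} = {C}" using p by simp
      then have "C \<in> components G S" by blast
      then show ?thesis unfolding pC using False one by simp
    qed
  qed
  then have "(\<lambda>C\<in>components G (insert e S). if C = ?A \<union> ?B then x ?A \<otimes>\<^bsub>dual_ring\<^esub> x ?B else x C) =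
      push (coarse (insert e S)) (components G S) (components G (insert e S)) x"
    unfolding push_def by (rule restrict_ext)
  then show "pure_power (components G (insert e S)) alg_A
      (\<lambda>C\<in>components G (insert e S). if C = ?A \<union> ?B then x ?A \<otimes>\<^bsub>dual_ring\<^esub> x ?B else x C) =
      pure_power (components G (insert e S)) alg_A (push (coarse (insert e S)) (components G S) (components G (insert e S)) x)"
    by simp
qed

text \<open>One formula covers both cases. If the ends lie in one component, the set of components
  is unchanged and \<open>coarse\<close> is the identity on it; otherwise the Betti number is
  unchanged and the inclusion of B-factors is the identity. Commutativity of squares then follows
  from functoriality alone, without cases.\<close>

lemma edge_map_T_eq:
  assumes S: "S \<subseteq> edges G" and e: "e \<in> edges G - S"
  shows "edge_map_T G S e = mapT (coarse (insert e S)) (components G S) (components G (insert e S))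
    (betti1 G S) (betti1 G (insert e S))"
proof (cases "component_of G S (fst (endpoints G e)) = component_of G S (snd (endpoints G e))")
  case True
  have e': "e \<in> edges G" "e \<notin> S" using e by auto
  have c: "components G (insert e S) = components G S" by (rule components_insert_same[OF S e'(1) True])
  have b: "betti1 G (insert e S) = Suc (betti1 G S)" by (rule betti_insert(1)[OF S e' True])
  have co: "coarse (insert e S) C = C" if "C \<in> components G S" for C
    by (rule coarse_self) (use that c in simp)
  show ?thesis
    unfolding edge_map_T_def Let_def mapT_def if_P[OF True] unfolding c b append_unit_B_push
  proof (rule tensor_map_cong[OF _ refl])
    fix x assume "x \<in> carrier (tensor_power (components G S) alg_A)"
    then have x: "x \<in> carrier (power_group (components G S) alg_A)" by simp
    have "power_push alg_A (coarse (insert e S)) (components G S) (components G S) =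
        power_push alg_A (\<lambda>i. i) (components G S) (components G S)"
      by (rule power_push_cong) (rule co)
    then show "x = power_push alg_A (coarse (insert e S)) (components G S) (components G S) x"
      using power_push_id[OF dual_algebras(1) finite_components x] by simp
  qed
next
  case False
  have e': "e \<in> edges G" "e \<notin> S" using e by auto
  have b: "betti1 G (insert e S) = betti1 G S" by (rule betti_insert(2)[OF S e' False])
  show ?thesis
    unfolding edge_map_T_def Let_def mapT_def if_not_P[OF False] unfolding merge_A_push[OF S e'(1) False] b
  proof (rule tensor_map_cong[OF refl])
    fix y assume "y \<in> carrier (tensor_power {..<betti1 G S} alg_B)"
    then have y: "y \<in> carrier (power_group {..<betti1 G S} alg_B)" by simp
    show "y = power_push alg_B (\<lambda>i. i) {..<betti1 G S} {..<betti1 G S} y"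
      by (rule power_push_id[OF dual_algebras(2) finite_lessThan y, symmetric])
  qed
qed

lemma edge_map_Y_eq:
  assumes S: "S \<subseteq> edges G" and e: "e \<in> edges G - S"
  shows "edge_map_Y G S e = mapY (\<lambda>e. e) S (insert e S) (coarse (insert e S)) (components G S)
    (components G (insert e S)) (betti1 G S) (betti1 G (insert e S))"
proof -
  have "e \<notin> S" using e by simp
  then show ?thesis
    unfolding edge_map_Y_def mapY_def edge_map_T_eq[OF S e] mod_T_eq by (simp add: insert_unit_A_push)
qed

lemma finite_sub: "S \<subseteq> edges G \<Longrightarrow> finite S"
  using finite_E finite_subset by blast

lemma cube_T:
  assumes es: "edge_ordering G es"
  shows "cube es (mod_T G) (edge_map_T G) (\<lambda>S. basisT (components G S) (betti1 G S)) (\<lambda>S. degT (components G S) (betti1 G S))"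
proof
  note E = es[unfolded edge_ordering_def, THEN conjunct2]
  show "distinct es" using es by (simp add: edge_ordering_def)
  show "free_graded (mod_T G S) (basisT (components G S) (betti1 G S)) (degT (components G S) (betti1 G S))" for S
    unfolding mod_T_eq by (rule free_modT[OF finite_components])
  fix S e assume "S \<subseteq> set es" and "e \<in> set es - S"
  then have S: "S \<subseteq> edges G" and e: "e \<in> edges G - S" unfolding E .
  show "bigraded_hom (mod_T G S) (mod_T G (insert e S)) (edge_map_T G S e)"
    unfolding edge_map_T_eq[OF S e] mod_T_eq
    by (rule mapT_hom[OF coarse_in[OF subset_insertI] finite_components finite_components betti1_insert_le[OF S e]])
  fix f x assume "f \<in> set es - S" and ef: "e \<noteq> f" and x: "x \<in> carrier (mod_T G S)"
  then have f: "f \<in> edges G - S" unfolding E by simp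
  \<comment> \<open>Adding f and then e gives the map of the inclusion of S into the final edge set,
    an expression symmetric in e and f.\<close>
  have two: "edge_map_T G (insert f S) e (edge_map_T G S f x) =
      mapT (coarse (insert e (insert f S))) (components G S) (components G (insert e (insert f S)))
        (betti1 G S) (betti1 G (insert e (insert f S))) x"
    if e: "e \<in> edges G - S" and f: "f \<in> edges G - S" and ef: "e \<noteq> f" for e f
  proof -
    have Sf: "insert f S \<subseteq> edges G" "e \<in> edges G - insert f S" using S e f ef by auto
    have "edge_map_T G (insert f S) e (edge_map_T G S f x) =
        mapT (\<lambda>C. coarse (insert e (insert f S)) (coarse (insert f S) C)) (components G S) (components G (insert e (insert f S)))
        (betti1 G S) (betti1 G (insert e (insert f S))) x"
      unfolding edge_map_T_eq[OF S f] edge_map_T_eq[OF Sf]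
      by (rule mapT_comp[OF coarse_in[OF subset_insertI] coarse_in[OF subset_insertI] finite_components finite_components
        finite_components betti1_insert_le[OF S f] betti1_insert_le[OF Sf] x[unfolded mod_T_eq]])
    also have "mapT (\<lambda>C. coarse (insert e (insert f S)) (coarse (insert f S) C)) (components G S) (components G (insert e (insert f S)))
        (betti1 G S) (betti1 G (insert e (insert f S))) = mapT (coarse (insert e (insert f S))) (components G S) (components G (insert e (insert f S)))
        (betti1 G S) (betti1 G (insert e (insert f S)))"
      by (rule mapT_cong) (rule coarse_coarse[OF subset_insertI subset_insertI])
    finally show ?thesis .
  qed
  show "edge_map_T G (insert f S) e (edge_map_T G S f x) = edge_map_T G (insert e S) f (edge_map_T G S e x)"
    unfolding two[OF e f ef] two[OF f e ef[symmetric]] insert_commute[of e f S] by (rule refl)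
qed

lemma cube_Y:
  assumes es: "edge_ordering G es"
  shows "cube es (mod_Y G) (edge_map_Y G) (\<lambda>S. basisY S (components G S) (betti1 G S)) (\<lambda>S. degY S (components G S) (betti1 G S))"
proof
  note E = es[unfolded edge_ordering_def, THEN conjunct2]
  show "distinct es" using es by (simp add: edge_ordering_def)
  show "free_graded (mod_Y G S) (basisY S (components G S) (betti1 G S)) (degY S (components G S) (betti1 G S))"
    if "S \<subseteq> set es" for S
    unfolding mod_Y_eq by (rule free_modY[OF finite_sub[OF that[unfolded E]] finite_components])
  fix S e assume "S \<subseteq> set es" and "e \<in> set es - S"
  then have S: "S \<subseteq> edges G" and e: "e \<in> edges G - S" unfolding E .
  have fin: "finite T" if "T \<subseteq> insert a (insert b S)" for T a b
    by (rule finite_subset[OF that]) (simp add: finite_sub[OF S])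
  have id: "(\<lambda>i. i) \<in> T \<rightarrow> insert a T" for T a by auto
  show "bigraded_hom (mod_Y G S) (mod_Y G (insert e S)) (edge_map_Y G S e)"
    unfolding edge_map_Y_eq[OF S e] mod_Y_eq
    by (rule mapY_hom[OF id fin fin coarse_in[OF subset_insertI] finite_components finite_components betti1_insert_le[OF S e]])
      auto
  fix f x assume "f \<in> set es - S" and ef: "e \<noteq> f" and x: "x \<in> carrier (mod_Y G S)"
  then have f: "f \<in> edges G - S" unfolding E by simp
  have two: "edge_map_Y G (insert f S) e (edge_map_Y G S f x) =
      mapY (\<lambda>e. e) S (insert e (insert f S)) (coarse (insert e (insert f S))) (components G S) (components G (insert e (insert f S)))
        (betti1 G S) (betti1 G (insert e (insert f S))) x"
    if e: "e \<in> edges G - S" and f: "f \<in> edges G - S" and ef: "e \<noteq> f" for e f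
  proof -
    have Sf: "insert f S \<subseteq> edges G" "e \<in> edges G - insert f S" using S e f ef by auto
    have fin3: "finite S" "finite (insert f S)" "finite (insert e (insert f S))" using finite_sub[OF S] by auto
    have "edge_map_Y G (insert f S) e (edge_map_Y G S f x) =
        mapY (\<lambda>e. e) S (insert e (insert f S)) (\<lambda>C. coarse (insert e (insert f S)) (coarse (insert f S) C)) (components G S) (components G (insert e (insert f S)))
        (betti1 G S) (betti1 G (insert e (insert f S))) x"
      unfolding edge_map_Y_eq[OF S f] edge_map_Y_eq[OF Sf]
      by (rule mapY_comp[OF id id fin3 coarse_in[OF subset_insertI] coarse_in[OF subset_insertI] finite_components finite_components
        finite_components betti1_insert_le[OF S f] betti1_insert_le[OF Sf] x[unfolded mod_Y_eq]])
    also have "mapY (\<lambda>e. e) S (insert e (insert f S)) (\<lambda>C. coarse (insert e (insert f S)) (coarse (insert f S) C)) (components G S) (components G (insert e (insert f S)))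
        (betti1 G S) (betti1 G (insert e (insert f S))) = mapY (\<lambda>e. e) S (insert e (insert f S)) (coarse (insert e (insert f S))) (components G S) (components G (insert e (insert f S)))
        (betti1 G S) (betti1 G (insert e (insert f S)))"
      by (rule mapY_cong[OF refl]) (rule coarse_coarse[OF subset_insertI subset_insertI])
    finally show ?thesis .
  qed
  show "edge_map_Y G (insert f S) e (edge_map_Y G S f x) = edge_map_Y G (insert e S) f (edge_map_Y G S e x)"
    unfolding two[OF e f ef] two[OF f e ef[symmetric]] insert_commute[of e f S] by (rule refl)
qed

end

section \<open>Isomorphisms of cubes\<close>

lemma reorder_sign_inverse:
  assumes inj: "inj_on h S" and gh: "\<And>e. e \<in> S \<Longrightarrow> g (h e) = e"
  shows "reorder_sign es' es g (h ` S) * reorder_sign es es' h S = 1"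
proof -
  let ?s = "\<lambda>a b. if cube_pos es a < cube_pos es b \<and> cube_pos es' (h b) < cube_pos es' (h a) then -1 else 1 :: int"
  \<comment> \<open>A pair is an inversion of g exactly when the exchanged pair is an inversion of
    h, so the two signs have the same factors and their product is a product of squares.\<close>
  have "reorder_sign es' es g (h ` S) = (\<Prod>a\<in>S. \<Prod>b\<in>S. ?s b a)"
    unfolding reorder_sign_def prod.reindex[OF inj] comp_def
    by (intro prod.cong refl) (auto simp: gh)
  also have "\<dots> = (\<Prod>a\<in>S. \<Prod>b\<in>S. ?s a b)" by (rule prod.swap)
  finally have "reorder_sign es' es g (h ` S) * reorder_sign es es' h S = (\<Prod>a\<in>S. \<Prod>b\<in>S. ?s a b * ?s a b)"
    unfolding reorder_sign_def by (simp only: prod.distrib)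
  also have "\<dots> = 1" by (intro prod.neutral ballI) auto
  finally show ?thesis .
qed

text \<open>F and F' cancel at each vertex of the cube, and the twisting signs of the two directions
  multiply to 1 on corresponding edge sets.\<close>

lemma cube_map_inverse:
  assumes "cube_morphism es M d X dg es' M' d' X' dg' h g F" and "cube_morphism es' M' d' X' dg' es M d X dg g h F'"
    and hg: "\<And>e. e \<in> set es' \<Longrightarrow> h (g e) = e"
    and FF: "\<And>S x. S \<subseteq> set es \<Longrightarrow> x \<in> carrier (M S) \<Longrightarrow> F' (h ` S) (F S x) = x"
    and v: "v \<in> carrier (obj (cube_complex es M d) i)"
  shows "cube_morphism.cube_map es' es M g h F' i (cube_morphism.cube_map es es' M' h g F i v) = v"
proof (rule ext)
  interpret A: cube_morphism es M d X dg es' M' d' X' dg' h g F by (rule assms(1))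
  interpret B: cube_morphism es' M' d' X' dg' es M d X dg g h F' by (rule assms(2))
  fix T
  show "B.cube_map i (A.cube_map i v) T = v T"
  proof (cases "T \<in> cube_level es i")
    case False
    then have "v T = undefined" by (rule PiE_arb[OF v[unfolded A.A.carrier_C]])
    then show ?thesis using False unfolding B.cube_map_def by simp
  next
    case T: True
    have Ts: "T \<subseteq> set es" by (rule A.A.levelD(1)[OF T])
    note hT = B.level_image(1)[OF T] and gT = B.level_image(2)[OF T]
    have vT: "v T \<in> carrier (M T)" by (rule PiE_mem[OF v[unfolded A.A.carrier_C] T])
    have inj: "inj_on h T" using A.h Ts by (auto simp: bij_betw_def intro: inj_on_subset)
    have Fh: "bigraded_hom (M T) (M' (h ` T)) (F T)" by (rule A.F_hom[OF Ts])
    have F'h: "bigraded_hom (M' (h ` T)) (M T) (F' (h ` T))" by (rule B.F_hom_level[OF T])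
    note FT = bigraded_hom_closed[OF Fh vT]
    interpret T: comm_group "M T" by (rule A.A.comm[OF Ts])
    have g': "group (M' (h ` T))" by (rule comm_group.axioms(2)[OF A.B.comm[OF A.B.levelD(1)[OF hT]]])
    have 1: "A.cube_map i v (h ` T) = F T (v T) [^]\<^bsub>M' (h ` T)\<^esub> reorder_sign es es' h T"
      unfolding A.cube_map_apply[OF hT] gT by (rule refl)
    have 2: "F' (h ` T) (F T (v T) [^]\<^bsub>M' (h ` T)\<^esub> reorder_sign es es' h T) =
        F' (h ` T) (F T (v T)) [^]\<^bsub>M T\<^esub> reorder_sign es es' h T"
      by (rule hom_int_pow[OF bigraded_homD(3)[OF F'h] FT g' T.is_group])
    have s: "reorder_sign es es' h T * reorder_sign es' es g (h ` T) = 1"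
      unfolding mult.commute[of "reorder_sign es es' h T"]
      by (rule reorder_sign_inverse[OF inj A.gh[OF subsetD[OF Ts]]])
    show ?thesis
      unfolding B.cube_map_apply[OF T] 1 2 FF[OF Ts vT] T.int_pow_pow[OF vT] s T.int_pow_1[OF vT] by (rule refl)
  qed
qed

lemma cube_isomorphic:
  assumes m: "cube_morphism es M d X dg es' M' d' X' dg' h g F" and m': "cube_morphism es' M' d' X' dg' es M d X dg g h F'"
    and FF: "\<And>S x. S \<subseteq> set es \<Longrightarrow> x \<in> carrier (M S) \<Longrightarrow> F' (h ` S) (F S x) = x"
    and FF': "\<And>S x. S \<subseteq> set es' \<Longrightarrow> x \<in> carrier (M' S) \<Longrightarrow> F (g ` S) (F' S x) = x"
  shows "complex_isomorphic (cube_complex es M d) (cube_complex es' M' d')"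
    and "bigraded_isomorphic (cohomology (cube_complex es M d) i) (cohomology (cube_complex es' M' d') i)"
proof -
  have gh: "g (h e) = e" if "e \<in> set es" for e by (rule cube_morphism.gh[OF m that])
  have hg: "h (g e) = e" if "e \<in> set es'" for e by (rule cube_morphism.gh[OF m' that])
  have 1: "cube_morphism.cube_map es' es M g h F' i (cube_morphism.cube_map es es' M' h g F i v) = v"
    if "v \<in> carrier (obj (cube_complex es M d) i)" for i v
    by (rule cube_map_inverse[OF m m' _ _ that]; (rule hg FF; assumption)?)
  have 2: "cube_morphism.cube_map es es' M' h g F i (cube_morphism.cube_map es' es M g h F' i v) = v"
    if "v \<in> carrier (obj (cube_complex es' M' d') i)" for i v
    by (rule cube_map_inverse[OF m' m _ _ that]; (rule gh FF'; assumption)?)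
  note c = cube_morphism.chain_map_cube_map[OF m] cube_morphism.chain_map_cube_map[OF m']
  show "complex_isomorphic (cube_complex es M d) (cube_complex es' M' d')"
    by (rule complex_isoI(1)[OF c]; (rule 1 2; assumption))
  show "bigraded_isomorphic (cohomology (cube_complex es M d) i) (cohomology (cube_complex es' M' d') i)"
    by (rule complex_isoI(2)[OF c]; (rule 1 2; assumption))
qed

text \<open>With the identity bijection and a common order there are no inversions, so the general
  map of cubes reduces to F on each summand.\<close>

lemma cube_morphism_id_chain_map:
  assumes "cube_morphism es M d X dg es M' d' X' dg' (\<lambda>e. e) (\<lambda>e. e) F"
  shows "chain_map (cube_complex es M d) (cube_complex es M' d')
    (\<lambda>i. \<lambda>c\<in>carrier (obj (cube_complex es M d) i). \<lambda>S\<in>cube_level es i. F S (c S))"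
proof -
  interpret cube_morphism es M d X dg es M' d' X' dg' "\<lambda>e. e" "\<lambda>e. e" F by (rule assms)
  show ?thesis
  proof (rule chain_map_cong[OF chain_map_cube_map])
    fix i x assume x: "x \<in> carrier (obj A.C i)"
    have "cube_map i x = (\<lambda>S\<in>cube_level es i. F S (x S))"
      unfolding cube_map_def image_ident reorder_sign_id
    proof (rule restrict_ext)
      fix S assume S: "S \<in> cube_level es i"
      have xS: "x S \<in> carrier (M S)" by (rule PiE_mem[OF x[unfolded A.carrier_C] S])
      have Fh: "bigraded_hom (M S) (M' S) (F S)" using F_hom[OF A.levelD(1)[OF S]] by simp
      interpret S: comm_group "M' S" by (rule B.comm[OF B.levelD(1)[OF S]])
      show "F S (x S) [^]\<^bsub>M' S\<^esub> (1 :: int) = F S (x S)" by (rule S.int_pow_1[OF bigraded_hom_closed[OF Fh xS]])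
    qed
    then show "(\<lambda>c\<in>carrier (obj A.C i). \<lambda>S\<in>cube_level es i. F S (c S)) x = cube_map i x"
      unfolding restrict_apply'[OF x] by (rule sym)
  qed
qed

section \<open>The maps phi and psi\<close>

lemma eta_power_hom: "finite S \<Longrightarrow> eta_power S \<in> hom (power_group S alg_A) integer_group"
    and eta_power_pure: "finite S \<Longrightarrow> x \<in> (S \<rightarrow>\<^sub>E carrier alg_A) \<Longrightarrow>
      eta_power S (pure_power S alg_A x) = (\<Prod>e\<in>S. eta_A (x e))"
proof -
  assume S: "finite S"
  note cA = dual_comm[OF dual_algebras(1)]
  have 1: "(\<lambda>x. \<Prod>e\<in>S. eta_A (x e)) \<in> (S \<rightarrow>\<^sub>E carrier alg_A) \<rightarrow> carrier integer_group" by simp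
  have 2: "(\<Prod>e\<in>S. eta_A ((f(i := x \<otimes>\<^bsub>alg_A\<^esub> y)) e)) =
      (\<Prod>e\<in>S. eta_A ((f(i := x)) e)) \<otimes>\<^bsub>integer_group\<^esub> (\<Prod>e\<in>S. eta_A ((f(i := y)) e))"
    if i: "i \<in> S" and x: "x \<in> carrier alg_A" and y: "y \<in> carrier alg_A" for f i x y
  proof -
    have r: "(\<Prod>e\<in>S. eta_A ((f(i := z)) e)) = eta_A z * (\<Prod>e\<in>S - {i}. eta_A (f e))" for z
    proof -
      have "(\<Prod>e\<in>S. eta_A ((f(i := z)) e)) = eta_A ((f(i := z)) i) * (\<Prod>e\<in>S - {i}. eta_A ((f(i := z)) e))"
        by (rule prod.remove[OF S i])
      also have "(\<Prod>e\<in>S - {i}. eta_A ((f(i := z)) e)) = (\<Prod>e\<in>S - {i}. eta_A (f e))"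
        by (rule prod.cong) auto
      finally show ?thesis by simp
    qed
    have a: "eta_A (x \<otimes>\<^bsub>alg_A\<^esub> y) = eta_A x + eta_A y" using hom_mult[OF eta_A_hom x y] by simp
    show ?thesis unfolding r a by (simp add: distrib_right)
  qed
  show "eta_power S \<in> hom (power_group S alg_A) integer_group"
    unfolding eta_power_def by (rule power_universal(1)[OF comm_group_integer_group cA 1 2])
  show "eta_power S (pure_power S alg_A x) = (\<Prod>e\<in>S. eta_A (x e))" if "x \<in> (S \<rightarrow>\<^sub>E carrier alg_A)"
    unfolding eta_power_def by (rule power_universal(2)[OF comm_group_integer_group cA 1 2 that])
qed

text \<open>In a product of nonzero total degree some factor has nonzero degree and is killed by
  eta. Hence psi preserves the bidegree although it discards the edge factors.\<close>

lemma eta_power_grade: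
  assumes S: "finite S" and z: "z \<in> grade (tensor_power S alg_A) d" and d: "d \<noteq> 0"
  shows "eta_power S z = 0"
proof -
  let ?P = "{pure_power S alg_A x | x a. x \<in> (\<Pi>\<^sub>E i\<in>S. grade alg_A (a i)) \<and>
           (\<Sum>i\<in>S. fst (a i)) = fst d \<and> (\<Sum>i\<in>S. snd (a i)) = snd d}"
  note bA = dual_bigraded[OF dual_algebras(1)] and cA = dual_comm[OF dual_algebras(1)]
  have z: "z \<in> generate (power_group S alg_A) ?P" using z unfolding tensor_power_def with_grading_simps .
  have P: "p \<in> carrier (power_group S alg_A) \<and> eta_power S p = 0" if p: "p \<in> ?P" for p
  proof -
    obtain x a where p: "p = pure_power S alg_A x" "x \<in> (\<Pi>\<^sub>E i\<in>S. grade alg_A (a i))"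
      and e: "(\<Sum>i\<in>S. fst (a i)) = fst d" "(\<Sum>i\<in>S. snd (a i)) = snd d" using p by blast
    have x: "x \<in> (S \<rightarrow>\<^sub>E carrier alg_A)"
      by (rule subsetD[OF PiE_mono p(2)]) (rule subgroup.subset[OF bigraded_module_grade[OF bA]])
    have "\<exists>i\<in>S. a i \<noteq> 0"
    proof (rule ccontr)
      assume "\<not> (\<exists>i\<in>S. a i \<noteq> 0)"
      then have "fst d = 0" "snd d = 0" unfolding e[symmetric] by simp_all
      then show False using d by (simp add: prod_eq_iff)
    qed
    then obtain i where i: "i \<in> S" "a i \<noteq> 0" by blast
    have "eta_A (x i) = 0" by (rule eta_A_grade[OF PiE_mem[OF p(2) i(1)] i(2)])
    then have "(\<Prod>e\<in>S. eta_A (x e)) = 0" using S i(1) by (intro prod_zero) auto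
    then show ?thesis unfolding p(1) eta_power_pure[OF S x] using pure_power_closed[OF cA x] by simp
  qed
  have "eta_power S z \<in> {\<one>\<^bsub>integer_group\<^esub>}"
  proof (rule hom_generate_subset[OF _ group_integer_group eta_power_hom[OF S] group.triv_subgroup[OF group_integer_group] _ _ z])
    show "group (power_group S alg_A)" by (rule comm_group.axioms(2)[OF comm_group_power_group[OF cA]])
    show "?P \<subseteq> carrier (power_group S alg_A)" using P by blast
    show "eta_power S p \<in> {\<one>\<^bsub>integer_group\<^esub>}" if "p \<in> ?P" for p using P[OF that] by simp
  qed
  then show ?thesis by simp
qed

text \<open>The inserted factor is 1 and eta sends 1 to 1; this is the compatibility of psi with the
  edge factor of the differential.\<close>

lemma eta_power_insert:
  assumes S: "finite S" and e: "e \<notin> S" and z: "z \<in> carrier (power_group S alg_A)"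
  shows "eta_power (insert e S) (power_push alg_A (\<lambda>i. i) S (insert e S) z) = eta_power S z"
proof (rule power_hom_ext[OF dual_comm[OF dual_algebras(1)] group_integer_group _ eta_power_hom[OF S] _ z])
  have id: "(\<lambda>i. i) \<in> S \<rightarrow> insert e S" and S': "finite (insert e S)" using S by auto
  note pp = power_push_hom[OF dual_algebras(1) id S S'] power_push_pure[OF dual_algebras(1) id S S']
  show "(\<lambda>z. eta_power (insert e S) (power_push alg_A (\<lambda>i. i) S (insert e S) z)) \<in> hom (power_group S alg_A) integer_group"
    using hom_compose[OF pp(1) eta_power_hom[OF S']] by (simp add: comp_def)
  fix x assume x: "x \<in> (S \<rightarrow>\<^sub>E carrier alg_A)"
  then have x': "x \<in> (S \<rightarrow>\<^sub>E carrier dual_ring)" by simp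
  have px: "push (\<lambda>i. i) S (insert e S) x \<in> (insert e S \<rightarrow>\<^sub>E carrier alg_A)"
    using push_closed[OF x', of "\<lambda>i. i" "insert e S"] by simp
  have "(\<Prod>i\<in>insert e S. eta_A ((x(e := \<one>\<^bsub>dual_ring\<^esub>)) i)) =
      eta_A ((x(e := \<one>\<^bsub>dual_ring\<^esub>)) e) * (\<Prod>i\<in>S. eta_A ((x(e := \<one>\<^bsub>dual_ring\<^esub>)) i))"
    by (rule prod.insert[OF S e])
  also have "\<dots> = (\<Prod>i\<in>S. eta_A ((x(e := \<one>\<^bsub>dual_ring\<^esub>)) i))" by (simp add: eta_A_one)
  also have "\<dots> = (\<Prod>i\<in>S. eta_A (x i))" by (rule prod.cong) (use e in auto)
  finally show "eta_power (insert e S) (power_push alg_A (\<lambda>i. i) S (insert e S) (pure_power S alg_A x)) =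
      eta_power S (pure_power S alg_A x)"
    unfolding pp(2)[OF x] unfolding eta_power_pure[OF S' px] eta_power_pure[OF S x] unfolding push_insert[OF x' e] .
qed

context fin_graph
begin

lemma one_power_closed: "(\<lambda>e\<in>S. \<one>\<^bsub>dual_ring\<^esub>) \<in> (S \<rightarrow>\<^sub>E carrier alg_A)"
  by simp

lemma one_power_mem: "pure_power S alg_A (\<lambda>e\<in>S. \<one>\<^bsub>dual_ring\<^esub>) \<in> carrier (power_group S alg_A)"
  by (rule pure_power_closed[OF dual_comm[OF dual_algebras(1)] one_power_closed])

lemma comm_mod_T: "comm_group (mod_T G S)" and bigraded_mod_T: "bigraded_module (mod_T G S)"
  unfolding mod_T_eq by (rule free_gradedD(1,3)[OF free_modT[OF finite_components]])+

lemma bigraded_mod_Y: "S \<subseteq> edges G \<Longrightarrow> bigraded_module (mod_Y G S)"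
  unfolding mod_Y_eq by (rule free_gradedD(3)[OF free_modY[OF finite_sub finite_components]])

lemma comm_power_A: "comm_group (tensor_power S alg_A)"
  unfolding tensor_power_def same_with_grading by (rule comm_group_power_group[OF dual_comm[OF dual_algebras(1)]])

lemma carrier_mod_Y: "carrier (mod_Y G S) = carrier (tensor_group (tensor_power S alg_A) (mod_T G S))"
  by (simp add: mod_Y_def)

lemma edge_map_Y_pure:
  assumes S: "S \<subseteq> edges G" and e: "e \<in> edges G - S"
    and x: "x \<in> carrier (power_group S alg_A)" and z: "z \<in> carrier (mod_T G S)"
  shows "edge_map_Y G S e (pure_tensor (tensor_power S alg_A) (mod_T G S) x z) =
    pure_tensor (tensor_power (insert e S) alg_A) (mod_T G (insert e S))
      (power_push alg_A (\<lambda>i. i) S (insert e S) x) (edge_map_T G S e z)"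
proof -
  have id: "(\<lambda>i. i) \<in> S \<rightarrow> insert e S" by auto
  have "finite (insert e S)" using finite_sub[OF S] by simp
  note mapY_pure[OF id finite_sub[OF S] this coarse_in[OF subset_insertI] finite_components finite_components
    betti1_insert_le[OF S e] x z[unfolded mod_T_eq]]
  then show ?thesis unfolding edge_map_Y_eq[OF S e] edge_map_T_eq[OF S e] mod_T_eq .
qed

lemma phi_summand_hom:
  assumes S: "S \<subseteq> edges G"
  shows "bigraded_hom (mod_T G S) (mod_Y G S) (phi_summand G S)"
  unfolding bigraded_hom_def
proof (intro conjI allI bigraded_mod_T bigraded_mod_Y[OF S])
  let ?o = "pure_power S alg_A (\<lambda>e\<in>S. \<one>\<^bsub>dual_ring\<^esub>)"
  have "?o \<in> carrier (tensor_power S alg_A)" using one_power_mem by simp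
  from pure_tensor_right_hom[OF comm_power_A comm_mod_T this]
  show "phi_summand G S \<in> hom (mod_T G S) (mod_Y G S)"
    unfolding mod_Y_def phi_summand_def tensor_def[of _ "mod_T G S"] hom_with_grading .
  fix d
  have "\<one>\<^bsub>dual_ring\<^esub> \<in> grade alg_A 0" unfolding alg_A_def by (rule graded_dual_one)
  then have "(\<lambda>e\<in>S. \<one>\<^bsub>dual_ring\<^esub>) \<in> (\<Pi>\<^sub>E e\<in>S. grade alg_A 0)" by simp
  from pure_power_grade[OF this] have o: "?o \<in> grade (tensor_power S alg_A) 0" by simp
  show "phi_summand G S ` grade (mod_T G S) d \<subseteq> grade (mod_Y G S) d"
  proof (rule image_subsetI)
    fix z assume "z \<in> grade (mod_T G S) d"
    from pure_tensor_grade[OF o this] show "phi_summand G S z \<in> grade (mod_Y G S) d"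
      unfolding phi_summand_def mod_Y_def by simp
  qed
qed

text \<open>Inserting a further unit turns the tensor of units over S into the tensor of units over
  the larger edge set.\<close>

lemma phi_summand_edge:
  assumes S: "S \<subseteq> edges G" and e: "e \<in> edges G - S" and z: "z \<in> carrier (mod_T G S)"
  shows "phi_summand G (insert e S) (edge_map_T G S e z) = edge_map_Y G S e (phi_summand G S z)"
proof -
  have id: "(\<lambda>i. i) \<in> S \<rightarrow> insert e S" by auto
  have "finite (insert e S)" using finite_sub[OF S] by simp
  note p = power_push_pure[OF dual_algebras(1) id finite_sub[OF S] this one_power_closed]
  show ?thesis
    unfolding phi_summand_def edge_map_Y_pure[OF S e one_power_mem z] p push_one by (rule refl)
qed

context
  fixes S
  assumes S: "S \<subseteq> edges G"
begin

interpretation T: comm_group "mod_T G S" by (rule comm_mod_T)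

lemma psi_summand_hom': "psi_summand G S \<in> hom (tensor_group (tensor_power S alg_A) (mod_T G S)) (mod_T G S)"
    and psi_summand_pure: "p \<in> carrier (power_group S alg_A) \<Longrightarrow> z \<in> carrier (mod_T G S) \<Longrightarrow>
      psi_summand G S (pure_tensor (tensor_power S alg_A) (mod_T G S) p z) = z [^]\<^bsub>mod_T G S\<^esub> eta_power S p"
proof -
  note fS = finite_sub[OF S]
  have 1: "z [^]\<^bsub>mod_T G S\<^esub> eta_power S p \<in> carrier (mod_T G S)"
    if "p \<in> carrier (tensor_power S alg_A)" "z \<in> carrier (mod_T G S)" for p z
    by (rule T.int_pow_closed[OF that(2)])
  have 2: "z [^]\<^bsub>mod_T G S\<^esub> eta_power S (p \<otimes>\<^bsub>tensor_power S alg_A\<^esub> p') =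
      z [^]\<^bsub>mod_T G S\<^esub> eta_power S p \<otimes>\<^bsub>mod_T G S\<^esub> z [^]\<^bsub>mod_T G S\<^esub> eta_power S p'"
    if "p \<in> carrier (tensor_power S alg_A)" "p' \<in> carrier (tensor_power S alg_A)" "z \<in> carrier (mod_T G S)" for p p' z
  proof -
    have "eta_power S (p \<otimes>\<^bsub>tensor_power S alg_A\<^esub> p') = eta_power S p + eta_power S p'"
      using hom_mult[OF eta_power_hom[OF fS]] that by simp
    then show ?thesis using T.int_pow_mult[OF that(3)] by simp
  qed
  have 3: "(z \<otimes>\<^bsub>mod_T G S\<^esub> z') [^]\<^bsub>mod_T G S\<^esub> eta_power S p =
      z [^]\<^bsub>mod_T G S\<^esub> eta_power S p \<otimes>\<^bsub>mod_T G S\<^esub> z' [^]\<^bsub>mod_T G S\<^esub> eta_power S p"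
    if "p \<in> carrier (tensor_power S alg_A)" "z \<in> carrier (mod_T G S)" "z' \<in> carrier (mod_T G S)" for p z z'
    by (rule hom_mult[OF int_pow_hom[OF comm_mod_T] that(2,3)])
  show "psi_summand G S \<in> hom (tensor_group (tensor_power S alg_A) (mod_T G S)) (mod_T G S)"
    unfolding psi_summand_def by (rule tensor_universal(1)[OF comm_mod_T comm_power_A comm_mod_T]; (rule 1 2 3; assumption))
  show "psi_summand G S (pure_tensor (tensor_power S alg_A) (mod_T G S) p z) = z [^]\<^bsub>mod_T G S\<^esub> eta_power S p"
    if p: "p \<in> carrier (power_group S alg_A)" and z: "z \<in> carrier (mod_T G S)"
  proof -
    have p': "p \<in> carrier (tensor_power S alg_A)" using p by simp
    show ?thesis
      unfolding psi_summand_def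
      by (rule tensor_universal(2)[OF comm_mod_T comm_power_A comm_mod_T]; (rule 1 2 3 p' z; assumption?))
  qed
qed

lemma psi_summand_hom: "bigraded_hom (mod_Y G S) (mod_T G S) (psi_summand G S)"
  unfolding mod_Y_def
proof (rule bigraded_hom_tensor[OF dual_power_bigraded[OF dual_algebras(1) finite_sub[OF S]] bigraded_mod_T
      bigraded_mod_Y[OF S, unfolded mod_Y_def] bigraded_mod_T psi_summand_hom'])
  fix x y a b assume x: "x \<in> grade (tensor_power S alg_A) a" and y: "y \<in> grade (mod_T G S) b"
  have x': "x \<in> carrier (power_group S alg_A)"
    using subsetD[OF subgroup.subset[OF bigraded_module_grade[OF dual_power_bigraded[OF dual_algebras(1) finite_sub[OF S]]]] x] by simp
  note sub = bigraded_module_grade[OF bigraded_mod_T]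
  have y': "y \<in> carrier (mod_T G S)" by (rule subsetD[OF subgroup.subset[OF sub] y])
  show "psi_summand G S (pure_tensor (tensor_power S alg_A) (mod_T G S) x y) \<in> grade (mod_T G S) (a + b)"
    unfolding psi_summand_pure[OF x' y']
  \<comment> \<open>For nonzero a the exponent vanishes and the result is the neutral element, which
    lies in every degree; for a = 0 the degree of y is already the total degree.\<close>
  proof (cases "a = 0")
    case True
    then show "y [^]\<^bsub>mod_T G S\<^esub> eta_power S x \<in> grade (mod_T G S) (a + b)"
      using int_pow_in_subgroup[OF T.is_group sub y] by simp
  next
    case False
    show "y [^]\<^bsub>mod_T G S\<^esub> eta_power S x \<in> grade (mod_T G S) (a + b)"
      unfolding eta_power_grade[OF finite_sub[OF S] x False] int_pow_0 by (rule subgroup.one_closed[OF sub])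
  qed
qed

lemma psi_phi_summand:
  assumes z: "z \<in> carrier (mod_T G S)"
  shows "psi_summand G S (phi_summand G S z) = z"
proof -
  have "eta_power S (pure_power S alg_A (\<lambda>e\<in>S. \<one>\<^bsub>dual_ring\<^esub>)) = 1"
    unfolding eta_power_pure[OF finite_sub[OF S] one_power_closed] by (simp add: eta_A_one)
  then show ?thesis
    unfolding phi_summand_def psi_summand_pure[OF one_power_mem z] using T.int_pow_1[OF z] by simp
qed

text \<open>On pure tensors both sides are the same integer multiple of the same element: the edge
  map is additive, and the inserted unit does not change the value of eta.\<close>

lemma psi_summand_edge:
  assumes e: "e \<in> edges G - S" and z: "z \<in> carrier (mod_Y G S)"
    and dY: "bigraded_hom (mod_Y G S) (mod_Y G (insert e S)) (edge_map_Y G S e)"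
    and dT: "bigraded_hom (mod_T G S) (mod_T G (insert e S)) (edge_map_T G S e)"
    and psi: "psi_summand G (insert e S) \<in> hom (mod_Y G (insert e S)) (mod_T G (insert e S))"
    and pure: "\<And>p z. p \<in> carrier (power_group (insert e S) alg_A) \<Longrightarrow> z \<in> carrier (mod_T G (insert e S)) \<Longrightarrow>
      psi_summand G (insert e S) (pure_tensor (tensor_power (insert e S) alg_A) (mod_T G (insert e S)) p z) =
        z [^]\<^bsub>mod_T G (insert e S)\<^esub> eta_power (insert e S) p"
  shows "psi_summand G (insert e S) (edge_map_Y G S e z) = edge_map_T G S e (psi_summand G S z)"
proof (rule tensor_hom_ext[OF comm_power_A comm_mod_T _ _ _ _ z[unfolded carrier_mod_Y]])
  have id: "(\<lambda>i. i) \<in> S \<rightarrow> insert e S" by auto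
  have fS: "finite S" "finite (insert e S)" and eS: "e \<notin> S" using finite_sub[OF S] e by auto
  have Y: "hom (mod_Y G S) N = hom (tensor_group (tensor_power S alg_A) (mod_T G S)) N" for N :: "('z, 'y) monoid_scheme"
    unfolding mod_Y_def tensor_def[of _ "mod_T G S"] hom_with_grading by (rule refl)
  show gT': "group (mod_T G (insert e S))" by (rule comm_group.axioms(2)[OF comm_mod_T])
  have "(\<lambda>z. psi_summand G (insert e S) (edge_map_Y G S e z)) \<in> hom (mod_Y G S) (mod_T G (insert e S))"
    using hom_compose[OF bigraded_homD(3)[OF dY] psi] by (simp add: comp_def)
  then show "(\<lambda>z. psi_summand G (insert e S) (edge_map_Y G S e z)) \<in>
      hom (tensor_group (tensor_power S alg_A) (mod_T G S)) (mod_T G (insert e S))" unfolding Y .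
  show "(\<lambda>z. edge_map_T G S e (psi_summand G S z)) \<in>
      hom (tensor_group (tensor_power S alg_A) (mod_T G S)) (mod_T G (insert e S))"
    using hom_compose[OF psi_summand_hom' bigraded_homD(3)[OF dT]] by (simp add: comp_def)
  fix p z assume "p \<in> carrier (tensor_power S alg_A)" and z: "z \<in> carrier (mod_T G S)"
  then have p: "p \<in> carrier (power_group S alg_A)" by simp
  have pp: "power_push alg_A (\<lambda>i. i) S (insert e S) p \<in> carrier (power_group (insert e S) alg_A)"
    by (rule hom_in_carrier[OF power_push_hom[OF dual_algebras(1) id fS] p])
  show "psi_summand G (insert e S) (edge_map_Y G S e (pure_tensor (tensor_power S alg_A) (mod_T G S) p z)) =
      edge_map_T G S e (psi_summand G S (pure_tensor (tensor_power S alg_A) (mod_T G S) p z))"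
    unfolding edge_map_Y_pure[OF S e p z] psi_summand_pure[OF p z] pure[OF pp bigraded_hom_closed[OF dT z]]
      eta_power_insert[OF fS(1) eS p]
    by (rule hom_int_pow[OF bigraded_homD(3)[OF dT] z T.is_group gT', symmetric])
qed

end

context
  fixes es
  assumes es: "edge_ordering G es"
begin

lemma set_es: "set es = edges G"
  using es by (simp add: edge_ordering_def)

lemma phi_morphism:
  "cube_morphism es (mod_T G) (edge_map_T G) (\<lambda>S. basisT (components G S) (betti1 G S)) (\<lambda>S. degT (components G S) (betti1 G S))
     es (mod_Y G) (edge_map_Y G) (\<lambda>S. basisY S (components G S) (betti1 G S)) (\<lambda>S. degY S (components G S) (betti1 G S))
     (\<lambda>e. e) (\<lambda>e. e) (phi_summand G)"
proof (rule cube_morphism.intro[OF cube_T[OF es] cube_Y[OF es]], rule cube_morphism_axioms.intro, unfold image_ident set_es)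
  show "bij_betw (\<lambda>e. e) (edges G) (edges G)" by (simp add: bij_betw_def)
qed (rule refl phi_summand_hom phi_summand_edge; assumption?)+

lemma psi_morphism:
  "cube_morphism es (mod_Y G) (edge_map_Y G) (\<lambda>S. basisY S (components G S) (betti1 G S)) (\<lambda>S. degY S (components G S) (betti1 G S))
     es (mod_T G) (edge_map_T G) (\<lambda>S. basisT (components G S) (betti1 G S)) (\<lambda>S. degT (components G S) (betti1 G S))
     (\<lambda>e. e) (\<lambda>e. e) (psi_summand G)"
proof (rule cube_morphism.intro[OF cube_Y[OF es] cube_T[OF es]], rule cube_morphism_axioms.intro, unfold image_ident set_es)
  show "bij_betw (\<lambda>e. e) (edges G) (edges G)" by (simp add: bij_betw_def)
  show "bigraded_hom (mod_Y G S) (mod_T G S) (psi_summand G S)" if "S \<subseteq> edges G" for S by (rule psi_summand_hom[OF that])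
  fix S e z assume S: "S \<subseteq> edges G" and e: "e \<in> edges G - S" and z: "z \<in> carrier (mod_Y G S)"
  have S': "insert e S \<subseteq> edges G" using S e by simp
  show "psi_summand G (insert e S) (edge_map_Y G S e z) = edge_map_T G S e (psi_summand G S z)"
    by (rule psi_summand_edge[OF S e z cube.d_hom[OF cube_Y[OF es], unfolded set_es, OF S e]
      cube.d_hom[OF cube_T[OF es], unfolded set_es, OF S e] bigraded_homD(3)[OF psi_summand_hom[OF S']] psi_summand_pure[OF S']])
qed (rule refl)

lemma phi_chain_map: "chain_map (C_T G es) (C_Y G es) (phi G es)"
proof -
  have eq: "phi G es = (\<lambda>i. \<lambda>c\<in>carrier (obj (C_T G es) i). \<lambda>S\<in>cube_level es i. phi_summand G S (c S))"
    by (rule ext) (rule phi_def)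
  show ?thesis unfolding eq unfolding C_T_def C_Y_def by (rule cube_morphism_id_chain_map[OF phi_morphism])
qed

lemma psi_chain_map: "chain_map (C_Y G es) (C_T G es) (psi G es)"
proof -
  have eq: "psi G es = (\<lambda>i. \<lambda>c\<in>carrier (obj (C_Y G es) i). \<lambda>S\<in>cube_level es i. psi_summand G S (c S))"
    by (rule ext) (rule psi_def)
  show ?thesis unfolding eq unfolding C_T_def C_Y_def by (rule cube_morphism_id_chain_map[OF psi_morphism])
qed

lemma psi_phi:
  assumes c: "c \<in> carrier (obj (C_T G es) i)"
  shows "psi G es i (phi G es i c) = c"
proof (rule ext)
  fix S
  have pc: "phi G es i c \<in> carrier (obj (C_Y G es) i)" by (rule bigraded_hom_closed[OF chain_mapD(3)[OF phi_chain_map] c])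
  have C: "c \<in> (\<Pi>\<^sub>E S\<in>cube_level es i. carrier (mod_T G S))"
    using c unfolding C_T_def cube.carrier_C[OF cube_T[OF es]] .
  show "psi G es i (phi G es i c) S = c S"
  proof (cases "S \<in> cube_level es i")
    case True
    have S: "S \<subseteq> edges G" using True unfolding cube_level_def set_es by simp
    show ?thesis
      unfolding psi_def restrict_apply'[OF pc] restrict_apply'[OF True]
      unfolding phi_def restrict_apply'[OF c] restrict_apply'[OF True]
      by (rule psi_phi_summand[OF S PiE_mem[OF C True]])
  next
    case False
    then show ?thesis using PiE_arb[OF C False] pc by (simp add: psi_def)
  qed
qed

end

end

section \<open>Isomorphic graphs\<close>

text \<open>Carrying the inverse maps as data makes the situation symmetric, so each fact about G is
  available for H through \<open>sym\<close>.\<close>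

locale graph_iso = G: fin_graph G + H: fin_graph H
  for G :: "('v, 'e) multigraph" and H :: "('x, 'y) multigraph" +
  fixes f :: "'v \<Rightarrow> 'x" and f' :: "'x \<Rightarrow> 'v" and h :: "'e \<Rightarrow> 'y" and h' :: "'y \<Rightarrow> 'e"
  assumes f: "\<And>x. x \<in> verts G \<Longrightarrow> f x \<in> verts H" "\<And>x. x \<in> verts G \<Longrightarrow> f' (f x) = x"
    and f': "\<And>y. y \<in> verts H \<Longrightarrow> f' y \<in> verts G" "\<And>y. y \<in> verts H \<Longrightarrow> f (f' y) = y"
    and h: "\<And>e. e \<in> edges G \<Longrightarrow> h e \<in> edges H" "\<And>e. e \<in> edges G \<Longrightarrow> h' (h e) = e"
    and h': "\<And>e. e \<in> edges H \<Longrightarrow> h' e \<in> edges G" "\<And>e. e \<in> edges H \<Longrightarrow> h (h' e) = e"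
    and ends: "\<And>e. e \<in> edges G \<Longrightarrow> ends H (h e) = f ` ends G e"
      "\<And>e. e \<in> edges H \<Longrightarrow> ends G (h' e) = f' ` ends H e"
begin

lemma sym: "graph_iso H G f' f h' h"
  by unfold_locales (rule f f' h h' ends; assumption)+

lemma inj_h: "inj_on h (edges G)"
  by (rule inj_on_inverseI[of _ h']) (rule h(2))

lemma h_sub: "S \<subseteq> edges G \<Longrightarrow> h ` S \<subseteq> edges H"
  using h(1) by blast

lemma h'_h: "S \<subseteq> edges G \<Longrightarrow> h' ` h ` S = S"
  unfolding image_image by (rule trans[OF image_cong[OF refl] image_ident]) (rule h(2), blast)

lemma f'_f: "C \<subseteq> verts G \<Longrightarrow> f' ` f ` C = C"
  unfolding image_image by (rule trans[OF image_cong[OF refl] image_ident]) (rule f(2), blast)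

lemma reachable_image:
  assumes S: "S \<subseteq> edges G" and r: "(x, y) \<in> reachable G S"
  shows "(f x, f y) \<in> reachable H (h ` S)"
  using r S
proof (induction rule: G.reachable_induct)
  case refl
  then show ?case by (intro H.reachable_refl f(1))
next
  case (step y z e)
  have "ends H (h e) = {f y, f z}" using ends(1)[OF subsetD[OF S step.hyps(2)]] step.hyps(3) by simp
  then have "(f y, f z) \<in> {(x, y). \<exists>e\<in>h ` S. ends H e = {x, y}}" using step.hyps(2) by blast
  then have "(f y, f z) \<in> reachable H (h ` S)"
    unfolding reachable_def using f(1)[OF step.hyps(4)] f(1)[OF step.hyps(5)] by (intro IntI r_into_rtrancl SigmaI)
  then show ?case by (rule H.reachable_trans[OF step.IH])
qed

text \<open>One inclusion transports walks along f; the other transports them along the inverse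
  isomorphism.\<close>

lemma component_image:
  assumes S: "S \<subseteq> edges G" and x: "x \<in> verts G"
  shows "component_of H (h ` S) (f x) = f ` component_of G S x"
proof (intro equalityI subsetI)
  fix y assume "y \<in> component_of H (h ` S) (f x)"
  then have r: "(f x, y) \<in> reachable H (h ` S)" unfolding H.mem_component .
  have y: "y \<in> verts H" using H.reachable_V[OF r] by simp
  have "(f' (f x), f' y) \<in> reachable G (h' ` h ` S)" by (rule graph_iso.reachable_image[OF sym h_sub[OF S] r])
  then have "f' y \<in> component_of G S x" unfolding h'_h[OF S] f(2)[OF x] G.mem_component .
  then have "f (f' y) \<in> f ` component_of G S x" by (rule imageI)
  then show "y \<in> f ` component_of G S x" unfolding f'(2)[OF y] .
next
  fix y assume "y \<in> f ` component_of G S x"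
  then obtain z where z: "y = f z" "(x, z) \<in> reachable G S" unfolding G.mem_component[symmetric] by blast
  show "y \<in> component_of H (h ` S) (f x)" unfolding H.mem_component z(1) by (rule reachable_image[OF S z(2)])
qed

lemma components_image:
  assumes S: "S \<subseteq> edges G"
  shows "components H (h ` S) = image f ` components G S"
proof -
  have fV: "verts H = f ` verts G"
  proof (intro equalityI subsetI)
    fix y assume y: "y \<in> verts H"
    have "f (f' y) \<in> f ` verts G" by (rule imageI[OF f'(1)[OF y]])
    then show "y \<in> f ` verts G" unfolding f'(2)[OF y] .
  next
    fix y assume "y \<in> f ` verts G"
    then show "y \<in> verts H" using f(1) by blast
  qed
  show ?thesis
    unfolding G.components_image H.components_image fV image_image
    by (rule image_cong[OF refl]) (rule component_image[OF S])
qed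

lemma components_sub: "C \<in> components G S \<Longrightarrow> C \<subseteq> verts G"
  using G.component_subset unfolding G.components_image by blast

text \<open>Vertices, edges and components correspond bijectively, so Euler's relation yields equal
  Betti numbers. Cycles are not transported, since the orientations chosen in the two graphs need
  not correspond.\<close>

lemma betti1_image:
  assumes S: "S \<subseteq> edges G"
  shows "betti1 H (h ` S) = betti1 G S"
proof -
  have "card (verts H) = card (verts G)"
    by (rule bij_betw_same_card[of f', OF bij_betwI[of _ _ _ f]]) (use f f' in auto)
  moreover have "card (h ` S) = card S" by (rule card_image[OF inj_on_subset[OF inj_h S]])
  moreover have "betti0 H (h ` S) = betti0 G S"
    unfolding betti0_def components_image[OF S]
    by (rule card_image, rule inj_on_inverseI[of _ "image f'"], rule f'_f[OF components_sub])
  ultimately show ?thesis using G.betti1_rank[OF S] H.betti1_rank[OF h_sub[OF S]] by simp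
qed

text \<open>Edge and component factors are relabelled. The B-factors are indexed by position and
  their number is the same on both sides, so nothing moves there.\<close>

definition transport where
  "transport S = mapY h S (h ` S) (image f) (components G S) (components H (h ` S)) (betti1 G S) (betti1 H (h ` S))"

lemma image_f_components: "S \<subseteq> edges G \<Longrightarrow> image f \<in> components G S \<rightarrow> components H (h ` S)"
  unfolding components_image by blast

lemma transport_hom:
  assumes S: "S \<subseteq> edges G"
  shows "bigraded_hom (mod_Y G S) (mod_Y H (h ` S)) (transport S)"
  unfolding transport_def mod_Y_eq
  by (rule mapY_hom[OF _ G.finite_sub[OF S] finite_imageI[OF G.finite_sub[OF S]] image_f_components[OF S]
    G.finite_components H.finite_components eq_refl[OF betti1_image[OF S, symmetric]]]) blast

lemma transport_inverse:
  assumes S: "S \<subseteq> edges G" and z: "z \<in> carrier (mod_Y G S)"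
  shows "graph_iso.transport H G f' h' (h ` S) (transport S z) = z"
proof -
  interpret I: graph_iso H G f' f h' h by (rule sym)
  note fS = G.finite_sub[OF S]
  have S': "h' ` h ` S = S" by (rule h'_h[OF S])
  have hS: "h ` S \<subseteq> edges H" by (rule h_sub[OF S])
  have m: "h \<in> S \<rightarrow> h ` S" "h' \<in> h ` S \<rightarrow> S" using S' by blast+
  have p: "image f' \<in> components H (h ` S) \<rightarrow> components G S" using I.image_f_components[OF hS] unfolding S' .
  have "I.transport (h ` S) (transport S z) = mapY (\<lambda>e. h' (h e)) S S (\<lambda>C. f' ` f ` C) (components G S) (components G S)
      (betti1 G S) (betti1 G S) z"
    unfolding transport_def I.transport_def unfolding S'
    by (rule mapY_comp[OF m fS finite_imageI[OF fS] fS image_f_components[OF S] p G.finite_components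
      H.finite_components G.finite_components _ _ z[unfolded mod_Y_eq]]) (simp_all add: betti1_image[OF S])
  also have "\<dots> = z"
    by (rule mapY_id[OF fS G.finite_components z[unfolded mod_Y_eq] h(2)[OF subsetD[OF S]] f'_f[OF components_sub]])
  finally show ?thesis .
qed

lemma coarse_image:
  assumes S: "S \<subseteq> S'" "S' \<subseteq> edges G" and C: "C \<in> components G S"
  shows "f ` G.coarse S' C = H.coarse (h ` S') (f ` C)"
proof -
  obtain x where x: "x \<in> verts G" "C = component_of G S x" using G.component_nonempty C by blast
  have S0: "S \<subseteq> edges G" using S by blast
  have "f ` G.coarse S' C = component_of H (h ` S') (f x)"
    unfolding x(2) G.coarse_component[OF x(1) S(1)] by (rule component_image[OF S(2) x(1), symmetric])
  also have "\<dots> = H.coarse (h ` S') (component_of H (h ` S) (f x))"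
    by (rule H.coarse_component[OF f(1)[OF x(1)] image_mono[OF S(1)], symmetric])
  also have "component_of H (h ` S) (f x) = f ` C" unfolding x(2) by (rule component_image[OF S0 x(1)])
  finally show ?thesis .
qed

text \<open>By functoriality both sides are induced by composite index maps, and these agree because
  relabelling the vertices commutes with the passage to coarser components.\<close>

lemma transport_edge:
  assumes S: "S \<subseteq> edges G" and e: "e \<in> edges G - S" and z: "z \<in> carrier (mod_Y G S)"
  shows "transport (insert e S) (edge_map_Y G S e z) = edge_map_Y H (h ` S) (h e) (transport S z)"
proof -
  have S': "insert e S \<subseteq> edges G" using S e by simp
  have hS: "h ` S \<subseteq> edges H" by (rule h_sub[OF S])
  have "h e \<notin> h ` S" using inj_onD[OF inj_h] S e by blast
  then have he: "h e \<in> edges H - h ` S" using h(1) e by simp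
  note fS = G.finite_sub[OF S] and fS' = G.finite_sub[OF S'] and fH = H.finite_sub[OF hS]
  have fH': "finite (insert (h e) (h ` S))" using fH by simp
  have hi: "h ` insert e S = insert (h e) (h ` S)" by (rule image_insert)
  have m: "(\<lambda>i. i) \<in> S \<rightarrow> insert e S" "h \<in> insert e S \<rightarrow> insert (h e) (h ` S)" "h \<in> S \<rightarrow> h ` S"
    "(\<lambda>i. i) \<in> h ` S \<rightarrow> insert (h e) (h ` S)" by auto
  note z' = z[unfolded mod_Y_eq]
  have b: "betti1 G S \<le> betti1 G (insert e S)" by (rule G.betti1_insert_le[OF S e])
  have b': "betti1 H (h ` S) = betti1 G S" "betti1 H (insert (h e) (h ` S)) = betti1 G (insert e S)"
    using betti1_image[OF S] betti1_image[OF S'] unfolding hi by simp_all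
  have p: "image f \<in> components G (insert e S) \<rightarrow> components H (insert (h e) (h ` S))"
    using image_f_components[OF S'] unfolding hi .
  have "transport (insert e S) (edge_map_Y G S e z) =
      mapY h S (insert (h e) (h ` S)) (\<lambda>C. f ` G.coarse (insert e S) C) (components G S)
        (components H (insert (h e) (h ` S))) (betti1 G S) (betti1 G (insert e S)) z"
    unfolding transport_def G.edge_map_Y_eq[OF S e] hi b'
    by (rule mapY_comp[OF m(1,2) fS fS' fH' G.coarse_in[OF subset_insertI] p G.finite_components
      G.finite_components H.finite_components b order_refl z'])
  also have "mapY h S (insert (h e) (h ` S)) (\<lambda>C. f ` G.coarse (insert e S) C) (components G S)
        (components H (insert (h e) (h ` S))) (betti1 G S) (betti1 G (insert e S)) =
      mapY h S (insert (h e) (h ` S)) (\<lambda>C. H.coarse (insert (h e) (h ` S)) (f ` C)) (components G S)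
        (components H (insert (h e) (h ` S))) (betti1 G S) (betti1 G (insert e S))"
    by (rule mapY_cong[OF refl]) (rule coarse_image[OF subset_insertI S', unfolded hi])
  also have "mapY h S (insert (h e) (h ` S)) (\<lambda>C. H.coarse (insert (h e) (h ` S)) (f ` C)) (components G S)
        (components H (insert (h e) (h ` S))) (betti1 G S) (betti1 G (insert e S)) z =
      edge_map_Y H (h ` S) (h e) (transport S z)"
    unfolding transport_def H.edge_map_Y_eq[OF hS he] b'
    by (rule mapY_comp[OF m(3,4) fS fH fH' image_f_components[OF S] H.coarse_in[OF subset_insertI]
      G.finite_components H.finite_components H.finite_components order_refl b z', symmetric])
  finally show ?thesis .
qed

lemma transport_morphism:
  assumes es: "edge_ordering G es" and es': "edge_ordering H es'"
  shows "cube_morphism es (mod_Y G) (edge_map_Y G) (\<lambda>S. basisY S (components G S) (betti1 G S)) (\<lambda>S. degY S (components G S) (betti1 G S))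
     es' (mod_Y H) (edge_map_Y H) (\<lambda>S. basisY S (components H S) (betti1 H S)) (\<lambda>S. degY S (components H S) (betti1 H S))
     h h' transport"
proof (rule cube_morphism.intro[OF G.cube_Y[OF es] H.cube_Y[OF es']], rule cube_morphism_axioms.intro,
    unfold G.set_es[OF es] H.set_es[OF es'])
  show "bij_betw h (edges G) (edges H)" by (rule bij_betwI[of _ _ _ h']) (use h h' in auto)
qed (rule h(2) transport_hom transport_edge; assumption)+

lemma complex_iso:
  assumes es: "edge_ordering G es" and es': "edge_ordering H es'"
  shows "complex_isomorphic (C_Y G es) (C_Y H es')"
    and "bigraded_isomorphic (cohomology (C_Y G es) i) (cohomology (C_Y H es') i)"
proof -
  interpret I: graph_iso H G f' f h' h by (rule sym)
  have 1: "I.transport (h ` S) (transport S x) = x" if "S \<subseteq> set es" "x \<in> carrier (mod_Y G S)" for S x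
    by (rule transport_inverse[OF that[unfolded G.set_es[OF es]]])
  have 2: "transport (h' ` S) (I.transport S x) = x" if "S \<subseteq> set es'" "x \<in> carrier (mod_Y H S)" for S x
    by (rule I.transport_inverse[OF that[unfolded H.set_es[OF es']]])
  note i = cube_isomorphic[where F = transport and F' = I.transport,
    OF transport_morphism[OF es es'] I.transport_morphism[OF es' es]]
  show "complex_isomorphic (C_Y G es) (C_Y H es')"
    unfolding C_Y_def by (rule i(1); (rule 1 2; assumption))
  show "bigraded_isomorphic (cohomology (C_Y G es) i) (cohomology (C_Y H es') i)"
    unfolding C_Y_def by (rule i(2); (rule 1 2; assumption))
qed

end

lemma graph_isomorphic_iso:
  assumes G: "finite_graph G" and H: "finite_graph H" and i: "graph_isomorphic G H"
  shows "\<exists>f f' h h'. graph_iso G H f f' h h'"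
proof -
  obtain f h where f: "bij_betw f (verts G) (verts H)" and h: "bij_betw h (edges G) (edges H)"
    and e: "\<And>e. e \<in> edges G \<Longrightarrow> ends H (h e) = f ` ends G e"
    using i unfolding graph_isomorphic_def by blast
  let ?f' = "inv_into (verts G) f" and ?h' = "inv_into (edges G) h"
  have f1: "?f' (f x) = x" if "x \<in> verts G" for x using bij_betw_inv_into_left[OF f that] .
  have h2: "h (?h' e) = e" if "e \<in> edges H" for e using bij_betw_inv_into_right[OF h that] .
  have h1: "?h' e \<in> edges G" if "e \<in> edges H" for e using bij_betw_apply[OF bij_betw_inv_into[OF h] that] .
  have "graph_iso G H f ?f' h ?h'"
  proof (rule graph_iso.intro[OF fin_graph.intro[OF G] fin_graph.intro[OF H]], rule graph_iso_axioms.intro)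
    show "f x \<in> verts H" if "x \<in> verts G" for x using bij_betw_apply[OF f that] .
    show "?f' (f x) = x" if "x \<in> verts G" for x by (rule f1[OF that])
    show "?f' y \<in> verts G" if "y \<in> verts H" for y using bij_betw_apply[OF bij_betw_inv_into[OF f] that] .
    show "f (?f' y) = y" if "y \<in> verts H" for y using bij_betw_inv_into_right[OF f that] .
    show "h x \<in> edges H" if "x \<in> edges G" for x using bij_betw_apply[OF h that] .
    show "?h' (h x) = x" if "x \<in> edges G" for x using bij_betw_inv_into_left[OF h that] .
    show "?h' e \<in> edges G" if "e \<in> edges H" for e by (rule h1[OF that])
    show "h (?h' e) = e" if "e \<in> edges H" for e by (rule h2[OF that])
    show "ends H (h x) = f ` ends G x" if "x \<in> edges G" for x by (rule e[OF that])
    show "ends G (?h' x) = ?f' ` ends H x" if x: "x \<in> edges H" for x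
    proof -
      have "ends H x = f ` ends G (?h' x)" using e[OF h1[OF x]] unfolding h2[OF x] .
      moreover have "ends G (?h' x) \<subseteq> verts G" using G h1[OF x] by (auto simp: finite_graph_def)
      ultimately show ?thesis using inv_into_image_cancel[of f "verts G" "ends G (?h' x)"] f
        by (simp add: bij_betw_def)
    qed
  qed
  then show ?thesis by blast
qed

lemma graph_isomorphic_refl: "graph_isomorphic G G"
proof -
  have "bij_betw id (verts G) (verts G)" "bij_betw id (edges G) (edges G)" by (rule bij_betw_id)+
  moreover have "\<forall>e\<in>edges G. ends G (id e) = id ` ends G e" by simp
  ultimately show ?thesis unfolding graph_isomorphic_def by blast
qed

section \<open>Graded dimensions\<close>

definition monomial :: "nat \<times> nat \<Rightarrow> int poly poly" where
  "monomial d = t_var ^ fst d * w_var ^ snd d"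

lemma monomial_0 [simp]: "monomial 0 = 1"
  by (simp add: monomial_def)

lemma monomial_add: "monomial (d + e) = monomial d * monomial e"
  by (simp add: monomial_def power_add mult_ac)

lemma monomial_sum: "monomial (\<Sum>i\<in>I. d i) = (\<Prod>i\<in>I. monomial (d i))"
  by (induction I rule: infinite_finite_induct) (simp_all add: monomial_add)

lemma qdim_ranks:
  assumes r: "\<And>d. has_rank (graded_part M d) (r d)" and D: "finite D" "\<And>d. d \<notin> D \<Longrightarrow> r d = 0"
  shows "qdim M = (\<Sum>d\<in>D. of_nat (r d) * monomial d)"
proof -
  have "qdim M = (\<Sum>d | r d \<noteq> 0. of_nat (r d) * monomial d)"
    unfolding qdim_def monomial_def has_rank_rank(1)[OF r]
    by (rule sum.cong) (auto simp: mult.assoc)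
  also have "\<dots> = (\<Sum>d\<in>D. of_nat (r d) * monomial d)"
  proof (rule sum.mono_neutral_left[OF D(1)])
    show "{d. r d \<noteq> 0} \<subseteq> D"
    proof
      fix d assume "d \<in> {d. r d \<noteq> 0}"
      then show "d \<in> D" using D(2)[of d] unfolding mem_Collect_eq by metis
    qed
  qed simp
  finally show ?thesis .
qed

text \<open>The graded ranks count basis elements by degree, so each of them contributes its own
  monomial.\<close>

lemma qdim_free:
  assumes M: "free_graded M X dg"
  shows "qdim M = (\<Sum>x\<in>X. monomial (dg x))"
proof -
  have X: "finite X" by (rule free_gradedD(5)[OF M])
  have "qdim M = (\<Sum>d\<in>dg ` X. of_nat (card {x \<in> X. dg x = d}) * monomial d)"
  proof (rule qdim_ranks[OF free_gradedD(6)[OF M] finite_imageI[OF X]])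
    fix d assume "d \<notin> dg ` X"
    then have "{x \<in> X. dg x = d} = {}" by blast
    then show "card {x \<in> X. dg x = d} = 0" by (simp only: card.empty)
  qed
  also have "\<dots> = (\<Sum>d\<in>dg ` X. \<Sum>x\<in>{x \<in> X. dg x = d}. monomial (dg x))"
  proof (rule sum.cong[OF refl])
    fix d
    have "(\<Sum>x\<in>{x \<in> X. dg x = d}. monomial (dg x)) = (\<Sum>x\<in>{x \<in> X. dg x = d}. monomial d)"
      by (rule sum.cong) auto
    then show "of_nat (card {x \<in> X. dg x = d}) * monomial d = (\<Sum>x\<in>{x \<in> X. dg x = d}. monomial (dg x))"
      by (simp only: sum_constant)
  qed
  also have "\<dots> = (\<Sum>x\<in>X. monomial (dg x))" by (rule sum.image_gen[OF X, symmetric])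
  finally show ?thesis .
qed

text \<open>Finite type asks for trivial homogeneous parts outside a finite set of degrees, which is
  stronger than rank 0. For cochains it follows from vanishing coordinates, and cohomology inherits
  it.\<close>

lemma free_graded_grade_trivial:
  assumes M: "free_graded M X dg" and d: "d \<notin> dg ` X"
  shows "grade M d = {\<one>\<^bsub>M\<^esub>}"
proof -
  obtain b c where "free_bigraded M X b c dg" using M unfolding free_graded_def by blast
  then interpret free_bigraded M X b c dg .
  have "m = \<one>\<^bsub>M\<^esub>" if m: "m \<in> grade M d" for m
  proof (rule ext_coord[OF grade_closed[OF m] one_closed])
    fix x assume x: "x \<in> X"
    then have "dg x \<noteq> d" using d by blast
    then have "c x m = 0" using m x unfolding grade_eq by simp
    then show "c x m = c x \<one>\<^bsub>M\<^esub>" using c_one[OF x] by simp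
  qed
  then show ?thesis using subgroup.one_closed[OF grade_subgroup] by blast
qed

lemma finite_type_ranks:
  assumes "\<And>d. has_rank (graded_part M d) (r d)" "finite D" "\<And>d. d \<notin> D \<Longrightarrow> grade M d = {\<one>\<^bsub>M\<^esub>}"
  shows "finite_type M"
  unfolding finite_type_def
proof (intro conjI allI)
  show "finite {d. grade M d \<noteq> {\<one>\<^bsub>M\<^esub>}}" by (rule finite_subset[OF _ assms(2)]) (use assms(3) in blast)
  show "vectorspace.fin_dim rat_field (rationalization (graded_part M d))" for d
    by (rule has_rank_rank(2)[OF assms(1)])
qed

lemma cohomology_grade_trivial:
  assumes C: "cochain_complex C" and d: "grade (obj C i) d = {\<one>\<^bsub>obj C i\<^esub>}"
  shows "grade (cohomology C i) d = {\<one>\<^bsub>cohomology C i\<^esub>}"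
proof -
  have z: "\<one>\<^bsub>obj C i\<^esub> \<in> cocycles C i" by (rule subgroup.one_closed[OF cocycles_subgroup[OF C]])
  have b: "\<one>\<^bsub>obj C i\<^esub> \<in> coboundaries C i" by (rule subgroup.one_closed[OF coboundaries_subgroup[OF C]])
  have "cocycles C i \<inter> {\<one>\<^bsub>obj C i\<^esub>} = {\<one>\<^bsub>obj C i\<^esub>}" using z by blast
  then show ?thesis
    unfolding grade_cohomology[OF C] d cohomology_one[OF C] using coset_eq_coboundaries[OF C z] b by simp
qed

text \<open>All degrees that occur lie in one finite set D, so both alternating sums can be split by
  bidegree, where the integral statement applies.\<close>

lemma euler_characteristic:
  assumes C: "cochain_complex C" and free: "\<And>i. free_graded (obj C i) (X i) (dg i)"
    and n: "\<And>i. i > n \<Longrightarrow> X i = {}"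
  shows "finite_type (obj C i)" "finite_type (cohomology C i)"
    and "graded_euler C = (\<Sum>i=0..n. (-1) ^ i * qdim (cohomology C i))"
    and "(\<Sum>i=0..n. (-1) ^ i * qdim (cohomology C i)) = (\<Sum>i=0..n. (-1) ^ i * qdim (obj C i))"
proof -
  define c where "c = (\<lambda>d i. card {x \<in> X i. dg i x = d})"
  define D where "D = (\<Union>i\<in>{0..n}. dg i ` X i)"
  have c: "has_rank (graded_part (obj C i) d) (c d i)" for d i
    unfolding c_def by (rule free_gradedD(6)[OF free])
  have cn: "c d (Suc n) = 0" for d unfolding c_def using n[of "Suc n"] by simp
  have D: "finite D" unfolding D_def using free_gradedD(5)[OF free] by simp
  have deg: "d \<in> D \<and> i \<le> n" if "d \<in> dg i ` X i" for d i
  proof -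
    have "i \<le> n" using n[of i] that by (cases "i > n") auto
    then show ?thesis using that unfolding D_def by auto
  qed
  have "\<exists>h. (\<forall>i. has_rank (graded_part (cohomology C i) d) (h i)) \<and>
      (\<Sum>i=0..n. (-1) ^ i * int (h i)) = (\<Sum>i=0..n. (-1) ^ i * int (c d i))" for d
    by (rule euler_characteristic_degree[OF C c cn])
  then obtain h where h: "\<And>d i. has_rank (graded_part (cohomology C i) d) (h d i)"
    and e: "\<And>d. (\<Sum>i=0..n. (-1) ^ i * int (h d i)) = (\<Sum>i=0..n. (-1) ^ i * int (c d i))"
    by metis
  have triv: "grade (obj C i) d = {\<one>\<^bsub>obj C i\<^esub>}" if "\<not> (d \<in> D \<and> i \<le> n)" for d i
    by (rule free_graded_grade_trivial[OF free]) (use deg[of d i] that in blast)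
  have htriv: "grade (cohomology C i) d = {\<one>\<^bsub>cohomology C i\<^esub>}" if "\<not> (d \<in> D \<and> i \<le> n)" for d i
    by (rule cohomology_grade_trivial[OF C triv[OF that]])
  have h0: "h d i = 0" if "\<not> (d \<in> D \<and> i \<le> n)" for d i
  proof (rule has_rank_unique[OF h])
    note b = bigraded_cohomology[OF C, of i]
    show "has_rank (graded_part (cohomology C i) d) 0"
      by (rule has_rank_trivial[OF comm_group_graded_part[OF bigraded_module_comm[OF b] bigraded_module_grade[OF b]]])
        (simp add: htriv[OF that])
  qed
  have c0: "c d i = 0" if "d \<notin> D" for d i
  proof -
    have "{x \<in> X i. dg i x = d} = {}" using deg[of d i] that by blast
    then show ?thesis unfolding c_def by (simp only: card.empty)
  qed
  show "finite_type (obj C i)"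
    by (rule finite_type_ranks[OF c D]) (rule triv, simp)
  show "finite_type (cohomology C i)"
    by (rule finite_type_ranks[OF h D]) (rule htriv, simp)
  have qh: "qdim (cohomology C i) = (\<Sum>d\<in>D. of_nat (h d i) * monomial d)" for i
    by (rule qdim_ranks[OF h D]) (rule h0, simp)
  have qc: "qdim (obj C i) = (\<Sum>d\<in>D. of_nat (c d i) * monomial d)" for i
    by (rule qdim_ranks[OF c D c0])
  \<comment> \<open>Exchanging the two summations collects the alternating sum of ranks in front of
    each monomial; it is used for cohomology and cochains alike.\<close>
  have sw: "(\<Sum>i=0..n. (-1) ^ i * (\<Sum>d\<in>D. of_nat (r d i) * monomial d)) =
      (\<Sum>d\<in>D. of_int (\<Sum>i=0..n. (-1) ^ i * int (r d i)) * monomial d)" for r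
  proof -
    have "(\<Sum>i=0..n. (-1) ^ i * (\<Sum>d\<in>D. of_nat (r d i) * monomial d)) =
        (\<Sum>i=0..n. \<Sum>d\<in>D. (-1) ^ i * of_nat (r d i) * monomial d)"
      by (simp only: sum_distrib_left mult.assoc)
    also have "\<dots> = (\<Sum>d\<in>D. \<Sum>i=0..n. (-1) ^ i * of_nat (r d i) * monomial d)" by (rule sum.swap)
    also have "\<dots> = (\<Sum>d\<in>D. of_int (\<Sum>i=0..n. (-1) ^ i * int (r d i)) * monomial d)"
      by (rule sum.cong[OF refl]) (simp add: sum_distrib_right)
    finally show ?thesis .
  qed
  show "(\<Sum>i=0..n. (-1) ^ i * qdim (cohomology C i)) = (\<Sum>i=0..n. (-1) ^ i * qdim (obj C i))"
    unfolding qh qc sw e by (rule refl)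
  have "i \<in> {0..n}" if "qdim (cohomology C i) \<noteq> 0" for i
  proof (rule ccontr)
    assume "i \<notin> {0..n}"
    then have "h d i = 0" for d by (intro h0) simp
    then show False using that unfolding qh by simp
  qed
  then show "graded_euler C = (\<Sum>i=0..n. (-1) ^ i * qdim (cohomology C i))"
    unfolding graded_euler_def by (intro sum.mono_neutral_left) auto
qed

text \<open>Expanding the product of the factors 1 + \<open>monomial d\<close> over I gives one term
  for each choice of a basis element in every tensor factor.\<close>

lemma sum_monomial_power:
  assumes I: "finite I"
  shows "(\<Sum>f\<in>(I \<rightarrow>\<^sub>E (UNIV :: bool set)). monomial (\<Sum>i\<in>I. if f i then d else 0)) = (1 + monomial d) ^ card I"
proof -
  have "(\<Sum>f\<in>(I \<rightarrow>\<^sub>E (UNIV :: bool set)). monomial (\<Sum>i\<in>I. if f i then d else 0)) =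
      (\<Prod>i\<in>I. \<Sum>b\<in>(UNIV :: bool set). monomial (if b then d else 0))"
    unfolding monomial_sum by (rule prod_sum_PiE[OF I, symmetric]) simp
  also have "(\<Sum>b\<in>(UNIV :: bool set). monomial (if b then d else 0)) = 1 + monomial d"
    by (simp add: UNIV_bool)
  finally show ?thesis by simp
qed

lemma sum_monomial_basisY:
  assumes S: "finite S" and I: "finite I"
  shows "(\<Sum>x\<in>basisY S I k. monomial (degY S I k x)) = (1 + t_var) ^ (card S + card I) * (1 + w_var) ^ k"
proof -
  have tw: "monomial (1, 0) = t_var" "monomial (0, 1) = w_var" by (simp_all add: monomial_def)
  have "(\<Sum>z\<in>basisT I k. monomial (degT I k z)) =
      (\<Sum>f\<in>(I \<rightarrow>\<^sub>E UNIV). \<Sum>g\<in>({..<k} \<rightarrow>\<^sub>E UNIV).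
        monomial (\<Sum>i\<in>I. if f i then (1, 0) else 0) * monomial (\<Sum>i\<in>{..<k}. if g i then (0, 1) else 0))"
    unfolding basisT_def degT_def sum.cartesian_product by (rule sum.cong) (auto simp: monomial_add)
  also have "\<dots> = (1 + t_var) ^ card I * (1 + w_var) ^ k"
    unfolding sum_product[symmetric] sum_monomial_power[OF I] sum_monomial_power[OF finite_lessThan] tw by simp
  finally have T: "(\<Sum>z\<in>basisT I k. monomial (degT I k z)) = (1 + t_var) ^ card I * (1 + w_var) ^ k" .
  have "(\<Sum>x\<in>basisY S I k. monomial (degY S I k x)) =
      (\<Sum>f\<in>(S \<rightarrow>\<^sub>E UNIV). \<Sum>z\<in>basisT I k. monomial (\<Sum>i\<in>S. if f i then (1, 0) else 0) * monomial (degT I k z))"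
    unfolding basisY_def degY_def sum.cartesian_product by (rule sum.cong) (auto simp: monomial_add)
  also have "\<dots> = (1 + t_var) ^ card S * ((1 + t_var) ^ card I * (1 + w_var) ^ k)"
    unfolding sum_product[symmetric] sum_monomial_power[OF S] T tw by (rule refl)
  finally show ?thesis by (simp only: power_add mult.assoc)
qed

context fin_graph
begin

context
  fixes es
  assumes es: "edge_ordering G es"
begin

interpretation Y: cube es "mod_Y G" "edge_map_Y G" "\<lambda>S. basisY S (components G S) (betti1 G S)"
    "\<lambda>S. degY S (components G S) (betti1 G S)"
  by (rule cube_Y[OF es])

lemma card_edges: "card (edges G) = length es"
  using es distinct_card unfolding edge_ordering_def by metis

lemma level_empty: "i > length es \<Longrightarrow> cube_level es i = {}"
proof -
  assume "i > length es"
  then have "card S \<noteq> i" if "S \<subseteq> set es" for S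
    using card_mono[OF _ that] card_length[of es] by simp
  then show ?thesis unfolding cube_level_def by simp
qed

lemma C_Y_euler:
  shows "finite_type (obj (C_Y G es) i)" and "finite_type (cohomology (C_Y G es) i)"
    and "graded_euler (C_Y G es) = (\<Sum>i=0..length es. (-1) ^ i * qdim (cohomology (C_Y G es) i))"
    and "(\<Sum>i=0..length es. (-1) ^ i * qdim (cohomology (C_Y G es) i)) =
     (\<Sum>i=0..length es. (-1) ^ i * qdim (obj (C_Y G es) i))"
proof -
  have X: "Sigma (cube_level es i) (\<lambda>S. basisY S (components G S) (betti1 G S)) = {}" if "i > length es" for i
    unfolding level_empty[OF that] by simp
  note e = euler_characteristic[OF Y.cochain_complex_C Y.free_C X]
  show "finite_type (obj (C_Y G es) i)" unfolding C_Y_def by (rule e(1))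
  show "finite_type (cohomology (C_Y G es) i)" unfolding C_Y_def by (rule e(2))
  show "graded_euler (C_Y G es) = (\<Sum>i=0..length es. (-1) ^ i * qdim (cohomology (C_Y G es) i))"
    unfolding C_Y_def by (rule e(3))
  show "(\<Sum>i=0..length es. (-1) ^ i * qdim (cohomology (C_Y G es) i)) =
     (\<Sum>i=0..length es. (-1) ^ i * qdim (obj (C_Y G es) i))"
    unfolding C_Y_def by (rule e(4))
qed

text \<open>The sum over all edge sets is grouped by cardinality, which is the cohomological degree
  of the summand of S and accounts for its sign.\<close>

lemma g_poly_eq: "(\<Sum>i=0..length es. (-1) ^ i * qdim (obj (C_Y G es) i)) = g_poly G"
proof -
  let ?w = "\<lambda>S. (-1) ^ card S * (1 + t_var) ^ (card S + betti0 G S) * (1 + w_var) ^ betti1 G S"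
  have q: "(-1) ^ i * qdim (obj (C_Y G es) i) = (\<Sum>S\<in>{S \<in> Pow (edges G). card S = i}. ?w S)" for i
  proof -
    have fX: "finite (basisY S (components G S) (betti1 G S))" if "S \<in> cube_level es i" for S
      by (rule free_gradedD(5)[OF Y.free[OF Y.levelD(1)[OF that]]])
    have "qdim (obj (C_Y G es) i) = (\<Sum>z\<in>Sigma (cube_level es i) (\<lambda>S. basisY S (components G S) (betti1 G S)).
        case z of (S, x) \<Rightarrow> monomial (degY S (components G S) (betti1 G S) x))"
      unfolding C_Y_def qdim_free[OF Y.free_C] by (rule sum.cong) auto
    also have "\<dots> = (\<Sum>S\<in>cube_level es i. \<Sum>x\<in>basisY S (components G S) (betti1 G S).
        monomial (degY S (components G S) (betti1 G S) x))"
      by (rule sum.Sigma[symmetric]) (use Y.finite_level fX in auto)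
    also have "\<dots> = (\<Sum>S\<in>cube_level es i. (1 + t_var) ^ (card S + betti0 G S) * (1 + w_var) ^ betti1 G S)"
      unfolding betti0_def
      by (rule sum.cong[OF refl]) (rule sum_monomial_basisY[OF Y.levelD(3) finite_components])
    finally have "(-1) ^ i * qdim (obj (C_Y G es) i) =
        (\<Sum>S\<in>cube_level es i. (-1) ^ i * ((1 + t_var) ^ (card S + betti0 G S) * (1 + w_var) ^ betti1 G S))"
      by (simp only: sum_distrib_left)
    also have "\<dots> = (\<Sum>S\<in>{S \<in> Pow (edges G). card S = i}. ?w S)"
      unfolding cube_level_def set_es[OF es] by (rule sum.cong) (auto simp: mult.assoc)
    finally show ?thesis .
  qed
  show ?thesis
    unfolding q g_poly_def
  proof (rule sum.group)
    show "finite (Pow (edges G))" using finite_E by simp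
    show "card ` Pow (edges G) \<subseteq> {0..length es}" using card_mono[OF finite_E] by (auto simp: card_edges)
  qed simp
qed

lemma C_Y_complex: "cochain_complex (C_Y G es)" and C_Y_trivial: "i > length es \<Longrightarrow> trivial_group (obj (C_Y G es) i)"
  unfolding C_Y_def by (rule Y.cochain_complex_C Y.trivial_obj; assumption?)+

end

end

theorem theorem4p2:
  fixes G :: "('v, 'e) multigraph" and es :: "'e list" and n :: nat
  assumes "finite_graph G" and "card (edges G) = n" and "edge_ordering G es"
  shows
    "(cochain_complex (C_Y G es) \<and> (\<forall>i>n. trivial_group (obj (C_Y G es) i))) \<and>
     ((\<forall>es'. edge_ordering G es' \<longrightarrow>
         complex_isomorphic (C_Y G es) (C_Y G es') \<and>
         (\<forall>i. bigraded_isomorphic (cohomology (C_Y G es) i) (cohomology (C_Y G es') i))) \<and>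
      (\<forall>(G' :: ('x, 'y) multigraph) es'.
         finite_graph G' \<and> graph_isomorphic G G' \<and> edge_ordering G' es' \<longrightarrow>
         complex_isomorphic (C_Y G es) (C_Y G' es') \<and>
         (\<forall>i. bigraded_isomorphic (cohomology (C_Y G es) i) (cohomology (C_Y G' es') i)))) \<and>
     ((\<forall>i. finite_type (obj (C_Y G es) i) \<and> finite_type (cohomology (C_Y G es) i)) \<and>
      graded_euler (C_Y G es) = (\<Sum>i=0..n. (-1) ^ i * qdim (cohomology (C_Y G es) i)) \<and>
      (\<Sum>i=0..n. (-1) ^ i * qdim (cohomology (C_Y G es) i)) =
        (\<Sum>i=0..n. (-1) ^ i * qdim (obj (C_Y G es) i)) \<and>
      (\<Sum>i=0..n. (-1) ^ i * qdim (obj (C_Y G es) i)) = g_poly G) \<and>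
     (chain_map (C_T G es) (C_Y G es) (phi G es) \<and>
      chain_map (C_Y G es) (C_T G es) (psi G es) \<and>
      (\<forall>i. \<forall>x\<in>carrier (obj (C_T G es) i). psi G es i (phi G es i x) = x) \<and>
      complex_summand (C_T G es) (C_Y G es) \<and>
      (\<forall>i. bigraded_hom (cohomology (C_T G es) i) (cohomology (C_Y G es) i)
              (cohomology_map (C_T G es) (C_Y G es) (phi G es) i) \<and>
           bigraded_hom (cohomology (C_Y G es) i) (cohomology (C_T G es) i)
              (cohomology_map (C_Y G es) (C_T G es) (psi G es) i) \<and>
           (\<forall>X\<in>carrier (cohomology (C_T G es) i).
              cohomology_map (C_Y G es) (C_T G es) (psi G es) i
                (cohomology_map (C_T G es) (C_Y G es) (phi G es) i X) = X) \<and>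
           direct_summand (cohomology (C_T G es) i) (cohomology (C_Y G es) i)))"
proof -
  note es = assms(3)
  interpret fin_graph G by (rule fin_graph.intro[OF assms(1)])
  have n: "n = length es" using assms(2) card_edges[OF es] by simp
  \<comment> \<open>A change of the edge order is covered by the case of an isomorphism from G to
    itself, with different orders on its two sides.\<close>
  have iso': "complex_isomorphic (C_Y G es) (C_Y G es') \<and>
      (\<forall>i. bigraded_isomorphic (cohomology (C_Y G es) i) (cohomology (C_Y G es') i))"
    if es': "edge_ordering G es'" for es'
  proof -
    obtain f f' h h' where i: "graph_iso G G f f' h h'"
      using graph_isomorphic_iso[OF assms(1) assms(1) graph_isomorphic_refl] by blast
    show ?thesis using graph_iso.complex_iso[OF i es es'] by simp
  qed
  have a: "cochain_complex (C_Y G es) \<and> (\<forall>i>n. trivial_group (obj (C_Y G es) i))"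
    unfolding n using C_Y_complex[OF es] C_Y_trivial[OF es] by simp
  have b: "(\<forall>es'. edge_ordering G es' \<longrightarrow>
         complex_isomorphic (C_Y G es) (C_Y G es') \<and>
         (\<forall>i. bigraded_isomorphic (cohomology (C_Y G es) i) (cohomology (C_Y G es') i))) \<and>
      (\<forall>(G' :: ('x, 'y) multigraph) es'.
         finite_graph G' \<and> graph_isomorphic G G' \<and> edge_ordering G' es' \<longrightarrow>
         complex_isomorphic (C_Y G es) (C_Y G' es') \<and>
         (\<forall>i. bigraded_isomorphic (cohomology (C_Y G es) i) (cohomology (C_Y G' es') i)))"
    proof (intro conjI allI impI)
      fix es' assume e: "edge_ordering G es'"
      show "complex_isomorphic (C_Y G es) (C_Y G es')" using iso'[OF e] by (rule conjunct1)
      show "bigraded_isomorphic (cohomology (C_Y G es) i) (cohomology (C_Y G es') i)" for i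
        using iso'[OF e] by (rule conjunct2[THEN spec])
    next
      fix G' :: "('x, 'y) multigraph" and es'
      assume a: "finite_graph G' \<and> graph_isomorphic G G' \<and> edge_ordering G' es'"
      obtain f f' h h' where i: "graph_iso G G' f f' h h'" using graph_isomorphic_iso[OF assms(1), of G'] a by blast
      have e: "edge_ordering G' es'" using a by simp
      show "complex_isomorphic (C_Y G es) (C_Y G' es')" by (rule graph_iso.complex_iso(1)[OF i es e])
      show "bigraded_isomorphic (cohomology (C_Y G es) i) (cohomology (C_Y G' es') i)" for i
        by (rule graph_iso.complex_iso(2)[OF i es e])
    qed
  have c: "(\<forall>i. finite_type (obj (C_Y G es) i) \<and> finite_type (cohomology (C_Y G es) i)) \<and>
      graded_euler (C_Y G es) = (\<Sum>i=0..n. (-1) ^ i * qdim (cohomology (C_Y G es) i)) \<and>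
      (\<Sum>i=0..n. (-1) ^ i * qdim (cohomology (C_Y G es) i)) =
        (\<Sum>i=0..n. (-1) ^ i * qdim (obj (C_Y G es) i)) \<and>
      (\<Sum>i=0..n. (-1) ^ i * qdim (obj (C_Y G es) i)) = g_poly G"
    unfolding n by (intro conjI allI C_Y_euler[OF es] g_poly_eq[OF es])
  note phi = phi_chain_map[OF es] and psi = psi_chain_map[OF es]
  have ret: "psi G es i (phi G es i x) = x" if "x \<in> carrier (obj (C_T G es) i)" for i x
    by (rule psi_phi[OF es that])
  have d: "chain_map (C_T G es) (C_Y G es) (phi G es) \<and>
      chain_map (C_Y G es) (C_T G es) (psi G es) \<and>
      (\<forall>i. \<forall>x\<in>carrier (obj (C_T G es) i). psi G es i (phi G es i x) = x) \<and>
      complex_summand (C_T G es) (C_Y G es) \<and>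
      (\<forall>i. bigraded_hom (cohomology (C_T G es) i) (cohomology (C_Y G es) i)
              (cohomology_map (C_T G es) (C_Y G es) (phi G es) i) \<and>
           bigraded_hom (cohomology (C_Y G es) i) (cohomology (C_T G es) i)
              (cohomology_map (C_Y G es) (C_T G es) (psi G es) i) \<and>
           (\<forall>X\<in>carrier (cohomology (C_T G es) i).
              cohomology_map (C_Y G es) (C_T G es) (psi G es) i
                (cohomology_map (C_T G es) (C_Y G es) (phi G es) i X) = X) \<and>
           direct_summand (cohomology (C_T G es) i) (cohomology (C_Y G es) i))"
  proof (intro conjI allI ballI phi psi bigraded_hom_cohomology_map[OF phi] bigraded_hom_cohomology_map[OF psi])
    show "psi G es i (phi G es i x) = x" if "x \<in> carrier (obj (C_T G es) i)" for i x by (rule ret[OF that])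
    show "complex_summand (C_T G es) (C_Y G es)" by (rule complex_summandI(1)[OF phi psi]) (rule ret)
    show "direct_summand (cohomology (C_T G es) i) (cohomology (C_Y G es) i)" for i
      by (rule complex_summandI(2)[OF phi psi]) (rule ret)
    show "cohomology_map (C_Y G es) (C_T G es) (psi G es) i (cohomology_map (C_T G es) (C_Y G es) (phi G es) i X) = X"
      if "X \<in> carrier (cohomology (C_T G es) i)" for i X
      by (rule cohomology_map_retract[OF phi psi _ that]) (rule ret)
  qed
  show ?thesis by (rule conjI[OF a conjI[OF b conjI[OF c d]]])
qed

end
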